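(* Let $Z_n=(Z^n_{j_1j_2})_{0\le j_1<N,\,0\le j_2<n}$ be the $N\times n$ random matrix with entries $$Z^n_{j_1 j_2}=\frac{1}{\sqrt{n}}\sum_{(k_1,k_2)\in \mathbb{Z}^2} h(k_1,k_2)\,U(j_1-k_1,j_2-k_2),$$ where $(h(k_1,k_2))_{(k_1,k_2)\in\mathbb{Z}^2}$ is a deterministic complex sequence with $\sum_{(k_1,k_2)\in\mathbb{Z}^2}|h(k_1,k_2)|<\infty$ and $(U(j_1,j_2))_{(j_1,j_2)\in\mathbb{Z}^2}$ are independent $\mathcal{CN}(0,1)$ random variables. Let $\Phi:[0,1]\times[0,1]\to\mathbb{C}$ be defined by $$\Phi(t_1,t_2)=\sum_{(l_1,l_2)\in \mathbb{Z}^2} h(l_1,l_2)\,e^{2\pi \mathbf{i}(l_1 t_1-l_2 t_2)}.$$ Then, as $n\to\infty$ with $N/n\to c$, the empirical distribution $F^{Z_nZ_n^*}$ of the eigenvalues of $Z_nZ_n^*$ converges in probability to the non-random probability measure $\mu$ whose Stieltjes transform is $f(z)=\int_{[0,1]}\pi_z(dx)$, $z\in\mathbb{C}^+$, where $\pi_z$ is the unique Stieltjes kernel with support included in $[0,1]$ satisfying, for every $z\in\mathbb{C}^+$, $$\forall g\in C([0,1]),\quad \int g\,d\pi_z=\int_0^1\frac{g(u)}{-z+\int_0^1\frac{|\Phi|^2(u,t)}{1+c\int_0^1|\Phi|^2(x,t)\,\pi_z(dx)}\,dt}\,du .$$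
   Context: $N=N(n)$ is a sequence of positive integers with $N\le n$ and $\lim_{n\to\infty}N(n)/n=c\in(0,1]$. $\mathbf{i}=\sqrt{-1}$; $A^*$ is the Hermitian adjoint of a matrix $A$. $\mathcal{CN}(0,1)$ is the law of a complex Gaussian variable $U$ with $\mathbb{E}U=0$, $\mathbb{E}U^2=0$, $\mathbb{E}|U|^2=1$ (i.e. $U=A+\mathbf{i}B$ with $A,B$ independent real centered Gaussians of standard deviation $1/\sqrt2$). $|\Phi|^2(u,t)$ means $|\Phi(u,t)|^2$. For a matrix $A$, $F^{AA^*}$ denotes the empirical distribution function of the eigenvalues of $AA^*$. Convergence in probability of random distribution functions $F^n$ to a probability measure $\mu$ means $\mathbb{P}\{\mathcal{L}(F^n,\mu)\ge\epsilon\}\to0$ for every $\epsilon>0$, where $\mathcal{L}$ is the Lévy distance between distribution functions ($\mu$ being identified with its distribution function). $\mathbb{C}^+=\{z\in\mathbb{C}:\mathrm{Im}(z)>0\}$. The Stieltjes transform of a probability measure $\mu$ on $\mathbb{R}$ is $f(z)=\int_{\mathbb{R}}\frac{\mu(d\lambda)}{\lambda-z}$, $z\in\mathbb{C}^+$. $C(\mathcal{X})$ is the set of bounded continuous functions on a topological space $\mathcal{X}$ with supremum norm $\|\cdot\|_\infty$, and $\mathcal{M}_{\mathbb{C}}(\mathcal{X})$ the set of complex measures on $\mathcal{X}$. A Stieltjes kernel (on $\mathcal X$) is a map $\pi:\mathbb{C}^+\to\mathcal{M}_{\mathbb{C}}(\mathcal{X})$, written $\pi_z(dx)$ or $\pi(z,dx)$,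 such that: (1) $|\int g\,d\pi_z|\le\|g\|_\infty/\mathrm{Im}(z)$ for all $z\in\mathbb{C}^+$, $g\in C(\mathcal{X})$; (2) $z\mapsto\int g\,d\pi_z$ is analytic on $\mathbb{C}^+$ for all $g\in C(\mathcal{X})$; (3) $\mathrm{Im}(\int g\,d\pi_z)\ge0$ for all $z\in\mathbb{C}^+$ and $g\in C(\mathcal{X})$ with $g\ge0$; (4) $\mathrm{Im}(z\int g\,d\pi_z)\ge0$ for all $z\in\mathbb{C}^+$ and $g\in C(\mathcal{X})$ with $g\ge0$. *)

theory Defs
  imports
    "HOL-Probability.Probability"
    "HOL-Complex_Analysis.Complex_Analysis"
    "Jordan_Normal_Form.Schur_Decomposition"
begin

abbreviation upper_half_plane :: "complex set" ("\<complex>\<^sup>+") where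
  "\<complex>\<^sup>+ \<equiv> {z. Im z > 0}"


text \<open>
  Complex Borel measures are represented by their set functions; only the values on Borel sets
  are meaningful. The summability in \<open>complex_measure\<close> is automatically absolute, because every
  rearrangement of a disjoint family is again a disjoint family.
\<close>

definition complex_measure :: "('a::topological_space set \<Rightarrow> complex) \<Rightarrow> bool" where
  "complex_measure \<nu> \<longleftrightarrow> \<nu> {} = 0 \<and>
     (\<forall>A::nat \<Rightarrow> 'a set. range A \<subseteq> sets borel \<longrightarrow> disjoint_family A \<longrightarrow>
        (\<lambda>i. \<nu> (A i)) sums \<nu> (\<Union>i. A i))"

text \<open>
  The positive part of the Jordan decomposition of a finite signed measure \<open>\<nu>\<close>. Since
  \<open>ennreal\<close> maps negative reals to 0 and \<open>\<nu> {} = 0\<close>, this is the usual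
  supremum of \<open>\<nu> B\<close> over the Borel sets \<open>B \<subseteq> A\<close>. The negative part is the
  upper variation of \<open>- \<nu>\<close>.
\<close>

definition upper_variation :: "('a::topological_space set \<Rightarrow> real) \<Rightarrow> 'a measure" where
  "upper_variation \<nu> =
     measure_of UNIV (sets borel) (\<lambda>A. SUP B\<in>{B \<in> sets borel. B \<subseteq> A}. ennreal (\<nu> B))"

definition cm_integral :: "('a::topological_space set \<Rightarrow> complex) \<Rightarrow> ('a \<Rightarrow> complex) \<Rightarrow> complex" where
  "cm_integral \<nu> g =
     (LINT x|upper_variation (\<lambda>A. Re (\<nu> A)). g x) - (LINT x|upper_variation (\<lambda>A. - Re (\<nu> A)). g x)
     + \<i> * ((LINT x|upper_variation (\<lambda>A. Im (\<nu> A)). g x)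
            - (LINT x|upper_variation (\<lambda>A. - Im (\<nu> A)). g x))"

definition cm_set_integral ::
  "('a::topological_space set \<Rightarrow> complex) \<Rightarrow> 'a set \<Rightarrow> ('a \<Rightarrow> complex) \<Rightarrow> complex" where
  "cm_set_integral \<nu> S g = cm_integral \<nu> (\<lambda>x. indicator S x * g x)"

text \<open>An open set has positive total variation iff it contains a Borel set that is not null.\<close>

definition cm_support :: "('a::topological_space set \<Rightarrow> complex) \<Rightarrow> 'a set" where
  "cm_support \<nu> = {x. \<forall>V. open V \<longrightarrow> x \<in> V \<longrightarrow> (\<exists>A\<in>sets borel. A \<subseteq> V \<and> \<nu> A \<noteq> 0)}"


text \<open>
  The type \<open>'a \<Rightarrow>\<^sub>C complex\<close> consists of the bounded continuous functions, with the
  supremum norm.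
\<close>

definition stieltjes_kernel :: "(complex \<Rightarrow> 'a::topological_space set \<Rightarrow> complex) \<Rightarrow> bool" where
  "stieltjes_kernel \<pi> \<longleftrightarrow>
     (\<forall>z\<in>\<complex>\<^sup>+. complex_measure (\<pi> z)) \<and>
     (\<forall>z\<in>\<complex>\<^sup>+. \<forall>g::'a \<Rightarrow>\<^sub>C complex. cmod (cm_integral (\<pi> z) (apply_bcontfun g)) \<le> norm g / Im z) \<and>
     (\<forall>g::'a \<Rightarrow>\<^sub>C complex. (\<lambda>z. cm_integral (\<pi> z) (apply_bcontfun g)) analytic_on \<complex>\<^sup>+) \<and>
     (\<forall>z\<in>\<complex>\<^sup>+. \<forall>g::'a \<Rightarrow>\<^sub>C real. (\<forall>x. 0 \<le> apply_bcontfun g x) \<longrightarrow>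
        0 \<le> Im (cm_integral (\<pi> z) (\<lambda>x. complex_of_real (apply_bcontfun g x)))) \<and>
     (\<forall>z\<in>\<complex>\<^sup>+. \<forall>g::'a \<Rightarrow>\<^sub>C real. (\<forall>x. 0 \<le> apply_bcontfun g x) \<longrightarrow>
        0 \<le> Im (z * cm_integral (\<pi> z) (\<lambda>x. complex_of_real (apply_bcontfun g x))))"

definition stieltjes_transform :: "real measure \<Rightarrow> complex \<Rightarrow> complex" where
  "stieltjes_transform \<mu> z = (LINT x|\<mu>. 1 / (complex_of_real x - z))"


definition std_complex_normal :: "complex measure" where
  "std_complex_normal =
     distr (density lborel (normal_density 0 (1 / sqrt 2)) \<Otimes>\<^sub>M density lborel (normal_density 0 (1 / sqrt 2)))
       borel (\<lambda>(a, b). Complex a b)"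

text \<open>
  The series is absolutely convergent almost surely when \<open>h\<close> is absolutely summable and the
  \<open>U p\<close> are standard complex Gaussian; \<open>infsum\<close> is 0 on the exceptional null set.
\<close>

definition Z_mat ::
  "(int \<times> int \<Rightarrow> complex) \<Rightarrow> (int \<times> int \<Rightarrow> 'w \<Rightarrow> complex) \<Rightarrow> (nat \<Rightarrow> nat) \<Rightarrow> nat \<Rightarrow> 'w \<Rightarrow> complex mat" where
  "Z_mat h U N n \<omega> = Matrix.mat (N n) n (\<lambda>(j1, j2).
     1 / complex_of_real (sqrt (real n)) *
       (\<Sum>\<^sub>\<infinity>(k1, k2)\<in>UNIV. h (k1, k2) * U (int j1 - k1, int j2 - k2) \<omega>))"

definition Phi :: "(int \<times> int \<Rightarrow> complex) \<Rightarrow> real \<Rightarrow> real \<Rightarrow> complex" where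
  "Phi h t1 t2 = (\<Sum>\<^sub>\<infinity>(l1, l2)\<in>UNIV.
     h (l1, l2) * exp (2 * of_real pi * \<i> * (of_int l1 * of_real t1 - of_int l2 * of_real t2)))"

text \<open>
  Eigenvalues are counted with algebraic multiplicity. Those of a Hermitian matrix are real, so
  that comparing real parts with \<open>x\<close> compares the eigenvalues themselves.
\<close>

definition empirical_cdf :: "complex mat \<Rightarrow> real \<Rightarrow> real" where
  "empirical_cdf H x =
     real (\<Sum>a | eigenvalue H a \<and> Re a \<le> x. Polynomial.order a (char_poly H)) / real (dim_row H)"

definition levy_dist :: "(real \<Rightarrow> real) \<Rightarrow> (real \<Rightarrow> real) \<Rightarrow> real" where
  "levy_dist F G = Inf {\<epsilon>. \<epsilon> > 0 \<and> (\<forall>x. F (x - \<epsilon>) - \<epsilon> \<le> G x \<and> G x \<le> F (x + \<epsilon>) + \<epsilon>)}"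

definition cdf_tendsto_in_prob ::
  "'w measure \<Rightarrow> (nat \<Rightarrow> 'w \<Rightarrow> real \<Rightarrow> real) \<Rightarrow> real measure \<Rightarrow> bool" where
  "cdf_tendsto_in_prob P F \<mu> \<longleftrightarrow>
     (\<forall>\<epsilon>>0. (\<lambda>n. measure P {\<omega> \<in> space P. levy_dist (F n \<omega>) (cdf \<mu>) \<ge> \<epsilon>}) \<longlonglongrightarrow> 0)"

definition kernel_equation ::
  "real \<Rightarrow> (real \<Rightarrow> real \<Rightarrow> complex) \<Rightarrow> (real set \<Rightarrow> complex) \<Rightarrow> complex \<Rightarrow> bool" where
  "kernel_equation c \<Phi> \<nu> z \<longleftrightarrow>
     (\<forall>g::real \<Rightarrow> complex. continuous_on {0..1} g \<longrightarrow>
        cm_set_integral \<nu> {0..1} g =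
        (LINT u:{0..1}|lborel. g u /
           (- z + (LINT t:{0..1}|lborel. complex_of_real ((cmod (\<Phi> u t))\<^sup>2) /
              (1 + complex_of_real c *
                 cm_set_integral \<nu> {0..1} (\<lambda>x. complex_of_real ((cmod (\<Phi> x t))\<^sup>2)))))))"

end

theory Submission
  imports Defs
begin

text \<open>
  The proof compares \<open>Z\<close> with its periodization, in which the shifts of the filter are taken modulo the
  size of the matrix. Only the positions near the boundary differ, and since \<open>h\<close> is summable the
  squared Hilbert-Schmidt distance is \<open>o(n)\<close> in mean; by \<open>resolvent_trace_lipschitz\<close> such a
  perturbation is invisible in the limit of the Stieltjes transform. The two-dimensional Fourier
  transform is unitary, so it preserves singular values, and it maps the periodized matrix to a matrix
  with independent Gaussian entries, the variance at \<open>(a, b)\<close> being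
  \<open>\<bar>\<Phi> (a / N) (b / n)\<bar>\<^sup>2 / n\<close> (\<open>fourier_orthogonality\<close>, \<open>H_coupling\<close>).

  For such a matrix \<open>Y\<close> let \<open>G\<close> be the resolvent at \<open>w\<close>, with \<open>w\<^sup>2 = z\<close>, of the Hermitian matrix with
  off-diagonal blocks \<open>Y\<close> and \<open>Y\<^sup>*\<close>. Gaussian integration by parts gives an exact Dyson equation
  (\<open>dyson_equation\<close>). Replacing coordinates one by one bounds the variance of weighted traces of \<open>G\<close>:
  the matrix that multiplies a single Gaussian variable has trace norm at most \<open>S / sqrt n\<close> with
  \<open>S = \<Sum> \<bar>h k\<bar>\<close>, which is small enough for the \<open>N * n\<close> variables (\<open>weighted_trace_variance\<close>). Hence the
  expected diagonal entries solve a finite vector equation up to a vanishing error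
  (\<open>approximate_vector_equation\<close>). The solution of the integral equation of the theorem, sampled on the
  grid, solves the same vector equation up to a Riemann sum error, and for large \<open>Im z\<close> that equation is
  stable. This identifies the limit of the transforms on an interval of the imaginary axis
  (\<open>vector_equation_limit\<close>, \<open>model_trace_in_probability\<close>).

  The integral equation for the density \<open>m z u\<close> of the kernel is a contraction for large \<open>Im z\<close>. Its
  iterates satisfy the Herglotz bounds on the whole half plane, so Vitali's theorem yields an analytic
  solution there; uniqueness for large \<open>Im z\<close> spreads by analytic continuation
  (\<open>profile_equation_solvable\<close>, \<open>stieltjes_kernel_exists_unique\<close>). The limit law itself is obtained from
  the random matrices: with positive probability the transforms are close to the prediction at finitely
  many points and the first moment is bounded, so a sequence of realizations is tight and a weak limit
  has the required transform (\<open>limit_law_exists\<close>). Finally, compactness shows that laws with a common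
  tail bound and transforms close at finitely many points are close in the Levy distance
  (\<open>levy_closeness_criterion\<close>), which turns the convergence of the transforms in probability into that of
  the distribution functions.
\<close>

section \<open>Complex measures given by their set functions\<close>

definition signed_measure :: "('a::topological_space set => real) => bool" where
  "signed_measure r \<longleftrightarrow> r {} = 0 \<and>
     (\<forall>A::nat => 'a set. range A \<subseteq> sets borel \<longrightarrow> disjoint_family A \<longrightarrow>
        (\<lambda>i. r (A i)) sums r (\<Union>i. A i))"

lemma signed_measure_uminus: "signed_measure r \<Longrightarrow> signed_measure (\<lambda>A. - r A)"
  unfolding signed_measure_def by (auto intro: sums_minus)

lemma ennreal_le_of_le_enn2real: "S = \<infinity> \<or> x \<le> enn2real S \<Longrightarrow> ennreal x \<le> S"
  by (cases S) (auto intro: ennreal_leI)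

lemma complex_measure_Re_Im:
  assumes "complex_measure \<nu>"
  shows "signed_measure (\<lambda>A. Re (\<nu> A))" "signed_measure (\<lambda>A. Im (\<nu> A))"
  using assms unfolding complex_measure_def signed_measure_def
  by (auto intro: sums_Re sums_Im)

context
  fixes r :: "'a::topological_space set => real"
  assumes r: "signed_measure r"
begin

lemma signed_empty: "r {} = 0"
  using r unfolding signed_measure_def by blast

lemma signed_sums:
  "range A \<subseteq> sets borel \<Longrightarrow> disjoint_family A \<Longrightarrow> (\<lambda>i. r (A i)) sums r (\<Union>i. A (i::nat))"
  using r unfolding signed_measure_def by blast

lemma signed_union:
  assumes "A \<in> sets borel" "B \<in> sets borel" "A \<inter> B = {}"
  shows "r (A \<union> B) = r A + r B"
proof -
  have 1: "range (binaryset A B) \<subseteq> sets borel" using assms by (auto simp: binaryset_def)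
  have 2: "disjoint_family (binaryset A B)"
    using assms by (auto simp: disjoint_family_on_def binaryset_def)
  have "(\<lambda>i. r (binaryset A B i)) sums r (A \<union> B)"
    using signed_sums[OF 1 2] by (simp add: UN_binaryset_eq)
  moreover have "(\<lambda>i. r (binaryset A B i)) sums (r A + r B)"
    by (rule binaryset_sums[of r]) (rule signed_empty)
  ultimately show ?thesis using sums_unique2 by blast
qed

lemma signed_diff:
  assumes "A \<in> sets borel" "B \<in> sets borel" "B \<subseteq> A"
  shows "r (A - B) = r A - r B"
proof -
  have "r (B \<union> (A - B)) = r B + r (A - B)" using assms by (intro signed_union) auto
  moreover have "B \<union> (A - B) = A" using assms by auto
  ultimately show ?thesis by simp
qed

text \<open>Call a Borel set fat if the values on its Borel subsets are unbounded. A fat set contains a smaller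
  fat set such that the difference has a value above 1, and iterating this gives disjoint sets whose
  values do not tend to 0, against countable additivity.\<close>

lemma signed_bounded: "\<exists>K. \<forall>B\<in>sets borel. \<bar>r B\<bar> \<le> K"
proof (rule ccontr)
  define fat where "fat E \<longleftrightarrow> E \<in> sets borel \<and> (\<forall>K. \<exists>B\<in>sets borel. B \<subseteq> E \<and> K < \<bar>r B\<bar>)" for E
  assume "\<not> ?thesis"
  hence "\<forall>K. \<exists>B\<in>sets borel. K < \<bar>r B\<bar>" by (meson not_le)
  hence fatU: "fat UNIV" unfolding fat_def by simp
  have split: "fat A \<or> fat (E - A)" if E: "fat E" "A \<in> sets borel" "A \<subseteq> E" for E A
  proof (rule ccontr)
    assume nf: "\<not> ?thesis"
    have meas: "A \<in> sets borel" "E - A \<in> sets borel" using E unfolding fat_def by auto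
    obtain K1 where K1: "\<And>B. B \<in> sets borel \<Longrightarrow> B \<subseteq> A \<Longrightarrow> \<bar>r B\<bar> \<le> K1"
      using nf meas(1) unfolding fat_def by (meson not_less)
    obtain K2 where K2: "\<And>B. B \<in> sets borel \<Longrightarrow> B \<subseteq> E - A \<Longrightarrow> \<bar>r B\<bar> \<le> K2"
      using nf meas(2) unfolding fat_def by (meson not_less)
    obtain B where B: "B \<in> sets borel" "B \<subseteq> E" "K1 + K2 < \<bar>r B\<bar>"
      using E unfolding fat_def by blast
    have "r ((B \<inter> A) \<union> (B - A)) = r (B \<inter> A) + r (B - A)"
      using B E by (intro signed_union) auto
    moreover have "(B \<inter> A) \<union> (B - A) = B" by auto
    moreover have "\<bar>r (B \<inter> A)\<bar> \<le> K1" "\<bar>r (B - A)\<bar> \<le> K2"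
      using B E by (intro K1 K2; auto)+
    ultimately show False using B by simp
  qed
  have step: "\<exists>E'. fat E' \<and> E' \<subseteq> E \<and> 1 < \<bar>r (E - E')\<bar>" if E: "fat E" for E
  proof -
    obtain A where A: "A \<in> sets borel" "A \<subseteq> E" "1 + \<bar>r E\<bar> < \<bar>r A\<bar>"
      using E unfolding fat_def by blast
    have E': "E \<in> sets borel" using E unfolding fat_def by blast
    have d: "r (E - A) = r E - r A" by (rule signed_diff[OF E' A(1,2)])
    have EA: "E - (E - A) = A" using A by auto
    have gt: "1 < \<bar>r A\<bar>" "1 < \<bar>r (E - A)\<bar>" using A(3) d by linarith+
    from split[OF E A(1,2)] show ?thesis
    proof
      assume "fat A" thus ?thesis using A(2) gt(2) by blast
    next
      assume "fat (E - A)" thus ?thesis using gt(1) EA by (intro exI[of _ "E - A"]) auto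
    qed
  qed
  have "\<exists>F. \<forall>n. fat (F n) \<and> (F (Suc n) \<subseteq> F n \<and> 1 < \<bar>r (F n - F (Suc n))\<bar>)"
    by (rule dependent_nat_choice) (use fatU step in blast)+
  then obtain F where F0: "\<And>n. fat (F n)" and F1: "\<And>n. F (Suc n) \<subseteq> F n \<and> 1 < \<bar>r (F n - F (Suc n))\<bar>"
    by blast
  have dec: "F m \<subseteq> F n" if "n \<le> m" for n m
    using that by (rule lift_Suc_antimono_le[rotated]) (use F1 in auto)
  define B where "B n = F n - F (Suc n)" for n
  have "disjoint_family B"
    unfolding disjoint_family_on_def B_def
  proof (intro ballI impI)
    fix m n :: nat assume "m \<noteq> n"
    then consider "Suc m \<le> n" | "Suc n \<le> m" by linarith
    thus "(F m - F (Suc m)) \<inter> (F n - F (Suc n)) = {}" by cases (use dec in blast)+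
  qed
  moreover have "range B \<subseteq> sets borel" using F0 unfolding fat_def B_def by auto
  ultimately have "(\<lambda>i. r (B i)) sums r (\<Union>i. B i)" by (intro signed_sums)
  hence "(\<lambda>i. r (B i)) \<longlonglongrightarrow> 0" using sums_summable summable_LIMSEQ_zero by blast
  hence "eventually (\<lambda>i. \<bar>r (B i)\<bar> < 1) sequentially"
    using tendstoD[of "\<lambda>i. r (B i)" 0 sequentially 1] by (simp add: dist_real_def)
  then obtain i where "\<bar>r (B i)\<bar> < 1" unfolding eventually_sequentially by blast
  thus False using F1[of i] unfolding B_def by simp
qed

text \<open>Since signed measures are bounded, the supremum in the upper variation is finite and can be taken
  in the reals.\<close>

definition pos_var :: "'a set => real" where
  "pos_var A = (SUP B\<in>{B \<in> sets borel. B \<subseteq> A}. r B)"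

lemma bdd_var: "bdd_above (r ` {B \<in> sets borel. B \<subseteq> A})"
proof -
  obtain K where K: "\<forall>B\<in>sets borel. \<bar>r B\<bar> \<le> K" using signed_bounded by blast
  show ?thesis by (rule bdd_aboveI2[where M=K]) (use K in \<open>auto simp: abs_le_iff\<close>)
qed

lemma pos_var_upper: "B \<in> sets borel \<Longrightarrow> B \<subseteq> A \<Longrightarrow> r B \<le> pos_var A"
  unfolding pos_var_def by (rule cSUP_upper[OF _ bdd_var]) auto

lemma pos_var_least: "(\<And>B. B \<in> sets borel \<Longrightarrow> B \<subseteq> A \<Longrightarrow> r B \<le> K) \<Longrightarrow> pos_var A \<le> K"
  unfolding pos_var_def by (rule cSUP_least) auto

lemma pos_var_nonneg: "0 \<le> pos_var A"
  using pos_var_upper[of "{}" A] signed_empty by simp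

lemma pos_var_mono: "A \<subseteq> B \<Longrightarrow> pos_var A \<le> pos_var B"
  by (rule pos_var_least) (rule pos_var_upper, assumption, rule order_trans)

lemma SUP_eq_pos_var: "(SUP B\<in>{B \<in> sets borel. B \<subseteq> A}. ennreal (r B)) = ennreal (pos_var A)"
proof (rule antisym)
  show "(SUP B\<in>{B \<in> sets borel. B \<subseteq> A}. ennreal (r B)) \<le> ennreal (pos_var A)"
    by (rule SUP_least) (auto intro!: ennreal_leI pos_var_upper)
  show "ennreal (pos_var A) \<le> (SUP B\<in>{B \<in> sets borel. B \<subseteq> A}. ennreal (r B))" (is "_ \<le> ?S")
  proof (cases "?S = \<infinity>")
    case False
    have "pos_var A \<le> enn2real ?S"
    proof (rule pos_var_least)
      fix B assume B: "B \<in> sets borel" "B \<subseteq> A"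
      have "B \<in> {B \<in> sets borel. B \<subseteq> A}" using B by simp
      from SUP_upper[OF this, of "\<lambda>B. ennreal (r B)"] have "ennreal (r B) \<le> ?S" .
      hence "enn2real (ennreal (r B)) \<le> enn2real ?S"
        using False by (simp add: enn2real_mono less_top[symmetric])
      moreover have "r B \<le> enn2real (ennreal (r B))" by (cases "0 \<le> r B") (auto simp: ennreal_neg)
      ultimately show "r B \<le> enn2real ?S" by linarith
    qed
    thus ?thesis by (intro ennreal_le_of_le_enn2real) blast
  next
    case True
    thus ?thesis by (intro ennreal_le_of_le_enn2real) blast
  qed
qed

lemma pos_var_union:
  assumes "A \<in> sets borel" "B \<in> sets borel" "A \<inter> B = {}"
  shows "pos_var (A \<union> B) = pos_var A + pos_var B"
proof (rule antisym)
  show "pos_var (A \<union> B) \<le> pos_var A + pos_var B"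
  proof (rule pos_var_least)
    fix C assume C: "C \<in> sets borel" "C \<subseteq> A \<union> B"
    have "C = (C \<inter> A) \<union> (C \<inter> B)" using C by auto
    moreover have "r ((C \<inter> A) \<union> (C \<inter> B)) = r (C \<inter> A) + r (C \<inter> B)"
      using C assms by (intro signed_union) auto
    ultimately show "r C \<le> pos_var A + pos_var B"
      using pos_var_upper[of "C \<inter> A" A] pos_var_upper[of "C \<inter> B" B] C assms by auto
  qed
  have "pos_var A \<le> pos_var (A \<union> B) - pos_var B"
  proof (rule pos_var_least)
    fix C assume C: "C \<in> sets borel" "C \<subseteq> A"
    have "pos_var B \<le> pos_var (A \<union> B) - r C"
    proof (rule pos_var_least)
      fix D assume D: "D \<in> sets borel" "D \<subseteq> B"
      have "r (C \<union> D) = r C + r D" using C D assms by (intro signed_union) auto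
      moreover have "r (C \<union> D) \<le> pos_var (A \<union> B)" using C D by (intro pos_var_upper) auto
      ultimately show "r D \<le> pos_var (A \<union> B) - r C" by simp
    qed
    thus "r C \<le> pos_var (A \<union> B) - pos_var B" by simp
  qed
  thus "pos_var A + pos_var B \<le> pos_var (A \<union> B)" by simp
qed

lemma pos_var_empty: "pos_var {} = 0"
proof (rule antisym[OF pos_var_least pos_var_nonneg])
  fix B :: "'a set" assume "B \<subseteq> {}"
  hence "B = {}" by simp
  thus "r B \<le> 0" using signed_empty by simp
qed

lemma pos_var_finite_UN:
  assumes "range A \<subseteq> sets borel" "disjoint_family A"
  shows "pos_var (\<Union>i<n. A (i::nat)) = (\<Sum>i<n. pos_var (A i))"
proof (induction n)
  case (Suc n)
  have "(\<Union>i<n. A i) \<inter> A n = {}"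
    using assms(2) unfolding disjoint_family_on_def disjoint_iff by (metis UNIV_I UN_E lessThan_iff less_irrefl disjoint_iff)
  moreover have "(\<Union>i<n. A i) \<in> sets borel" using assms by auto
  ultimately have "pos_var ((\<Union>i<n. A i) \<union> A n) = pos_var (\<Union>i<n. A i) + pos_var (A n)"
    using assms by (intro pos_var_union) auto
  thus ?case using Suc by (simp add: lessThan_Suc Un_commute)
qed (simp add: pos_var_empty)

lemma pos_var_countably_additive: "countably_additive (sets borel) (\<lambda>A. ennreal (pos_var A))"
proof (rule countably_additiveI)
  fix A :: "nat => 'a set"
  assume A: "range A \<subseteq> sets borel" "disjoint_family A"
  have le: "(\<Sum>i<n. pos_var (A i)) \<le> pos_var (\<Union>i. A i)" for n
    unfolding pos_var_finite_UN[OF A, symmetric] by (rule pos_var_mono) auto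
  have summ: "summable (\<lambda>i. pos_var (A i))"
    using le pos_var_nonneg by (intro summableI_nonneg_bounded) auto
  have "pos_var (\<Union>i. A i) \<le> (\<Sum>i. pos_var (A i))"
  proof (rule pos_var_least)
    fix B assume B: "B \<in> sets borel" "B \<subseteq> (\<Union>i. A i)"
    have "(\<lambda>i. r (B \<inter> A i)) sums r (\<Union>i. B \<inter> A i)"
      using A B by (intro signed_sums) (auto simp: disjoint_family_on_def)
    moreover have "(\<Union>i. B \<inter> A i) = B" using B by auto
    ultimately have "(\<lambda>i. r (B \<inter> A i)) sums r B" by simp
    moreover have "r (B \<inter> A i) \<le> pos_var (A i)" for i
      using A B by (intro pos_var_upper) auto
    ultimately show "r B \<le> (\<Sum>i. pos_var (A i))"
      using sums_le[OF _ _ summable_sums[OF summ], of "\<lambda>i. r (B \<inter> A i)" "r B"] by simp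
  qed
  moreover have "(\<Sum>i. pos_var (A i)) \<le> pos_var (\<Union>i. A i)"
    by (rule suminf_le_const[OF summ le])
  ultimately have "(\<Sum>i. pos_var (A i)) = pos_var (\<Union>i. A i)" by simp
  thus "(\<Sum>i. ennreal (pos_var (A i))) = ennreal (pos_var (\<Union>i. A i))"
    using suminf_ennreal2[OF pos_var_nonneg summ] by metis
qed

text \<open>The constructor of measures returns the null measure unless its argument is countably additive, so
  the additivity of the supremum is what gives the upper variation its intended values.\<close>

lemma upper_variation_facts:
  shows sets_upper_variation: "sets (upper_variation r) = sets borel"
    and space_upper_variation: "space (upper_variation r) = UNIV"
    and emeasure_upper_variation: "A \<in> sets borel \<Longrightarrow> emeasure (upper_variation r) A = ennreal (pos_var A)"
proof -
  have eq: "upper_variation r = measure_of UNIV (sets borel) (\<lambda>A. ennreal (pos_var A))"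
    unfolding upper_variation_def SUP_eq_pos_var ..
  have sa: "sigma_algebra UNIV (sets (borel::'a measure))"
    using sets.sigma_algebra_axioms[of "borel::'a measure"] by simp
  show "sets (upper_variation r) = sets borel"
    unfolding eq using sigma_algebra.sets_measure_of_eq[OF sa] by simp
  show "space (upper_variation r) = UNIV" unfolding eq by (simp add: space_measure_of_conv)
  show "emeasure (upper_variation r) A = ennreal (pos_var A)" if "A \<in> sets borel" for A
    unfolding eq
    by (rule emeasure_measure_of_sigma[OF sa _ pos_var_countably_additive that])
       (simp add: positive_def pos_var_empty)
qed

lemma finite_upper_variation: "finite_measure (upper_variation r)"
  by (rule finite_measureI) (simp add: space_upper_variation emeasure_upper_variation)

lemma measure_upper_variation:
  "A \<in> sets borel \<Longrightarrow> measure (upper_variation r) A = pos_var A"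
  by (simp add: measure_def emeasure_upper_variation pos_var_nonneg)

end

text \<open>Passing from a subset of \<open>A\<close> to its complement in \<open>A\<close> turns the supremum of \<open>r\<close> into that of \<open>- r\<close>.\<close>

lemma jordan_decomposition:
  assumes r: "signed_measure r" and A: "A \<in> sets borel"
  shows "r A = measure (upper_variation r) A - measure (upper_variation (\<lambda>A. - r A)) A"
proof -
  note r' = signed_measure_uminus[OF r]
  have "pos_var r A \<le> r A + pos_var (\<lambda>A. - r A) A"
  proof (rule pos_var_least[OF r])
    fix B assume B: "B \<in> sets borel" "B \<subseteq> A"
    have "- r (A - B) \<le> pos_var (\<lambda>A. - r A) A" using A B by (intro pos_var_upper[OF r']) auto
    thus "r B \<le> r A + pos_var (\<lambda>A. - r A) A" using signed_diff[OF r A B] by simp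
  qed
  moreover have "pos_var (\<lambda>A. - r A) A \<le> pos_var r A - r A"
  proof (rule pos_var_least[OF r'])
    fix B assume B: "B \<in> sets borel" "B \<subseteq> A"
    have "r (A - B) \<le> pos_var r A" using A B by (intro pos_var_upper[OF r]) auto
    thus "- r B \<le> pos_var r A - r A" using signed_diff[OF r A B] by simp
  qed
  ultimately show ?thesis
    using measure_upper_variation[OF r A] measure_upper_variation[OF r' A] by simp
qed

text \<open>The supremum is attained on the set where the density is positive.\<close>

lemma upper_variation_density:
  fixes lam :: "'a::topological_space measure" and f :: "'a => real"
  assumes lam: "sets lam = sets borel" and f: "integrable lam f"
  shows "upper_variation (\<lambda>A. LINT x:A|lam. f x) = density lam (\<lambda>x. ennreal (f x))"
proof -
  have [measurable]: "f \<in> borel_measurable lam" using f by auto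
  have sp: "space lam = UNIV" using sets_eq_imp_space_eq[OF lam] by simp
  have SUP: "(SUP B\<in>{B \<in> sets borel. B \<subseteq> A}. ennreal (LINT x:B|lam. f x)) = emeasure (density lam (\<lambda>x. ennreal (f x))) A"
    if A: "A \<in> sets borel" for A
  proof -
    have em: "emeasure (density lam (\<lambda>x. ennreal (f x))) C = (\<integral>\<^sup>+x. ennreal (indicator C x * max 0 (f x)) \<partial>lam)"
      if "C \<in> sets borel" for C
      using that lam by (subst emeasure_density)
        (auto intro!: nn_integral_cong simp: max_def ennreal_neg split: split_indicator)
    have int: "integrable lam (\<lambda>x. indicator C x * max 0 (f x))" if "C \<in> sets borel" for C
    proof -
      have "integrable lam (\<lambda>x. indicator C x *\<^sub>R max 0 (f x))"
        using that lam by (intro integrable_mult_indicator integrable_max f) auto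
      thus ?thesis by simp
    qed
    have em': "emeasure (density lam (\<lambda>x. ennreal (f x))) C = ennreal (LINT x|lam. indicator C x * max 0 (f x))"
      if "C \<in> sets borel" for C
      unfolding em[OF that] by (rule nn_integral_eq_integral[OF int[OF that]]) simp
    show ?thesis
    proof (rule antisym)
      show "(SUP B\<in>{B \<in> sets borel. B \<subseteq> A}. ennreal (LINT x:B|lam. f x)) \<le> emeasure (density lam (\<lambda>x. ennreal (f x))) A"
      proof (rule SUP_least)
        fix B assume "B \<in> {B \<in> sets borel. B \<subseteq> A}"
        hence B: "B \<in> sets borel" "B \<subseteq> A" by auto
        have "(LINT x:B|lam. f x) \<le> (LINT x|lam. indicator A x * max 0 (f x))"
          unfolding set_lebesgue_integral_def
          using B lam f by (intro integral_mono int A integrable_mult_indicator) (auto split: split_indicator)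
        thus "ennreal (LINT x:B|lam. f x) \<le> emeasure (density lam (\<lambda>x. ennreal (f x))) A"
          unfolding em'[OF A] by (rule ennreal_leI)
      qed
      define B where "B = A \<inter> {x. 0 \<le> f x}"
      have "{x\<in>space lam. 0 \<le> f x} \<in> sets lam" by measurable
      hence B: "B \<in> sets borel" "B \<subseteq> A" using A lam sp unfolding B_def by auto
      have "(LINT x:B|lam. f x) = (LINT x|lam. indicator A x * max 0 (f x))"
        unfolding set_lebesgue_integral_def B_def
        by (intro Bochner_Integration.integral_cong) (auto split: split_indicator)
      hence "emeasure (density lam (\<lambda>x. ennreal (f x))) A = ennreal (LINT x:B|lam. f x)"
        using em'[OF A] by simp
      also have "\<dots> \<le> (SUP B\<in>{B \<in> sets borel. B \<subseteq> A}. ennreal (LINT x:B|lam. f x))"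
        using B by (intro SUP_upper[of B]) simp
      finally show "emeasure (density lam (\<lambda>x. ennreal (f x))) A \<le> \<dots>" .
    qed
  qed
  have sa: "sigma_algebra UNIV (sets (borel::'a measure))"
    using sets.sigma_algebra_axioms[of "borel::'a measure"] by simp
  have "upper_variation (\<lambda>A. LINT x:A|lam. f x) = measure_of UNIV (sets borel) (emeasure (density lam (\<lambda>x. ennreal (f x))))"
    unfolding upper_variation_def by (rule measure_of_eq) (auto simp: SUP sigma_algebra.sigma_sets_eq[OF sa])
  also have "\<dots> = density lam (\<lambda>x. ennreal (f x))"
    using measure_of_of_measure[of "density lam (\<lambda>x. ennreal (f x))"] lam sp by simp
  finally show ?thesis .
qed

text \<open>By the Jordan decomposition the four variations recombine to the measure.\<close>

lemma cm_integral_indicator: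
  assumes "complex_measure \<nu>" "A \<in> sets borel"
  shows "cm_integral \<nu> (indicator A) = \<nu> A"
proof -
  note sm = complex_measure_Re_Im[OF assms(1)]
  have *: "(LINT x|upper_variation r. indicator A x) = complex_of_real (measure (upper_variation r) A)"
    if "signed_measure r" for r :: "'a set => real"
  proof -
    have "emeasure (upper_variation r) A < \<infinity>"
      using finite_measure.emeasure_finite[OF finite_upper_variation[OF that]] by (simp add: top.not_eq_extremum)
    moreover have "(LINT x|upper_variation r. indicator A x :: complex) = (LINT x|upper_variation r. complex_of_real (indicator A x))"
      by (intro Bochner_Integration.integral_cong) (auto split: split_indicator)
    ultimately show ?thesis using assms(2) by (simp add: sets_upper_variation[OF that] space_upper_variation[OF that])
  qed
  have "cm_integral \<nu> (indicator A) = complex_of_real (Re (\<nu> A)) + \<i> * complex_of_real (Im (\<nu> A))"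
    unfolding cm_integral_def 
    by (simp add: * sm signed_measure_uminus jordan_decomposition[OF sm(1) assms(2)] jordan_decomposition[OF sm(2) assms(2)])
  thus ?thesis using complex_eq[of "\<nu> A"] by simp
qed

lemma cm_integral_dominated_convergence:
  fixes g :: "nat => 'a::topological_space => complex"
  assumes \<nu>: "complex_measure \<nu>" and "\<And>n. g n \<in> borel_measurable borel" "f \<in> borel_measurable borel"
    and "\<And>x. (\<lambda>n. g n x) \<longlonglongrightarrow> f x" and "\<And>n x. cmod (g n x) \<le> K"
  shows "(\<lambda>n. cm_integral \<nu> (g n)) \<longlonglongrightarrow> cm_integral \<nu> f"
proof -
  note sm = complex_measure_Re_Im[OF \<nu>]
  have *: "(\<lambda>n. LINT x|upper_variation r. g n x) \<longlonglongrightarrow> (LINT x|upper_variation r. f x)"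
    if "signed_measure r" for r :: "'a set => real"
  proof (rule integral_dominated_convergence[where w="\<lambda>_. K"])
    interpret finite_measure "upper_variation r" by (rule finite_upper_variation[OF that])
    show "integrable (upper_variation r) (\<lambda>_. K)" by simp
    note eq = measurable_cong_sets[OF sets_upper_variation[OF that] refl]
    show "f \<in> borel_measurable (upper_variation r)" "\<And>n. g n \<in> borel_measurable (upper_variation r)"
      unfolding eq using assms(2,3) by auto
  qed (use assms in auto)
  show ?thesis unfolding cm_integral_def
    by (intro tendsto_intros * sm signed_measure_uminus)
qed

text \<open>Indicators of half lines are limits of continuous functions with values in the unit interval, and
  half lines generate the Borel sets.\<close>

lemma complex_measure_eqI:
  fixes \<nu>1 \<nu>2 :: "real set => complex"
  assumes cm: "complex_measure \<nu>1" "complex_measure \<nu>2"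
    and eq: "\<And>g::real => real. continuous_on UNIV g \<Longrightarrow> (\<forall>x. 0 \<le> g x \<and> g x \<le> 1) \<Longrightarrow>
      cm_integral \<nu>1 (\<lambda>x. complex_of_real (g x)) = cm_integral \<nu>2 (\<lambda>x. complex_of_real (g x))"
    and A: "A \<in> sets borel"
  shows "\<nu>1 A = \<nu>2 A"
proof -
  have atM: "\<nu>1 {..a} = \<nu>2 {..a}" for a
  proof -
    define g where "g k x = max 0 (min 1 (1 - real k * (x - a)))" for k x
    have c: "continuous_on UNIV (g k)" for k unfolding g_def by (intro continuous_intros)
    have lim: "(\<lambda>k. g k x) \<longlonglongrightarrow> indicator {..a} x" for x
    proof (cases "x \<le> a")
      case True
      have "g k x = 1" for k 
      proof -
        have "real k * (x - a) \<le> 0" using True by (simp add: mult_nonneg_nonpos)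
        thus ?thesis by (simp add: g_def)
      qed
      thus ?thesis using True by simp
    next
      case False
      have "eventually (\<lambda>k. 1 / (x - a) \<le> real k) sequentially"
        using filterlim_real_sequentially by (simp add: filterlim_at_top)
      hence "eventually (\<lambda>k. g k x = 0) sequentially"
      proof eventually_elim
        case (elim k)
        thus ?case using False unfolding g_def by (simp add: field_simps)
      qed
      thus ?thesis using False by (simp add: tendsto_eventually)
    qed
    have "(\<lambda>k. cm_integral \<nu> (\<lambda>x. complex_of_real (g k x))) \<longlonglongrightarrow> \<nu> {..a}" if "complex_measure \<nu>" for \<nu>
    proof -
      have "(\<lambda>k. cm_integral \<nu> (\<lambda>x. complex_of_real (g k x))) \<longlonglongrightarrow> cm_integral \<nu> (indicator {..a})"
      proof (rule cm_integral_dominated_convergence[OF that, where K=1])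
        show "(\<lambda>x. complex_of_real (g n x)) \<in> borel_measurable borel" for n
          by (intro borel_measurable_continuous_onI continuous_intros c)
        show "(\<lambda>n. complex_of_real (g n x)) \<longlonglongrightarrow> indicator {..a} x" for x
          using tendsto_of_real[OF lim[of x], where ?'a=complex] by (simp add: indicator_def of_bool_def split: if_splits)
        show "cmod (complex_of_real (g n x)) \<le> 1" for n x by (simp add: g_def)
      qed simp
      thus ?thesis using cm_integral_indicator[OF that, of "{..a}"] by simp
    qed
    from this[OF cm(1)] this[OF cm(2)] show ?thesis
      using eq[OF c] by (simp add: g_def LIMSEQ_unique)
  qed
  have one: "cm_integral \<nu>1 (indicator UNIV) = cm_integral \<nu>2 (indicator UNIV)"
    using eq[of "\<lambda>_. 1"] by (simp add: indicator_def)
  have U: "\<nu>1 UNIV = \<nu>2 UNIV"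
    using one unfolding cm_integral_indicator[OF cm(1) sets.top[of borel, unfolded space_borel]]
      cm_integral_indicator[OF cm(2) sets.top[of borel, unfolded space_borel]] .
  have cmpl: "\<nu> (UNIV - B) = \<nu> UNIV - \<nu> B" if "complex_measure \<nu>" "B \<in> sets borel" for \<nu> :: "real set => complex" and B
    using signed_diff[OF complex_measure_Re_Im(1)[OF that(1)], of UNIV B]
      signed_diff[OF complex_measure_Re_Im(2)[OF that(1)], of UNIV B] that(2)
    by (simp add: complex_eq_iff)
  have bs: "sets borel = sigma_sets UNIV (range (atMost :: real => _))"
    by (subst borel_eq_atMost) (auto simp: sets_measure_of)
  have stab: "Int_stable (range (atMost :: real => _))"
    unfolding Int_stable_def by auto
  have pw: "range (atMost :: real => _) \<subseteq> Pow UNIV" by simp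
  from A have "A \<in> sigma_sets UNIV (range (atMost :: real => _))" using bs by simp
  with stab pw show ?thesis
  proof (induction rule: sigma_sets_induct_disjoint)
    case (basic A) thus ?case using atM by auto
  next
    case empty show ?case using cm unfolding complex_measure_def by simp
  next
    case (compl A)
    hence "A \<in> sets borel" using bs by simp
    thus ?case using cmpl[OF cm(1), of A] cmpl[OF cm(2), of A] compl U by simp
  next
    case (union A)
    hence "range A \<subseteq> sets borel" using bs by auto
    hence "(\<lambda>i. \<nu>1 (A i)) sums \<nu>1 (\<Union>i. A i)" and 2: "(\<lambda>i. \<nu>2 (A i)) sums \<nu>2 (\<Union>i. A i)"
      using cm union(1) unfolding complex_measure_def by blast+
    moreover have "(\<lambda>i. \<nu>1 (A i)) = (\<lambda>i. \<nu>2 (A i))" using union(3) by simp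
    ultimately show ?case by (metis sums_unique2)
  qed
qed

text \<open>By the Lindelof property, countably many open sets without mass cover the complement of the support.\<close>

lemma cm_integral_support:
  fixes \<nu> :: "real set => complex"
  assumes \<nu>: "complex_measure \<nu>" and supp: "cm_support \<nu> \<subseteq> S" and S: "closed S"
    and g: "g \<in> borel_measurable borel"
  shows "cm_integral \<nu> g = cm_set_integral \<nu> S g"
proof -
  define \<V> where "\<V> = {V. open V \<and> (\<forall>A\<in>sets borel. A \<subseteq> V \<longrightarrow> \<nu> A = 0)}"
  have cover: "- S \<subseteq> \<Union>\<V>"
  proof
    fix x assume "x \<in> - S"
    hence "x \<notin> cm_support \<nu>" using supp by auto
    then obtain V where "open V" "x \<in> V" "\<forall>A\<in>sets borel. A \<subseteq> V \<longrightarrow> \<nu> A = 0"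
      unfolding cm_support_def by auto
    thus "x \<in> \<Union>\<V>" unfolding \<V>_def by auto
  qed
  obtain \<W> where \<W>: "\<W> \<subseteq> \<V>" "countable \<W>" "\<Union>\<W> = \<Union>\<V>"
    using Lindelof[of \<V>] unfolding \<V>_def by blast
  have null: "\<nu> A = 0" if A: "A \<in> sets borel" "A \<subseteq> - S" for A
  proof (cases "\<W> = {}")
    case True
    hence "A = {}" using A cover \<W> by auto
    thus ?thesis using \<nu> unfolding complex_measure_def by simp
  next
    case False
    define W where "W i = from_nat_into \<W> i" for i
    have W: "W i \<in> \<V>" for i using from_nat_into[OF False, of i] \<W> unfolding W_def by auto
    have UW: "(\<Union>i. W i) = \<Union>\<V>"
      using \<W> range_from_nat_into[OF False \<W>(2)] unfolding W_def by auto
    define B where "B i = A \<inter> disjointed W i" for i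
    have Wb: "range W \<subseteq> sets borel" using W unfolding \<V>_def by auto
    have db: "range (disjointed W) \<subseteq> sets borel"
      using sets.range_disjointed_sets[OF Wb] by simp
    have B: "range B \<subseteq> sets borel" using A db unfolding B_def by auto
    have Bd: "disjoint_family B" using disjoint_family_disjointed[of W]
      unfolding B_def disjoint_family_on_def by blast
    have UB: "(\<Union>i. B i) = A"
    proof -
      have "(\<Union>i. B i) = A \<inter> (\<Union>i. disjointed W i)" unfolding B_def by simp
      also have "\<dots> = A \<inter> \<Union>\<V>" unfolding UN_disjointed_eq UW ..
      finally show ?thesis using A(2) cover by auto
    qed
    have "\<nu> (B i) = 0" for i
    proof -
      have "B i \<subseteq> W i" using disjointed_subset[of W i] unfolding B_def by auto
      moreover have "B i \<in> sets borel" using B by auto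
      ultimately show ?thesis using W[of i] unfolding \<V>_def by auto
    qed
    moreover have "(\<lambda>i. \<nu> (B i)) sums \<nu> (\<Union>i. B i)" using \<nu> B Bd unfolding complex_measure_def by auto
    ultimately have "(\<lambda>i::nat. 0) sums \<nu> A" using UB by simp
    thus ?thesis using sums_unique2 sums_zero by blast
  qed
  have *: "(LINT x|upper_variation r. g x) = (LINT x|upper_variation r. indicator S x * g x)"
    if r: "signed_measure r" "\<And>A. A \<in> sets borel \<Longrightarrow> A \<subseteq> - S \<Longrightarrow> r A = 0" for r
  proof (rule integral_cong_AE)
    note [measurable_cong] = sets_upper_variation[OF r(1)]
    have [measurable]: "S \<in> sets borel" "g \<in> borel_measurable borel" using S g by auto
    show "g \<in> borel_measurable (upper_variation r)" 
      "(\<lambda>x. indicator S x * g x) \<in> borel_measurable (upper_variation r)" by measurable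
    have "pos_var r (- S) \<le> 0" using r by (intro pos_var_least) auto
    hence "emeasure (upper_variation r) (- S) = 0"
      using emeasure_upper_variation[OF r(1), of "- S"] S by (simp add: ennreal_neg borel_closed)
    hence "AE x in upper_variation r. x \<notin> - S"
      using S sets_upper_variation[OF r(1)] by (intro AE_not_in) (auto simp: null_sets_def)
    thus "AE x in upper_variation r. g x = indicator S x * g x" by eventually_elim auto
  qed
  note sm = complex_measure_Re_Im[OF \<nu>]
  show ?thesis unfolding cm_set_integral_def cm_integral_def
    by (intro arg_cong2[where f="(+)"] arg_cong2[where f="(-)"] arg_cong2[where f="(*)"] refl * sm signed_measure_uminus)
       (simp_all add: null)
qed

lemma borel_measurable_cm_integral:
  fixes F :: "'a::second_countable_topology => 'b::second_countable_topology => complex"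
  assumes \<nu>: "complex_measure \<nu>" and F: "(\<lambda>(x, t). F x t) \<in> borel_measurable (borel \<Otimes>\<^sub>M borel)"
  shows "(\<lambda>t. cm_integral \<nu> (\<lambda>x. F x t)) \<in> borel_measurable borel"
proof -
  note sm = complex_measure_Re_Im[OF \<nu>]
  have *: "(\<lambda>t. LINT x|upper_variation r. F x t) \<in> borel_measurable borel"
    if "signed_measure r" for r :: "'a set => real"
  proof -
    interpret finite_measure "upper_variation r" by (rule finite_upper_variation[OF that])
    have [measurable_cong]: "sets (upper_variation r) = sets borel" by (rule sets_upper_variation[OF that])
    have [measurable]: "(\<lambda>p. F (fst p) (snd p)) \<in> borel_measurable (borel \<Otimes>\<^sub>M borel)"
      using F by (simp add: case_prod_unfold)
    have "(\<lambda>(t,x). F x t) \<in> borel_measurable (borel \<Otimes>\<^sub>M upper_variation r)"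
    proof -
      have sw: "(\<lambda>q. (snd q, fst q)) \<in> borel \<Otimes>\<^sub>M upper_variation r \<rightarrow>\<^sub>M borel \<Otimes>\<^sub>M borel"
        by measurable
      show ?thesis using measurable_compose[OF sw F] by (simp add: case_prod_unfold)
    qed
    thus ?thesis by (rule borel_measurable_lebesgue_integral)
  qed
  show ?thesis unfolding cm_integral_def
    by (intro borel_measurable_add borel_measurable_diff borel_measurable_times borel_measurable_const * sm signed_measure_uminus)
qed

lemma complex_measure_density:
  fixes lam :: "'a::topological_space measure" and m :: "'a => complex"
  assumes lam: "sets lam = sets borel" and m: "integrable lam m"
  shows "complex_measure (\<lambda>A. LINT x:A|lam. m x)"
  unfolding complex_measure_def
proof (intro conjI allI impI)
  show "(LINT x:{}|lam. m x) = 0" by (simp add: set_lebesgue_integral_def)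
  fix A :: "nat => 'a set" assume A: "range A \<subseteq> sets borel" "disjoint_family A"
  have int: "set_integrable lam B m" if "B \<in> sets borel" for B
    unfolding set_integrable_def using that lam m by (intro integrable_mult_indicator) auto
  have part: "(\<Sum>i<n. LINT x:A i|lam. m x) = (LINT x:(\<Union>i<n. A i)|lam. m x)" for n
  proof (induction n)
    case (Suc n)
    have "(\<Union>i<n. A i) \<inter> A n = {}"
      using A(2) unfolding disjoint_family_on_def disjoint_iff by (metis UNIV_I UN_E lessThan_iff less_irrefl disjoint_iff)
    moreover have "(\<Union>i<n. A i) \<in> sets borel" using A by auto
    ultimately have "(LINT x:(\<Union>i<n. A i) \<union> A n|lam. m x) = (LINT x:(\<Union>i<n. A i)|lam. m x) + (LINT x:A n|lam. m x)"
      using A by (intro set_integral_Un int) auto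
    thus ?case using Suc by (simp add: lessThan_Suc Un_commute)
  qed (simp add: set_lebesgue_integral_def)
  have "(\<lambda>n. LINT x:(\<Union>i<n. A i)|lam. m x) \<longlonglongrightarrow> (LINT x:(\<Union>n. \<Union>i<n. A i)|lam. m x)"
  proof (rule set_integral_cont_up)
    show "(\<Union>i<n. A i) \<in> sets lam" for n using A lam by auto
    show "incseq (\<lambda>n. \<Union>i<n. A i)" by (force simp: incseq_def)
    show "set_integrable lam (\<Union>n. \<Union>i<n. A i) m" using A by (intro int) auto
  qed
  moreover have "(\<Union>n. \<Union>i<n. A i) = (\<Union>i. A i)" by auto
  ultimately show "(\<lambda>i. LINT x:A i|lam. m x) sums (LINT x:(\<Union>i. A i)|lam. m x)"
    unfolding sums_def part by simp
qed

lemma cm_integral_density: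
  fixes lam :: "'a::topological_space measure" and m g :: "'a => complex"
  assumes lam: "sets lam = sets borel" and m: "integrable lam m"
    and g: "g \<in> borel_measurable borel" "\<And>x. cmod (g x) \<le> K"
  shows "cm_integral (\<lambda>A. LINT x:A|lam. m x) g = (LINT x|lam. g x * m x)"
proof -
  have [measurable_cong]: "sets lam = sets borel" by (rule lam)
  have [measurable]: "g \<in> borel_measurable borel" by (rule g)
  have gb: "integrable lam (\<lambda>x. complex_of_real (f x) * g x)" if "integrable lam f" for f
  proof (rule Bochner_Integration.integrable_bound[where f="\<lambda>x. K * f x"])
    have [measurable]: "f \<in> borel_measurable lam" using that by auto
    show "(\<lambda>x. complex_of_real (f x) * g x) \<in> borel_measurable lam" by measurable
    show "integrable lam (\<lambda>x. K * f x)" using that by simp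
    show "AE x in lam. cmod (complex_of_real (f x) * g x) \<le> norm (K * f x)"
    proof (rule AE_I2)
      fix x
      have "cmod (g x) \<le> \<bar>K\<bar>" using g(2)[of x] by simp
      thus "cmod (complex_of_real (f x) * g x) \<le> norm (K * f x)"
        using mult_right_mono[of "cmod (g x)" "\<bar>K\<bar>" "\<bar>f x\<bar>"] by (simp add: norm_mult abs_mult mult.commute)
    qed
  qed
  have *: "(LINT x|upper_variation (\<lambda>A. LINT x:A|lam. f x). g x) - (LINT x|upper_variation (\<lambda>A. - (LINT x:A|lam. f x)). g x)
     = (LINT x|lam. complex_of_real (f x) * g x)" if f: "integrable lam f" for f
  proof -
    have [measurable]: "f \<in> borel_measurable lam" using f by auto
    have 1: "(LINT x|upper_variation (\<lambda>A. LINT x:A|lam. f x). g x) = (LINT x|lam. complex_of_real (max 0 (f x)) * g x)"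
      if f: "integrable lam f" for f :: "'a => real"
    proof -
      have [measurable]: "f \<in> borel_measurable lam" using f by auto
      have "density lam (\<lambda>x. ennreal (f x)) = density lam (\<lambda>x. ennreal (max 0 (f x)))"
        by (intro arg_cong2[where f=density] refl ext) (auto simp: max_def ennreal_neg)
      hence "(LINT x|upper_variation (\<lambda>A. LINT x:A|lam. f x). g x) = (LINT x|density lam (\<lambda>x. ennreal (max 0 (f x))). g x)"
        using upper_variation_density[OF lam f] by simp
      also have "\<dots> = (LINT x|lam. max 0 (f x) *\<^sub>R g x)" by (rule integral_density) auto
      finally show ?thesis by (simp add: scaleR_conv_of_real)
    qed
    have 2: "(\<lambda>A. - (LINT x:A|lam. f x)) = (\<lambda>A. LINT x:A|lam. - f x)"
      by (simp add: set_lebesgue_integral_def)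
    have "(LINT x|lam. complex_of_real (max 0 (f x)) * g x) - (LINT x|lam. complex_of_real (max 0 (- f x)) * g x)
       = (LINT x|lam. complex_of_real (max 0 (f x)) * g x - complex_of_real (max 0 (- f x)) * g x)"
      using f by (intro Bochner_Integration.integral_diff[symmetric] gb) auto
    also have "\<dots> = (LINT x|lam. complex_of_real (f x) * g x)"
      by (intro Bochner_Integration.integral_cong) (auto simp: max_def)
    finally show ?thesis unfolding 2 using 1[OF f] 1[of "\<lambda>x. - f x"] f by simp
  qed
  have set_Re_Im: "Re (LINT x:A|lam. m x) = (LINT x:A|lam. Re (m x)) \<and> Im (LINT x:A|lam. m x) = (LINT x:A|lam. Im (m x))"
    if "integrable lam (\<lambda>x. indicator A x *\<^sub>R m x)" for A
    unfolding set_lebesgue_integral_def using integral_Re[OF that] integral_Im[OF that] by simp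
  have ind: "integrable lam (\<lambda>x. indicator A x *\<^sub>R m x)" if "A \<in> sets borel" for A
    using that lam m by (intro integrable_mult_indicator) auto
  have uv: "upper_variation r = upper_variation r'"
    if eq: "\<And>A. A \<in> sets borel \<Longrightarrow> r A = r' A" for r r' :: "'a set => real"
  proof -
    have "(SUP B\<in>{B \<in> sets borel. B \<subseteq> A}. ennreal (r B)) = (SUP B\<in>{B \<in> sets borel. B \<subseteq> A}. ennreal (r' B))" for A
      by (rule SUP_cong[OF refl]) (simp add: eq)
    thus ?thesis unfolding upper_variation_def by simp
  qed
  have u1: "upper_variation (\<lambda>A. Re (LINT x:A|lam. m x)) = upper_variation (\<lambda>A. LINT x:A|lam. Re (m x))"
    by (rule uv) (use set_Re_Im[OF ind] in blast)
  have u2: "upper_variation (\<lambda>A. - Re (LINT x:A|lam. m x)) = upper_variation (\<lambda>A. - (LINT x:A|lam. Re (m x)))"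
    by (rule uv) (use set_Re_Im[OF ind] in presburger)
  have u3: "upper_variation (\<lambda>A. Im (LINT x:A|lam. m x)) = upper_variation (\<lambda>A. LINT x:A|lam. Im (m x))"
    by (rule uv) (use set_Re_Im[OF ind] in blast)
  have u4: "upper_variation (\<lambda>A. - Im (LINT x:A|lam. m x)) = upper_variation (\<lambda>A. - (LINT x:A|lam. Im (m x)))"
    by (rule uv) (use set_Re_Im[OF ind] in presburger)
  have "cm_integral (\<lambda>A. LINT x:A|lam. m x) g =
     (LINT x|lam. complex_of_real (Re (m x)) * g x) + \<i> * (LINT x|lam. complex_of_real (Im (m x)) * g x)"
    unfolding cm_integral_def u1 u2 u3 u4 *[OF integrable_Re[OF m]] *[OF integrable_Im[OF m]] ..
  also have "\<dots> = (LINT x|lam. complex_of_real (Re (m x)) * g x + \<i> * (complex_of_real (Im (m x)) * g x))"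
    using gb[OF integrable_Re[OF m]] gb[OF integrable_Im[OF m]] by simp
  also have "\<dots> = (LINT x|lam. g x * m x)"
  proof (intro Bochner_Integration.integral_cong refl)
    fix x
    have "complex_of_real (Re (m x)) * g x + \<i> * (complex_of_real (Im (m x)) * g x)
       = g x * (complex_of_real (Re (m x)) + \<i> * complex_of_real (Im (m x)))"
      by (simp add: algebra_simps)
    thus "complex_of_real (Re (m x)) * g x + \<i> * (complex_of_real (Im (m x)) * g x) = g x * m x"
      using complex_eq[of "m x"] by simp
  qed
  finally show ?thesis .
qed

lemma cm_support_density:
  fixes lam :: "'a::topological_space measure" and m :: "'a => complex"
  assumes S: "closed S" and lam: "AE x in lam. x \<in> S" and sets: "sets lam = sets borel"
    and m: "m \<in> borel_measurable lam"
  shows "cm_support (\<lambda>A. LINT x:A|lam. m x) \<subseteq> S"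
proof
  fix x assume x: "x \<in> cm_support (\<lambda>A. LINT x:A|lam. m x)"
  show "x \<in> S"
  proof (rule ccontr)
    assume "x \<notin> S"
    then obtain A where A: "A \<subseteq> - S" "A \<in> sets borel" "(LINT x:A|lam. m x) \<noteq> 0"
      using x S unfolding cm_support_def by (auto simp: open_Compl dest!: spec[of _ "- S"])
    have "(LINT x:A|lam. m x) = (LINT x|lam. 0)" unfolding set_lebesgue_integral_def
    proof (rule integral_cong_AE)
      show "(\<lambda>x. indicator A x *\<^sub>R m x) \<in> borel_measurable lam"
        using A m sets by (intro borel_measurable_scaleR) auto
      show "AE x in lam. indicator A x *\<^sub>R m x = 0" using lam A(1) by (auto split: split_indicator)
    qed simp
    thus False using A by simp
  qed
qed

section \<open>Holomorphic dependence on a parameter\<close>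

text \<open>Cauchy's inequality bounds the derivatives near \<open>z\<close> uniformly in \<open>x\<close>, so the difference quotients
  are dominated by a constant.\<close>

lemma integral_holomorphic_derivative:
  fixes g :: "complex => 'a => complex"
  assumes M: "finite_measure M" and S: "open S"
    and hol: "\<And>x. (\<lambda>z. g z x) holomorphic_on S"
    and meas: "\<And>z. z \<in> S \<Longrightarrow> g z \<in> borel_measurable M"
    and bnd: "\<And>z x. z \<in> S \<Longrightarrow> cmod (g z x) \<le> B z" and B: "continuous_on S B"
    and z: "z \<in> S"
  shows "((\<lambda>z. LINT x|M. g z x) has_field_derivative (LINT x|M. deriv (\<lambda>z. g z x) z)) (at z)"
proof -
  interpret finite_measure M by fact
  obtain r where r: "r > 0" "cball z r \<subseteq> S" using S z open_contains_cball by blast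
  have "bounded (B ` cball z r)" using B r by (intro compact_imp_bounded compact_continuous_image) (auto intro: continuous_on_subset)
  then obtain b where b': "\<And>y. y \<in> B ` cball z r \<Longrightarrow> norm y \<le> b" unfolding bounded_iff by blast
  have b: "B w \<le> b" if "w \<in> cball z r" for w using b'[of "B w"] that by fastforce
  have gb: "cmod (g w x) \<le> b" if "w \<in> cball z r" for w x
    using bnd[of w x] b[OF that] r that by force
  have dif: "((\<lambda>z. g z x) has_field_derivative deriv (\<lambda>z. g z x) w) (at w)" if "w \<in> S" for w x
    using holomorphic_derivI[OF hol S that] .
  define U where "U = ball z (r/2)"
  have U: "open U" "z \<in> U" "convex U" using r unfolding U_def by auto
  have UC: "cball w (r/2) \<subseteq> cball z r" if "w \<in> U" for w
  proof
    fix v assume "v \<in> cball w (r/2)"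
    thus "v \<in> cball z r" using that dist_triangle[of z v w] unfolding U_def by simp
  qed
  have US: "U \<subseteq> S" using r by (auto simp: U_def)
  have db: "cmod (deriv (\<lambda>z. g z x) w) \<le> b / (r/2)" if "w \<in> U" for w x
  proof -
    have "cmod ((deriv ^^ 1) (\<lambda>z. g z x) w) \<le> fact 1 * b / (r/2) ^ 1"
    proof (rule Cauchy_inequality)
      have s: "cball w (r/2) \<subseteq> S" using UC[OF that] r by blast
      show "(\<lambda>z. g z x) holomorphic_on ball w (r/2)"
        by (rule holomorphic_on_subset[OF hol]) (use s ball_subset_cball in blast)
      show "continuous_on (cball w (r/2)) (\<lambda>z. g z x)"
        by (rule holomorphic_on_imp_continuous_on[OF holomorphic_on_subset[OF hol s]])
      fix v assume "cmod (w - v) = r/2"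
      hence "v \<in> cball w (r/2)" by (simp add: dist_norm)
      thus "cmod (g v x) \<le> b" using gb UC[OF that] by blast
    qed (use r in auto)
    thus ?thesis by simp
  qed
  have lip: "cmod (g w x - g z x) \<le> b / (r/2) * cmod (w - z)" if "w \<in> U" for w x
    by (rule field_differentiable_bound[of U _ "\<lambda>w. deriv (\<lambda>z. g z x) w"])
       (use U that US db dif has_field_derivative_at_within in blast)+
  have int: "integrable M (g w)" if "w \<in> U" for w
  proof (rule integrable_const_bound)
    show "AE x in M. cmod (g w x) \<le> b" using gb that r unfolding U_def by (auto intro!: AE_I2)
    show "g w \<in> borel_measurable M" using meas that US by blast
  qed
  have "((\<lambda>w. ((LINT x|M. g w x) - (LINT x|M. g z x)) / (w - z)) \<longlongrightarrow> (LINT x|M. deriv (\<lambda>z. g z x) z)) (at z within U)"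
    unfolding tendsto_at_iff_sequentially comp_def
  proof (intro allI impI)
    fix X assume X: "\<forall>i. X i \<in> U - {z}" "X \<longlonglongrightarrow> z"
    have qm: "(\<lambda>x. (g (X i) x - g z x) / (X i - z)) \<in> borel_measurable M" for i
      using X US z by (intro borel_measurable_divide borel_measurable_diff meas borel_measurable_const) auto
    have lim: "(\<lambda>i. (g (X i) x - g z x) / (X i - z)) \<longlonglongrightarrow> deriv (\<lambda>z. g z x) z" for x
    proof -
      have "((\<lambda>w. (g w x - g z x) / (w - z)) \<longlongrightarrow> deriv (\<lambda>z. g z x) z) (at z)"
        using dif[OF z, of x] by (simp add: has_field_derivative_iff)
      thus ?thesis using X by (auto simp: tendsto_at_iff_sequentially comp_def)
    qed
    have "(\<lambda>i. LINT x|M. (g (X i) x - g z x) / (X i - z)) \<longlonglongrightarrow> (LINT x|M. deriv (\<lambda>z. g z x) z)"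
    proof (rule integral_dominated_convergence[where w="\<lambda>_. b / (r/2)"])
      show "(\<lambda>x. deriv (\<lambda>z. g z x) z) \<in> borel_measurable M"
        by (rule borel_measurable_LIMSEQ_metric[OF qm lim])
      show "AE x in M. cmod ((g (X i) x - g z x) / (X i - z)) \<le> b / (r/2)" for i
      proof (rule AE_I2)
        fix x
        have "X i \<in> U" "X i \<noteq> z" using X by auto
        thus "cmod ((g (X i) x - g z x) / (X i - z)) \<le> b / (r/2)"
          using lip[of "X i" x] by (simp add: norm_divide divide_le_eq)
      qed
    qed (use qm lim in auto)
    moreover have "(LINT x|M. (g (X i) x - g z x) / (X i - z)) = ((LINT x|M. g (X i) x) - (LINT x|M. g z x)) / (X i - z)" for i
    proof -
      have "X i \<in> U" "X i \<noteq> z" using X by auto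
      thus ?thesis using int[of "X i"] int[of z] U by simp
    qed
    ultimately show "(\<lambda>i. ((LINT x|M. g (X i) x) - (LINT x|M. g z x)) / (X i - z)) \<longlonglongrightarrow> (LINT x|M. deriv (\<lambda>z. g z x) z)"
      by (simp only:)
  qed
  thus ?thesis unfolding has_field_derivative_iff at_within_open[OF U(2,1)] .
qed

lemma integral_holomorphic:
  fixes g :: "complex => 'a => complex"
  assumes "finite_measure M" and "open S"
    and "\<And>x. (\<lambda>z. g z x) holomorphic_on S"
    and "\<And>z. z \<in> S \<Longrightarrow> g z \<in> borel_measurable M"
    and "\<And>z x. z \<in> S \<Longrightarrow> cmod (g z x) \<le> B z" and "continuous_on S B"
  shows "(\<lambda>z. LINT x|M. g z x) holomorphic_on S"
  unfolding holomorphic_on_open[OF assms(2)] using integral_holomorphic_derivative[OF assms] by blast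

text \<open>Vitali's theorem. By Montel's theorem every subsequence has a convergent subsequence; its limit is
  known on \<open>T\<close>, hence on \<open>S\<close> by analytic continuation.\<close>

lemma vitali_convergence:
  fixes F :: "nat => complex => complex"
  assumes S: "open S" "connected S" and hol: "\<And>n. F n holomorphic_on S"
    and bnd: "\<And>n z. z \<in> S \<Longrightarrow> cmod (F n z) \<le> B z" and B: "continuous_on S B"
    and T: "open T" "T \<noteq> {}" "T \<subseteq> S" and conv: "\<And>z. z \<in> T \<Longrightarrow> convergent (\<lambda>n. F n z)"
  obtains g where "g holomorphic_on S" "\<And>z. z \<in> S \<Longrightarrow> (\<lambda>n. F n z) \<longlonglongrightarrow> g z"
proof -
  have loc: "\<exists>b. \<forall>h\<in>range F. \<forall>z\<in>K. cmod (h z) \<le> b" if K: "compact K" "K \<subseteq> S" for K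
  proof -
    have "bounded (B ` K)" using B K by (intro compact_imp_bounded compact_continuous_image) (auto intro: continuous_on_subset)
    then obtain b where b': "\<And>y. y \<in> B ` K \<Longrightarrow> norm y \<le> b" unfolding bounded_iff by blast
    have b: "B w \<le> b" if "w \<in> K" for w using b'[of "B w"] that by fastforce
    have "cmod (F n z) \<le> b" if "z \<in> K" for n z
      using bnd[of z n] b[OF that] K that by force
    thus ?thesis by blast
  qed
  have montel: "\<exists>g r. g holomorphic_on S \<and> strict_mono r \<and> (\<forall>x\<in>S. (\<lambda>n. F (s (r n)) x) \<longlonglongrightarrow> g x)" for s :: "nat => nat"
  proof -
    have "range (\<lambda>n. F (s n)) \<subseteq> range F" by auto
    moreover have "h holomorphic_on S" if "h \<in> range F" for h using hol that by auto
    ultimately obtain g r where "g holomorphic_on S" "strict_mono (r :: nat => nat)" "\<And>x. x \<in> S \<Longrightarrow> (\<lambda>n. F (s (r n)) x) \<longlonglongrightarrow> g x"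
      by (rule_tac Montel[of S "range F" "\<lambda>n. F (s n)"]) (use S(1) loc in \<open>auto simp: comp_def\<close>)
    thus ?thesis by (intro exI[of _ g] exI[of _ r]) blast
  qed
  obtain g r where g: "g holomorphic_on S" and r: "strict_mono r" "\<forall>x\<in>S. (\<lambda>n. F (r n) x) \<longlonglongrightarrow> g x"
    using montel[of id] by auto
  have gT: "(\<lambda>n. F n z) \<longlonglongrightarrow> g z" if "z \<in> T" for z
  proof -
    obtain l where l: "(\<lambda>n. F n z) \<longlonglongrightarrow> l" using conv[OF \<open>z \<in> T\<close>] unfolding convergent_def by blast
    have "(\<lambda>n. F (r n) z) \<longlonglongrightarrow> l" using LIMSEQ_subseq_LIMSEQ[OF l r(1)] by (simp add: comp_def)
    thus ?thesis using r(2) that T l LIMSEQ_unique by blast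
  qed
  have "(\<lambda>n. F n z) \<longlonglongrightarrow> g z" if z: "z \<in> S" for z
  proof (rule ccontr)
    assume "\<not> ?thesis"
    then obtain e where e: "e > 0" "\<not> eventually (\<lambda>n. dist (F n z) (g z) < e) sequentially"
      unfolding tendsto_iff by blast
    then obtain s :: "nat => nat" where s: "strict_mono s" "\<And>n. \<not> dist (F (s n) z) (g z) < e"
      using not_eventually_sequentiallyD[OF e(2)] by blast
    obtain g' r' where g': "g' holomorphic_on S" and r': "strict_mono r'" "\<forall>x\<in>S. (\<lambda>n. F (s (r' n)) x) \<longlonglongrightarrow> g' x"
      using montel[of s] by blast
    have "g' w = g w" if "w \<in> T" for w
    proof -
      have "(\<lambda>n. F (s (r' n)) w) \<longlonglongrightarrow> g w"
        using LIMSEQ_subseq_LIMSEQ[OF gT[OF that] strict_mono_o[OF s(1) r'(1)]] by (simp add: comp_def)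
      thus ?thesis using r'(2) that T LIMSEQ_unique by blast
    qed
    hence "g' z = g z"
      using analytic_continuation_open[OF T(1) S(1) T(2) S(2) T(3) g' g _ z] by blast
    hence "(\<lambda>n. F (s (r' n)) z) \<longlonglongrightarrow> g z" using r'(2) z by auto
    hence "eventually (\<lambda>n. dist (F (s (r' n)) z) (g z) < e) sequentially" using e(1) tendstoD by blast
    then obtain n where "dist (F (s (r' n)) z) (g z) < e" unfolding eventually_sequentially by blast
    thus False using s(2) by blast
  qed
  thus thesis using that[OF g] by blast
qed

lemma norm_integral_le_bound:
  fixes f :: "'a => 'b::{banach, second_countable_topology}"
  assumes M: "prob_space M" and b: "\<And>x. x \<in> space M \<Longrightarrow> norm (f x) \<le> b" and b0: "0 \<le> b"
  shows "norm (LINT x|M. f x) \<le> b"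
proof -
  interpret prob_space M by fact
  show ?thesis
  proof (cases "integrable M f")
    case True
    have "norm (LINT x|M. f x) \<le> (LINT x|M. norm (f x))" by (rule integral_norm_bound)
    also have "\<dots> \<le> (LINT x|M. b)" using True b by (intro integral_mono) auto
    finally show ?thesis by (simp add: prob_space)
  qed (simp add: not_integrable_integral_eq b0)
qed

section \<open>The limiting equation\<close>

text \<open>Here \<open>\<sigma>\<close> stands for the squared modulus of the symbol and \<open>lam\<close> for the uniform distribution on the
  unit interval. Normalizing the bound \<open>K\<close> to be at least 1 makes \<open>8 * K\<close> a height above which the
  equation is a contraction.\<close>

locale profile_equation =
  fixes lam :: "real measure" and \<sigma> :: "real => real => real" and K c :: real
  assumes prob_lam: "prob_space lam" and sets_lam [measurable_cong]: "sets lam = sets borel"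
    and meas_\<sigma>: "(\<lambda>(x, t). \<sigma> x t) \<in> borel_measurable (borel \<Otimes>\<^sub>M borel)"
    and \<sigma>_nonneg: "\<And>x t. 0 \<le> \<sigma> x t" and \<sigma>_le: "\<And>x t. \<sigma> x t \<le> K" and K1: "1 \<le> K"
    and c01: "0 \<le> c" "c \<le> 1"
begin

interpretation prob_space lam by (rule prob_lam)

lemma meas_\<sigma>' [measurable]: 
  assumes [measurable]: "f \<in> M \<rightarrow>\<^sub>M borel" "g \<in> M \<rightarrow>\<^sub>M borel"
  shows "(\<lambda>x. \<sigma> (f x) (g x)) \<in> borel_measurable M"
proof -
  have "(\<lambda>x. (f x, g x)) \<in> M \<rightarrow>\<^sub>M borel \<Otimes>\<^sub>M borel" by measurable
  from measurable_compose[OF this meas_\<sigma>] show ?thesis by simp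
qed

lemma integrable_bounded:
  fixes f :: "real => complex"
  assumes "f \<in> borel_measurable borel" "\<And>x. cmod (f x) \<le> b"
  shows "integrable lam f"
  by (rule integrable_const_bound[where B=b]) (use assms in auto)

lemma integral_bounded:
  fixes f :: "real => complex"
  assumes "\<And>x. cmod (f x) \<le> b"
  shows "cmod (LINT x|lam. f x) \<le> b"
  using norm_integral_le_bound[OF prob_lam, of f b] assms order_trans[OF norm_ge_zero assms[of 0]] by simp

definition column_average :: "(real => complex) => real => complex" where
  "column_average m t = of_real c * (LINT x|lam. of_real (\<sigma> x t) * m x)"

abbreviation share :: "(real => complex) => real => real => complex" where
  "share m u t \<equiv> of_real (\<sigma> u t) / (1 + column_average m t)"

definition profile_step :: "complex => (real => complex) => real => complex" where
  "profile_step z m u = 1 / (- z + (LINT t|lam. share m u t))"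

lemma column_average_measurable [measurable]:
  assumes [measurable]: "m \<in> borel_measurable borel"
  shows "column_average m \<in> borel_measurable borel"
  unfolding column_average_def by measurable

lemma profile_step_measurable:
  assumes [measurable]: "m \<in> borel_measurable borel"
  shows "profile_step z m \<in> borel_measurable borel"
  unfolding profile_step_def by measurable

lemma column_average_le:
  assumes "\<And>x. cmod (m x) \<le> b"
  shows "cmod (column_average m t) \<le> K * b"
proof -
  have b0: "0 \<le> b" using assms[of 0] norm_ge_zero order_trans by blast
  have "cmod (LINT x|lam. of_real (\<sigma> x t) * m x) \<le> K * b"
    by (rule integral_bounded) (use assms \<sigma>_nonneg \<sigma>_le K1 in \<open>auto simp: norm_mult intro!: mult_mono\<close>)
  hence "c * cmod (LINT x|lam. of_real (\<sigma> x t) * m x) \<le> 1 * (K * b)"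
    using c01 b0 K1 by (intro mult_mono) auto
  thus ?thesis using c01 by (simp add: column_average_def norm_mult)
qed

lemma Im_of_real_mult: "Im (of_real r * w) = r * Im w" by simp

text \<open>The values at \<open>z\<close> of the Stieltjes transforms of probability measures on \<open>[0, \<infinity>)\<close>
  obey these bounds, and the equation preserves them.\<close>

definition herglotz_class :: "complex => (real => complex) => bool" where
  "herglotz_class z m \<longleftrightarrow> m \<in> borel_measurable borel \<and>
     (\<forall>u. 0 \<le> Im (m u) \<and> 0 \<le> Im (z * m u) \<and> cmod (m u) \<le> 1 / Im z)"

lemma integral_Im_nonneg:
  fixes f :: "real => complex"
  assumes "\<And>x. 0 \<le> Im (f x)"
  shows "0 \<le> Im (LINT x|lam. f x)"
proof (cases "integrable lam f")
  case True
  have "Im (LINT x|lam. f x) = (LINT x|lam. Im (f x))" using integral_Im[OF True] by simp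
  thus ?thesis using assms by (simp add: Bochner_Integration.integral_nonneg)
qed (simp add: not_integrable_integral_eq)

text \<open>Multiplication by \<open>z\<close> keeps the averages in the closed upper half plane, which bounds the
  denominator away from 0.\<close>

lemma herglotz_denominator:
  assumes z: "Im z > 0" and m: "herglotz_class z m"
  shows "Im z \<le> Im (z * (1 + column_average m t))" "Im z / cmod z \<le> cmod (1 + column_average m t)"
    "0 \<le> Im (column_average m t)" "1 + column_average m t \<noteq> 0"
proof -
  have m': "0 \<le> Im (m u)" "0 \<le> Im (z * m u)" for u using m unfolding herglotz_class_def by auto
  have "z * column_average m t = of_real c * (LINT x|lam. of_real (\<sigma> x t) * (z * m x))"
  proof -
    have "(LINT x|lam. of_real (\<sigma> x t) * (z * m x)) = (LINT x|lam. z * (of_real (\<sigma> x t) * m x))"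
      by (simp add: mult.left_commute)
    thus ?thesis unfolding column_average_def by simp
  qed
  moreover have "0 \<le> Im (LINT x|lam. of_real (\<sigma> x t) * (z * m x))"
    unfolding Im_of_real_mult using m'(2) \<sigma>_nonneg by (intro integral_Im_nonneg) (simp only: Im_of_real_mult mult_nonneg_nonneg)
  ultimately have "0 \<le> Im (z * column_average m t)" using c01 by simp
  thus 1: "Im z \<le> Im (z * (1 + column_average m t))" by (simp add: distrib_left)
  have z0: "cmod z > 0" using z by auto
  have "Im z \<le> cmod (z * (1 + column_average m t))" using 1 abs_Im_le_cmod by (meson abs_ge_self order_trans)
  thus 2: "Im z / cmod z \<le> cmod (1 + column_average m t)" using z0 by (simp add: norm_mult divide_le_eq mult.commute)
  have "0 < Im z / cmod z" using z z0 by simp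
  thus "1 + column_average m t \<noteq> 0" using 2 by auto
  have "0 \<le> Im (LINT x|lam. of_real (\<sigma> x t) * m x)"
    using m'(1) \<sigma>_nonneg by (intro integral_Im_nonneg) simp
  thus "0 \<le> Im (column_average m t)" using c01 unfolding column_average_def by simp
qed

lemma Im_inverse_nonneg_iff: "0 \<le> Im (1 / w) \<longleftrightarrow> Im w \<le> 0"
proof (cases "w = 0")
  case False
  have "Im (1 / w) = - Im w / (cmod w)\<^sup>2" by (subst complex_div_cnj) (simp add: Im_divide_of_real)
  moreover have "0 < (cmod w)\<^sup>2" using False by simp
  ultimately show ?thesis by (simp only: zero_le_divide_iff) auto
qed simp

lemma profile_step_herglotz:
  assumes z: "Im z > 0" and m: "herglotz_class z m"
  shows "herglotz_class z (profile_step z m)"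
    and "Im z \<le> cmod (- z + (LINT t|lam. share m u t))"
proof -
  have mm: "m \<in> borel_measurable borel" using m unfolding herglotz_class_def by blast
  have z0: "cmod z > 0" "z \<noteq> 0" using z by auto
  define D where "D u = - z + (LINT t|lam. share m u t)" for u
  have "0 \<le> Im (LINT t|lam. - (share m u t))" for u
  proof (rule integral_Im_nonneg)
    fix t
    have "0 \<le> Im (1 / (- 1 - column_average m t))"
      unfolding Im_inverse_nonneg_iff using herglotz_denominator(3)[OF z m, of t] by simp
    hence "0 \<le> \<sigma> u t * Im (1 / (- 1 - column_average m t))" using \<sigma>_nonneg by simp
    also have "\<dots> = Im (of_real (\<sigma> u t) * (1 / (- 1 - column_average m t)))" by (simp only: Im_complex_of_real Re_complex_of_real times_complex.simps mult_zero_left add_0_right)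
    also have "of_real (\<sigma> u t) * (1 / (- 1 - column_average m t)) = - (share m u t)"
    proof -
      have "- 1 - column_average m t = - (1 + column_average m t)" by simp
      thus ?thesis by (simp only: divide_minus_right mult_minus_right times_divide_eq_right mult_1_right)
    qed
    finally show "0 \<le> Im (- (share m u t))" .
  qed
  hence ImD: "Im (D u) \<le> - Im z" for u unfolding D_def by (simp add: integral_minus)
  have nD: "Im z \<le> cmod (D u)" for u using ImD[of u] abs_Im_le_cmod[of "D u"] by linarith
  thus "Im z \<le> cmod (- z + (LINT t|lam. share m u t))" unfolding D_def .
  have D0: "D u \<noteq> 0" for u using nD[of u] z by auto
  have zD: "Im (D u / z) \<le> 0" for u
  proof -
    have "0 \<le> Im (LINT t|lam. - (of_real (\<sigma> u t) / (z * (1 + column_average m t))))"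
    proof (rule integral_Im_nonneg)
      fix t
      let ?d = "z * (1 + column_average m t)"
      have d: "Im z \<le> Im ?d" by (rule herglotz_denominator(1)[OF z m])
      have "0 \<le> Im (1 / (- ?d))" unfolding Im_inverse_nonneg_iff using d z by (simp del: times_complex.simps)
      hence "0 \<le> \<sigma> u t * Im (1 / (- ?d))" using \<sigma>_nonneg by (intro mult_nonneg_nonneg)
      also have "\<dots> = Im (of_real (\<sigma> u t) * (1 / (- ?d)))" by (simp only: Im_complex_of_real Re_complex_of_real times_complex.simps mult_zero_left add_0_right)
      also have "of_real (\<sigma> u t) * (1 / (- ?d)) = - (of_real (\<sigma> u t) / ?d)" by simp
      finally show "0 \<le> Im (- (of_real (\<sigma> u t) / ?d))" .
    qed
    moreover have "D u / z = - 1 + (LINT t|lam. of_real (\<sigma> u t) / (z * (1 + column_average m t)))"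
    proof -
      have "(LINT t|lam. of_real (\<sigma> u t) / (z * (1 + column_average m t))) = (LINT t|lam. (share m u t) / z)"
        by (intro Bochner_Integration.integral_cong refl) (simp add: mult.commute)
      also have "\<dots> = (LINT t|lam. share m u t) / z" by (rule integral_divide_zero)
      finally show ?thesis unfolding D_def using z0 by (simp add: diff_divide_distrib)
    qed
    ultimately show ?thesis by (simp add: integral_minus)
  qed
  show "herglotz_class z (profile_step z m)" unfolding herglotz_class_def
  proof (intro conjI allI)
    show "profile_step z m \<in> borel_measurable borel" by (rule profile_step_measurable[OF mm])
    fix u
    have e: "profile_step z m u = 1 / D u" unfolding profile_step_def D_def ..
    show "0 \<le> Im (profile_step z m u)" unfolding e Im_inverse_nonneg_iff using ImD[of u] z by simp
    have "z * profile_step z m u = 1 / (D u / z)" unfolding e by simp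
    thus "0 \<le> Im (z * profile_step z m u)" using zD[of u] Im_inverse_nonneg_iff[of "D u / z"] by presburger
    show "cmod (profile_step z m u) \<le> 1 / Im z" unfolding e
      using nD[of u] z D0[of u] by (simp add: norm_divide frac_le)
  qed
qed

text \<open>High above the real axis the equation is a contraction.\<close>

lemma profile_step_large:
  assumes z: "8 * K \<le> Im z" and a: "\<And>t. cmod (column_average m t) \<le> 1/2"
  shows "cmod (profile_step z m u) \<le> 2 / Im z"
    and "Im z / 2 \<le> cmod (- z + (LINT t|lam. share m u t))"
proof -
  have half: "1/2 \<le> cmod (1 + column_average m t)" for t
    using norm_triangle_ineq2[of 1 "- column_average m t"] a[of t] by simp
  have "cmod (LINT t|lam. share m u t) \<le> 2 * K"
  proof (rule integral_bounded)
    fix t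
    have "cmod (share m u t) \<le> K / (1/2)"
      unfolding norm_divide norm_of_real
      by (rule frac_le) (use half[of t] \<sigma>_nonneg[of u t] \<sigma>_le[of u t] K1 in auto)
    thus "cmod (share m u t) \<le> 2 * K" by simp
  qed
  moreover have "Im z \<le> cmod z" using abs_Im_le_cmod[of z] by linarith
  moreover have "cmod z - cmod (LINT t|lam. share m u t) \<le> cmod (- z + (LINT t|lam. share m u t))"
    using norm_triangle_ineq2[of "- z" "- (LINT t|lam. share m u t)"] by simp
  ultimately show 1: "Im z / 2 \<le> cmod (- z + (LINT t|lam. share m u t))"
    using z K1 by linarith
  show "cmod (profile_step z m u) \<le> 2 / Im z"
    unfolding profile_step_def norm_divide
    using frac_le[OF _ _ _ 1, of 1 1] z K1 by simp
qed

lemma profile_step_contraction: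
  assumes z: "8 * K \<le> Im z"
    and a: "\<And>t. cmod (column_average m t) \<le> 1/2" and a': "\<And>t. cmod (column_average m' t) \<le> 1/2"
    and [measurable]: "m \<in> borel_measurable borel" "m' \<in> borel_measurable borel"
    and b: "\<And>x. cmod (m x) \<le> b" "\<And>x. cmod (m' x) \<le> b"
    and d: "\<And>x. cmod (m x - m' x) \<le> d"
  shows "cmod (profile_step z m u - profile_step z m' u) \<le> d / 4"
proof -
  have d0: "0 \<le> d" using d[of 0] norm_ge_zero order_trans by blast
  have y: "Im z > 0" using z K1 by linarith
  have half: "1/2 \<le> cmod (1 + column_average m t)" "1/2 \<le> cmod (1 + column_average m' t)" for t
    using norm_triangle_ineq2[of 1 "- column_average m t"] a[of t]
      norm_triangle_ineq2[of 1 "- column_average m' t"] a'[of t] by simp_all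
  have bd: "cmod (of_real (\<sigma> x t) * f x) \<le> K * B" if "\<And>x. cmod (f x) \<le> B" for f :: "real => complex" and x t B
    using that[of x] \<sigma>_nonneg[of x t] \<sigma>_le[of x t] K1 by (auto simp: norm_mult intro!: mult_mono)
  have ca: "column_average m t - column_average m' t = column_average (\<lambda>x. m x - m' x) t" for t
  proof -
    have "integrable lam (\<lambda>x. of_real (\<sigma> x t) * m x)" "integrable lam (\<lambda>x. of_real (\<sigma> x t) * m' x)"
      by (rule integrable_bounded[OF _ bd[OF b(1)]], measurable, rule integrable_bounded[OF _ bd[OF b(2)]], measurable)
    thus ?thesis unfolding column_average_def by (simp add: right_diff_distrib)
  qed
  define I where "I m u = (LINT t|lam. share m u t)" for m u
  have qb: "cmod (share m u t) \<le> K / (1/2)" "cmod (share m' u t) \<le> K / (1/2)" for t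
    unfolding norm_divide norm_of_real
    by (rule frac_le; use half[of t] \<sigma>_nonneg[of u t] \<sigma>_le[of u t] K1 in auto)+
  have "I m' u - I m u = (LINT t|lam. share m' u t - share m u t)"
    unfolding I_def
    by (rule Bochner_Integration.integral_diff[symmetric]; rule integrable_bounded[OF _ qb(2)] integrable_bounded[OF _ qb(1)]; measurable)
  also have "cmod \<dots> \<le> 4 * K * (K * d)"
  proof (rule integral_bounded)
    fix t
    have n0: "1 + column_average m t \<noteq> 0" "1 + column_average m' t \<noteq> 0" using half[of t] by auto
    have "share m' u t - share m u t
       = of_real (\<sigma> u t) * (column_average m t - column_average m' t) / ((1 + column_average m t) * (1 + column_average m' t))"
      using n0 by (simp add: field_simps)
    also have "cmod \<dots> \<le> (K * (K * d)) / (1/2 * (1/2))"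
      unfolding norm_divide norm_mult norm_of_real ca
      by (rule frac_le; (intro mult_mono column_average_le d)?)
         (use half[of t] \<sigma>_nonneg[of u t] \<sigma>_le[of u t] K1 d0 in \<open>auto intro!: mult_nonneg_nonneg\<close>)
    finally show "cmod (share m' u t - share m u t) \<le> 4 * K * (K * d)"
      by simp
  qed
  finally have I: "cmod (I m' u - I m u) \<le> 4 * K * (K * d)" .
  have D: "Im z / 2 \<le> cmod (- z + I m u)" "Im z / 2 \<le> cmod (- z + I m' u)"
    unfolding I_def by (rule profile_step_large(2)[OF z a], rule profile_step_large(2)[OF z a'])
  have nz: "- z + I m u \<noteq> 0" "- z + I m' u \<noteq> 0" using D y by auto
  have "profile_step z m u - profile_step z m' u = (I m' u - I m u) / ((- z + I m u) * (- z + I m' u))"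
    unfolding profile_step_def I_def[symmetric] using nz by (simp add: field_simps)
  also have "cmod \<dots> \<le> (4 * K * (K * d)) / ((Im z / 2) * (Im z / 2))"
    unfolding norm_divide norm_mult
    by (rule frac_le[OF _ I mult_pos_pos mult_mono]) (use D y I K1 d0 in simp_all)
  also have "\<dots> = 16 * K\<^sup>2 * d / (Im z)\<^sup>2" using y by (simp add: field_simps power2_eq_square)
  also have "\<dots> \<le> 16 * K\<^sup>2 * d / (8 * K)\<^sup>2"
    using z K1 d0 by (intro divide_left_mono power_mono mult_pos_pos) auto
  also have "\<dots> = d / 4" using K1 by (simp add: field_simps power2_eq_square)
  finally show ?thesis .
qed

lemma profile_equation_unique:
  assumes z: "8 * K \<le> Im z"
    and m: "m \<in> borel_measurable borel" "\<And>t. cmod (column_average m t) \<le> 1/2" "\<And>u. m u = profile_step z m u"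
    and m': "m' \<in> borel_measurable borel" "\<And>t. cmod (column_average m' t) \<le> 1/2" "\<And>u. m' u = profile_step z m' u"
  shows "m u = m' u"
proof -
  have y: "Im z > 0" using z K1 by linarith
  have b: "cmod (m x) \<le> 2 / Im z" "cmod (m' x) \<le> 2 / Im z" for x
    using profile_step_large(1)[OF z m(2), of x] profile_step_large(1)[OF z m'(2), of x] m(3)[of x] m'(3)[of x] by simp_all
  have "cmod (m x - m' x) \<le> (4 / Im z) * (1/4) ^ k" for k x
  proof (induction k arbitrary: x)
    case 0
    show ?case using norm_triangle_ineq4[of "m x" "m' x"] b[of x] by simp
  next
    case (Suc k)
    from profile_step_contraction[OF z m(2) m'(2) m(1) m'(1) b Suc.IH, of x]
    show ?case using m(3)[of x] m'(3)[of x] by simp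
  qed
  moreover have "(\<lambda>k. (4 / Im z) * (1/4::real) ^ k) \<longlonglongrightarrow> (4 / Im z) * 0"
    by (intro tendsto_intros LIMSEQ_power_zero) auto
  ultimately have "cmod (m u - m' u) \<le> 4 / Im z * 0" by (intro LIMSEQ_le_const) auto
  thus ?thesis by simp
qed

text \<open>The iteration starts from the Stieltjes transform of the unit mass at 0.\<close>

primrec profile_iterate :: "nat => complex => real => complex" where
  "profile_iterate 0 z = (\<lambda>u. - 1 / z)"
| "profile_iterate (Suc k) z = profile_step z (profile_iterate k z)"

lemma profile_iterate_herglotz:
  assumes z: "Im z > 0" shows "herglotz_class z (profile_iterate k z)"
proof (induction k)
  case 0
  have "cmod (- 1 / z) \<le> 1 / Im z" using z abs_Im_le_cmod[of z] by (simp add: norm_divide frac_le)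
  moreover have "0 \<le> Im (- 1 / z)"
    using z Im_inverse_nonneg_iff[of "- z"] by (simp only: divide_minus_right divide_minus_left uminus_complex.sel neg_le_0_iff_le less_imp_le)
  moreover have "Im (z * (- 1 / z)) = 0" using z by auto
  ultimately show ?case unfolding herglotz_class_def profile_iterate.simps by (intro conjI allI borel_measurable_const) simp_all
qed (use profile_step_herglotz(1)[OF z] in simp)

lemma herglotz_column_average:
  assumes "8 * K \<le> Im z" "herglotz_class z m"
  shows "cmod (column_average m t) \<le> 1/2"
proof -
  have "cmod (column_average m t) \<le> K * (1 / Im z)"
    by (rule column_average_le) (use assms(2) in \<open>auto simp: herglotz_class_def\<close>)
  also have "\<dots> \<le> K * (1 / (8 * K))" using assms K1 by (intro mult_left_mono divide_left_mono) auto
  finally show ?thesis using K1 by simp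
qed

lemma profile_iterate_convergent:
  assumes z: "8 * K \<le> Im z" shows "convergent (\<lambda>k. profile_iterate k z u)"
proof -
  have y: "Im z > 0" using z K1 by linarith
  note H = profile_iterate_herglotz[OF y]
  have b: "cmod (profile_iterate k z x) \<le> 2 / Im z" for k x
  proof -
    have "cmod (profile_iterate k z x) \<le> 1 / Im z" using H[of k] unfolding herglotz_class_def by blast
    also have "\<dots> \<le> 2 / Im z" using y by (simp add: divide_right_mono)
    finally show ?thesis .
  qed
  have mm: "profile_iterate k z \<in> borel_measurable borel" for k using H[of k] unfolding herglotz_class_def by blast
  have dd: "cmod (profile_iterate (Suc k) z x - profile_iterate k z x) \<le> (4 / Im z) * (1/4) ^ k" for k x
  proof (induction k arbitrary: x)
    case 0
    show ?case using norm_triangle_ineq4[of "profile_iterate (Suc 0) z x" "profile_iterate 0 z x"] b[of "Suc 0" x] b[of 0 x]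
      by (simp del: profile_iterate.simps)
  next
    case (Suc k)
    from profile_step_contraction[OF z herglotz_column_average[OF z H] herglotz_column_average[OF z H] mm mm b b Suc.IH, of x]
    show ?case by simp
  qed
  have "summable (\<lambda>k. (4 / Im z) * (1/4::real) ^ k)" by (intro summable_mult summable_geometric) simp
  hence "summable (\<lambda>k. profile_iterate (Suc k) z u - profile_iterate k z u)"
    by (rule summable_comparison_test') (rule dd)
  hence "convergent (\<lambda>n. \<Sum>k<n. profile_iterate (Suc k) z u - profile_iterate k z u)"
    by (simp only: summable_iff_convergent)
  moreover have "(\<Sum>k<n. profile_iterate (Suc k) z u - profile_iterate k z u) = profile_iterate n z u - profile_iterate 0 z u" for n
    by (rule sum_lessThan_telescope)
  ultimately have "convergent (\<lambda>n. profile_iterate n z u - profile_iterate 0 z u)" by (simp only:)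
  hence "convergent (\<lambda>n. (profile_iterate n z u - profile_iterate 0 z u) + profile_iterate 0 z u)"
    by (intro convergent_add convergent_const)
  thus ?thesis by simp
qed

lemma profile_iterate_holomorphic: "(\<lambda>z. profile_iterate k z u) holomorphic_on \<complex>\<^sup>+"
proof (induction k arbitrary: u)
  case 0
  show ?case by (auto intro!: holomorphic_intros)
next
  case (Suc k)
  have fin: "finite_measure lam" by (rule finite_measure_axioms)
  have op: "open \<complex>\<^sup>+" by (rule open_halfspace_Im_gt)
  note H = profile_iterate_herglotz[of _ k]
  have mm: "profile_iterate k z \<in> borel_measurable borel" if "Im z > 0" for z using H[OF that] unfolding herglotz_class_def by blast
  have 1: "(\<lambda>z. LINT x|lam. of_real (\<sigma> x t) * profile_iterate k z x) holomorphic_on \<complex>\<^sup>+" for t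
  proof (rule integral_holomorphic[OF fin op])
    show "(\<lambda>z. of_real (\<sigma> x t) * profile_iterate k z x) holomorphic_on \<complex>\<^sup>+" for x
      by (intro holomorphic_intros Suc.IH)
    show "cmod (of_real (\<sigma> x t) * profile_iterate k z x) \<le> K * (1 / Im z)" if "z \<in> \<complex>\<^sup>+" for z x
      using H[of z] that \<sigma>_nonneg[of x t] \<sigma>_le[of x t] K1 unfolding herglotz_class_def norm_mult
      by (intro mult_mono) auto
    show "continuous_on \<complex>\<^sup>+ (\<lambda>z. K * (1 / Im z))" by (intro continuous_intros) auto
    fix z assume "z \<in> \<complex>\<^sup>+"
    hence [measurable]: "profile_iterate k z \<in> borel_measurable borel" using mm by simp
    show "(\<lambda>x. of_real (\<sigma> x t) * profile_iterate k z x) \<in> borel_measurable lam" by measurable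
  qed
  have 2: "(\<lambda>z. LINT t|lam. share (profile_iterate k z) u t) holomorphic_on \<complex>\<^sup>+"
  proof (rule integral_holomorphic[OF fin op])
    show "(\<lambda>z. share (profile_iterate k z) u t) holomorphic_on \<complex>\<^sup>+" for t
      using herglotz_denominator(4)[OF _ H] unfolding column_average_def by (intro holomorphic_intros 1) auto
    show "cmod (share (profile_iterate k z) u t) \<le> K / (Im z / cmod z)" if "z \<in> \<complex>\<^sup>+" for z t
    proof -
      have "cmod z > 0" using that by auto
      thus ?thesis unfolding norm_divide norm_of_real
        by (intro frac_le) (use that herglotz_denominator(2)[OF _ H, of z t] \<sigma>_nonneg[of u t] \<sigma>_le[of u t] K1 in auto)
    qed
    show "continuous_on \<complex>\<^sup>+ (\<lambda>z. K / (Im z / cmod z))" by (intro continuous_intros) auto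
    fix z assume "z \<in> \<complex>\<^sup>+"
    hence [measurable]: "profile_iterate k z \<in> borel_measurable borel" using mm by simp
    show "(\<lambda>t. share (profile_iterate k z) u t) \<in> borel_measurable lam" by measurable
  qed
  have "- z + (LINT t|lam. share (profile_iterate k z) u t) \<noteq> 0" if "Im z > 0" for z
    using profile_step_herglotz(2)[OF that H[OF that], of u] that by auto
  thus ?case unfolding profile_iterate.simps profile_step_def by (intro holomorphic_intros 2) auto
qed

text \<open>The iterates converge high above the real axis, where the equation contracts; Vitali's theorem
  carries the convergence to the whole half plane, and the Herglotz bounds survive in the limit.\<close>

theorem profile_equation_solvable:
  obtains m where "\<And>u. (\<lambda>z. m z u) holomorphic_on \<complex>\<^sup>+"
    "\<And>z. Im z > 0 \<Longrightarrow> herglotz_class z (m z)"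
    "\<And>z u. Im z > 0 \<Longrightarrow> m z u = profile_step z (m z) u"
proof -
  have op: "open \<complex>\<^sup>+" by (rule open_halfspace_Im_gt)
  have conn: "connected \<complex>\<^sup>+" by (intro convex_connected convex_halfspace_Im_gt)
  have "\<exists>g. g holomorphic_on \<complex>\<^sup>+ \<and> (\<forall>z\<in>\<complex>\<^sup>+. (\<lambda>k. profile_iterate k z u) \<longlonglongrightarrow> g z)" for u
  proof (rule vitali_convergence[OF op conn, of "\<lambda>k z. profile_iterate k z u" "\<lambda>z. 1 / Im z" "{z. Im z > 8 * K}"])
    show "(\<lambda>z. profile_iterate n z u) holomorphic_on \<complex>\<^sup>+" for n by (rule profile_iterate_holomorphic)
    show "cmod (profile_iterate n z u) \<le> 1 / Im z" if "z \<in> \<complex>\<^sup>+" for n z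
      using profile_iterate_herglotz[of z n] that unfolding herglotz_class_def by blast
    show "continuous_on \<complex>\<^sup>+ (\<lambda>z. 1 / Im z)" by (intro continuous_intros) auto
    show "open {z. Im z > 8 * K}" by (rule open_halfspace_Im_gt)
    show "{z. Im z > 8 * K} \<noteq> {}" by (auto intro!: exI[of _ "Complex 0 (8 * K + 1)"])
    show "{z. Im z > 8 * K} \<subseteq> \<complex>\<^sup>+" using K1 by auto
    show "convergent (\<lambda>n. profile_iterate n z u)" if "z \<in> {z. Im z > 8 * K}" for z
      using that by (intro profile_iterate_convergent) simp
  qed blast
  then obtain g where g: "\<And>u. g u holomorphic_on \<complex>\<^sup>+" "\<And>u z. Im z > 0 \<Longrightarrow> (\<lambda>k. profile_iterate k z u) \<longlonglongrightarrow> g u z"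
    by (metis mem_Collect_eq)
  define m where "m z u = g u z" for z u
  have lim: "(\<lambda>k. profile_iterate k z u) \<longlonglongrightarrow> m z u" if "Im z > 0" for z u using g(2)[OF that] unfolding m_def .
  have H: "herglotz_class z (m z)" if z: "Im z > 0" for z
    unfolding herglotz_class_def
  proof (intro conjI allI)
    have Hk: "profile_iterate k z \<in> borel_measurable borel" "0 \<le> Im (profile_iterate k z u)" "0 \<le> Im (z * profile_iterate k z u)"
      "cmod (profile_iterate k z u) \<le> 1 / Im z" for k u
      using profile_iterate_herglotz[OF z, of k] unfolding herglotz_class_def by blast+
    show "m z \<in> borel_measurable borel" by (rule borel_measurable_LIMSEQ_metric[OF Hk(1) lim[OF z]])
    fix u
    show "0 \<le> Im (m z u)" by (rule LIMSEQ_le_const[OF tendsto_Im[OF lim[OF z]]]) (use Hk in auto)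
    show "0 \<le> Im (z * m z u)"
      by (rule LIMSEQ_le_const[OF tendsto_Im[OF tendsto_mult_left[OF lim[OF z]]]]) (use Hk in \<open>auto simp del: times_complex.simps\<close>)
    show "cmod (m z u) \<le> 1 / Im z" by (rule LIMSEQ_le_const2[OF tendsto_norm[OF lim[OF z]]]) (use Hk in auto)
  qed
  have eq: "m z u = profile_step z (m z) u" if z: "Im z > 0" for z u
  proof -
    have Hk: "profile_iterate k z \<in> borel_measurable borel" "cmod (profile_iterate k z u) \<le> 1 / Im z" for k u
      using profile_iterate_herglotz[OF z, of k] unfolding herglotz_class_def by blast+
    note [measurable] = Hk(1)
    have [measurable]: "m z \<in> borel_measurable borel" using H[OF z] unfolding herglotz_class_def by blast
    have ca: "(\<lambda>k. column_average (profile_iterate k z) t) \<longlonglongrightarrow> column_average (m z) t" for t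
      unfolding column_average_def
    proof (intro tendsto_intros integral_dominated_convergence[where w="\<lambda>_. K * (1 / Im z)"])
      show "AE x in lam. cmod (of_real (\<sigma> x t) * profile_iterate k z x) \<le> K * (1 / Im z)" for k
        unfolding norm_mult norm_of_real abs_of_nonneg[OF \<sigma>_nonneg]
        by (intro AE_I2 mult_mono Hk(2) \<sigma>_le) (use K1 in auto)
    qed (auto intro!: tendsto_intros lim[OF z])
    have "(\<lambda>k. LINT t|lam. share (profile_iterate k z) u t) \<longlonglongrightarrow> (LINT t|lam. share (m z) u t)"
    proof (rule integral_dominated_convergence[where w="\<lambda>_. K / (Im z / cmod z)"])
      show "AE t in lam. cmod (share (profile_iterate k z) u t) \<le> K / (Im z / cmod z)" for k
      proof (rule AE_I2)
        fix t
        have "cmod z > 0" using z by auto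
        thus "cmod (share (profile_iterate k z) u t) \<le> K / (Im z / cmod z)"
          unfolding norm_divide norm_of_real
          by (intro frac_le) (use z herglotz_denominator(2)[OF z profile_iterate_herglotz[OF z, of k], of t] \<sigma>_nonneg[of u t] \<sigma>_le[of u t] K1 in auto)
      qed
      show "AE t in lam. (\<lambda>k. share (profile_iterate k z) u t) \<longlonglongrightarrow> share (m z) u t"
        by (intro AE_I2 tendsto_intros ca herglotz_denominator(4)[OF z H[OF z]])
    qed auto
    moreover have "- z + (LINT t|lam. share (m z) u t) \<noteq> 0"
      using profile_step_herglotz(2)[OF z H[OF z], of u] z by auto
    ultimately have "(\<lambda>k. profile_step z (profile_iterate k z) u) \<longlonglongrightarrow> profile_step z (m z) u"
      unfolding profile_step_def by (intro tendsto_intros) auto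
    moreover have "(\<lambda>k. profile_iterate (Suc k) z u) \<longlonglongrightarrow> m z u" using lim[OF z] LIMSEQ_Suc by blast
    ultimately show ?thesis by (simp add: LIMSEQ_unique)
  qed
  have "(\<lambda>z. m z u) holomorphic_on \<complex>\<^sup>+" for u unfolding m_def using g(1)[of u] by simp
  thus thesis using that H eq by blast
qed

end

section \<open>Stieltjes transforms determine probability measures\<close>

lemma sub_halfplane_nonzero: "Im z > 0 \<Longrightarrow> complex_of_real x - z \<noteq> 0"
  by (auto simp: complex_eq_iff)

lemma norm_resolvent_le:
  assumes "Im z > 0" shows "cmod (1 / (complex_of_real x - z) ^ k) \<le> (1 / Im z) ^ k"
proof -
  have "Im z \<le> cmod (complex_of_real x - z)"
    using abs_Im_le_cmod[of "complex_of_real x - z"] assms by simp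
  hence "1 / cmod (complex_of_real x - z) \<le> 1 / Im z" using assms by (intro divide_left_mono mult_pos_pos) auto
  hence "(1 / cmod (complex_of_real x - z)) ^ k \<le> (1 / Im z) ^ k" by (intro power_mono) auto
  thus ?thesis by (simp add: norm_divide norm_power power_one_over)
qed

lemma resolvent_power_derivative:
  assumes \<mu>: "real_distribution \<mu>" and z: "Im z > 0"
  shows "((\<lambda>z. LINT x|\<mu>. 1 / (complex_of_real x - z) ^ k) has_field_derivative
    of_nat k * (LINT x|\<mu>. 1 / (complex_of_real x - z) ^ Suc k)) (at z)"
proof -
  interpret real_distribution \<mu> by fact
  have d: "((\<lambda>z. 1 / (complex_of_real x - z) ^ k) has_field_derivative of_nat k * (1 / (complex_of_real x - z) ^ Suc k)) (at z)"
    if "Im z > 0" for x z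
  proof -
    have nz: "complex_of_real x - z \<noteq> 0" by (rule sub_halfplane_nonzero[OF that])
    have "((\<lambda>z. 1 / (complex_of_real x - z)) has_field_derivative (1 / (complex_of_real x - z)) ^ 2) (at z)"
      using nz by (auto intro!: derivative_eq_intros simp: power2_eq_square)
    from DERIV_power[OF this, of k]
    have "((\<lambda>z. (1 / (complex_of_real x - z)) ^ k) has_field_derivative of_nat k * ((1 / (complex_of_real x - z)) ^ Suc k)) (at z)"
      by (cases k) (simp_all add: power2_eq_square algebra_simps)
    thus ?thesis by (simp only: power_one_over)
  qed
  have "((\<lambda>z. LINT x|\<mu>. 1 / (complex_of_real x - z) ^ k) has_field_derivative
     (LINT x|\<mu>. deriv (\<lambda>z. 1 / (complex_of_real x - z) ^ k) z)) (at z)"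
  proof (rule integral_holomorphic_derivative[where S="\<complex>\<^sup>+" and B="\<lambda>z. (1 / Im z) ^ k"])
    show "(\<lambda>z. 1 / (complex_of_real x - z) ^ k) holomorphic_on \<complex>\<^sup>+" for x
      using sub_halfplane_nonzero by (intro holomorphic_intros) auto
    show "continuous_on \<complex>\<^sup>+ (\<lambda>z. (1 / Im z) ^ k)" by (intro continuous_intros) auto
    show "cmod (1 / (complex_of_real x - z) ^ k) \<le> (1 / Im z) ^ k" if "z \<in> \<complex>\<^sup>+" for z x
      using norm_resolvent_le that by blast
  qed (use z finite_measure_axioms open_halfspace_Im_gt in auto)
  moreover have "deriv (\<lambda>z. 1 / (complex_of_real x - z) ^ k) z = of_nat k * (1 / (complex_of_real x - z) ^ Suc k)" for x
    by (rule DERIV_imp_deriv[OF d[OF z]])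
  ultimately show ?thesis by (simp only: integral_mult_right_zero)
qed

lemma stieltjes_transform_holomorphic:
  assumes "real_distribution \<mu>" shows "stieltjes_transform \<mu> holomorphic_on \<complex>\<^sup>+"
proof -
  have "stieltjes_transform \<mu> = (\<lambda>z. LINT x|\<mu>. 1 / (complex_of_real x - z) ^ 1)"
    unfolding stieltjes_transform_def by simp
  thus ?thesis using resolvent_power_derivative[OF assms, of _ 1]
    by (auto simp: holomorphic_on_open open_halfspace_Im_gt)
qed

lemma exp_limit_imaginary: "(\<lambda>n. (1 + \<i> * of_real a / of_nat n) ^ n) \<longlonglongrightarrow> exp (\<i> * of_real a)"
proof (cases "a = 0")
  case False
  define w where "w = \<i> * complex_of_real a"
  have w: "w \<noteq> 0" "Re w = 0" using False by (auto simp: w_def)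
  have "(Ln has_field_derivative inverse 1) (at 1)" by (rule has_field_derivative_Ln) auto
  hence "((\<lambda>h. (Ln (1 + h) - Ln 1) / h) \<longlongrightarrow> 1) (at 0)" unfolding DERIV_def by simp
  moreover have "filterlim (\<lambda>n. w / of_nat n) (at 0) sequentially"
  proof -
    have "(\<lambda>n. w / of_nat n) \<longlonglongrightarrow> 0" by (rule lim_const_over_n)
    moreover have "eventually (\<lambda>n. w / of_nat n \<noteq> 0) sequentially"
      using eventually_gt_at_top[of 0] by eventually_elim (use w in auto)
    ultimately show ?thesis by (simp add: filterlim_at)
  qed
  ultimately have "(\<lambda>n. (Ln (1 + w / of_nat n) - Ln 1) / (w / of_nat n)) \<longlonglongrightarrow> 1"
    by (rule filterlim_compose)
  hence "(\<lambda>n. exp (w * ((Ln (1 + w / of_nat n) - Ln 1) / (w / of_nat n)))) \<longlonglongrightarrow> exp (w * 1)"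
    by (intro tendsto_intros)
  moreover have "eventually (\<lambda>n. exp (w * ((Ln (1 + w / of_nat n) - Ln 1) / (w / of_nat n))) = (1 + w / of_nat n) ^ n) sequentially"
    using eventually_gt_at_top[of 0]
  proof eventually_elim
    case (elim n)
    have "Re (1 + w / of_nat n) = 1" using w by (simp add: Re_divide_of_nat)
    hence "1 + w / of_nat n \<noteq> 0" by (metis one_neq_zero zero_complex.sel(1))
    hence "(1 + w / of_nat n) ^ n = exp (of_nat n * Ln (1 + w / of_nat n))" by (simp add: exp_of_nat_mult)
    thus ?case using elim w by (simp add: mult.commute)
  qed
  ultimately have "(\<lambda>n. (1 + w / of_nat n) ^ n) \<longlonglongrightarrow> exp (w * 1)" by (rule Lim_transform_eventually)
  thus ?thesis by (simp add: w_def)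
qed simp

text \<open>Derivatives of the Stieltjes transform at \<open>\<i> n / t\<close> give the integrals of
  \<open>(1 + \<i> t x / n)\<close> to the power \<open>-n\<close>, hence in the limit the characteristic function.\<close>

lemma stieltjes_transform_inj:
  assumes \<mu>: "real_distribution \<mu>" and \<nu>: "real_distribution \<nu>"
    and eq: "\<And>z. Im z > 0 \<Longrightarrow> stieltjes_transform \<mu> z = stieltjes_transform \<nu> z"
  shows "\<mu> = \<nu>"
proof (rule Levy_uniqueness[OF \<mu> \<nu>])
  have pow: "(LINT x|\<mu>. 1 / (complex_of_real x - z) ^ Suc k) = (LINT x|\<nu>. 1 / (complex_of_real x - z) ^ Suc k)" if "Im z > 0" for z k
    using that
  proof (induction k arbitrary: z)
    case 0
    thus ?case using eq[of z] unfolding stieltjes_transform_def by simp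
  next
    case (Suc k)
    have "((\<lambda>z. LINT x|\<nu>. 1 / (complex_of_real x - z) ^ Suc k) has_field_derivative
      of_nat (Suc k) * (LINT x|\<mu>. 1 / (complex_of_real x - z) ^ Suc (Suc k))) (at z)"
      by (rule has_field_derivative_transform_within_open[OF resolvent_power_derivative[OF \<mu> Suc.prems] open_halfspace_Im_gt[of 0]])
         (use Suc in auto)
    from DERIV_unique[OF this resolvent_power_derivative[OF \<nu> Suc.prems]]
    show ?case by (simp del: power_Suc of_nat_Suc)
  qed
  have conv: "(\<lambda>n. (of_nat n / (\<i> * of_real t)) ^ n * (LINT x|\<rho>. 1 / (complex_of_real x - \<i> * of_real (real n / t)) ^ n)) \<longlonglongrightarrow> char \<rho> (- t)"
    if \<rho>: "real_distribution \<rho>" and t: "t > 0" for \<rho> t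
  proof -
    interpret real_distribution \<rho> by fact
    have alg: "(of_nat n / (\<i> * of_real t)) ^ n * (1 / (complex_of_real x - \<i> * of_real (real n / t)) ^ n)
      = 1 / (1 + \<i> * of_real (t * x) / of_nat n) ^ n" for n x
    proof (cases "n = 0")
      case False
      have nz: "complex_of_real x - \<i> * of_real (real n / t) \<noteq> 0"
        using False t by (intro sub_halfplane_nonzero) simp
      have "(1 + \<i> * of_real (t * x) / of_nat n) = (\<i> * of_real t / of_nat n) * (complex_of_real x - \<i> * of_real (real n / t))"
        using False t by (simp add: field_simps)
      hence "1 / (1 + \<i> * of_real (t * x) / of_nat n) = 1 / ((\<i> * of_real t / of_nat n) * (complex_of_real x - \<i> * of_real (real n / t)))"
        by (rule arg_cong)
      also have "\<dots> = (of_nat n / (\<i> * of_real t)) * (1 / (complex_of_real x - \<i> * of_real (real n / t)))"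
        by (simp only: times_divide_eq_right times_divide_eq_left divide_divide_eq_right divide_divide_eq_left mult_1_left mult_1_right)
      finally have "1 / (1 + \<i> * of_real (t * x) / of_nat n) = (of_nat n / (\<i> * of_real t)) * (1 / (complex_of_real x - \<i> * of_real (real n / t)))" .
      hence "(1 / (1 + \<i> * of_real (t * x) / of_nat n)) ^ n = ((of_nat n / (\<i> * of_real t)) * (1 / (complex_of_real x - \<i> * of_real (real n / t)))) ^ n" by (rule arg_cong)
      thus ?thesis by (simp only: power_mult_distrib power_one_over)
    qed simp
    have "(\<lambda>n. LINT x|\<rho>. 1 / (1 + \<i> * of_real (t * x) / of_nat n) ^ n) \<longlonglongrightarrow> (LINT x|\<rho>. iexp (- t * x))"
    proof (rule integral_dominated_convergence[where w="\<lambda>_. 1"])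
      show "AE x in \<rho>. cmod (1 / (1 + \<i> * of_real (t * x) / of_nat n) ^ n) \<le> 1" for n
      proof (rule AE_I2)
        fix x
        have "Re (1 + \<i> * of_real (t * x) / of_nat n) = 1" by (cases "n = 0") (auto simp: Re_divide_of_nat)
        hence "1 \<le> cmod (1 + \<i> * of_real (t * x) / of_nat n)" using complex_Re_le_cmod by metis
        hence "1 \<le> cmod (1 + \<i> * of_real (t * x) / of_nat n) ^ n" by (rule one_le_power)
        thus "cmod (1 / (1 + \<i> * of_real (t * x) / of_nat n) ^ n) \<le> 1" by (simp add: norm_divide norm_power)
      qed
      show "AE x in \<rho>. (\<lambda>n. 1 / (1 + \<i> * of_real (t * x) / of_nat n) ^ n) \<longlonglongrightarrow> iexp (- t * x)"
      proof (rule AE_I2)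
        fix x
        have "(\<lambda>n. 1 / (1 + \<i> * of_real (t * x) / of_nat n) ^ n) \<longlonglongrightarrow> 1 / exp (\<i> * of_real (t * x))"
          by (intro tendsto_intros exp_limit_imaginary) auto
        thus "(\<lambda>n. 1 / (1 + \<i> * of_real (t * x) / of_nat n) ^ n) \<longlonglongrightarrow> iexp (- t * x)"
          by (simp add: exp_minus field_simps)
      qed
    qed auto
    thus ?thesis unfolding char_def using alg by (simp only: integral_mult_right_zero[symmetric])
  qed
  have neg: "char \<mu> (- t) = char \<nu> (- t)" if t: "t > 0" for t
  proof -
    have "eventually (\<lambda>n. (of_nat n / (\<i> * of_real t)) ^ n * (LINT x|\<nu>. 1 / (complex_of_real x - \<i> * of_real (real n / t)) ^ n)
       = (of_nat n / (\<i> * of_real t)) ^ n * (LINT x|\<mu>. 1 / (complex_of_real x - \<i> * of_real (real n / t)) ^ n)) sequentially"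
      using eventually_gt_at_top[of 0]
    proof eventually_elim
      case (elim n)
      then obtain k where n: "n = Suc k" using gr0_conv_Suc by blast
      have "Im (\<i> * of_real (real n / t)) > 0" using elim t by simp
      from pow[OF this, of k] show ?case unfolding n by simp
    qed
    from Lim_transform_eventually[OF conv[OF \<nu> t] this] show ?thesis using conv[OF \<mu> t] LIMSEQ_unique by blast
  qed
  have pos: "char \<rho> t = cnj (char \<rho> (- t))" for \<rho> t
  proof -
    have "cnj (LINT x|\<rho>. iexp (- t * x)) = (LINT x|\<rho>. cnj (iexp (- t * x)))" by (rule Bochner_Integration.integral_cnj[symmetric])
    thus ?thesis unfolding char_def by (simp add: exp_cnj)
  qed
  show "char \<mu> = char \<nu>"
  proof
    fix t :: real
    consider "t < 0" | "t = 0" | "t > 0" by linarith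
    thus "char \<mu> t = char \<nu> t"
    proof cases
      case 1 thus ?thesis using neg[of "- t"] by simp
    next
      case 2 thus ?thesis using real_distribution.char_zero \<mu> \<nu> by (simp add: real_distribution.char_zero)
    next
      case 3 thus ?thesis using neg[of t] pos[of \<mu> t] pos[of \<nu> t] by simp
    qed
  qed
qed

lemma holomorphic_eq_halfplane:
  assumes f: "f holomorphic_on \<complex>\<^sup>+" and g: "g holomorphic_on \<complex>\<^sup>+"
    and z: "\<And>j::nat. f (Z j) = g (Z j)" "\<And>j. Im (Z j) > 0" "\<And>j. Z j \<noteq> l" "Z \<longlonglongrightarrow> l" "Im l > 0"
    and w: "Im w > 0"
  shows "f w = g w"
proof -
  have "(\<lambda>w. f w - g w) w = 0"
  proof (rule analytic_continuation[of "\<lambda>w. f w - g w" "\<complex>\<^sup>+" "range Z" l])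
    show "(\<lambda>w. f w - g w) holomorphic_on \<complex>\<^sup>+" by (intro holomorphic_intros f g)
    show "connected \<complex>\<^sup>+" by (intro convex_connected convex_halfspace_Im_gt)
    show "l islimpt range Z" unfolding islimpt_sequential using z by (intro exI[of _ Z]) auto
  qed (use z w open_halfspace_Im_gt in auto)
  thus ?thesis by simp
qed

section \<open>Levy distance, tightness and the closeness criterion\<close>

lemma levy_dist_le:
  assumes "\<epsilon> > 0" "\<And>x. F (x - \<epsilon>) - \<epsilon> \<le> G x \<and> G x \<le> F (x + \<epsilon>) + \<epsilon>"
  shows "levy_dist F G \<le> \<epsilon>"
  unfolding levy_dist_def using assms by (intro cInf_lower) (auto intro!: bdd_belowI[of _ 0])

text \<open>Finitely many continuity points of the limit, with gaps below \<open>\<epsilon>\<close>, reach from where its distribution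
  function is below \<open>\<epsilon> / 2\<close> to where it is above \<open>1 - \<epsilon> / 2\<close>. By monotonicity, closeness at these
  points is enough.\<close>

lemma weak_conv_imp_levy:
  assumes M: "\<And>n. real_distribution (M n)" and \<mu>: "real_distribution \<mu>" and conv: "weak_conv_m M \<mu>"
    and e: "\<epsilon> > 0"
  shows "eventually (\<lambda>n. levy_dist (cdf (M n)) (cdf \<mu>) \<le> \<epsilon>) sequentially"
proof -
  interpret \<mu>: real_distribution \<mu> by fact
  have mono: "mono (cdf \<mu>)" by (auto simp: mono_def \<mu>.cdf_nondecreasing)
  define \<delta> where "\<delta> = \<epsilon> / 2"
  have d: "\<delta> > 0" using e by (simp add: \<delta>_def)
  have "\<exists>a. isCont (cdf \<mu>) a \<and> of_int k * \<delta> < a \<and> a < of_int (k + 1) * \<delta>" for k :: int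
  proof -
    have "uncountable {of_int k * \<delta><..<of_int (k + 1) * \<delta>}" using d by (simp add: uncountable_open_interval algebra_simps)
    hence "\<not> {of_int k * \<delta><..<of_int (k + 1) * \<delta>} \<subseteq> {a. \<not> isCont (cdf \<mu>) a}"
      using mono_ctble_discont[OF mono] countable_subset by blast
    thus ?thesis by auto
  qed
  then obtain a where a: "\<And>k. isCont (cdf \<mu>) (a k)" "\<And>k. of_int k * \<delta> < a k" "\<And>k. a k < of_int (k + 1) * \<delta>"
    by metis
  have "eventually (\<lambda>x. cdf \<mu> x < \<epsilon> / 2) at_bot"
    using order_tendstoD(2)[OF \<mu>.cdf_lim_at_bot, of "\<epsilon> / 2"] e by simp
  then obtain L where L: "\<And>x. x \<le> L \<Longrightarrow> cdf \<mu> x < \<epsilon> / 2" unfolding eventually_at_bot_linorder by blast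
  have "eventually (\<lambda>x. 1 - \<epsilon> / 2 < cdf \<mu> x) at_top"
    using order_tendstoD(1)[OF \<mu>.cdf_lim_at_top_prob, of "1 - \<epsilon> / 2"] e by simp
  then obtain R where R: "\<And>x. R \<le> x \<Longrightarrow> 1 - \<epsilon> / 2 < cdf \<mu> x" unfolding eventually_at_top_linorder by blast
  \<comment> \<open>The cell \<open>lo\<close> lies to the left of \<open>L\<close> and the cell \<open>hi\<close> to the right of \<open>R\<close>.\<close>
  define lo where "lo = \<lfloor>L / \<delta>\<rfloor> - 1"
  define hi where "hi = \<lceil>R / \<delta>\<rceil>"
  have lo: "a lo \<le> L"
  proof -
    have "of_int (lo + 1) * \<delta> \<le> L / \<delta> * \<delta>" using d unfolding lo_def by (intro mult_right_mono) auto
    thus ?thesis using a(3)[of lo] d by simp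
  qed
  have hi: "R \<le> a hi"
  proof -
    have "R / \<delta> * \<delta> \<le> of_int hi * \<delta>" using d unfolding hi_def by (intro mult_right_mono) auto
    thus ?thesis using a(2)[of hi] d by simp
  qed
  have "eventually (\<lambda>n. \<forall>k\<in>{lo..hi} \<union> {lo, hi}. \<bar>cdf (M n) (a k) - cdf \<mu> (a k)\<bar> < \<epsilon> / 2) sequentially"
  proof (rule eventually_ball_finite)
    show "\<forall>k\<in>{lo..hi} \<union> {lo, hi}. eventually (\<lambda>n. \<bar>cdf (M n) (a k) - cdf \<mu> (a k)\<bar> < \<epsilon> / 2) sequentially"
    proof
      fix k
      have "(\<lambda>n. cdf (M n) (a k)) \<longlonglongrightarrow> cdf \<mu> (a k)"
        using conv a(1) unfolding weak_conv_m_def weak_conv_def by blast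
      from tendstoD[OF this, of "\<epsilon> / 2"] show "eventually (\<lambda>n. \<bar>cdf (M n) (a k) - cdf \<mu> (a k)\<bar> < \<epsilon> / 2) sequentially"
        using e by (simp add: dist_real_def)
    qed
  qed simp
  thus ?thesis
  proof eventually_elim
    case (elim n)
    interpret n: real_distribution "M n" by (rule M)
    have near: "\<bar>cdf (M n) (a k) - cdf \<mu> (a k)\<bar> < \<epsilon> / 2" if "k \<in> {lo..hi} \<union> {lo, hi}" for k
      using elim that by blast
    have near_lo: "\<bar>cdf (M n) (a lo) - cdf \<mu> (a lo)\<bar> < \<epsilon> / 2" and near_hi: "\<bar>cdf (M n) (a hi) - cdf \<mu> (a hi)\<bar> < \<epsilon> / 2"
      by (rule near, simp)+
    have a_mono: "a k < a l" if "k < l" for k l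
    proof -
      have "k + 1 \<le> l" using that by simp
      hence "of_int (k + 1) * \<delta> \<le> of_int l * \<delta>" using d by (intro mult_right_mono) (simp_all only: of_int_le_iff less_imp_le)
      thus ?thesis using a(3)[of k] a(2)[of l] by linarith
    qed
    show ?case
    proof (rule levy_dist_le[OF e], intro conjI)
      fix x :: real
      define j where "j = \<lfloor>x / \<delta>\<rfloor>"
      have "of_int j * \<delta> \<le> x / \<delta> * \<delta>" using d unfolding j_def by (intro mult_right_mono) auto
      hence j1: "of_int j * \<delta> \<le> x" using d by simp
      have "x / \<delta> * \<delta> < of_int (j + 1) * \<delta>" using d unfolding j_def by (intro mult_strict_right_mono) linarith+
      hence j2: "x < of_int (j + 1) * \<delta>" using d by simp
      show "cdf \<mu> x \<le> cdf (M n) (x + \<epsilon>) + \<epsilon>"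
      proof -
        define k where "k = j + 1"
        have k: "x \<le> a k" "a k \<le> x + \<epsilon>"
          using a(2)[of k] a(3)[of k] j1 j2 unfolding k_def \<delta>_def by (simp_all add: algebra_simps)
        consider "k \<in> {lo..hi}" | "k < lo" | "hi < k" by fastforce
        thus ?thesis
        proof cases
          case 1
          hence "\<bar>cdf (M n) (a k) - cdf \<mu> (a k)\<bar> < \<epsilon> / 2" by (intro near) blast
          thus ?thesis using \<mu>.cdf_nondecreasing[OF k(1)] n.cdf_nondecreasing[OF k(2)] e by linarith
        next
          case 2
          have "x \<le> L" using a_mono[OF 2] k(1) lo by linarith
          thus ?thesis using L[of x] n.cdf_nonneg[of "x + \<epsilon>"] e by linarith
        next
          case 3
          have "a hi \<le> x + \<epsilon>" using a_mono[OF 3] k(2) by linarith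
          thus ?thesis using R[OF hi] near_hi n.cdf_nondecreasing[of "a hi" "x + \<epsilon>"] \<mu>.cdf_bounded_prob[of x] by linarith
        qed
      qed
      show "cdf (M n) (x - \<epsilon>) - \<epsilon> \<le> cdf \<mu> x"
      proof -
        define k where "k = j - 1"
        have k: "a k \<le> x" "x - \<epsilon> \<le> a k"
          using a(2)[of k] a(3)[of k] j1 j2 unfolding k_def \<delta>_def by (simp_all add: algebra_simps)
        consider "k \<in> {lo..hi}" | "k < lo" | "hi < k" by fastforce
        thus ?thesis
        proof cases
          case 1
          hence "\<bar>cdf (M n) (a k) - cdf \<mu> (a k)\<bar> < \<epsilon> / 2" by (intro near) blast
          thus ?thesis using \<mu>.cdf_nondecreasing[OF k(1)] n.cdf_nondecreasing[OF k(2)] e by linarith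
        next
          case 2
          have "x - \<epsilon> \<le> a lo" using a_mono[OF 2] k(2) by linarith
          thus ?thesis using L[OF lo] near_lo n.cdf_nondecreasing[of "x - \<epsilon>" "a lo"] \<mu>.cdf_nonneg[of x] by linarith
        next
          case 3
          have "R \<le> x" using a_mono[OF 3] k(1) hi by linarith
          thus ?thesis using R[of x] n.cdf_bounded_prob[of "x - \<epsilon>"] e by linarith
        qed
      qed
    qed
  qed
qed

lemma tail_bound_imp_tight:
  assumes M: "\<And>n. real_distribution (M n)"
    and tail: "\<And>n a. a > 0 \<Longrightarrow> measure (M n) {x. a < \<bar>x\<bar>} \<le> C / a"
  shows "tight M"
  unfolding tight_def
proof (intro conjI allI impI)
  fix e :: real assume e: "e > 0"
  define a where "a = (\<bar>C\<bar> + 1) / e"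
  have a: "a > 0" using e by (simp add: a_def)
  have Ca1: "C * e < (\<bar>C\<bar> + 1) * e" using e by (intro mult_strict_right_mono) auto
  have Ca: "C / a < e"
  proof -
    have "C / a = C * e / (\<bar>C\<bar> + 1)" unfolding a_def by simp
    also have "\<dots> < e" using Ca1 by (subst pos_divide_less_eq) (auto simp: mult.commute)
    finally show ?thesis .
  qed
  show "\<exists>x y. x < y \<and> (\<forall>n. 1 - e < measure (M n) {x<..y})"
  proof (rule exI[of _ "- a - 1"], rule exI[of _ a], intro conjI allI)
    fix n
    interpret real_distribution "M n" by (rule M)
    have "1 - measure (M n) {- a - 1<..a} = measure (M n) (space (M n) - {- a - 1<..a})"
      by (rule prob_compl[symmetric]) simp
    also have "\<dots> \<le> measure (M n) {x. a < \<bar>x\<bar>}"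
    proof (rule finite_measure_mono)
      have "{x. a < \<bar>x\<bar>} = {x \<in> space borel. a < \<bar>x\<bar>}" by simp
      also have "\<dots> \<in> sets borel" by measurable
      finally show "{x. a < \<bar>x\<bar>} \<in> sets (M n)" by simp
    qed auto
    also have "\<dots> \<le> C / a" by (rule tail[OF a])
    finally show "1 - e < measure (M n) {- a - 1<..a}" using Ca by linarith
  qed (use a in simp)
qed (rule M)

lemma weak_conv_stieltjes:
  assumes M: "\<And>n. real_distribution (M n)" and \<mu>: "real_distribution \<mu>" and conv: "weak_conv_m M \<mu>"
    and z: "Im z > 0"
  shows "(\<lambda>n. stieltjes_transform (M n) z) \<longlonglongrightarrow> stieltjes_transform \<mu> z"
  unfolding stieltjes_transform_def
proof (rule weak_conv_imp_integral_bdd_continuous_conv[OF M \<mu> conv])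
  show "isCont (\<lambda>x. 1 / (complex_of_real x - z)) x" for x
    using sub_halfplane_nonzero[OF z] by (intro continuous_intros) auto
  show "cmod (1 / (complex_of_real x - z)) \<le> 1 / Im z" for x
    using norm_resolvent_le[OF z, of x 1] by simp
qed

text \<open>By the identity theorem it suffices to test transforms on a sequence that accumulates inside the
  half plane.\<close>

context
  fixes Z :: "nat => complex" and l :: complex
  assumes Z: "\<And>j. Im (Z j) > 0" "\<And>j. Z j \<noteq> l" "Z \<longlonglongrightarrow> l" "Im l > 0"
begin

lemma stieltjes_transform_determined:
  assumes \<mu>: "real_distribution \<mu>" and \<nu>: "real_distribution \<nu>"
    and eq: "\<And>j. stieltjes_transform \<mu> (Z j) = stieltjes_transform \<nu> (Z j)"
  shows "\<mu> = \<nu>"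
  by (rule stieltjes_transform_inj[OF \<mu> \<nu>]) 
     (rule holomorphic_eq_halfplane[OF stieltjes_transform_holomorphic[OF \<mu>] stieltjes_transform_holomorphic[OF \<nu>] eq Z])

text \<open>Tightness gives a weak limit along a subsequence, and its transform agrees with \<open>f\<close> on a sequence
  with an interior accumulation point.\<close>

lemma stieltjes_limit_exists:
  assumes M: "\<And>n. real_distribution (M n)"
    and tail: "\<And>n a. a > 0 \<Longrightarrow> measure (M n) {x. a < \<bar>x\<bar>} \<le> C / a"
    and f: "f holomorphic_on \<complex>\<^sup>+" and lim: "\<And>j. (\<lambda>n. stieltjes_transform (M n) (Z j)) \<longlonglongrightarrow> f (Z j)"
  obtains \<mu> where "real_distribution \<mu>" "\<And>z. Im z > 0 \<Longrightarrow> stieltjes_transform \<mu> z = f z"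
proof -
  have tight: "tight M" by (rule tail_bound_imp_tight[OF M tail])
  have id: "strict_mono (id :: nat => nat)" by (simp add: strict_mono_def)
  obtain r \<mu> where r: "strict_mono (r :: nat => nat)" and \<mu>: "real_distribution \<mu>" and w: "weak_conv_m (M \<circ> id \<circ> r) \<mu>"
    using tight_imp_convergent_subsubsequence[OF tight id] by blast
  have eq: "stieltjes_transform \<mu> (Z j) = f (Z j)" for j
  proof (rule LIMSEQ_unique)
    show "(\<lambda>n. stieltjes_transform ((M \<circ> id \<circ> r) n) (Z j)) \<longlonglongrightarrow> stieltjes_transform \<mu> (Z j)"
      by (rule weak_conv_stieltjes[OF _ \<mu> w Z(1)]) (simp add: M)
    show "(\<lambda>n. stieltjes_transform ((M \<circ> id \<circ> r) n) (Z j)) \<longlonglongrightarrow> f (Z j)"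
      using LIMSEQ_subseq_LIMSEQ[OF lim r] by (simp add: comp_def)
  qed
  have "stieltjes_transform \<mu> z = f z" if "Im z > 0" for z
    by (rule holomorphic_eq_halfplane[OF stieltjes_transform_holomorphic[OF \<mu>] f eq Z that])
  with \<mu> show thesis by (rule that)
qed

text \<open>Compactness turns the uniqueness of the Stieltjes transform into a quantitative criterion:
  among laws with a common tail bound, closeness at finitely many points forces closeness in the
  Levy distance.\<close>

lemma levy_closeness_criterion:
  assumes \<mu>: "real_distribution \<mu>" and e: "\<epsilon> > 0"
  shows "\<exists>J. \<exists>\<delta>>0. \<forall>\<nu>. real_distribution \<nu> \<longrightarrow> (\<forall>a>0. measure \<nu> {x. a < \<bar>x\<bar>} \<le> C / a) \<longrightarrow>
     (\<forall>j\<le>J. cmod (stieltjes_transform \<nu> (Z j) - stieltjes_transform \<mu> (Z j)) < \<delta>) \<longrightarrow>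
     levy_dist (cdf \<nu>) (cdf \<mu>) < \<epsilon>"
proof (rule ccontr)
  assume "\<not> ?thesis"
  hence bad: "\<not> (\<forall>\<nu>. real_distribution \<nu> \<longrightarrow> (\<forall>a>0. measure \<nu> {x. a < \<bar>x\<bar>} \<le> C / a) \<longrightarrow>
     (\<forall>j\<le>J. cmod (stieltjes_transform \<nu> (Z j) - stieltjes_transform \<mu> (Z j)) < \<delta>) \<longrightarrow>
     levy_dist (cdf \<nu>) (cdf \<mu>) < \<epsilon>)" if "\<delta> > 0" for J \<delta>
    using that by blast
  have "\<exists>\<nu>. real_distribution \<nu> \<and> (\<forall>a>0. measure \<nu> {x. a < \<bar>x\<bar>} \<le> C / a) \<and>
     (\<forall>j\<le>k. cmod (stieltjes_transform \<nu> (Z j) - stieltjes_transform \<mu> (Z j)) < 1 / real (Suc k)) \<and>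
     \<epsilon> \<le> levy_dist (cdf \<nu>) (cdf \<mu>)" for k
    using bad[of "1 / real (Suc k)" k] by (auto simp: not_less)
  then obtain M where M: "\<And>k. real_distribution (M k)" "\<And>k a. a > 0 \<Longrightarrow> measure (M k) {x. a < \<bar>x\<bar>} \<le> C / a"
    "\<And>k j. j \<le> k \<Longrightarrow> cmod (stieltjes_transform (M k) (Z j) - stieltjes_transform \<mu> (Z j)) < 1 / real (Suc k)"
    "\<And>k. \<epsilon> \<le> levy_dist (cdf (M k)) (cdf \<mu>)"
    by metis
  have tight: "tight M" by (rule tail_bound_imp_tight[OF M(1) M(2)])
  have id: "strict_mono (id :: nat => nat)" by (simp add: strict_mono_def)
  obtain r \<nu> where r: "strict_mono (r :: nat => nat)" and \<nu>: "real_distribution \<nu>" and w: "weak_conv_m (M \<circ> id \<circ> r) \<nu>"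
    using tight_imp_convergent_subsubsequence[OF tight id] by blast
  have "stieltjes_transform \<nu> (Z j) = stieltjes_transform \<mu> (Z j)" for j
  proof (rule LIMSEQ_unique)
    show "(\<lambda>n. stieltjes_transform ((M \<circ> id \<circ> r) n) (Z j)) \<longlonglongrightarrow> stieltjes_transform \<nu> (Z j)"
      by (rule weak_conv_stieltjes[OF _ \<nu> w Z(1)]) (simp add: M)
    have "(\<lambda>k. stieltjes_transform (M k) (Z j) - stieltjes_transform \<mu> (Z j)) \<longlonglongrightarrow> 0"
    proof (rule Lim_null_comparison)
      show "eventually (\<lambda>k. cmod (stieltjes_transform (M k) (Z j) - stieltjes_transform \<mu> (Z j)) \<le> 1 / real (Suc k)) sequentially"
        using eventually_ge_at_top[of j] by eventually_elim (use M(3) less_imp_le in blast)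
      show "(\<lambda>k. 1 / real (Suc k)) \<longlonglongrightarrow> 0"
        using LIMSEQ_inverse_real_of_nat by (simp add: inverse_eq_divide)
    qed
    hence "(\<lambda>k. stieltjes_transform (M k) (Z j)) \<longlonglongrightarrow> stieltjes_transform \<mu> (Z j)" by (rule LIM_zero_cancel)
    thus "(\<lambda>n. stieltjes_transform ((M \<circ> id \<circ> r) n) (Z j)) \<longlonglongrightarrow> stieltjes_transform \<mu> (Z j)"
      using LIMSEQ_subseq_LIMSEQ[OF _ r] by (force simp: comp_def)
  qed
  hence "\<nu> = \<mu>" by (rule stieltjes_transform_determined[OF \<nu> \<mu>])
  with w have w': "weak_conv_m (M \<circ> id \<circ> r) \<mu>" by simp
  have "eventually (\<lambda>n. levy_dist (cdf ((M \<circ> id \<circ> r) n)) (cdf \<mu>) \<le> \<epsilon> / 2) sequentially"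
    by (rule weak_conv_imp_levy[OF _ \<mu> w']) (use M e in auto)
  then obtain n where "levy_dist (cdf (M (r n))) (cdf \<mu>) \<le> \<epsilon> / 2" unfolding eventually_sequentially by auto
  thus False using M(4)[of "r n"] e by linarith
qed

end

section \<open>Resolvents of Hermitian matrices\<close>

definition hermitian_on :: "nat => (nat => nat => complex) => bool" where
  "hermitian_on m H \<longleftrightarrow> (\<forall>i<m. \<forall>j<m. H j i = cnj (H i j))"

definition shifted_mat :: "nat => (nat => nat => complex) => complex => complex mat" where
  "shifted_mat m H w = Matrix.mat m m (\<lambda>(i, j). H i j - (if i = j then w else 0))"

text \<open>By Cramer's rule the entries of the inverse are rational functions of those of the matrix, hence
  measurable.\<close>

definition resolvent :: "nat => (nat => nat => complex) => complex => nat => nat => complex" where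
  "resolvent m H w i j = adj_mat (shifted_mat m H w) $$ (i, j) / det (shifted_mat m H w)"

abbreviation vnorm :: "nat => (nat => complex) => real" where
  "vnorm m x \<equiv> L2_set (\<lambda>i. cmod (x i)) {..<m}"

lemma vnorm_nonneg: "0 \<le> vnorm m x" by (rule L2_set_nonneg)

lemma vnorm_power2: "(vnorm m x)\<^sup>2 = (\<Sum>i<m. (cmod (x i))\<^sup>2)"
  unfolding L2_set_def by (simp add: sum_nonneg)

lemma vnorm_unit: "j < m \<Longrightarrow> vnorm m (\<lambda>i. if i = j then 1 else 0) = 1"
proof -
  assume "j < m"
  have "(\<Sum>i<m. (cmod (if i = j then 1 else 0))\<^sup>2) = (\<Sum>i<m. if i = j then 1 else (0::real))"
    by (intro sum.cong) auto
  thus ?thesis using \<open>j < m\<close> unfolding L2_set_def by simp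
qed

lemma component_le_vnorm: "i < m \<Longrightarrow> cmod (x i) \<le> vnorm m x"
  by (rule member_le_L2_set) auto

lemma sum_mult_le_vnorm: "cmod (\<Sum>i<m. x i * y i) \<le> vnorm m x * vnorm m y"
proof -
  have "cmod (\<Sum>i<m. x i * y i) \<le> (\<Sum>i<m. \<bar>cmod (x i)\<bar> * \<bar>cmod (y i)\<bar>)"
    by (rule order_trans[OF norm_sum]) (simp add: norm_mult)
  also have "\<dots> \<le> vnorm m x * vnorm m y" by (rule L2_set_mult_ineq)
  finally show ?thesis .
qed

text \<open>A solution of \<open>(H - w) y = x\<close> is bounded since \<open>\<langle>y, H y\<rangle>\<close> is real, so that
  \<open>\<langle>y, x\<rangle>\<close> has imaginary part \<open>- Im w\<close> times the squared norm of \<open>y\<close>.\<close>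

lemma hermitian_coercive:
  assumes H: "hermitian_on m H" and w: "Im w > 0"
    and eq: "\<And>i. i < m \<Longrightarrow> (\<Sum>k<m. H i k * y k) = x i + w * y i"
  shows "vnorm m y \<le> vnorm m x / Im w"
proof -
  define S where "S = (\<Sum>i<m. cnj (y i) * (\<Sum>k<m. H i k * y k))"
  have "cnj S = (\<Sum>i<m. \<Sum>k<m. y i * cnj (H i k) * cnj (y k))"
    unfolding S_def by (simp add: sum_distrib_left mult.assoc)
  also have "\<dots> = (\<Sum>i<m. \<Sum>k<m. cnj (y k) * (H k i * y i))"
  proof (intro sum.cong refl)
    fix i k assume "i \<in> {..<m}" "k \<in> {..<m}"
    hence "cnj (H i k) = H k i" using H[unfolded hermitian_on_def, rule_format, of i k] by simp
    thus "y i * cnj (H i k) * cnj (y k) = cnj (y k) * (H k i * y i)" by simp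
  qed
  also have "\<dots> = (\<Sum>k<m. \<Sum>i<m. cnj (y k) * (H k i * y i))" by (rule sum.swap)
  also have "\<dots> = S" unfolding S_def by (simp add: sum_distrib_left)
  finally have "cnj S = S" .
  hence ImS: "Im S = 0" by (metis Reals_cnj_iff complex_is_Real_iff)
  have "S = (\<Sum>i<m. cnj (y i) * x i + w * of_real ((cmod (y i))\<^sup>2))"
    unfolding S_def
  proof (intro sum.cong refl)
    fix i assume "i \<in> {..<m}"
    hence i: "i < m" by simp
    show "cnj (y i) * (\<Sum>k<m. H i k * y k) = cnj (y i) * x i + w * of_real ((cmod (y i))\<^sup>2)"
      unfolding eq[OF i] complex_norm_square by (simp add: algebra_simps)
  qed
  also have "\<dots> = (\<Sum>i<m. cnj (y i) * x i) + w * (\<Sum>i<m. of_real ((cmod (y i))\<^sup>2))"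
    by (simp only: sum.distrib sum_distrib_left)
  also have "(\<Sum>i<m. of_real ((cmod (y i))\<^sup>2)) = complex_of_real ((vnorm m y)\<^sup>2)"
    unfolding vnorm_power2 by (rule of_real_sum[symmetric])
  finally have "S = (\<Sum>i<m. cnj (y i) * x i) + w * complex_of_real ((vnorm m y)\<^sup>2)" .
  hence "Im (\<Sum>i<m. cnj (y i) * x i) = - (Im w * (vnorm m y)\<^sup>2)" using ImS by simp
  hence "Im w * (vnorm m y)\<^sup>2 \<le> cmod (\<Sum>i<m. cnj (y i) * x i)"
    using abs_Im_le_cmod[of "\<Sum>i<m. cnj (y i) * x i"] by linarith
  also have "\<dots> \<le> vnorm m (\<lambda>i. cnj (y i)) * vnorm m x" by (rule sum_mult_le_vnorm)
  also have "vnorm m (\<lambda>i. cnj (y i)) = vnorm m y" by simp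
  finally have *: "Im w * vnorm m y * vnorm m y \<le> vnorm m x * vnorm m y" by (simp add: power2_eq_square mult_ac)
  show ?thesis
  proof (cases "vnorm m y = 0")
    case True thus ?thesis using w by (simp add: vnorm_nonneg)
  next
    case False
    hence "vnorm m y > 0" using vnorm_nonneg[of y m] by linarith
    hence "Im w * vnorm m y \<le> vnorm m x" using * mult_right_le_imp_le by blast
    thus ?thesis using w by (simp add: pos_le_divide_eq mult.commute)
  qed
qed

lemma shifted_mat_carrier: "shifted_mat m H w \<in> carrier_mat m m"
  unfolding shifted_mat_def by simp

lemma det_shifted_mat:
  assumes H: "hermitian_on m H" and w: "Im w > 0"
  shows "det (shifted_mat m H w) \<noteq> 0"
proof
  assume "det (shifted_mat m H w) = 0"
  then obtain v where v: "v \<in> carrier_vec m" "v \<noteq> 0\<^sub>v m" "shifted_mat m H w *\<^sub>v v = 0\<^sub>v m"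
    using det_0_iff_vec_prod_zero_field[OF shifted_mat_carrier] by blast
  have "(\<Sum>k<m. H i k * v $ k) = 0 + w * v $ i" if i: "i < m" for i
  proof -
    have "0 = (shifted_mat m H w *\<^sub>v v) $ i" using v i by simp
    also have "\<dots> = (\<Sum>k<m. (H i k - (if i = k then w else 0)) * v $ k)"
      using v(1) i unfolding shifted_mat_def by (simp add: scalar_prod_def lessThan_atLeast0)
    also have "\<dots> = (\<Sum>k<m. H i k * v $ k) - (\<Sum>k<m. (if i = k then w else 0) * v $ k)"
      by (simp add: left_diff_distrib sum_subtractf)
    also have "(\<Sum>k<m. (if i = k then w else 0) * v $ k) = (\<Sum>k<m. if i = k then w * v $ k else 0)"
      by (intro sum.cong) auto
    also have "\<dots> = w * v $ i" using i by simp
    finally show ?thesis by simp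
  qed
  from hermitian_coercive[OF H w, of "\<lambda>k. v $ k" "\<lambda>_. 0", OF this]
  have "vnorm m (\<lambda>k. v $ k) \<le> 0" unfolding L2_set_def by simp
  hence "v $ i = 0" if "i < m" for i using component_le_vnorm[OF that, of "\<lambda>k. v $ k"] by (metis norm_le_zero_iff order_trans)
  hence "v = 0\<^sub>v m" using v(1) by (intro eq_vecI) auto
  thus False using v by simp
qed

context
  fixes m :: nat and H :: "nat => nat => complex" and w :: complex
  assumes H: "hermitian_on m H" and w: "Im w > 0"
begin

lemma
  assumes ij: "i < m" "j < m"
  shows resolvent_right: "(\<Sum>k<m. H i k * resolvent m H w k j) = (if i = j then 1 else 0) + w * resolvent m H w i j"
    and resolvent_left: "(\<Sum>k<m. resolvent m H w i k * H k j) = (if i = j then 1 else 0) + w * resolvent m H w i j"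
proof -
  let ?A = "shifted_mat m H w" and ?R = "resolvent m H w"
  have d: "det ?A \<noteq> 0" by (rule det_shifted_mat[OF H w])
  note adj = adj_mat[OF shifted_mat_carrier[of m H w]]
  have ai: "adj_mat ?A $$ (k, l) = det ?A * ?R k l" for k l unfolding resolvent_def using d by simp
  have cancel: "X = (if i = j then 1 else 0) + w * ?R i j"
    if "(if i = j then det ?A else 0) = det ?A * (X - w * ?R i j)" for X
  proof -
    have "det ?A * (if i = j then 1 else 0) = det ?A * (X - w * ?R i j)" using that by (simp split: if_splits)
    hence "(if i = j then 1 else 0) = X - w * ?R i j" using d mult_left_cancel by blast
    thus ?thesis by (simp add: algebra_simps)
  qed
  have "(if i = j then det ?A else 0) = (?A * adj_mat ?A) $$ (i, j)" unfolding adj(2) using ij by simp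
  also have "\<dots> = (\<Sum>k<m. (H i k - (if i = k then w else 0)) * adj_mat ?A $$ (k, j))"
    using ij adj(1) shifted_mat_carrier[of m H w]
    by (auto simp: scalar_prod_def lessThan_atLeast0 shifted_mat_def intro!: sum.cong)
  also have "\<dots> = (\<Sum>k<m. det ?A * (H i k * ?R k j)) - (\<Sum>k<m. if i = k then det ?A * w * ?R k j else 0)"
    unfolding sum_subtractf[symmetric] ai by (intro sum.cong refl) (auto simp: algebra_simps)
  also have "\<dots> = det ?A * ((\<Sum>k<m. H i k * ?R k j) - w * ?R i j)"
    using ij by (simp add: sum_distrib_left right_diff_distrib)
  finally show "(\<Sum>k<m. H i k * ?R k j) = (if i = j then 1 else 0) + w * ?R i j" by (rule cancel)
  have "(if i = j then det ?A else 0) = (adj_mat ?A * ?A) $$ (i, j)" unfolding adj(3) using ij by simp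
  also have "\<dots> = (\<Sum>k<m. adj_mat ?A $$ (i, k) * (H k j - (if k = j then w else 0)))"
    using ij adj(1) shifted_mat_carrier[of m H w]
    by (auto simp: scalar_prod_def lessThan_atLeast0 shifted_mat_def intro!: sum.cong)
  also have "\<dots> = (\<Sum>k<m. det ?A * (?R i k * H k j)) - (\<Sum>k<m. if k = j then det ?A * w * ?R i k else 0)"
    unfolding sum_subtractf[symmetric] ai by (intro sum.cong refl) (auto simp: algebra_simps)
  also have "\<dots> = det ?A * ((\<Sum>k<m. ?R i k * H k j) - w * ?R i j)"
    using ij by (simp add: sum_distrib_left right_diff_distrib)
  finally show "(\<Sum>k<m. ?R i k * H k j) = (if i = j then 1 else 0) + w * ?R i j" by (rule cancel)
qed

lemma resolvent_apply_norm:
  "vnorm m (\<lambda>i. \<Sum>j<m. resolvent m H w i j * x j) \<le> vnorm m x / Im w"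
proof (rule hermitian_coercive[OF H w])
  fix i assume i: "i < m"
  have "(\<Sum>k<m. H i k * (\<Sum>j<m. resolvent m H w k j * x j)) = (\<Sum>k<m. \<Sum>j<m. H i k * resolvent m H w k j * x j)"
    by (simp add: sum_distrib_left mult.assoc)
  also have "\<dots> = (\<Sum>j<m. \<Sum>k<m. H i k * resolvent m H w k j * x j)" by (rule sum.swap)
  also have "\<dots> = (\<Sum>j<m. ((if i = j then 1 else 0) + w * resolvent m H w i j) * x j)"
    using i by (simp add: sum_distrib_right[symmetric] resolvent_right)
  also have "\<dots> = (\<Sum>j<m. (if i = j then x j else 0)) + (\<Sum>j<m. w * (resolvent m H w i j * x j))"
    unfolding sum.distrib[symmetric] by (intro sum.cong refl) (auto simp: algebra_simps)
  also have "\<dots> = x i + w * (\<Sum>j<m. resolvent m H w i j * x j)" using i by (simp add: sum_distrib_left)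
  finally show "(\<Sum>k<m. H i k * (\<Sum>j<m. resolvent m H w k j * x j)) = x i + w * (\<Sum>j<m. resolvent m H w i j * x j)" .
qed

lemma resolvent_entry_le:
  assumes "i < m" "j < m" shows "cmod (resolvent m H w i j) \<le> 1 / Im w"
proof -
  have "(\<Sum>k<m. resolvent m H w i k * (if k = j then 1 else 0)) = (\<Sum>k<m. if k = j then resolvent m H w i k else 0)"
    by (intro sum.cong) auto
  also have "\<dots> = resolvent m H w i j" using assms by simp
  finally show ?thesis
    using component_le_vnorm[OF assms(1), of "\<lambda>i. \<Sum>k<m. resolvent m H w i k * (if k = j then 1 else 0)"]
      resolvent_apply_norm[of "\<lambda>k. if k = j then 1 else 0"] vnorm_unit[OF assms(2)] by simp
qed

end

lemma resolvent_difference: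
  assumes H: "hermitian_on m H" and H': "hermitian_on m H'" and w: "Im w > 0" and ij: "i < m" "j < m"
  shows "resolvent m H w i j - resolvent m H' w i j =
    (\<Sum>k<m. \<Sum>l<m. resolvent m H' w i k * (H' k l - H k l) * resolvent m H w l j)"
proof -
  let ?R = "resolvent m H w" and ?R' = "resolvent m H' w"
  have "(\<Sum>k<m. \<Sum>l<m. ?R' i k * (H' k l - H k l) * ?R l j)
      = (\<Sum>k<m. \<Sum>l<m. ?R' i k * H' k l * ?R l j) - (\<Sum>k<m. \<Sum>l<m. ?R' i k * (H k l * ?R l j))"
    by (simp add: sum_subtractf algebra_simps)
  also have "(\<Sum>k<m. \<Sum>l<m. ?R' i k * H' k l * ?R l j) = (\<Sum>l<m. (\<Sum>k<m. ?R' i k * H' k l) * ?R l j)"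
    by (subst sum.swap) (simp add: sum_distrib_right)
  also have "\<dots> = (\<Sum>l<m. (if i = l then ?R l j else 0)) + (\<Sum>l<m. w * (?R' i l * ?R l j))"
    unfolding sum.distrib[symmetric]
  proof (intro sum.cong refl)
    fix l assume "l \<in> {..<m}"
    hence "(\<Sum>k<m. ?R' i k * H' k l) = (if i = l then 1 else 0) + w * ?R' i l"
      using ij by (intro resolvent_left[OF H' w]) auto
    thus "(\<Sum>k<m. ?R' i k * H' k l) * ?R l j = (if i = l then ?R l j else 0) + w * (?R' i l * ?R l j)"
      by (simp only:) (auto simp: algebra_simps)
  qed
  also have "(\<Sum>k<m. \<Sum>l<m. ?R' i k * (H k l * ?R l j)) = (\<Sum>k<m. ?R' i k * (\<Sum>l<m. H k l * ?R l j))"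
    by (simp add: sum_distrib_left)
  also have "\<dots> = (\<Sum>k<m. (if k = j then ?R' i k else 0)) + (\<Sum>k<m. w * (?R' i k * ?R k j))"
    unfolding sum.distrib[symmetric]
  proof (intro sum.cong refl)
    fix k assume "k \<in> {..<m}"
    hence "(\<Sum>l<m. H k l * ?R l j) = (if k = j then 1 else 0) + w * ?R k j"
      using ij by (intro resolvent_right[OF H w]) auto
    thus "?R' i k * (\<Sum>l<m. H k l * ?R l j) = (if k = j then ?R' i k else 0) + w * (?R' i k * ?R k j)"
      by (simp only:) (auto simp: algebra_simps)
  qed
  finally show ?thesis using ij by simp
qed

lemma resolvent_weighted_trace_difference:
  assumes H: "hermitian_on m H" and H': "hermitian_on m H'" and w: "Im w > 0"
  shows "(\<Sum>i<m. d i * resolvent m H w i i) - (\<Sum>i<m. d i * resolvent m H' w i i) =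
    (\<Sum>k<m. \<Sum>l<m. (H' k l - H k l) * (\<Sum>i<m. resolvent m H w l i * d i * resolvent m H' w i k))"
proof -
  let ?R = "resolvent m H w" and ?R' = "resolvent m H' w"
  have "(\<Sum>i<m. d i * ?R i i) - (\<Sum>i<m. d i * ?R' i i) = (\<Sum>i<m. d i * (?R i i - ?R' i i))"
    by (simp add: sum_subtractf right_diff_distrib)
  also have "\<dots> = (\<Sum>i<m. \<Sum>k<m. \<Sum>l<m. (H' k l - H k l) * (?R l i * d i * ?R' i k))"
    by (intro sum.cong refl) (simp add: resolvent_difference[OF H H' w] sum_distrib_left mult_ac)
  also have "\<dots> = (\<Sum>k<m. \<Sum>i<m. \<Sum>l<m. (H' k l - H k l) * (?R l i * d i * ?R' i k))" by (rule sum.swap)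
  also have "\<dots> = (\<Sum>k<m. \<Sum>l<m. \<Sum>i<m. (H' k l - H k l) * (?R l i * d i * ?R' i k))"
    by (intro sum.cong refl sum.swap)
  finally show ?thesis by (simp add: sum_distrib_left)
qed

lemma resolvent_sandwich_norm:
  assumes H: "hermitian_on m H" and H': "hermitian_on m H'" and w: "Im w > 0"
    and d: "\<And>i. i < m \<Longrightarrow> cmod (d i) \<le> D"
  shows "vnorm m (\<lambda>l. \<Sum>k<m. (\<Sum>i<m. resolvent m H w l i * d i * resolvent m H' w i k) * y k)
    \<le> D / (Im w)\<^sup>2 * vnorm m y"
proof (cases "m = 0")
  case False
  hence D: "0 \<le> D" using d[of 0] norm_ge_zero order_trans by blast
  let ?R = "resolvent m H w" and ?R' = "resolvent m H' w"
  have "(\<Sum>k<m. (\<Sum>i<m. ?R l i * d i * ?R' i k) * y k) = (\<Sum>i<m. ?R l i * (d i * (\<Sum>k<m. ?R' i k * y k)))" for l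
    unfolding sum_distrib_right sum_distrib_left by (subst sum.swap) (simp add: mult_ac)
  hence "vnorm m (\<lambda>l. \<Sum>k<m. (\<Sum>i<m. ?R l i * d i * ?R' i k) * y k) = vnorm m (\<lambda>l. \<Sum>i<m. ?R l i * (d i * (\<Sum>k<m. ?R' i k * y k)))"
    by simp
  also have "\<dots> \<le> vnorm m (\<lambda>i. d i * (\<Sum>k<m. ?R' i k * y k)) / Im w" by (rule resolvent_apply_norm[OF H w])
  also have "\<dots> \<le> (D * vnorm m (\<lambda>i. \<Sum>k<m. ?R' i k * y k)) / Im w"
  proof (intro divide_right_mono)
    have "vnorm m (\<lambda>i. d i * (\<Sum>k<m. ?R' i k * y k)) \<le> L2_set (\<lambda>i. D * cmod (\<Sum>k<m. ?R' i k * y k)) {..<m}"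
      using d by (intro L2_set_mono) (auto simp: norm_mult intro!: mult_right_mono)
    thus "vnorm m (\<lambda>i. d i * (\<Sum>k<m. ?R' i k * y k)) \<le> D * vnorm m (\<lambda>i. \<Sum>k<m. ?R' i k * y k)"
      using D by (simp add: L2_set_right_distrib)
  qed (use w in simp)
  also have "\<dots> \<le> (D * (vnorm m y / Im w)) / Im w"
    using resolvent_apply_norm[OF H' w, of y] D w by (intro divide_right_mono mult_left_mono) auto
  finally show ?thesis by (simp add: power2_eq_square)
qed simp

text \<open>A bound for the operator norm, phrased by bilinear forms because these pair with rank one matrices.\<close>

definition bilinear_bound :: "nat => (nat => nat => complex) => real => bool" where
  "bilinear_bound m M K \<longleftrightarrow> (\<forall>x y. cmod (\<Sum>i<m. \<Sum>j<m. x i * M i j * y j) \<le> K * vnorm m x * vnorm m y)"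

lemma resolvent_sandwich_bilinear:
  assumes "hermitian_on m H" and "hermitian_on m H'" and "Im w > 0"
    and "\<And>i. i < m \<Longrightarrow> cmod (d i) \<le> D"
  shows "bilinear_bound m (\<lambda>l k. \<Sum>i<m. resolvent m H w l i * d i * resolvent m H' w i k) (D / (Im w)\<^sup>2)"
  unfolding bilinear_bound_def
proof (intro allI)
  fix x y
  define M where "M l k = (\<Sum>i<m. resolvent m H w l i * d i * resolvent m H' w i k)" for l k
  have "cmod (\<Sum>i<m. \<Sum>j<m. x i * M i j * y j) = cmod (\<Sum>i<m. x i * (\<Sum>j<m. M i j * y j))"
    by (simp add: sum_distrib_left mult.assoc)
  also have "\<dots> \<le> vnorm m x * vnorm m (\<lambda>i. \<Sum>j<m. M i j * y j)" by (rule sum_mult_le_vnorm)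
  also have "\<dots> \<le> vnorm m x * (D / (Im w)\<^sup>2 * vnorm m y)"
    unfolding M_def by (intro mult_left_mono resolvent_sandwich_norm assms vnorm_nonneg)
  finally show "cmod (\<Sum>i<m. \<Sum>j<m. x i * (\<Sum>k<m. resolvent m H w i k * d k * resolvent m H' w k j) * y j) \<le> D / (Im w)\<^sup>2 * vnorm m x * vnorm m y"
    unfolding M_def by (simp add: mult_ac)
qed

text \<open>The difference is the trace of \<open>H' - H\<close> times a matrix whose operator norm is at most \<open>D / (Im w)\<^sup>2\<close>.
  The Hilbert-Schmidt norm of the latter is larger by at most the factor \<open>sqrt m\<close>, and the trace is
  bounded by the product of the Hilbert-Schmidt norms.\<close>

lemma resolvent_trace_lipschitz:
  assumes H: "hermitian_on m H" and H': "hermitian_on m H'" and w: "Im w > 0"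
    and d: "\<And>i. i < m \<Longrightarrow> cmod (d i) \<le> D"
  shows "cmod ((\<Sum>i<m. d i * resolvent m H w i i) - (\<Sum>i<m. d i * resolvent m H' w i i))
    \<le> sqrt (\<Sum>k<m. \<Sum>l<m. (cmod (H' k l - H k l))\<^sup>2) * (D / (Im w)\<^sup>2 * sqrt (real m))"
proof -
  let ?M = "\<lambda>l k. \<Sum>i<m. resolvent m H w l i * d i * resolvent m H' w i k"
  have col: "vnorm m (\<lambda>l. ?M l k) \<le> D / (Im w)\<^sup>2" if k: "k < m" for k
  proof -
    have "(\<Sum>j<m. ?M l j * (if j = k then 1 else 0)) = ?M l k" for l
    proof -
      have "(\<Sum>j<m. ?M l j * (if j = k then 1 else 0)) = (\<Sum>j<m. if j = k then ?M l j else 0)" by (intro sum.cong) auto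
      thus ?thesis using k by simp
    qed
    thus ?thesis using resolvent_sandwich_norm[OF H H' w d, of "\<lambda>i. i" "\<lambda>j. if j = k then 1 else 0"] vnorm_unit[OF k] by simp
  qed
  have D0: "0 \<le> D / (Im w)\<^sup>2" if "m \<noteq> 0"
    using col[of 0] vnorm_nonneg[of "\<lambda>l. ?M l 0" m] that by linarith
  have "cmod (\<Sum>k<m. \<Sum>l<m. (H' k l - H k l) * ?M l k) \<le> (\<Sum>k<m. \<Sum>l<m. cmod (H' k l - H k l) * cmod (?M l k))"
    by (intro sum_norm_le) (simp add: sum_norm_le norm_mult)
  also have "\<dots> \<le> (\<Sum>k<m. vnorm m (\<lambda>l. H' k l - H k l) * (D / (Im w)\<^sup>2))"
  proof (intro sum_mono)
    fix k assume k: "k \<in> {..<m}"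
    have "(\<Sum>l<m. cmod (H' k l - H k l) * cmod (?M l k)) \<le> vnorm m (\<lambda>l. H' k l - H k l) * vnorm m (\<lambda>l. ?M l k)"
      using L2_set_mult_ineq[of "\<lambda>l. cmod (H' k l - H k l)" "\<lambda>l. cmod (?M l k)" "{..<m}"] by simp
    also have "\<dots> \<le> vnorm m (\<lambda>l. H' k l - H k l) * (D / (Im w)\<^sup>2)"
      using col k by (intro mult_left_mono vnorm_nonneg) auto
    finally show "(\<Sum>l<m. cmod (H' k l - H k l) * cmod (?M l k)) \<le> vnorm m (\<lambda>l. H' k l - H k l) * (D / (Im w)\<^sup>2)" .
  qed
  also have "\<dots> \<le> L2_set (\<lambda>k. vnorm m (\<lambda>l. H' k l - H k l)) {..<m} * L2_set (\<lambda>k. D / (Im w)\<^sup>2) {..<m}"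
  proof (cases "m = 0")
    case False
    thus ?thesis using L2_set_mult_ineq[of "\<lambda>k. vnorm m (\<lambda>l. H' k l - H k l)" "\<lambda>k. D / (Im w)\<^sup>2" "{..<m}"]
      by (simp only: abs_of_nonneg[OF D0[OF False]] abs_of_nonneg[OF vnorm_nonneg])
  qed simp
  also have "L2_set (\<lambda>k. D / (Im w)\<^sup>2) {..<m} = D / (Im w)\<^sup>2 * sqrt (real m)"
  proof (cases "m = 0")
    case False
    have "L2_set (\<lambda>k. D / (Im w)\<^sup>2) {..<m} = sqrt (real m * (D / (Im w)\<^sup>2)\<^sup>2)" unfolding L2_set_def by simp
    thus ?thesis using D0[OF False] by (simp only: real_sqrt_mult real_sqrt_abs abs_of_nonneg mult.commute)
  qed simp
  also have "L2_set (\<lambda>k. vnorm m (\<lambda>l. H' k l - H k l)) {..<m} = sqrt (\<Sum>k<m. \<Sum>l<m. (cmod (H' k l - H k l))\<^sup>2)"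
    unfolding L2_set_def by (simp add: sum_nonneg)
  finally show ?thesis unfolding resolvent_weighted_trace_difference[OF H H' w] .
qed

lemma has_vector_derivativeI_tendsto:
  fixes f :: "real => 'a::real_normed_vector"
  assumes "((\<lambda>s. (f s - f t) /\<^sub>R (s - t)) \<longlongrightarrow> D) (at t)"
  shows "(f has_vector_derivative D) (at t)"
  unfolding has_vector_derivative_def has_derivative_iff_norm
proof
  show "bounded_linear (\<lambda>x. x *\<^sub>R D)" by (rule bounded_linear_scaleR_left)
  have "((\<lambda>s. norm ((f s - f t) /\<^sub>R (s - t) - D)) \<longlongrightarrow> 0) (at t)"
    by (rule tendsto_norm_zero[OF LIM_zero[OF assms]])
  thus "((\<lambda>s. norm (f s - f t - (s - t) *\<^sub>R D) / norm (s - t)) \<longlongrightarrow> 0) (at t)"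
  proof (rule Lim_transform_eventually)
    have "eventually (\<lambda>s. s \<noteq> t) (at t)" by (simp add: eventually_at_filter)
    thus "eventually (\<lambda>s. norm ((f s - f t) /\<^sub>R (s - t) - D) = norm (f s - f t - (s - t) *\<^sub>R D) / norm (s - t)) (at t)"
    proof eventually_elim
      case (elim s)
      have "(f s - f t) /\<^sub>R (s - t) - D = (f s - f t - (s - t) *\<^sub>R D) /\<^sub>R (s - t)"
        using elim by (simp add: scaleR_diff_right)
      thus ?case by (simp add: divide_inverse mult.commute)
    qed
  qed
qed

lemma resolvent_has_derivative:
  assumes H: "\<And>t::real. hermitian_on m (\<lambda>i j. H i j + of_real t * B i j)" and w: "Im w > 0" and ij: "i < m" "j < m"
  shows "((\<lambda>t. resolvent m (\<lambda>i j. H i j + of_real t * B i j) w i j) has_vector_derivative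
    - (\<Sum>k<m. \<Sum>l<m. resolvent m (\<lambda>i j. H i j + of_real t * B i j) w i k * B k l * resolvent m (\<lambda>i j. H i j + of_real t * B i j) w l j)) (at t)"
proof -
  define R where "R t = resolvent m (\<lambda>i j. H i j + of_real t * B i j) w" for t :: real
  have diff: "R s i j - R t i j = - (of_real (s - t) * (\<Sum>k<m. \<Sum>l<m. R t i k * B k l * R s l j))" if "i < m" "j < m" for i j s t
  proof -
    have "R s i j - R t i j = (\<Sum>k<m. \<Sum>l<m. R t i k * ((H k l + of_real t * B k l) - (H k l + of_real s * B k l)) * R s l j)"
      unfolding R_def by (rule resolvent_difference[OF H H w that])
    also have "\<dots> = (\<Sum>k<m. \<Sum>l<m. - (of_real (s - t) * (R t i k * B k l * R s l j)))"
      by (intro sum.cong refl) (simp add: algebra_simps)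
    finally show ?thesis by (simp add: sum_negf sum_distrib_left)
  qed
  have entry: "cmod (R t i j) \<le> 1 / Im w" if "i < m" "j < m" for i j t
    unfolding R_def by (rule resolvent_entry_le[OF H w that])
  define C where "C = (\<Sum>k<m. \<Sum>l<m. (1 / Im w) * cmod (B k l) * (1 / Im w))"
  have lip: "cmod (R s l j - R t l j) \<le> \<bar>s - t\<bar> * C" if "l < m" for l s
  proof -
    have "cmod (\<Sum>k<m. \<Sum>l'<m. R t l k * B k l' * R s l' j) \<le> C"
      unfolding C_def using that ij w
      by (intro order_trans[OF norm_sum] sum_mono) (auto simp: norm_mult simp del: times_divide_eq_left times_divide_eq_right intro!: mult_mono entry)
    thus ?thesis unfolding diff[OF that ij(2)] norm_minus_cancel norm_mult norm_of_real by (intro mult_left_mono) auto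
  qed
  have cont: "((\<lambda>s. R s l j) \<longlongrightarrow> R t l j) (at t)" if "l < m" for l
  proof -
    have "((\<lambda>s. R s l j - R t l j) \<longlongrightarrow> 0) (at t)"
    proof (rule Lim_null_comparison)
      show "eventually (\<lambda>s. cmod (R s l j - R t l j) \<le> \<bar>s - t\<bar> * C) (at t)" using lip[OF that] by simp
      have "((\<lambda>s. \<bar>s - t\<bar> * C) \<longlongrightarrow> \<bar>t - t\<bar> * C) (at t)" by (intro tendsto_intros)
      thus "((\<lambda>s. \<bar>s - t\<bar> * C) \<longlongrightarrow> 0) (at t)" by simp
    qed
    thus ?thesis by (rule LIM_zero_cancel)
  qed
  have "((\<lambda>s. - (\<Sum>k<m. \<Sum>l<m. R t i k * B k l * R s l j)) \<longlongrightarrow> - (\<Sum>k<m. \<Sum>l<m. R t i k * B k l * R t l j)) (at t)"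
    by (intro tendsto_intros cont) auto
  hence "((\<lambda>s. (R s i j - R t i j) /\<^sub>R (s - t)) \<longlongrightarrow> - (\<Sum>k<m. \<Sum>l<m. R t i k * B k l * R t l j)) (at t)"
  proof (rule Lim_transform_eventually)
    have "eventually (\<lambda>s. s \<noteq> t) (at t)" by (simp add: eventually_at_filter)
    thus "eventually (\<lambda>s. - (\<Sum>k<m. \<Sum>l<m. R t i k * B k l * R s l j) = (R s i j - R t i j) /\<^sub>R (s - t)) (at t)"
    proof eventually_elim
      case (elim s)
      thus ?case unfolding diff[OF ij] by (simp add: scaleR_conv_of_real)
    qed
  qed
  thus ?thesis unfolding R_def by (rule has_vector_derivativeI_tendsto)
qed

lemma det_measurable:
  assumes "\<And>i j. i < n \<Longrightarrow> j < n \<Longrightarrow> (\<lambda>\<omega>. f \<omega> i j) \<in> borel_measurable M"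
  shows "(\<lambda>\<omega>. det (Matrix.mat n n (\<lambda>(i, j). f \<omega> i j :: complex))) \<in> borel_measurable M"
proof -
  have "det (Matrix.mat n n (\<lambda>(i, j). f \<omega> i j)) = (\<Sum>p\<in>{p. p permutes {0..<n}}. signof p * (\<Prod>i = 0..<n. f \<omega> i (p i)))" for \<omega>
    by (subst det_def'[of _ n]) (auto intro!: sum.cong prod.cong simp: permutes_in_image)
  thus ?thesis using assms
    by (auto intro!: borel_measurable_sum borel_measurable_times borel_measurable_prod simp: permutes_in_image)
qed

lemma resolvent_measurable:
  assumes H: "\<And>i j. i < m \<Longrightarrow> j < m \<Longrightarrow> (\<lambda>\<omega>. H \<omega> i j) \<in> borel_measurable M" and ij: "i < m" "j < m"
  shows "(\<lambda>\<omega>. resolvent m (H \<omega>) w i j) \<in> borel_measurable M"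
proof -
  define f where "f \<omega> i j = H \<omega> i j - (if i = j then w else 0)" for \<omega> i j
  have f: "(\<lambda>\<omega>. f \<omega> i j) \<in> borel_measurable M" if "i < m" "j < m" for i j
    unfolding f_def using H[OF that] by (intro borel_measurable_diff) auto
  define ins where "ins a i = (if i < a then i else Suc i)" for a i :: nat
  have "mat_delete (shifted_mat m (H \<omega>) w) j i = Matrix.mat (m - 1) (m - 1) (\<lambda>(a, b). f \<omega> (ins j a) (ins i b))" for \<omega>
    using ij unfolding mat_delete_def shifted_mat_def f_def ins_def by (intro eq_matI) auto
  hence "adj_mat (shifted_mat m (H \<omega>) w) $$ (i, j) = (- 1) ^ (j + i) * det (Matrix.mat (m - 1) (m - 1) (\<lambda>(a, b). f \<omega> (ins j a) (ins i b)))" for \<omega>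
    using ij by (simp add: adj_mat_def cofactor_def shifted_mat_def)
  moreover have "(\<lambda>\<omega>. det (Matrix.mat (m - 1) (m - 1) (\<lambda>(a, b). f \<omega> (ins j a) (ins i b)))) \<in> borel_measurable M"
    by (rule det_measurable) (auto simp: ins_def intro!: f)
  moreover have "(\<lambda>\<omega>. det (shifted_mat m (H \<omega>) w)) \<in> borel_measurable M"
    unfolding shifted_mat_def f_def[symmetric] by (rule det_measurable[OF f])
  ultimately show ?thesis unfolding resolvent_def by simp
qed

section \<open>The spectral distribution of a Gram matrix\<close>

lemma sum_lessThan_add: "(\<Sum>k<N + n. f k) = (\<Sum>k<N. f k) + (\<Sum>k<n. f (N + k))" for f :: "nat => 'a::comm_monoid_add"
  by (induction n) (simp_all add: add.assoc)

definition mtrace :: "complex mat => complex" where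
  "mtrace A = (\<Sum>i<dim_row A. A $$ (i, i))"

lemma mtrace_commute:
  assumes A: "A \<in> carrier_mat n n" and B: "B \<in> carrier_mat n n"
  shows "mtrace (A * B) = mtrace (B * A)"
proof -
  have "mtrace (A * B) = (\<Sum>i<n. \<Sum>k<n. A $$ (i, k) * B $$ (k, i))"
    unfolding mtrace_def using A B by (auto simp: scalar_prod_def lessThan_atLeast0 intro!: sum.cong)
  also have "\<dots> = (\<Sum>k<n. \<Sum>i<n. B $$ (k, i) * A $$ (i, k))" by (subst sum.swap) (simp add: mult.commute)
  also have "\<dots> = mtrace (B * A)"
    unfolding mtrace_def using A B by (auto simp: scalar_prod_def lessThan_atLeast0 intro!: sum.cong)
  finally show ?thesis .
qed

lemma mtrace_similar:
  assumes c: "A \<in> carrier_mat n n" "P \<in> carrier_mat n n" "Q \<in> carrier_mat n n" and PQ: "P * Q = 1\<^sub>m n"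
  shows "mtrace (Q * A * P) = mtrace A"
proof -
  have "mtrace (Q * A * P) = mtrace (P * (Q * A))" using c by (intro mtrace_commute) auto
  also have "P * (Q * A) = (P * Q) * A" using c by (simp add: assoc_mult_mat[of P n n Q n A n])
  also have "\<dots> = A" using PQ c by simp
  finally show ?thesis .
qed

text \<open>Schur triangulation reduces both traces to sums over the diagonal.\<close>

lemma mtrace_char_poly:
  assumes A: "A \<in> carrier_mat n n" and c: "char_poly A = (\<Prod>a\<leftarrow>es. [:- a, 1:])"
  shows "mtrace A = sum_list es"
    and "R \<in> carrier_mat n n \<Longrightarrow> (A - z \<cdot>\<^sub>m 1\<^sub>m n) * R = 1\<^sub>m n \<Longrightarrow> mtrace R = (\<Sum>e\<leftarrow>es. 1 / (e - z))"
proof -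
  obtain B P Q where BPQ: "schur_decomposition A es = (B, P, Q)" by (metis prod_cases3)
  from schur_decomposition[OF A c BPQ] have sim: "similar_mat_wit A B P Q" and ut: "upper_triangular B" and dB: "diag_mat B = es"
    by auto
  from similar_mat_witD2[OF A sim] have PQ: "P * Q = 1\<^sub>m n" and QP: "Q * P = 1\<^sub>m n" and AB: "A = P * B * Q"
    and cB: "B \<in> carrier_mat n n" and cP: "P \<in> carrier_mat n n" and cQ: "Q \<in> carrier_mat n n" by auto
  have es: "es = map (\<lambda>i. B $$ (i, i)) [0..<n]" using dB cB unfolding diag_mat_def by auto
  have len: "length es = n" by (simp add: es)
  have sl: "sum_list (map f es) = (\<Sum>i<n. f (B $$ (i, i)))" for f :: "complex => complex"
    unfolding es by (simp add: comp_def sum_list_distinct_conv_sum_set lessThan_atLeast0 atLeast_upt[symmetric])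
  have "mtrace A = mtrace B" unfolding AB using mtrace_similar[OF cB cQ cP QP] .
  also have "\<dots> = (\<Sum>i<n. B $$ (i, i))" unfolding mtrace_def using cB by simp
  also have "\<dots> = sum_list es" using sl[of "\<lambda>x. x"] by simp
  finally show "mtrace A = sum_list es" .
  assume R: "R \<in> carrier_mat n n" and AR: "(A - z \<cdot>\<^sub>m 1\<^sub>m n) * R = 1\<^sub>m n"
  define D where "D = B - z \<cdot>\<^sub>m 1\<^sub>m n"
  define S where "S = Q * R * P"
  have cD: "D \<in> carrier_mat n n" and cS: "S \<in> carrier_mat n n" unfolding D_def S_def using cB cQ cP R by auto
  have DQ: "D * Q = Q * (A - z \<cdot>\<^sub>m 1\<^sub>m n)"
  proof -
    have "Q * A = Q * P * (B * Q)" unfolding AB using cP cQ cB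
      by (simp add: assoc_mult_mat[of Q n n P n _ n] assoc_mult_mat[of P n n B n Q n])
    also have "\<dots> = B * Q" unfolding QP using cB cQ by simp
    finally have QA: "Q * A = B * Q" .
    have "D * Q = B * Q - z \<cdot>\<^sub>m 1\<^sub>m n * Q" unfolding D_def using cB cQ by (intro minus_mult_distrib_mat) auto
    also have "z \<cdot>\<^sub>m 1\<^sub>m n * Q = Q * (z \<cdot>\<^sub>m 1\<^sub>m n)" using cQ by (simp add: mult_smult_distrib[of Q n n _ n] mult_smult_assoc_mat[of _ n n Q n])
    also have "B * Q - Q * (z \<cdot>\<^sub>m 1\<^sub>m n) = Q * (A - z \<cdot>\<^sub>m 1\<^sub>m n)" unfolding QA[symmetric] using A cQ by (intro mult_minus_distrib_mat[symmetric]) auto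
    finally show ?thesis .
  qed
  have "D * S = D * Q * (R * P)" unfolding S_def using cD cQ cP R
    by (simp add: assoc_mult_mat[of Q n n R n P n] assoc_mult_mat[of D n n Q n _ n])
  also have "\<dots> = Q * ((A - z \<cdot>\<^sub>m 1\<^sub>m n) * R) * P"
  proof -
    define X where "X = A - z \<cdot>\<^sub>m 1\<^sub>m n"
    have X: "X \<in> carrier_mat n n" using A unfolding X_def by auto
    show ?thesis unfolding DQ X_def[symmetric] using X cQ cP R
      by (simp add: assoc_mult_mat[of X n n R n P n] assoc_mult_mat[of Q n n _ n _ n])
  qed
  also have "\<dots> = 1\<^sub>m n" unfolding AR using cQ cP QP by simp
  finally have DS: "D * S = 1\<^sub>m n" .
  have SD: "S * D = 1\<^sub>m n" by (rule mat_mult_left_right_inverse[OF cD cS DS])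
  have ent: "(\<Sum>k<n. S $$ (i, k) * D $$ (k, j)) = (if i = j then 1 else 0)" if "i < n" "j < n" for i j
  proof -
    have "(S * D) $$ (i, j) = (\<Sum>k<n. S $$ (i, k) * D $$ (k, j))"
      using cS cD that by (simp add: scalar_prod_def lessThan_atLeast0)
    thus ?thesis unfolding SD using that by simp
  qed
  have Dlow: "D $$ (k, j) = 0" if "j < k" "k < n" for k j
    using that ut cB unfolding D_def upper_triangular_def by auto
  have Ddiag: "D $$ (j, j) = B $$ (j, j) - z" if "j < n" for j using that cB unfolding D_def by simp
  have red: "(\<Sum>k<n. S $$ (i, k) * D $$ (k, j)) = S $$ (i, j) * D $$ (j, j)" if "i < n" "j < n" "\<And>k. k < j \<Longrightarrow> S $$ (i, k) = 0" for i j
  proof -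
    have "(\<Sum>k<n. S $$ (i, k) * D $$ (k, j)) = (\<Sum>k<n. if k = j then S $$ (i, j) * D $$ (j, j) else 0)"
    proof (intro sum.cong refl)
      fix k assume "k \<in> {..<n}"
      thus "S $$ (i, k) * D $$ (k, j) = (if k = j then S $$ (i, j) * D $$ (j, j) else 0)"
        using that Dlow[of j k] by (cases k j rule: linorder_cases) auto
    qed
    thus ?thesis using that by simp
  qed
  have Dnz: "D $$ (j, j) \<noteq> 0" if j: "j < n" for j
  proof -
    have "det D \<noteq> 0" using DS det_mult[OF cD cS] by auto
    moreover have "upper_triangular D" using Dlow cD unfolding upper_triangular_def by auto
    ultimately have "0 \<notin> set (diag_mat D)" using upper_triangular_imp_det_eq_0_iff[OF cD] by blast
    thus ?thesis using j cD unfolding diag_mat_def by (metis (mono_tags, lifting) atLeastLessThan_iff carrier_matD(1) image_eqI le0 list.set_map set_upt)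
  qed
  \<comment> \<open>The inverse of an upper triangular matrix is upper triangular.\<close>
  have Slow: "S $$ (i, j) = 0" if "j < i" "i < n" for i j
    using that
  proof (induction j rule: less_induct)
    case (less j)
    have "S $$ (i, j) * D $$ (j, j) = (\<Sum>k<n. S $$ (i, k) * D $$ (k, j))"
      by (rule red[symmetric]) (use less in auto)
    also have "\<dots> = 0" using ent[of i j] less by auto
    finally show ?case using Dnz[of j] less by auto
  qed
  have "S $$ (i, i) = 1 / (B $$ (i, i) - z)" if i: "i < n" for i
  proof -
    have "S $$ (i, i) * D $$ (i, i) = (\<Sum>k<n. S $$ (i, k) * D $$ (k, i))"
      by (rule red[symmetric]) (use i Slow in auto)
    also have "\<dots> = 1" using ent[OF i i] by simp
    finally show ?thesis using Ddiag[OF i] Dnz[OF i] by (simp add: nonzero_eq_divide_eq)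
  qed
  hence "mtrace S = (\<Sum>i<n. 1 / (B $$ (i, i) - z))" unfolding mtrace_def using cS by simp
  moreover have "mtrace S = mtrace R" unfolding S_def by (rule mtrace_similar[OF R cP cQ PQ])
  ultimately show "mtrace R = (\<Sum>e\<leftarrow>es. 1 / (e - z))" using sl[of "\<lambda>e. 1 / (e - z)"] by simp
qed

lemma mat_adjoint_carrier: "A \<in> carrier_mat N n \<Longrightarrow> mat_adjoint A \<in> carrier_mat n N"
  unfolding mat_adjoint_def by (auto intro!: carrier_matI)

lemma mat_adjoint_index:
  assumes "A \<in> carrier_mat N n" "i < n" "j < N"
  shows "mat_adjoint A $$ (i, j) = cnj (A $$ (j, i))"
  using assms unfolding mat_adjoint_def by (auto simp: mat_of_rows_def conjugate_vec_def)

lemma gram_index: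
  assumes Z: "Z \<in> carrier_mat N n" and ij: "i < N" "j < N"
  shows "(Z * mat_adjoint Z) $$ (i, j) = (\<Sum>k<n. Z $$ (i, k) * cnj (Z $$ (j, k)))"
proof -
  have c: "mat_adjoint Z \<in> carrier_mat n N" by (rule mat_adjoint_carrier[OF Z])
  have "(Z * mat_adjoint Z) $$ (i, j) = (\<Sum>k<n. Z $$ (i, k) * mat_adjoint Z $$ (k, j))"
    using Z c ij by (simp add: scalar_prod_def lessThan_atLeast0)
  thus ?thesis using mat_adjoint_index[OF Z _ ij(2)] by simp
qed

lemma gram_eigenvalue_nonneg:
  assumes Z: "Z \<in> carrier_mat N n" and e: "eigenvalue (Z * mat_adjoint Z) e"
  shows "\<exists>r\<ge>0. e = complex_of_real r"
proof -
  have c: "mat_adjoint Z \<in> carrier_mat n N" by (rule mat_adjoint_carrier[OF Z])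
  define A where "A = Z * mat_adjoint Z"
  have A: "A \<in> carrier_mat N N" unfolding A_def using Z c by simp
  obtain v where v: "v \<in> carrier_vec N" "v \<noteq> 0\<^sub>v N" "A *\<^sub>v v = e \<cdot>\<^sub>v v"
    using e A unfolding eigenvalue_def eigenvector_def A_def[symmetric] by auto
  have Av: "(\<Sum>k<N. A $$ (i, k) * v $ k) = e * v $ i" if i: "i < N" for i
  proof -
    have "(A *\<^sub>v v) $ i = (\<Sum>k<N. A $$ (i, k) * v $ k)"
      using A v(1) i by (simp add: scalar_prod_def lessThan_atLeast0)
    thus ?thesis using v i by simp
  qed
  define s where "s b = (\<Sum>k<N. cnj (Z $$ (k, b)) * v $ k)" for b
  define T where "T = (\<Sum>i<N. (cmod (v $ i))\<^sup>2)"
  have "e * complex_of_real T = (\<Sum>i<N. cnj (v $ i) * (e * v $ i))"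
    unfolding T_def of_real_sum sum_distrib_left by (intro sum.cong refl) (simp add: complex_norm_square mult_ac del: of_real_power)
  also have "\<dots> = (\<Sum>i<N. cnj (v $ i) * (\<Sum>k<N. A $$ (i, k) * v $ k))" by (simp add: Av)
  also have "\<dots> = (\<Sum>i<N. cnj (v $ i) * (\<Sum>b<n. Z $$ (i, b) * s b))"
  proof (intro sum.cong refl)
    fix i assume "i \<in> {..<N}"
    hence "(\<Sum>k<N. A $$ (i, k) * v $ k) = (\<Sum>k<N. \<Sum>b<n. Z $$ (i, b) * (cnj (Z $$ (k, b)) * v $ k))"
      unfolding A_def by (intro sum.cong refl) (simp add: gram_index[OF Z] sum_distrib_right mult.assoc)
    also have "\<dots> = (\<Sum>b<n. Z $$ (i, b) * s b)" unfolding s_def sum_distrib_left by (rule sum.swap)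
    finally show "cnj (v $ i) * (\<Sum>k<N. A $$ (i, k) * v $ k) = cnj (v $ i) * (\<Sum>b<n. Z $$ (i, b) * s b)"
      by (simp only:)
  qed
  also have "\<dots> = (\<Sum>b<n. (\<Sum>i<N. cnj (v $ i) * Z $$ (i, b)) * s b)"
    unfolding sum_distrib_left sum_distrib_right by (subst sum.swap) (simp add: mult.assoc)
  also have "\<dots> = (\<Sum>b<n. cnj (s b) * s b)" unfolding s_def by (simp add: mult.commute)
  also have "\<dots> = complex_of_real (\<Sum>b<n. (cmod (s b))\<^sup>2)"
    unfolding of_real_sum by (intro sum.cong refl) (simp add: complex_norm_square mult.commute del: of_real_power)
  finally have eq: "e * complex_of_real T = complex_of_real (\<Sum>b<n. (cmod (s b))\<^sup>2)" .
  obtain i where i: "i < N" "v $ i \<noteq> 0" using v by (metis carrier_vecD eq_vecI index_zero_vec(1) index_zero_vec(2))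
  have "T > 0" unfolding T_def
    by (rule sum_pos2[of _ i]) (use i in auto)
  hence "e = complex_of_real ((\<Sum>b<n. (cmod (s b))\<^sup>2) / T)" using eq by (simp add: field_simps)
  moreover have "0 \<le> (\<Sum>b<n. (cmod (s b))\<^sup>2) / T" using \<open>T > 0\<close> by (simp add: sum_nonneg)
  ultimately show ?thesis by blast
qed

lemma order_linear_factor: "Polynomial.order a [:- b, 1:] = (if a = b then 1 else 0)" for a b :: complex
proof (cases "a = b")
  case True
  thus ?thesis using order_power_n_n[of a 1] by simp
next
  case False
  thus ?thesis by (simp add: order_0I)
qed

lemma order_linear_factors:
  "Polynomial.order a (\<Prod>e\<leftarrow>es. [:- e, 1:]) = length (filter (\<lambda>e. e = a) es)" for a :: complex
proof (induction es)
  case (Cons e es)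
  have "(\<Prod>e\<leftarrow>es. [:- e, 1:]) \<noteq> (0 :: complex poly)" by (auto simp: prod_list_zero_iff)
  moreover have "[:- e, 1:] \<noteq> 0" by simp
  ultimately have "[:- e, 1:] * (\<Prod>e\<leftarrow>es. [:- e, 1:]) \<noteq> 0" by (metis mult_eq_0_iff)
  from order_mult[OF this, of a] show ?case using Cons by (auto simp: order_linear_factor)
qed simp

lemma empirical_cdf_eq:
  assumes A: "A \<in> carrier_mat N N" and c: "char_poly A = (\<Prod>a\<leftarrow>map (\<lambda>i. complex_of_real (e i)) [0..<N]. [:- a, 1:])"
  shows "empirical_cdf A x = real (card {i. i < N \<and> e i \<le> x}) / real N"
proof -
  let ?es = "map (\<lambda>i. complex_of_real (e i)) [0..<N]"
  have ord: "Polynomial.order a (char_poly A) = card {i. i < N \<and> complex_of_real (e i) = a}" for a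
  proof -
    have "length (filter (\<lambda>e. e = a) ?es) = length (filter (\<lambda>i. complex_of_real (e i) = a) [0..<N])" by (simp add: filter_map comp_def)
    also have "\<dots> = card (set (filter (\<lambda>i. complex_of_real (e i) = a) [0..<N]))" by (rule distinct_card[symmetric]) simp
    also have "set (filter (\<lambda>i. complex_of_real (e i) = a) [0..<N]) = {i. i < N \<and> complex_of_real (e i) = a}" by auto
    finally show ?thesis unfolding c order_linear_factors .
  qed
  have ev: "eigenvalue A a \<longleftrightarrow> a \<in> (\<lambda>i. complex_of_real (e i)) ` {..<N}" for a
    unfolding eigenvalue_root_char_poly[OF A] c by (auto simp: poly_prod_list prod_list_zero_iff comp_def)
  have set_eq: "{a. eigenvalue A a \<and> Re a \<le> x} = (\<lambda>i. complex_of_real (e i)) ` {i. i < N \<and> e i \<le> x}"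
    unfolding ev by auto
  have "(\<Sum>a | eigenvalue A a \<and> Re a \<le> x. Polynomial.order a (char_poly A))
      = (\<Sum>a\<in>(\<lambda>i. complex_of_real (e i)) ` {i. i < N \<and> e i \<le> x}. \<Sum>i | i \<in> {i. i < N \<and> e i \<le> x} \<and> complex_of_real (e i) = a. 1)"
    unfolding set_eq
  proof (intro sum.cong refl)
    fix a assume "a \<in> (\<lambda>i. complex_of_real (e i)) ` {i. i < N \<and> e i \<le> x}"
    hence "{i. i < N \<and> complex_of_real (e i) = a} = {i. i \<in> {i. i < N \<and> e i \<le> x} \<and> complex_of_real (e i) = a}" by auto
    thus "Polynomial.order a (char_poly A) = (\<Sum>i | i \<in> {i. i < N \<and> e i \<le> x} \<and> complex_of_real (e i) = a. 1)"
      unfolding ord by simp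
  qed
  also have "\<dots> = (\<Sum>i | i < N \<and> e i \<le> x. 1)" by (rule sum.image_gen[symmetric]) simp
  also have "\<dots> = card {i. i < N \<and> e i \<le> x}" by simp
  finally show ?thesis unfolding empirical_cdf_def using A by simp
qed

text \<open>The law is uniform on the list of eigenvalues. Its transform depends only on the characteristic
  polynomial, so it may be computed from any matrix \<open>A\<close> that shares it; the bound for the tail is
  Markov's inequality for the trace.\<close>

lemma gram_spectral_measure:
  assumes Z: "Z \<in> carrier_mat N n" and N: "N > 0"
  obtains \<nu> where "real_distribution \<nu>" "cdf \<nu> = empirical_cdf (Z * mat_adjoint Z)"
    "\<And>a. a > 0 \<Longrightarrow> measure \<nu> {x. a < \<bar>x\<bar>} \<le> ((\<Sum>i<N. \<Sum>j<n. (cmod (Z $$ (i, j)))\<^sup>2) / real N) / a"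
    "\<And>A R z. A \<in> carrier_mat N N \<Longrightarrow> char_poly A = char_poly (Z * mat_adjoint Z) \<Longrightarrow> R \<in> carrier_mat N N \<Longrightarrow>
       (A - z \<cdot>\<^sub>m 1\<^sub>m N) * R = 1\<^sub>m N \<Longrightarrow> stieltjes_transform \<nu> z = mtrace R / of_nat N"
proof -
  have cZ: "mat_adjoint Z \<in> carrier_mat n N" by (rule mat_adjoint_carrier[OF Z])
  define G where "G = Z * mat_adjoint Z"
  have G: "G \<in> carrier_mat N N" unfolding G_def using Z cZ by simp
  obtain es where es: "char_poly G = (\<Prod>a\<leftarrow>es. [:- a, 1:])" "length es = N" using char_poly_factorized[OF G] by blast
  have "\<exists>r\<ge>0. es ! i = complex_of_real r" if "i < N" for i
  proof -
    have "es ! i \<in> set es" using that es by simp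
    hence "poly (char_poly G) (es ! i) = 0" unfolding es by (auto simp: poly_prod_list prod_list_zero_iff)
    hence "eigenvalue G (es ! i)" using eigenvalue_root_char_poly[OF G] by blast
    thus ?thesis using gram_eigenvalue_nonneg[OF Z] unfolding G_def by blast
  qed
  then obtain e where e: "\<And>i. i < N \<Longrightarrow> 0 \<le> e i" "\<And>i. i < N \<Longrightarrow> es ! i = complex_of_real (e i)" by metis
  have es_map: "es = map (\<lambda>i. complex_of_real (e i)) [0..<N]"
    using es(2) e(2) by (intro nth_equalityI) auto
  define p where "p = pmf_of_set {..<N}"
  have ne: "{..<N} \<noteq> {}" using N by auto
  define \<nu> where "\<nu> = distr (measure_pmf p) borel e"
  have rd: "real_distribution \<nu>" unfolding \<nu>_def
    by (intro prob_space.real_distribution_distr) (auto intro: prob_space_measure_pmf)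
  have meas: "measure \<nu> B = real (card {i. i < N \<and> e i \<in> B}) / real N" if "B \<in> sets borel" for B
  proof -
    have "measure \<nu> B = measure (measure_pmf p) (e -` B)" unfolding \<nu>_def using that by (subst measure_distr) auto
    also have "\<dots> = real (card ({..<N} \<inter> e -` B)) / real (card {..<N})" unfolding p_def by (rule measure_pmf_of_set[OF ne]) simp
    also have "{..<N} \<inter> e -` B = {i. i < N \<and> e i \<in> B}" by auto
    finally show ?thesis by simp
  qed
  have c1: "cdf \<nu> = empirical_cdf (Z * mat_adjoint Z)"
  proof
    fix x
    show "cdf \<nu> x = empirical_cdf (Z * mat_adjoint Z) x"
      unfolding cdf_def using meas[of "{..x}"] empirical_cdf_eq[OF G, of e x] es(1) es_map unfolding G_def by simp
  qed
  have tr: "(\<Sum>i<N. e i) = (\<Sum>i<N. \<Sum>j<n. (cmod (Z $$ (i, j)))\<^sup>2)"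
  proof -
    have "complex_of_real (\<Sum>i<N. e i) = sum_list es"
      unfolding es_map by (simp add: sum_list_distinct_conv_sum_set lessThan_atLeast0 atLeast_upt[symmetric])
    also have "\<dots> = mtrace G" using mtrace_char_poly(1)[OF G es(1)] by simp
    also have "\<dots> = (\<Sum>i<N. \<Sum>j<n. Z $$ (i, j) * cnj (Z $$ (i, j)))"
      unfolding mtrace_def carrier_matD(1)[OF G] by (simp add: G_def gram_index[OF Z])
    also have "\<dots> = complex_of_real (\<Sum>i<N. \<Sum>j<n. (cmod (Z $$ (i, j)))\<^sup>2)"
      unfolding of_real_sum by (intro sum.cong refl) (simp add: complex_norm_square del: of_real_power)
    finally show ?thesis using of_real_eq_iff by blast
  qed
  have c2: "measure \<nu> {x. a < \<bar>x\<bar>} \<le> ((\<Sum>i<N. \<Sum>j<n. (cmod (Z $$ (i, j)))\<^sup>2) / real N) / a" if a: "a > 0" for a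
  proof -
    have "{x. a < \<bar>x\<bar>} = {x \<in> space borel. a < \<bar>x :: real\<bar>}" by simp
    also have "\<dots> \<in> sets borel" by measurable
    finally have B: "{x. a < \<bar>x\<bar>} \<in> sets borel" .
    have "real (card {i. i < N \<and> e i \<in> {x. a < \<bar>x\<bar>}}) * a = (\<Sum>i | i < N \<and> a < \<bar>e i\<bar>. a)" by simp
    also have "\<dots> \<le> (\<Sum>i | i < N \<and> a < \<bar>e i\<bar>. e i)" by (intro sum_mono) (use e(1) in force)
    also have "\<dots> \<le> (\<Sum>i<N. e i)" using e(1) by (intro sum_mono2) auto
    finally have "real (card {i. i < N \<and> e i \<in> {x. a < \<bar>x\<bar>}}) \<le> (\<Sum>i<N. e i) / a" using a by (simp add: pos_le_divide_eq)
    hence "real (card {i. i < N \<and> e i \<in> {x. a < \<bar>x\<bar>}}) / real N \<le> ((\<Sum>i<N. e i) / a) / real N" by (rule divide_right_mono) simp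
    thus ?thesis unfolding meas[OF B] tr by (simp add: mult.commute)
  qed
  have c3: "stieltjes_transform \<nu> z = mtrace R / of_nat N"
    if A: "A \<in> carrier_mat N N" and ch: "char_poly A = char_poly (Z * mat_adjoint Z)" and R: "R \<in> carrier_mat N N"
      and AR: "(A - z \<cdot>\<^sub>m 1\<^sub>m N) * R = 1\<^sub>m N" for A R z
  proof -
    have "mtrace R = (\<Sum>e\<leftarrow>es. 1 / (e - z))"
      by (rule mtrace_char_poly(2)[OF A _ R AR]) (use ch es(1) G_def in simp)
    also have "\<dots> = (\<Sum>i<N. 1 / (complex_of_real (e i) - z))"
      unfolding es_map by (simp add: comp_def sum_list_distinct_conv_sum_set lessThan_atLeast0 atLeast_upt[symmetric])
    finally have R': "mtrace R = (\<Sum>i<N. 1 / (complex_of_real (e i) - z))" .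
    have "stieltjes_transform \<nu> z = (LINT i|measure_pmf p. 1 / (complex_of_real (e i) - z))"
      unfolding stieltjes_transform_def \<nu>_def by (subst integral_distr) auto
    also have "\<dots> = (\<Sum>i<N. pmf p i *\<^sub>R (1 / (complex_of_real (e i) - z)))"
      by (rule integral_measure_pmf) (auto simp: p_def set_pmf_of_set[OF ne])
    also have "\<dots> = (\<Sum>i<N. (1 / (complex_of_real (e i) - z)) / of_nat N)"
      unfolding p_def by (intro sum.cong refl) (simp add: pmf_of_set[OF ne] scaleR_conv_of_real)
    finally show ?thesis unfolding R' sum_divide_distrib .
  qed
  show thesis by (rule that[OF rd c1 c2 c3])
qed

text \<open>Hermitization: for \<open>w\<^sup>2 = z\<close> the upper left block of the resolvent at \<open>w\<close> of the
  Hermitian matrix with off-diagonal blocks \<open>Y\<close> and its adjoint is \<open>w\<close> times the resolvent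
  of \<open>Y Y\<^sup>*\<close> at \<open>z\<close>.\<close>

definition hermitization :: "nat => (nat => nat => complex) => nat => nat => complex" where
  "hermitization N Y i j = (if i < N \<and> N \<le> j then Y i (j - N) else if N \<le> i \<and> j < N then cnj (Y j (i - N)) else 0)"

lemma hermitian_hermitization: "hermitian_on m (hermitization N Y)"
  unfolding hermitian_on_def hermitization_def by auto

lemma hermitization_resolvent:
  assumes W: "W \<in> carrier_mat N n" and w: "Im w > 0"
  defines "G \<equiv> resolvent (N + n) (hermitization N (\<lambda>i j. W $$ (i, j))) w"
  shows "(W * mat_adjoint W - w\<^sup>2 \<cdot>\<^sub>m 1\<^sub>m N) * Matrix.mat N N (\<lambda>(i, j). G i j / w) = 1\<^sub>m N"
proof -
  have cW: "mat_adjoint W \<in> carrier_mat n N" by (rule mat_adjoint_carrier[OF W])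
  let ?H = "hermitization N (\<lambda>i j. W $$ (i, j))"
  note rr = resolvent_right[OF hermitian_hermitization[of "N + n" N "\<lambda>i j. W $$ (i, j)"] w, folded G_def]
  have w0: "w \<noteq> 0" using w by auto
  have up: "(\<Sum>b<n. W $$ (i, b) * G (N + b) j) = (if i = j then 1 else 0) + w * G i j" if "i < N" "j < N" for i j
    using rr[of i j] that unfolding sum_lessThan_add by (simp add: hermitization_def)
  have lo: "(\<Sum>k<N. cnj (W $$ (k, b)) * G k j) = w * G (N + b) j" if "b < n" "j < N" for b j
    using rr[of "N + b" j] that unfolding sum_lessThan_add by (simp add: hermitization_def)
  show ?thesis
  proof (rule eq_matI)
    fix i j assume "i < dim_row (1\<^sub>m N :: complex mat)" "j < dim_col (1\<^sub>m N :: complex mat)"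
    hence ij: "i < N" "j < N" by auto
    have "((W * mat_adjoint W - w\<^sup>2 \<cdot>\<^sub>m 1\<^sub>m N) * Matrix.mat N N (\<lambda>(i, j). G i j / w)) $$ (i, j)
      = (\<Sum>k<N. ((\<Sum>b<n. W $$ (i, b) * cnj (W $$ (k, b))) - w\<^sup>2 * (if i = k then 1 else 0)) * (G k j / w))"
    proof -
      define X where "X = W * mat_adjoint W - w\<^sup>2 \<cdot>\<^sub>m 1\<^sub>m N"
      have cG: "W * mat_adjoint W \<in> carrier_mat N N" using W cW by auto
      have X: "X \<in> carrier_mat N N" unfolding X_def using cG by auto
      have ent: "X $$ (i, k) = (\<Sum>b<n. W $$ (i, b) * cnj (W $$ (k, b))) - w\<^sup>2 * (if i = k then 1 else 0)" if "k < N" for k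
        using gram_index[OF W ij(1) that] ij that cG unfolding X_def by (simp del: index_mult_mat(1))
      have "(X * Matrix.mat N N (\<lambda>(i, j). G i j / w)) $$ (i, j) = (\<Sum>k<N. X $$ (i, k) * (G k j / w))"
        using X ij by (simp add: scalar_prod_def lessThan_atLeast0)
      also have "\<dots> = (\<Sum>k<N. ((\<Sum>b<n. W $$ (i, b) * cnj (W $$ (k, b))) - w\<^sup>2 * (if i = k then 1 else 0)) * (G k j / w))"
        by (intro sum.cong refl) (simp add: ent)
      finally show ?thesis unfolding X_def .
    qed
    also have "\<dots> = (\<Sum>k<N. \<Sum>b<n. W $$ (i, b) * (cnj (W $$ (k, b)) * G k j) / w) - (\<Sum>k<N. if i = k then w * G k j else 0)"
      unfolding sum_subtractf[symmetric]
    proof (intro sum.cong refl)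
      fix k
      have "(\<Sum>b<n. W $$ (i, b) * cnj (W $$ (k, b))) * (G k j / w) = (\<Sum>b<n. W $$ (i, b) * (cnj (W $$ (k, b)) * G k j) / w)"
        unfolding sum_distrib_right by (intro sum.cong refl) simp
      moreover have "w\<^sup>2 * (if i = k then 1 else 0) * (G k j / w) = (if i = k then w * G k j else 0)"
        using w0 by (simp add: power2_eq_square)
      ultimately show "((\<Sum>b<n. W $$ (i, b) * cnj (W $$ (k, b))) - w\<^sup>2 * (if i = k then 1 else 0)) * (G k j / w)
         = (\<Sum>b<n. W $$ (i, b) * (cnj (W $$ (k, b)) * G k j) / w) - (if i = k then w * G k j else 0)"
        by (simp only: left_diff_distrib)
    qed
    also have "(\<Sum>k<N. \<Sum>b<n. W $$ (i, b) * (cnj (W $$ (k, b)) * G k j) / w) = (\<Sum>b<n. W $$ (i, b) * (\<Sum>k<N. cnj (W $$ (k, b)) * G k j) / w)"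
      by (subst sum.swap) (simp add: sum_distrib_left sum_divide_distrib)
    also have "\<dots> = (\<Sum>b<n. W $$ (i, b) * G (N + b) j)" using ij w0 by (intro sum.cong refl) (simp add: lo)
    also have "\<dots> - (\<Sum>k<N. if i = k then w * G k j else 0) = (if i = j then 1 else 0)" using ij up[OF ij] by simp
    finally show "((W * mat_adjoint W - w\<^sup>2 \<cdot>\<^sub>m 1\<^sub>m N) * Matrix.mat N N (\<lambda>(i, j). G i j / w)) $$ (i, j) = 1\<^sub>m N $$ (i, j)"
      using ij by simp
  qed (use W cW in auto)
qed

section \<open>Gaussian integration by parts\<close>

text \<open>The law of the real part, and of the imaginary part, of a standard complex normal variable.\<close>

definition half_normal :: "real measure" where
  "half_normal = density lborel (normal_density 0 (1 / sqrt 2))"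

lemma prob_half_normal: "prob_space half_normal"
  unfolding half_normal_def by (rule prob_space_normal_density) simp

lemma sets_half_normal [measurable_cong, simp]: "sets half_normal = sets borel"
  unfolding half_normal_def by simp

lemma half_normal_density: "normal_density 0 (1 / sqrt 2) x = exp (- x\<^sup>2) / sqrt pi"
  unfolding normal_density_def by (simp add: power_divide field_simps)

lemma integrable_half_normal_id: "integrable half_normal (\<lambda>x. x)"
  and integrable_half_normal_power2: "integrable half_normal (\<lambda>x. x\<^sup>2)"
  and integral_half_normal_power2: "(LINT x|half_normal. x\<^sup>2) = 1/2"
proof -
  have "has_bochner_integral lborel (\<lambda>x. normal_density 0 (1 / sqrt 2) x * (x - 0) ^ (2 * 0 + 1)) 0"
    by (rule normal_moment_odd) simp
  thus "integrable half_normal (\<lambda>x. x)"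
    unfolding half_normal_def by (subst integrable_density) (auto simp: has_bochner_integral_iff)
  have "has_bochner_integral lborel (\<lambda>x. normal_density 0 (1 / sqrt 2) x * (x - 0) ^ (2 * 1)) (fact (2 * 1) / ((2 / (1 / sqrt 2)\<^sup>2)^1 * fact 1))"
    by (rule normal_moment_even) simp
  hence *: "has_bochner_integral lborel (\<lambda>x. normal_density 0 (1 / sqrt 2) x * x\<^sup>2) (1/2)"
    by (simp add: power_divide)
  thus "integrable half_normal (\<lambda>x. x\<^sup>2)"
    unfolding half_normal_def by (subst integrable_density) (auto simp: has_bochner_integral_iff)
  show "(LINT x|half_normal. x\<^sup>2) = 1/2"
    unfolding half_normal_def using * by (subst integral_density) (auto simp: has_bochner_integral_iff)
qed

text \<open>Integration by parts, since the density \<open>\<phi>\<close> satisfies \<open>\<phi>' x = - 2 * x * \<phi> x\<close>.\<close>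

lemma real_normal_stein:
  fixes f f' :: "real => complex"
  assumes d: "\<And>x. (f has_vector_derivative f' x) (at x)" and c: "\<And>x. isCont f' x"
    and b: "\<And>x. cmod (f x) \<le> B" "\<And>x. cmod (f' x) \<le> B"
  shows "(LINT x|half_normal. of_real x * f x) = (LINT x|half_normal. f' x) / 2"
proof -
  define \<phi> where "\<phi> x = normal_density 0 (1 / sqrt 2) x" for x
  have \<phi>: "\<phi> x = exp (- x\<^sup>2) / sqrt pi" for x unfolding \<phi>_def by (rule half_normal_density)
  have \<phi>0: "0 \<le> \<phi> x" for x unfolding \<phi>_def by simp
  have B0: "0 \<le> B" using b(1)[of 0] norm_ge_zero order_trans by blast
  have cf: "isCont f x" for x using has_vector_derivative_continuous[OF d] .
  have [measurable]: "f \<in> borel_measurable borel" "f' \<in> borel_measurable borel"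
    using cf c by (auto intro!: borel_measurable_continuous_onI continuous_at_imp_continuous_on)
  interpret N: prob_space half_normal by (rule prob_half_normal)
  have i1: "integrable half_normal (\<lambda>x. f' x)"
    by (rule N.integrable_const_bound[where B=B]) (use b in auto)
  have i2: "integrable half_normal (\<lambda>x. of_real x * f x)"
  proof (rule Bochner_Integration.integrable_bound[of _ "\<lambda>x. B * x"])
    show "integrable half_normal (\<lambda>x. B * x)" using integrable_half_normal_id by simp
    show "AE x in half_normal. cmod (of_real x * f x) \<le> norm (B * x)"
      using b(1) B0 by (auto simp: norm_mult abs_mult mult.commute[of B] intro!: mult_left_mono)
  qed auto
  have int: "integrable lborel (\<lambda>x. \<phi> x *\<^sub>R g x)" and eq: "(LINT x|half_normal. g x) = (LINT x|lborel. \<phi> x *\<^sub>R g x)"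
    if "integrable half_normal g" "g \<in> borel_measurable borel" for g :: "real => complex"
    using that unfolding half_normal_def \<phi>_def by (simp_all add: integrable_density integral_density)
  define g where "g x = \<phi> x *\<^sub>R f' x - 2 *\<^sub>R (\<phi> x *\<^sub>R (of_real x * f x))" for x
  have dg: "((\<lambda>x. \<phi> x *\<^sub>R f x) has_vector_derivative g x) (at x)" for x
  proof -
    have "(\<phi> has_real_derivative \<phi> x * (- 2 * x)) (at x)"
      unfolding \<phi>[abs_def] divide_inverse by (auto intro!: derivative_eq_intros simp: power2_eq_square)
    hence "((\<lambda>x. \<phi> x *\<^sub>R f x) has_vector_derivative (\<phi> x *\<^sub>R f' x + (\<phi> x * (- 2 * x)) *\<^sub>R f x)) (at x)"
      by (intro has_vector_derivative_scaleR d)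
    moreover have "\<phi> x *\<^sub>R f' x + (\<phi> x * (- 2 * x)) *\<^sub>R f x = g x"
      unfolding g_def by (simp add: scaleR_conv_of_real algebra_simps)
    ultimately show ?thesis by simp
  qed
  have gi: "integrable lborel g" unfolding g_def
    by (intro Bochner_Integration.integrable_diff integrable_scaleR_right int i1 i2) measurable
  have c\<phi>: "isCont \<phi> x" for x unfolding \<phi>[abs_def] by (intro continuous_intros) auto
  have lim: "((\<lambda>x. \<phi> x *\<^sub>R f x) \<longlongrightarrow> 0) F" if "F = at_top \<or> F = at_bot" for F
  proof (rule Lim_null_comparison)
    show "eventually (\<lambda>x. norm (\<phi> x *\<^sub>R f x) \<le> \<phi> x * B) F"
      using b(1) \<phi>0 by (auto simp: mult_left_mono intro!: always_eventually)
    have "(\<phi> \<longlongrightarrow> 0) at_top" "(\<phi> \<longlongrightarrow> 0) at_bot" unfolding \<phi>[abs_def] by real_asymp+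
    hence "(\<phi> \<longlongrightarrow> 0) F" using that by auto
    from tendsto_mult_right[OF this, of B] show "((\<lambda>x. \<phi> x * B) \<longlongrightarrow> 0) F" by simp
  qed
  have "(LBINT x=-\<infinity>..\<infinity>. g x) = 0 - 0"
  proof (rule interval_integral_FTC_integrable[where F="\<lambda>x. \<phi> x *\<^sub>R f x"])
    show "isCont g x" for x unfolding g_def by (intro continuous_intros c\<phi> c cf)
    show "set_integrable lborel (einterval (- \<infinity>) \<infinity>) g" using gi by (simp add: set_integrable_def einterval_def)
    show "(((\<lambda>x. \<phi> x *\<^sub>R f x) \<circ> real_of_ereal) \<longlongrightarrow> 0) (at_right (- \<infinity>))" unfolding ereal_tendsto_simps1 using lim by blast
    show "(((\<lambda>x. \<phi> x *\<^sub>R f x) \<circ> real_of_ereal) \<longlongrightarrow> 0) (at_left \<infinity>)" unfolding ereal_tendsto_simps1 using lim by blast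
  qed (use dg in auto)
  hence "(LINT x|lborel. g x) = 0" by (simp add: interval_lebesgue_integral_def set_lebesgue_integral_def einterval_def)
  moreover have "(LINT x|lborel. g x) = (LINT x|half_normal. f' x) - 2 *\<^sub>R (LINT x|half_normal. of_real x * f x)"
  proof -
    have j1: "integrable lborel (\<lambda>x. \<phi> x *\<^sub>R f' x)" by (rule int[OF i1]) measurable
    have j2: "integrable lborel (\<lambda>x. \<phi> x *\<^sub>R (of_real x * f x))" by (rule int[OF i2]) measurable
    have e1: "(LINT x|half_normal. f' x) = (LINT x|lborel. \<phi> x *\<^sub>R f' x)" by (rule eq[OF i1]) measurable
    have e2: "(LINT x|half_normal. of_real x * f x) = (LINT x|lborel. \<phi> x *\<^sub>R (of_real x * f x))" by (rule eq[OF i2]) measurable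
    have "(LINT x|lborel. g x) = (LINT x|lborel. \<phi> x *\<^sub>R f' x) - (LINT x|lborel. 2 *\<^sub>R (\<phi> x *\<^sub>R (of_real x * f x)))"
      unfolding g_def by (rule Bochner_Integration.integral_diff[OF j1 integrable_scaleR_right]) (rule j2)
    also have "(LINT x|lborel. 2 *\<^sub>R (\<phi> x *\<^sub>R (of_real x * f x))) = 2 *\<^sub>R (LINT x|lborel. \<phi> x *\<^sub>R (of_real x * f x))"
      by (rule integral_scaleR_right)
    finally show ?thesis unfolding e1 e2 .
  qed
  ultimately show ?thesis by (simp add: scaleR_conv_of_real field_simps)
qed

abbreviation CN :: "complex measure" where "CN \<equiv> std_complex_normal"

lemma std_complex_normal_half: "CN = distr (half_normal \<Otimes>\<^sub>M half_normal) borel (\<lambda>(a, b). Complex a b)"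
  unfolding std_complex_normal_def half_normal_def ..

lemma measurable_Complex [measurable]: "(\<lambda>(a, b). Complex a b) \<in> borel \<Otimes>\<^sub>M borel \<rightarrow>\<^sub>M borel"
proof -
  have "(\<lambda>(a, b). Complex a b) = (\<lambda>p. complex_of_real (fst p) + \<i> * complex_of_real (snd p))"
    by (auto simp: complex_eq_iff)
  thus ?thesis by simp
qed

lemma measurable_Complex' [measurable]: "(\<lambda>p. Complex (fst p) (snd p)) \<in> half_normal \<Otimes>\<^sub>M half_normal \<rightarrow>\<^sub>M borel"
proof -
  have "(\<lambda>p. Complex (fst p) (snd p)) = (\<lambda>p. complex_of_real (fst p) + \<i> * complex_of_real (snd p))"
    by (auto simp: complex_eq_iff)
  thus ?thesis by simp
qed

lemma prob_std_complex_normal: "prob_space CN"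
proof -
  interpret N: prob_space half_normal by (rule prob_half_normal)
  interpret NN: pair_prob_space half_normal half_normal ..
  show ?thesis unfolding std_complex_normal_half case_prod_beta'
    by (rule NN.prob_space_distr) measurable
qed

lemma sets_std_complex_normal [measurable_cong, simp]: "sets CN = sets borel"
  unfolding std_complex_normal_def by simp

lemma space_std_complex_normal [simp]: "space CN = UNIV"
  unfolding std_complex_normal_def by simp

lemma integrable_pair_fst_snd:
  fixes f :: "real => 'b::{banach, second_countable_topology}"
  assumes "integrable half_normal f"
  shows "integrable (half_normal \<Otimes>\<^sub>M half_normal) (\<lambda>p. f (fst p))" "(LINT p|(half_normal \<Otimes>\<^sub>M half_normal). f (fst p)) = (LINT x|half_normal. f x)"
    "integrable (half_normal \<Otimes>\<^sub>M half_normal) (\<lambda>p. f (snd p))" "(LINT p|(half_normal \<Otimes>\<^sub>M half_normal). f (snd p)) = (LINT x|half_normal. f x)"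
proof -
  interpret N: prob_space half_normal by (rule prob_half_normal)
  interpret NN: pair_prob_space half_normal half_normal ..
  have 1: "distr (half_normal \<Otimes>\<^sub>M half_normal) half_normal fst = half_normal" by (rule N.distr_pair_fst)
  have 2: "distr (half_normal \<Otimes>\<^sub>M half_normal) half_normal snd = half_normal"
  proof (rule measure_eqI)
    fix A assume "A \<in> sets (distr (half_normal \<Otimes>\<^sub>M half_normal) half_normal snd)"
    hence A: "A \<in> sets half_normal" by simp
    have "snd -` A \<inter> space (half_normal \<Otimes>\<^sub>M half_normal) = space half_normal \<times> A"
      using sets.sets_into_space[OF A] by (auto simp: space_pair_measure)
    thus "emeasure (distr (half_normal \<Otimes>\<^sub>M half_normal) half_normal snd) A = emeasure half_normal A"
      using A N.emeasure_pair_measure_Times[OF sets.top[of half_normal] A] N.emeasure_space_1 by (simp add: emeasure_distr)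
  qed simp
  have [measurable]: "f \<in> borel_measurable half_normal" using assms by auto
  show "integrable (half_normal \<Otimes>\<^sub>M half_normal) (\<lambda>p. f (fst p))"
    using integrable_distr_eq[of fst "half_normal \<Otimes>\<^sub>M half_normal" half_normal f] assms 1 by simp
  show "integrable (half_normal \<Otimes>\<^sub>M half_normal) (\<lambda>p. f (snd p))"
    using integrable_distr_eq[of snd "half_normal \<Otimes>\<^sub>M half_normal" half_normal f] assms 2 by simp
  show "(LINT p|(half_normal \<Otimes>\<^sub>M half_normal). f (fst p)) = (LINT x|half_normal. f x)"
    using integral_distr[of fst "half_normal \<Otimes>\<^sub>M half_normal" half_normal f] 1 by simp
  show "(LINT p|(half_normal \<Otimes>\<^sub>M half_normal). f (snd p)) = (LINT x|half_normal. f x)"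
    using integral_distr[of snd "half_normal \<Otimes>\<^sub>M half_normal" half_normal f] 2 by simp
qed

lemma std_complex_normal_integral:
  fixes f :: "complex => 'b::{banach, second_countable_topology}"
  assumes [measurable]: "f \<in> borel_measurable borel"
  shows "(LINT y|CN. f y) = (LINT p|(half_normal \<Otimes>\<^sub>M half_normal). f (Complex (fst p) (snd p)))"
    and "integrable CN f \<longleftrightarrow> integrable (half_normal \<Otimes>\<^sub>M half_normal) (\<lambda>p. f (Complex (fst p) (snd p)))"
  unfolding std_complex_normal_half case_prod_beta' by (subst integral_distr integrable_distr_eq, measurable)+

lemma std_complex_normal_moment2:
  "integrable CN (\<lambda>y. (cmod y)\<^sup>2)" "(LINT y|CN. (cmod y)\<^sup>2) = 1"
  using integrable_pair_fst_snd[OF integrable_half_normal_power2]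
  by (subst std_complex_normal_integral, measurable, simp add: cmod_power2 integral_half_normal_power2)+

lemma std_complex_normal_integrable_norm: "integrable CN (\<lambda>y. cmod y)"
proof -
  interpret prob_space CN by (rule prob_std_complex_normal)
  show ?thesis
  proof (rule Bochner_Integration.integrable_bound[of _ "\<lambda>y. 1 + (cmod y)\<^sup>2"])
    show "integrable CN (\<lambda>y. 1 + (cmod y)\<^sup>2)" using std_complex_normal_moment2(1) by simp
    have "t \<le> 1 + t\<^sup>2" if "t \<ge> 0" for t :: real
      using zero_le_power2[of "t - 1"] that by (simp add: power2_eq_square algebra_simps) 
    thus "AE x in CN. norm (cmod x) \<le> norm (1 + (cmod x)\<^sup>2)" by (auto intro!: AE_I2)
  qed measurable
qed

text \<open>In terms of Wirtinger derivatives, integration against \<open>y\<close> differentiates in the conjugate variable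
  and integration against the conjugate of \<open>y\<close> differentiates in \<open>y\<close>.\<close>

lemma complex_normal_stein:
  fixes F D1 D2 :: "complex => complex"
  assumes m [measurable]: "F \<in> borel_measurable borel" "D1 \<in> borel_measurable borel" "D2 \<in> borel_measurable borel"
    and b: "\<And>y. cmod (F y) \<le> B" "\<And>y. cmod (D1 y) \<le> B" "\<And>y. cmod (D2 y) \<le> B"
    and d1: "\<And>a b. ((\<lambda>a. F (Complex a b)) has_vector_derivative D1 (Complex a b)) (at a)" "\<And>a b. isCont (\<lambda>a. D1 (Complex a b)) a"
    and d2: "\<And>a b. ((\<lambda>b. F (Complex a b)) has_vector_derivative D2 (Complex a b)) (at b)" "\<And>a b. isCont (\<lambda>b. D2 (Complex a b)) b"
  shows "(LINT y|CN. y * F y) = (LINT y|CN. (D1 y + \<i> * D2 y) / 2)"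
    and "(LINT y|CN. cnj y * F y) = (LINT y|CN. (D1 y - \<i> * D2 y) / 2)"
proof -
  interpret prob_space CN by (rule prob_std_complex_normal)
  have aux: "(LINT y|CN. of_real (Re y) * F y) = (LINT y|CN. D1 y) / 2"
    "(LINT y|CN. of_real (Im y) * F y) = (LINT y|CN. D2 y) / 2"
  proof -
    interpret N: prob_space half_normal by (rule prob_half_normal)
    interpret NN: pair_prob_space half_normal half_normal ..
    let ?NN = "half_normal \<Otimes>\<^sub>M half_normal"
    have B0: "0 \<le> B" using b(1)[of 0] norm_ge_zero order_trans by blast
    have int: "integrable ?NN (\<lambda>p. of_real (s p) * F (Complex (fst p) (snd p)))" if "integrable ?NN (s :: _ => real)" for s
    proof (rule Bochner_Integration.integrable_bound[of _ "\<lambda>p. B * s p"])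
      have [measurable]: "s \<in> borel_measurable ?NN" using that by auto
      show "integrable ?NN (\<lambda>p. B * s p)" using that by simp
      show "(\<lambda>p. of_real (s p) * F (Complex (fst p) (snd p))) \<in> borel_measurable ?NN" by measurable
      show "AE p in ?NN. cmod (of_real (s p) * F (Complex (fst p) (snd p))) \<le> norm (B * s p)"
        using b(1) B0 by (auto simp: norm_mult abs_mult mult.commute[of B] intro!: mult_left_mono AE_I2)
    qed
    have intD: "integrable ?NN (\<lambda>p. D (Complex (fst p) (snd p)))" if [measurable]: "D \<in> borel_measurable borel" and "\<And>y. cmod (D y) \<le> B" for D
      by (rule NN.P.integrable_const_bound[where B=B]) (use that in auto)
    have "(LINT y|CN. of_real (Re y) * F y) = (LINT p|?NN. of_real (fst p) * F (Complex (fst p) (snd p)))"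
      by (subst std_complex_normal_integral(1)) auto
    also have "\<dots> = (LINT y|half_normal. LINT x|half_normal. of_real x * F (Complex x y))"
      using NN.integral_snd[of "\<lambda>x y. of_real x * F (Complex x y)"] int[OF integrable_pair_fst_snd(1)[OF integrable_half_normal_id]]
      by (simp add: case_prod_beta')
    also have "\<dots> = (LINT y|half_normal. (LINT x|half_normal. D1 (Complex x y)) / 2)"
      by (intro Bochner_Integration.integral_cong refl real_normal_stein[where B=B] d1 b)
    also have "\<dots> = (LINT y|half_normal. LINT x|half_normal. D1 (Complex x y)) / 2" by simp
    also have "(LINT y|half_normal. LINT x|half_normal. D1 (Complex x y)) = (LINT p|?NN. D1 (Complex (fst p) (snd p)))"
      using NN.integral_snd[of "\<lambda>x y. D1 (Complex x y)"] intD[OF m(2) b(2)] by (simp add: case_prod_beta')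
    also have "\<dots> = (LINT y|CN. D1 y)" by (subst std_complex_normal_integral(1)) auto
    finally show "(LINT y|CN. of_real (Re y) * F y) = (LINT y|CN. D1 y) / 2" .
    have "(LINT y|CN. of_real (Im y) * F y) = (LINT p|?NN. of_real (snd p) * F (Complex (fst p) (snd p)))"
      by (subst std_complex_normal_integral(1)) auto
    also have "\<dots> = (LINT x|half_normal. LINT y|half_normal. of_real y * F (Complex x y))"
      using NN.integral_fst[of "\<lambda>x y. of_real y * F (Complex x y)"] int[OF integrable_pair_fst_snd(3)[OF integrable_half_normal_id]]
      by (simp add: case_prod_beta')
    also have "\<dots> = (LINT x|half_normal. (LINT y|half_normal. D2 (Complex x y)) / 2)"
      by (intro Bochner_Integration.integral_cong refl real_normal_stein[where B=B] d2 b)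
    also have "\<dots> = (LINT x|half_normal. LINT y|half_normal. D2 (Complex x y)) / 2" by simp
    also have "(LINT x|half_normal. LINT y|half_normal. D2 (Complex x y)) = (LINT p|?NN. D2 (Complex (fst p) (snd p)))"
      using NN.integral_fst[of "\<lambda>x y. D2 (Complex x y)"] intD[OF m(3) b(3)] by (simp add: case_prod_beta')
    also have "\<dots> = (LINT y|CN. D2 y)" by (subst std_complex_normal_integral(1)) auto
    finally show "(LINT y|CN. of_real (Im y) * F y) = (LINT y|CN. D2 y) / 2" .
  qed
  have iD: "integrable CN D1" "integrable CN D2"
    by (rule integrable_const_bound[where B=B]; use b in auto)+
  have B0: "0 \<le> B" using b(1)[of 0] norm_ge_zero order_trans by blast
  have iF: "integrable CN (\<lambda>y. of_real (s y) * F y)" if [measurable]: "s \<in> borel_measurable borel" and s: "\<And>y. \<bar>s y\<bar> \<le> cmod y" for s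
  proof (rule Bochner_Integration.integrable_bound[of _ "\<lambda>y. cmod y * B"])
    show "integrable CN (\<lambda>y. cmod y * B)" using std_complex_normal_integrable_norm by simp
    show "AE y in CN. cmod (of_real (s y) * F y) \<le> norm (cmod y * B)"
      using b(1) B0 s by (auto simp: norm_mult abs_mult intro!: mult_mono AE_I2)
  qed measurable
  have i1: "integrable CN (\<lambda>y. of_real (Re y) * F y)" by (rule iF) (auto simp: abs_Re_le_cmod)
  have i2: "integrable CN (\<lambda>y. of_real (Im y) * F y)" by (rule iF) (auto simp: abs_Im_le_cmod)
  have "(LINT y|CN. y * F y) = (LINT y|CN. of_real (Re y) * F y + \<i> * (of_real (Im y) * F y))"
    by (intro Bochner_Integration.integral_cong refl) (simp add: complex_eq_iff algebra_simps)
  also have "\<dots> = (LINT y|CN. D1 y) / 2 + \<i> * ((LINT y|CN. D2 y) / 2)"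
    using i1 i2 by (simp add: aux)
  also have "\<dots> = (LINT y|CN. (D1 y + \<i> * D2 y) / 2)" using iD by (simp add: add_divide_distrib)
  finally show "(LINT y|CN. y * F y) = (LINT y|CN. (D1 y + \<i> * D2 y) / 2)" .
  have "(LINT y|CN. cnj y * F y) = (LINT y|CN. of_real (Re y) * F y - \<i> * (of_real (Im y) * F y))"
    by (intro Bochner_Integration.integral_cong refl) (simp add: complex_eq_iff algebra_simps)
  also have "\<dots> = (LINT y|CN. D1 y) / 2 - \<i> * ((LINT y|CN. D2 y) / 2)"
    using i1 i2 by (simp add: aux)
  also have "\<dots> = (LINT y|CN. (D1 y - \<i> * D2 y) / 2)" using iD by (simp add: diff_divide_distrib)
  finally show "(LINT y|CN. cnj y * F y) = (LINT y|CN. (D1 y - \<i> * D2 y) / 2)" .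
qed

lemma borel_measurable_cnj [measurable (raw)]:
  assumes "f \<in> borel_measurable M" shows "(\<lambda>x. cnj (f x)) \<in> borel_measurable M"
  by (rule measurable_compose[OF assms]) (intro borel_measurable_continuous_onI continuous_intros)

abbreviation gauss_vec :: "'i set => ('i => complex) measure" where
  "gauss_vec R \<equiv> PiM R (\<lambda>_. CN)"

lemma prob_gauss_vec: "prob_space (gauss_vec R)"
  by (rule prob_space_PiM) (rule prob_std_complex_normal)

lemma product_sigma_finite_std_complex_normal: "product_sigma_finite (\<lambda>_. CN)"
  by (intro product_sigma_finite.intro prob_space_imp_sigma_finite prob_std_complex_normal)

lemma gauss_vec_update_measurable:
  assumes "p \<notin> I" "x \<in> space (gauss_vec I)"
  shows "(\<lambda>y. x(p := y)) \<in> borel \<rightarrow>\<^sub>M gauss_vec (insert p I)"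
proof -
  have "(\<lambda>y. x(p := y)) \<in> CN \<rightarrow>\<^sub>M gauss_vec (insert p I)"
    using assms by (intro measurable_fun_upd[where J=I]) auto
  thus ?thesis by (simp add: measurable_cong_sets[OF sets_std_complex_normal refl])
qed

lemma gauss_vec_coordinate_integrable:
  assumes "p \<in> R" shows "integrable (gauss_vec R) (\<lambda>x. cmod (x p))"
proof -
  have "distr (gauss_vec R) CN (\<lambda>x. x p) = CN"
    by (rule distr_PiM_component[OF prob_std_complex_normal assms])
  thus ?thesis using integrable_distr_eq[of "\<lambda>x. x p" "gauss_vec R" CN cmod] std_complex_normal_integrable_norm
      measurable_component_singleton[OF assms, of "\<lambda>_. CN"] by simp
qed

lemma gauss_vec_stein:
  assumes R: "finite R" "p \<in> R"
    and m: "F \<in> borel_measurable (gauss_vec R)" "D1 \<in> borel_measurable (gauss_vec R)" "D2 \<in> borel_measurable (gauss_vec R)"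
    and b: "\<And>x. cmod (F x) \<le> B" "\<And>x. cmod (D1 x) \<le> B" "\<And>x. cmod (D2 x) \<le> B"
    and d1: "\<And>x a b. ((\<lambda>a. F (x(p := Complex a b))) has_vector_derivative D1 (x(p := Complex a b))) (at a)" "\<And>x a b. isCont (\<lambda>a. D1 (x(p := Complex a b))) a"
    and d2: "\<And>x a b. ((\<lambda>b. F (x(p := Complex a b))) has_vector_derivative D2 (x(p := Complex a b))) (at b)" "\<And>x a b. isCont (\<lambda>b. D2 (x(p := Complex a b))) b"
  shows "(LINT x|gauss_vec R. x p * F x) = (LINT x|gauss_vec R. (D1 x + \<i> * D2 x) / 2)"
    and "(LINT x|gauss_vec R. cnj (x p) * F x) = (LINT x|gauss_vec R. (D1 x - \<i> * D2 x) / 2)"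
proof -
  interpret product_sigma_finite "\<lambda>_. CN" by (rule product_sigma_finite_std_complex_normal)
  interpret P: prob_space "gauss_vec R" by (rule prob_gauss_vec)
  define I where "I = R - {p}"
  have I: "finite I" "p \<notin> I" "R = insert p I" using R unfolding I_def by auto
  have B0: "0 \<le> B" using b(1) norm_ge_zero order_trans by blast
  note [measurable] = m
  have comp [measurable]: "(\<lambda>x. x p) \<in> gauss_vec R \<rightarrow>\<^sub>M borel"
    using measurable_component_singleton[OF R(2), of "\<lambda>_. CN"] by (simp add: measurable_cong_sets[OF refl sets_std_complex_normal])
  note ix = gauss_vec_coordinate_integrable[OF R(2)]
  have iF: "integrable (gauss_vec R) (\<lambda>x. s (x p) * F x)" if [measurable]: "s \<in> borel_measurable borel" and s: "\<And>y. cmod (s y) = cmod y" for s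
  proof (rule Bochner_Integration.integrable_bound[of _ "\<lambda>x. cmod (x p) * B"])
    show "integrable (gauss_vec R) (\<lambda>x. cmod (x p) * B)" using ix by simp
    show "AE x in gauss_vec R. cmod (s (x p) * F x) \<le> norm (cmod (x p) * B)"
      using b(1) B0 s by (auto simp: norm_mult abs_mult intro!: mult_left_mono AE_I2)
  qed measurable
  have iD: "integrable (gauss_vec R) (\<lambda>x. (D1 x + k * D2 x) / 2)" for k
  proof -
    have "integrable (gauss_vec R) D1" "integrable (gauss_vec R) D2" by (rule P.integrable_const_bound[where B=B]; use b in auto)+
    thus ?thesis by simp
  qed
  have sec: "(\<lambda>y. f (x(p := y))) \<in> borel_measurable borel" if "f \<in> borel_measurable (gauss_vec R)" "x \<in> space (gauss_vec I)" for f :: "_ => complex" and x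
    using measurable_compose[OF gauss_vec_update_measurable[OF I(2) that(2)], of f] that(1) unfolding I(3) .
  have "(LINT x|gauss_vec R. x p * F x) = (LINT x|gauss_vec I. LINT y|CN. y * F (x(p := y)))"
    using product_integral_insert[OF I(1,2), of "\<lambda>x. x p * F x"] iF[of "\<lambda>y. y"] unfolding I(3) by simp
  also have "\<dots> = (LINT x|gauss_vec I. LINT y|CN. (D1 (x(p := y)) + \<i> * D2 (x(p := y))) / 2)"
    by (intro Bochner_Integration.integral_cong refl complex_normal_stein(1)[where B=B] sec m b d1 d2)
  also have "\<dots> = (LINT x|gauss_vec R. (D1 x + \<i> * D2 x) / 2)"
    using product_integral_insert[OF I(1,2), of "\<lambda>x. (D1 x + \<i> * D2 x) / 2"] iD[of \<i>] unfolding I(3) by simp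
  finally show "(LINT x|gauss_vec R. x p * F x) = (LINT x|gauss_vec R. (D1 x + \<i> * D2 x) / 2)" .
  have "(LINT x|gauss_vec R. cnj (x p) * F x) = (LINT x|gauss_vec I. LINT y|CN. cnj y * F (x(p := y)))"
    using product_integral_insert[OF I(1,2), of "\<lambda>x. cnj (x p) * F x"] iF[of cnj, OF borel_measurable_continuous_onI[OF continuous_on_cnj[OF continuous_on_id]]] unfolding I(3) by simp
  also have "\<dots> = (LINT x|gauss_vec I. LINT y|CN. (D1 (x(p := y)) - \<i> * D2 (x(p := y))) / 2)"
    by (intro Bochner_Integration.integral_cong refl complex_normal_stein(2)[where B=B] sec m b d1 d2)
  also have "\<dots> = (LINT x|gauss_vec R. (D1 x - \<i> * D2 x) / 2)"
    using product_integral_insert[OF I(1,2), of "\<lambda>x. (D1 x - \<i> * D2 x) / 2"] iD[of "- \<i>"] unfolding I(3) by simp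
  finally show "(LINT x|gauss_vec R. cnj (x p) * F x) = (LINT x|gauss_vec R. (D1 x - \<i> * D2 x) / 2)" .
qed

section \<open>Concentration of Lipschitz functions\<close>

lemma (in prob_space) variance_decomposition:
  fixes f :: "'a => complex"
  assumes f [measurable]: "f \<in> borel_measurable M" and b: "\<And>x. x \<in> space M \<Longrightarrow> cmod (f x) \<le> B"
  shows "(LINT x|M. (cmod (f x - c))\<^sup>2) = (LINT x|M. (cmod (f x - (LINT x|M. f x)))\<^sup>2) + (cmod ((LINT x|M. f x) - c))\<^sup>2"
proof -
  define m where "m = (LINT x|M. f x)"
  have i: "integrable M f" by (rule integrable_const_bound[where B=B]) (use b in auto)
  have i2: "integrable M (\<lambda>x. (cmod (f x - m))\<^sup>2)"
  proof (rule integrable_const_bound[where B="(B + cmod m)\<^sup>2"])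
    show "AE x in M. norm ((cmod (f x - m))\<^sup>2) \<le> (B + cmod m)\<^sup>2"
    proof (rule AE_I2)
      fix x assume "x \<in> space M"
      hence "cmod (f x - m) \<le> B + cmod m" using b[of x] norm_triangle_ineq4[of "f x" m] by linarith
      thus "norm ((cmod (f x - m))\<^sup>2) \<le> (B + cmod m)\<^sup>2" by (simp add: power_mono)
    qed
  qed measurable
  have pt: "(cmod (f x - c))\<^sup>2 = (cmod (f x - m))\<^sup>2 + 2 * Re ((f x - m) * cnj (m - c)) + (cmod (m - c))\<^sup>2" for x
    unfolding cmod_power2 by (simp add: power2_eq_square algebra_simps)
  have r0: "(LINT x|M. Re ((f x - m) * cnj (m - c))) = 0"
  proof -
    have "(LINT x|M. Re ((f x - m) * cnj (m - c))) = Re (LINT x|M. (f x - m) * cnj (m - c))"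
      using i by (intro integral_Re) auto
    also have "(LINT x|M. (f x - m) * cnj (m - c)) = 0" using i unfolding m_def by (simp add: prob_space)
    finally show ?thesis by simp
  qed
  have i3: "integrable M (\<lambda>x. Re ((f x - m) * cnj (m - c)))" using i by (intro integrable_Re) auto
  have "(LINT x|M. (cmod (f x - c))\<^sup>2) = (LINT x|M. (cmod (f x - m))\<^sup>2) + 2 * (LINT x|M. Re ((f x - m) * cnj (m - c))) + (LINT x|M. (cmod (m - c))\<^sup>2)"
    unfolding pt using i2 i3 by (simp only: Bochner_Integration.integral_add Bochner_Integration.integrable_add integrable_const integrable_mult_right integral_mult_right_zero)
  thus ?thesis unfolding r0 by (simp add: m_def prob_space)
qed

text \<open>Replacing one coordinate at a time by its mean, each step costs at most the squared
  Lipschitz constant, because the mean is the best constant approximation and a standard complex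
  normal variable has second moment one.\<close>

lemma gauss_vec_variance_le:
  fixes f :: "('i => complex) => complex"
  assumes "finite R" and "f \<in> borel_measurable (gauss_vec R)" and "\<And>x. cmod (f x) \<le> B"
    and "\<And>p x y. p \<in> R \<Longrightarrow> x \<in> space (gauss_vec R) \<Longrightarrow> cmod (f (x(p := y)) - f x) \<le> L p * cmod (y - x p)"
  shows "(LINT x|gauss_vec R. (cmod (f x - (LINT x|gauss_vec R. f x)))\<^sup>2) \<le> (\<Sum>p\<in>R. (L p)\<^sup>2)"
  using assms
proof (induction R arbitrary: f rule: finite_induct)
  case empty
  have "space (gauss_vec {}) = {\<lambda>_. undefined}" by (simp add: space_PiM)
  interpret P: prob_space "gauss_vec ({} :: 'i set)" by (rule prob_gauss_vec)
  have "(LINT x|gauss_vec {}. f x) = (LINT x|gauss_vec ({} :: 'i set). f (\<lambda>_. undefined))"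
    by (intro Bochner_Integration.integral_cong) (auto simp: space_PiM)
  hence m: "(LINT x|gauss_vec {}. f x) = f (\<lambda>_. undefined)" by (simp add: P.prob_space)
  have "(LINT x|gauss_vec {}. (cmod (f x - f (\<lambda>_. undefined)))\<^sup>2) = (LINT x|gauss_vec ({} :: 'i set). 0)"
    by (intro Bochner_Integration.integral_cong) (auto simp: space_PiM)
  thus ?case unfolding m by simp
next
  case (insert p I)
  interpret product_sigma_finite "\<lambda>_. CN" by (rule product_sigma_finite_std_complex_normal)
  interpret P: prob_space "gauss_vec (insert p I)" by (rule prob_gauss_vec)
  interpret PI: prob_space "gauss_vec I" by (rule prob_gauss_vec)
  interpret G: prob_space CN by (rule prob_std_complex_normal)
  let ?R = "insert p I"
  note f [measurable] = insert.prems(1) and b = insert.prems(2) and lip = insert.prems(3)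
  have B0: "0 \<le> B" using b norm_ge_zero order_trans by blast
  have sec: "(\<lambda>y. f (x(p := y))) \<in> borel_measurable CN" if "x \<in> space (gauss_vec I)" for x
    unfolding measurable_cong_sets[OF sets_std_complex_normal refl]
    by (rule measurable_compose[OF gauss_vec_update_measurable[OF insert.hyps(2) that] f])
  define g where "g x = (LINT y|CN. f (x(p := y)))" for x
  have upd [measurable]: "(\<lambda>(x, y). x(p := y)) \<in> gauss_vec I \<Otimes>\<^sub>M CN \<rightarrow>\<^sub>M gauss_vec ?R"
    by (rule measurable_add_dim)
  have g [measurable]: "g \<in> borel_measurable (gauss_vec I)"
  proof -
    have "(\<lambda>(x, y). f (x(p := y))) \<in> borel_measurable (gauss_vec I \<Otimes>\<^sub>M CN)"
      using measurable_compose[OF upd f] by (simp add: case_prod_beta')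
    thus ?thesis unfolding g_def
      by (rule sigma_finite_measure.borel_measurable_lebesgue_integral[OF prob_space_imp_sigma_finite[OF prob_std_complex_normal]])
  qed
  have gb: "cmod (g x) \<le> B" for x unfolding g_def by (rule norm_integral_le_bound[OF prob_std_complex_normal b B0])
  define m where "m = (LINT x|gauss_vec ?R. f x)"
  have iF: "integrable (gauss_vec ?R) f" by (rule P.integrable_const_bound[where B=B]) (use b in auto)
  have mg: "m = (LINT x|gauss_vec I. g x)"
    unfolding m_def g_def by (rule product_integral_insert[OF insert.hyps(1,2) iF])
  have mb: "cmod m \<le> B" unfolding m_def by (rule norm_integral_le_bound[OF prob_gauss_vec b B0])
  have bound2: "(cmod (u - m))\<^sup>2 \<le> (2 * B)\<^sup>2" if "cmod u \<le> B" for u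
    using that mb norm_triangle_ineq4[of u m] by (intro power_mono) auto
  have i2: "integrable (gauss_vec ?R) (\<lambda>x. (cmod (f x - m))\<^sup>2)"
    by (rule P.integrable_const_bound[where B="(2 * B)\<^sup>2"]) (use bound2 b in auto)
  have "(LINT x|gauss_vec ?R. (cmod (f x - m))\<^sup>2) = (LINT x|gauss_vec I. LINT y|CN. (cmod (f (x(p := y)) - m))\<^sup>2)"
    by (rule product_integral_insert[OF insert.hyps(1,2) i2])
  also have "\<dots> \<le> (LINT x|gauss_vec I. (L p)\<^sup>2 + (cmod (g x - m))\<^sup>2)"
  proof (rule integral_mono)
    fix x assume x: "x \<in> space (gauss_vec I)"
    note [measurable] = sec[OF x]
    have vd: "(LINT y|CN. (cmod (f (x(p := y)) - c))\<^sup>2) = (LINT y|CN. (cmod (f (x(p := y)) - g x))\<^sup>2) + (cmod (g x - c))\<^sup>2" for c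
      unfolding g_def by (rule G.variance_decomposition[OF sec[OF x] b])
    have "(LINT y|CN. (cmod (f (x(p := y)) - g x))\<^sup>2) \<le> (LINT y|CN. (cmod (f (x(p := y)) - f (x(p := 0))))\<^sup>2)"
      unfolding vd[of "f (x(p := 0))"] by simp
    also have "\<dots> \<le> (LINT y|CN. (L p)\<^sup>2 * (cmod y)\<^sup>2)"
    proof (rule integral_mono)
      show "integrable CN (\<lambda>y. (cmod (f (x(p := y)) - f (x(p := 0))))\<^sup>2)"
      proof (rule G.integrable_const_bound[where B="(2 * B)\<^sup>2"])
        have "(cmod (f (x(p := y)) - f (x(p := 0))))\<^sup>2 \<le> (2 * B)\<^sup>2" for y
        proof (rule power_mono)
          have "cmod (f (x(p := y)) - f (x(p := 0))) \<le> B + B" by (rule order_trans[OF norm_triangle_ineq4 add_mono[OF b b]])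
          thus "cmod (f (x(p := y)) - f (x(p := 0))) \<le> 2 * B" by (simp only: mult_2)
        qed simp
        thus "AE y in CN. norm ((cmod (f (x(p := y)) - f (x(p := 0))))\<^sup>2) \<le> (2 * B)\<^sup>2" by auto
      qed measurable
      show "integrable CN (\<lambda>y. (L p)\<^sup>2 * (cmod y)\<^sup>2)" using std_complex_normal_moment2 by simp
      fix y
      have "x(p := 0) \<in> space (gauss_vec ?R)" using x by (auto simp: space_PiM PiE_def extensional_def)
      hence "cmod (f (x(p := 0, p := y)) - f (x(p := 0))) \<le> L p * cmod (y - (x(p := 0)) p)" by (rule lip[OF insertI1])
      hence "cmod (f (x(p := y)) - f (x(p := 0))) \<le> L p * cmod y" unfolding fun_upd_upd fun_upd_same diff_zero .
      hence "(cmod (f (x(p := y)) - f (x(p := 0))))\<^sup>2 \<le> (L p * cmod y)\<^sup>2" by (rule power_mono) simp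
      thus "(cmod (f (x(p := y)) - f (x(p := 0))))\<^sup>2 \<le> (L p)\<^sup>2 * (cmod y)\<^sup>2" by (simp add: power_mult_distrib)
    qed
    also have "\<dots> = (L p)\<^sup>2" using std_complex_normal_moment2 by simp
    finally show "(LINT y|CN. (cmod (f (x(p := y)) - m))\<^sup>2) \<le> (L p)\<^sup>2 + (cmod (g x - m))\<^sup>2"
      unfolding vd[of m] by simp
  next
    show "integrable (gauss_vec I) (\<lambda>x. LINT y|CN. (cmod (f (x(p := y)) - m))\<^sup>2)"
    proof (rule PI.integrable_const_bound[where B="(2 * B)\<^sup>2"])
      show "AE x in gauss_vec I. norm (LINT y|CN. (cmod (f (x(p := y)) - m))\<^sup>2) \<le> (2 * B)\<^sup>2"
        by (intro AE_I2 norm_integral_le_bound[OF prob_std_complex_normal]) (use bound2 b in auto)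
      have "(\<lambda>(x, y). (cmod (f (x(p := y)) - m))\<^sup>2) \<in> borel_measurable (gauss_vec I \<Otimes>\<^sub>M CN)"
        using measurable_compose[OF upd f] by (simp add: case_prod_beta')
      thus "(\<lambda>x. LINT y|CN. (cmod (f (x(p := y)) - m))\<^sup>2) \<in> borel_measurable (gauss_vec I)"
        by (rule sigma_finite_measure.borel_measurable_lebesgue_integral[OF prob_space_imp_sigma_finite[OF prob_std_complex_normal]])
    qed
    show "integrable (gauss_vec I) (\<lambda>x. (L p)\<^sup>2 + (cmod (g x - m))\<^sup>2)"
      by (intro Bochner_Integration.integrable_add PI.integrable_const PI.integrable_const_bound[where B="(2 * B)\<^sup>2"]) (use bound2 gb in auto)
  qed
  also have "\<dots> = (L p)\<^sup>2 + (LINT x|gauss_vec I. (cmod (g x - m))\<^sup>2)"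
  proof -
    have "integrable (gauss_vec I) (\<lambda>x. (cmod (g x - m))\<^sup>2)"
      by (rule PI.integrable_const_bound[where B="(2 * B)\<^sup>2"]) (use bound2 gb in auto)
    thus ?thesis by (simp add: PI.prob_space)
  qed
  also have "(LINT x|gauss_vec I. (cmod (g x - m))\<^sup>2) \<le> (\<Sum>q\<in>I. (L q)\<^sup>2)"
    unfolding mg
  proof (rule insert.IH[OF g gb])
    fix q and x :: "'i => complex" and y assume q: "q \<in> I" and x: "x \<in> space (gauss_vec I)"
    hence qp: "q \<noteq> p" using insert.hyps by auto
    have xq: "x(q := y) \<in> space (gauss_vec I)" using x q by (auto simp: space_PiM PiE_def extensional_def)
    have ins: "x(p := u) \<in> space (gauss_vec ?R)" for u using x by (auto simp: space_PiM PiE_def extensional_def)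
    have pt: "cmod (f (x(q := y, p := u)) - f (x(p := u))) \<le> L q * cmod (y - x q)" for u
    proof -
      have "cmod (f (x(p := u, q := y)) - f (x(p := u))) \<le> L q * cmod (y - (x(p := u)) q)"
        by (rule lip[OF insertI2[OF q] ins])
      moreover have "x(p := u, q := y) = x(q := y, p := u)" by (rule fun_upd_twist[OF qp[symmetric]])
      moreover have "(x(p := u)) q = x q" using qp by simp
      ultimately show ?thesis by (simp only:)
    qed
    have int: "integrable CN (\<lambda>u. f (x'(p := u)))" if "x' \<in> space (gauss_vec I)" for x'
      by (rule G.integrable_const_bound[where B=B]) (use sec[OF that] b in auto)
    have "g (x(q := y)) - g x = (LINT u|CN. f (x(q := y, p := u)) - f (x(p := u)))"
      unfolding g_def by (rule Bochner_Integration.integral_diff[symmetric]) (rule int[OF xq], rule int[OF x])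
    also have "cmod \<dots> \<le> L q * cmod (y - x q)"
      by (rule norm_integral_le_bound[OF prob_std_complex_normal pt]) (rule order_trans[OF norm_ge_zero pt])
    finally show "cmod (g (x(q := y)) - g x) \<le> L q * cmod (y - x q)" .
  qed
  finally show ?case using insert.hyps unfolding m_def by simp
qed

section \<open>The resolvent of a Gaussian Hermitian matrix\<close>

text \<open>Writing a Gaussian Hermitian matrix through independent standard complex normal variables
  \<open>x p\<close> and coefficient matrices \<open>C p\<close>, its law enters only through the covariances, which are
  assumed to be those of independent entries with variances \<open>s i k\<close>.  The parameter \<open>\<tau>\<close> bounds the
  trace norms of the coefficient matrices and controls the concentration of the resolvent.\<close>

locale gaussian_hermitian =
  fixes m :: nat and R :: "'i set" and C :: "'i => nat => nat => complex" and s :: "nat => nat => real" and \<tau> :: real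
  assumes R: "finite R"
    and cov: "\<And>i k a b. i < m \<Longrightarrow> k < m \<Longrightarrow> a < m \<Longrightarrow> b < m \<Longrightarrow>
      (\<Sum>p\<in>R. C p i k * cnj (C p b a) + cnj (C p k i) * C p a b) = (if i = b \<and> k = a then complex_of_real (s i k) else 0)"
    and trace_bound: "\<And>p M K. p \<in> R \<Longrightarrow> bilinear_bound m M K \<Longrightarrow> cmod (\<Sum>k<m. \<Sum>l<m. C p k l * M l k) \<le> \<tau> * K"
    and \<tau>: "0 \<le> \<tau>"
begin

definition H :: "('i => complex) => nat => nat => complex" where
  "H x i j = (\<Sum>p\<in>R. C p i j * x p + cnj (C p j i) * cnj (x p))"

lemma hermitian_H: "hermitian_on m (H x)"
  unfolding hermitian_on_def H_def by (simp add: add.commute)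

lemma H_update:
  assumes "p \<in> R"
  shows "H (x(p := y)) i j = H x i j + (C p i j * (y - x p) + cnj (C p j i) * cnj (y - x p))"
proof -
  have "H (x(p := y)) i j = (C p i j * y + cnj (C p j i) * cnj y) + (\<Sum>q\<in>R - {p}. C q i j * x q + cnj (C q j i) * cnj (x q))"
    unfolding H_def by (subst sum.remove[OF R assms]) simp
  moreover have "H x i j = (C p i j * x p + cnj (C p j i) * cnj (x p)) + (\<Sum>q\<in>R - {p}. C q i j * x q + cnj (C q j i) * cnj (x q))"
    unfolding H_def by (rule sum.remove[OF R assms])
  ultimately show ?thesis by (simp add: algebra_simps)
qed

lemma H_measurable: "(\<lambda>x. H x i j) \<in> borel_measurable (gauss_vec R)"
proof -
  have c: "(\<lambda>x. x p) \<in> gauss_vec R \<rightarrow>\<^sub>M borel" if "p \<in> R" for p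
    using measurable_component_singleton[OF that, of "\<lambda>_. CN"] by (simp add: measurable_cong_sets[OF refl sets_std_complex_normal])
  show ?thesis unfolding H_def
    by (intro borel_measurable_sum borel_measurable_add borel_measurable_times borel_measurable_const c
        borel_measurable_continuous_on[OF continuous_on_cnj[OF continuous_on_id]])
qed

context
  fixes w :: complex assumes w: "Im w > 0"
begin

definition G :: "('i => complex) => nat => nat => complex" where
  "G x = resolvent m (H x) w"

lemma G_le: "i < m \<Longrightarrow> j < m \<Longrightarrow> cmod (G x i j) \<le> 1 / Im w"
  unfolding G_def by (rule resolvent_entry_le[OF hermitian_H w])

lemma G_measurable: "i < m \<Longrightarrow> j < m \<Longrightarrow> (\<lambda>x. G x i j) \<in> borel_measurable (gauss_vec R)"
  unfolding G_def by (rule resolvent_measurable[OF H_measurable])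

text \<open>Moving one coordinate changes \<open>H\<close> by multiples of \<open>C p\<close> and its adjoint. These are tested against a
  product of resolvents with operator norm at most \<open>D / (Im w)\<^sup>2\<close>.\<close>

lemma weighted_trace_lipschitz:
  assumes p: "p \<in> R" and d: "\<And>i. i < m \<Longrightarrow> cmod (d i) \<le> D"
  shows "cmod ((\<Sum>i<m. d i * G (x(p := y)) i i) - (\<Sum>i<m. d i * G x i i)) \<le> 2 * \<tau> * D / (Im w)\<^sup>2 * cmod (y - x p)"
proof -
  define M where "M l k = (\<Sum>i<m. G (x(p := y)) l i * d i * G x i k)" for l k
  have M: "bilinear_bound m M (D / (Im w)\<^sup>2)"
    unfolding M_def G_def by (rule resolvent_sandwich_bilinear[OF hermitian_H hermitian_H w d])
  have M': "bilinear_bound m (\<lambda>l k. cnj (M k l)) (D / (Im w)\<^sup>2)"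
    unfolding bilinear_bound_def
  proof (intro allI)
    fix u v
    have "(\<Sum>i<m. \<Sum>j<m. u i * cnj (M j i) * v j) = cnj (\<Sum>j<m. \<Sum>i<m. cnj (v j) * M j i * cnj (u i))"
      by (subst sum.swap) (simp add: mult_ac)
    hence "cmod (\<Sum>i<m. \<Sum>j<m. u i * cnj (M j i) * v j) = cmod (\<Sum>j<m. \<Sum>i<m. cnj (v j) * M j i * cnj (u i))"
      by (simp only: complex_mod_cnj)
    also have "\<dots> \<le> D / (Im w)\<^sup>2 * vnorm m (\<lambda>j. cnj (v j)) * vnorm m (\<lambda>i. cnj (u i))"
      by (rule M[unfolded bilinear_bound_def, rule_format])
    finally show "cmod (\<Sum>i<m. \<Sum>j<m. u i * cnj (M j i) * v j) \<le> D / (Im w)\<^sup>2 * vnorm m u * vnorm m v"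
      by (simp add: mult_ac)
  qed
  let ?z = "y - x p"
  have "(\<Sum>i<m. d i * G (x(p := y)) i i) - (\<Sum>i<m. d i * G x i i)
     = (\<Sum>k<m. \<Sum>l<m. (H x k l - H (x(p := y)) k l) * M l k)"
    unfolding M_def G_def by (rule resolvent_weighted_trace_difference[OF hermitian_H hermitian_H w])
  also have "\<dots> = (\<Sum>k<m. \<Sum>l<m. - (?z * (C p k l * M l k)) - cnj ?z * cnj (C p l k * cnj (M l k)))"
    by (intro sum.cong refl) (simp add: H_update[OF p] algebra_simps)
  also have "\<dots> = - (?z * (\<Sum>k<m. \<Sum>l<m. C p k l * M l k)) - cnj ?z * cnj (\<Sum>k<m. \<Sum>l<m. C p l k * cnj (M l k))"
    by (simp only: sum_subtractf sum_negf sum_distrib_left cnj_sum)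
  also have "(\<Sum>k<m. \<Sum>l<m. C p l k * cnj (M l k)) = (\<Sum>l<m. \<Sum>k<m. C p l k * cnj (M l k))" by (rule sum.swap)
  also have "cmod (- (?z * (\<Sum>k<m. \<Sum>l<m. C p k l * M l k)) - cnj ?z * cnj (\<Sum>l<m. \<Sum>k<m. C p l k * cnj (M l k)))
     \<le> cmod ?z * cmod (\<Sum>k<m. \<Sum>l<m. C p k l * M l k) + cmod ?z * cmod (\<Sum>l<m. \<Sum>k<m. C p l k * cnj (M l k))"
    by (rule order_trans[OF norm_triangle_ineq4]) (simp only: norm_minus_cancel norm_mult complex_mod_cnj order_refl)
  also have "\<dots> \<le> cmod ?z * (\<tau> * (D / (Im w)\<^sup>2)) + cmod ?z * (\<tau> * (D / (Im w)\<^sup>2))"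
    by (intro add_mono mult_left_mono trace_bound[OF p M] trace_bound[OF p M'] norm_ge_zero)
  also have "\<dots> = 2 * \<tau> * D / (Im w)\<^sup>2 * cmod ?z" by (simp add: mult_ac)
  finally show ?thesis .
qed

lemma weighted_trace_variance:
  assumes d: "\<And>i. i < m \<Longrightarrow> cmod (d i) \<le> D"
  shows "(LINT x|gauss_vec R. (cmod ((\<Sum>i<m. d i * G x i i) - (LINT x|gauss_vec R. (\<Sum>i<m. d i * G x i i))))\<^sup>2)
     \<le> real (card R) * (2 * \<tau> * D / (Im w)\<^sup>2)\<^sup>2"
proof -
  have "(LINT x|gauss_vec R. (cmod ((\<Sum>i<m. d i * G x i i) - (LINT x|gauss_vec R. (\<Sum>i<m. d i * G x i i))))\<^sup>2)
     \<le> (\<Sum>p\<in>R. (2 * \<tau> * D / (Im w)\<^sup>2)\<^sup>2)"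
  proof (rule gauss_vec_variance_le[OF R, where B="\<Sum>i<m. cmod (d i) * (1 / Im w)"])
    show "(\<lambda>x. \<Sum>i<m. d i * G x i i) \<in> borel_measurable (gauss_vec R)"
      by (intro borel_measurable_sum borel_measurable_times borel_measurable_const G_measurable) auto
    show "cmod (\<Sum>i<m. d i * G x i i) \<le> (\<Sum>i<m. cmod (d i) * (1 / Im w))" for x
      by (rule sum_norm_le) (simp only: norm_mult, intro mult_left_mono G_le, auto)
  qed (rule weighted_trace_lipschitz[OF _ d])
  thus ?thesis by simp
qed

text \<open>The real and imaginary directions of \<open>x p\<close> perturb \<open>H\<close> by combinations of \<open>C p\<close> and its adjoint; each
  Wirtinger derivative retains one of the two.\<close>

lemma G_stein:
  assumes p: "p \<in> R" and kl: "k < m" "l < m"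
  shows "(LINT x|gauss_vec R. x p * G x k l) = - (LINT x|gauss_vec R. (\<Sum>a<m. \<Sum>b<m. G x k a * cnj (C p b a) * G x b l))"
    and "(LINT x|gauss_vec R. cnj (x p) * G x k l) = - (LINT x|gauss_vec R. (\<Sum>a<m. \<Sum>b<m. G x k a * C p a b * G x b l))"
proof -
  \<comment> \<open>The derivatives of \<open>H\<close> in the real and imaginary part of \<open>x p\<close>.\<close>
  define A1 where "A1 a b = C p a b + cnj (C p b a)" for a b
  define A2 where "A2 a b = \<i> * (C p a b - cnj (C p b a))" for a b
  define D where "D A x = - (\<Sum>a<m. \<Sum>b<m. G x k a * A a b * G x b l)" for A x
  define B where "B = 1 / Im w + (\<Sum>a<m. \<Sum>b<m. (1 / Im w) * cmod (A1 a b) * (1 / Im w)) + (\<Sum>a<m. \<Sum>b<m. (1 / Im w) * cmod (A2 a b) * (1 / Im w))"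
  have p0: "0 \<le> (\<Sum>a<m. \<Sum>b<m. (1 / Im w) * cmod (A a b) * (1 / Im w))" for A :: "nat => nat => complex"
    using w by (intro sum_nonneg mult_nonneg_nonneg) auto
  have Db: "cmod (D A x) \<le> (\<Sum>a<m. \<Sum>b<m. (1 / Im w) * cmod (A a b) * (1 / Im w))" for A x
    unfolding D_def norm_minus_cancel
  proof (intro sum_norm_le)
    fix a b assume "a \<in> {..<m}" "b \<in> {..<m}"
    thus "cmod (G x k a * A a b * G x b l) \<le> (1 / Im w) * cmod (A a b) * (1 / Im w)"
      unfolding norm_mult using kl w by (intro mult_mono G_le mult_nonneg_nonneg) auto
  qed
  have Dm: "D A \<in> borel_measurable (gauss_vec R)" for A
    unfolding D_def
    by (intro borel_measurable_uminus borel_measurable_sum borel_measurable_times borel_measurable_const G_measurable) (use kl in auto)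
  have line: "H (x(p := y + of_real t * e)) i j = H (x(p := y)) i j + of_real t * (C p i j * e + cnj (C p j i) * cnj e)" for x y t e i j
    unfolding H_update[OF p, of x] by (simp add: algebra_simps)
  have deriv: "((\<lambda>t. G (x(p := y + of_real t * e)) i j) has_vector_derivative
     - (\<Sum>a<m. \<Sum>b<m. G (x(p := y + of_real t * e)) i a * (C p a b * e + cnj (C p b a) * cnj e) * G (x(p := y + of_real t * e)) b j)) (at t)"
    if "i < m" "j < m" for x y t e i j
  proof -
    have eq: "G (x(p := y + of_real t * e)) = resolvent m (\<lambda>i j. H (x(p := y)) i j + of_real t * (C p i j * e + cnj (C p j i) * cnj e)) w" for t
      unfolding G_def line ..
    show ?thesis unfolding eq
      by (rule resolvent_has_derivative[OF _ w that]) (simp only: line[symmetric] hermitian_H)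
  qed
  have cont: "isCont (\<lambda>t. D A (x(p := y + of_real t * e))) t" for A x y e t
    unfolding D_def
    by (intro continuous_intros has_vector_derivative_continuous[OF deriv]) (use kl in auto)
  have c1: "Complex a b = Complex 0 b + of_real a * 1" and c2: "Complex a b = Complex a 0 + of_real b * \<i>" for a b
    by (auto simp: complex_eq_iff)
  have d1: "((\<lambda>a. G (x(p := Complex a b)) k l) has_vector_derivative D A1 (x(p := Complex a b))) (at a)" for x a b
    using deriv[OF kl, where x=x and y="Complex 0 b" and e=1 and t=a] unfolding c1[symmetric] D_def A1_def by simp
  have d2: "((\<lambda>b. G (x(p := Complex a b)) k l) has_vector_derivative D A2 (x(p := Complex a b))) (at b)" for x a b
    using deriv[OF kl, where x=x and y="Complex a 0" and e="\<i>" and t=b] unfolding c2[symmetric] D_def A2_def by (simp add: algebra_simps)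
  have e1: "isCont (\<lambda>a. D A1 (x(p := Complex a b))) a" for x a b
    using cont[where A=A1 and x=x and y="Complex 0 b" and e=1 and t=a] unfolding c1[symmetric] .
  have e2: "isCont (\<lambda>b. D A2 (x(p := Complex a b))) b" for x a b
    using cont[where A=A2 and x=x and y="Complex a 0" and e="\<i>" and t=b] unfolding c2[symmetric] .
  have b: "cmod (G x k l) \<le> B" "cmod (D A1 x) \<le> B" "cmod (D A2 x) \<le> B" for x
    using G_le[OF kl, of x] Db[of A1 x] Db[of A2 x] p0[of A1] p0[of A2] w unfolding B_def by (simp_all add: add_increasing add_increasing2)
  note st = gauss_vec_stein[OF R p G_measurable[OF kl] Dm Dm b d1 e1 d2 e2]
  have s1: "(D A1 x + \<i> * D A2 x) / 2 = - (\<Sum>a<m. \<Sum>b<m. G x k a * cnj (C p b a) * G x b l)" for x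
  proof -
    have "D A1 x + \<i> * D A2 x = - (\<Sum>a<m. \<Sum>b<m. G x k a * A1 a b * G x b l + \<i> * (G x k a * A2 a b * G x b l))"
      unfolding D_def by (simp only: sum.distrib sum_distrib_left mult_minus_right minus_add_distrib)
    also have "\<dots> = - (\<Sum>a<m. \<Sum>b<m. 2 * (G x k a * cnj (C p b a) * G x b l))"
      unfolding A1_def A2_def by (intro arg_cong[where f=uminus] sum.cong refl) (simp add: algebra_simps)
    finally show ?thesis by (simp add: sum_distrib_left[symmetric])
  qed
  have s2: "(D A1 x - \<i> * D A2 x) / 2 = - (\<Sum>a<m. \<Sum>b<m. G x k a * C p a b * G x b l)" for x
  proof -
    have "D A1 x - \<i> * D A2 x = - (\<Sum>a<m. \<Sum>b<m. G x k a * A1 a b * G x b l - \<i> * (G x k a * A2 a b * G x b l))"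
      unfolding D_def by (simp only: sum_subtractf sum_distrib_left mult_minus_right minus_diff_minus minus_diff_eq)
    also have "\<dots> = - (\<Sum>a<m. \<Sum>b<m. 2 * (G x k a * C p a b * G x b l))"
      unfolding A1_def A2_def by (intro arg_cong[where f=uminus] sum.cong refl) (simp add: algebra_simps)
    finally show ?thesis by (simp add: sum_distrib_left[symmetric])
  qed
  show "(LINT x|gauss_vec R. x p * G x k l) = - (LINT x|gauss_vec R. (\<Sum>a<m. \<Sum>b<m. G x k a * cnj (C p b a) * G x b l))"
    using st(1) unfolding s1 by simp
  show "(LINT x|gauss_vec R. cnj (x p) * G x k l) = - (LINT x|gauss_vec R. (\<Sum>a<m. \<Sum>b<m. G x k a * C p a b * G x b l))"
    using st(2) unfolding s2 by simp
qed

lemma coordinate_times_G_integrable: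
  assumes p: "p \<in> R" and kl: "k < m" "l < m"
  shows "integrable (gauss_vec R) (\<lambda>x. x p * G x k l)" "integrable (gauss_vec R) (\<lambda>x. cnj (x p) * G x k l)"
proof -
  have [measurable]: "(\<lambda>x. x p) \<in> gauss_vec R \<rightarrow>\<^sub>M borel"
    using measurable_component_singleton[OF p, of "\<lambda>_. CN"] by (simp add: measurable_cong_sets[OF refl sets_std_complex_normal])
  note [measurable] = G_measurable[OF kl]
  have i: "integrable (gauss_vec R) (\<lambda>x. cmod (x p) * (1 / Im w))" using gauss_vec_coordinate_integrable[OF p] by simp
  have "AE x in gauss_vec R. cmod (x p * G x k l) \<le> norm (cmod (x p) * (1 / Im w))"
    "AE x in gauss_vec R. cmod (cnj (x p) * G x k l) \<le> norm (cmod (x p) * (1 / Im w))"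
    using G_le[OF kl] w by (auto simp: norm_mult simp del: times_divide_eq_right intro!: mult_left_mono AE_I2)
  thus "integrable (gauss_vec R) (\<lambda>x. x p * G x k l)" "integrable (gauss_vec R) (\<lambda>x. cnj (x p) * G x k l)"
    by (auto intro!: Bochner_Integration.integrable_bound[OF i])
qed

lemma G_integrable: "i < m \<Longrightarrow> j < m \<Longrightarrow> integrable (gauss_vec R) (\<lambda>x. G x i j)"
  by (rule finite_measure.integrable_const_bound[OF prob_space.finite_measure[OF prob_gauss_vec], where B="1 / Im w"])
     (auto intro: G_le G_measurable)

lemma G_prod_integrable:
  assumes "i < m" "j < m" "k < m" "l < m"
  shows "integrable (gauss_vec R) (\<lambda>x. G x i j * G x k l)"
proof (rule finite_measure.integrable_const_bound[OF prob_space.finite_measure[OF prob_gauss_vec], where B="(1 / Im w) * (1 / Im w)"])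
  show "AE x in gauss_vec R. cmod (G x i j * G x k l) \<le> (1 / Im w) * (1 / Im w)"
    unfolding norm_mult using assms w by (intro AE_I2 mult_mono G_le) auto
qed (intro borel_measurable_times G_measurable assms)

text \<open>The Dyson equation: taking expectations in \<open>H G = 1 + w G\<close> and integrating by parts in
  each coordinate, only the covariances of the entries survive.\<close>

lemma dyson_equation:
  assumes i: "i < m"
  shows "1 + w * (LINT x|gauss_vec R. G x i i) = - (LINT x|gauss_vec R. (\<Sum>k<m. s i k * G x k k) * G x i i)"
proof -
  have HG: "(\<Sum>k<m. H x i k * G x k i) = 1 + w * G x i i" for x
    unfolding G_def using resolvent_right[OF hermitian_H w i i] by simp
  have "(LINT x|gauss_vec R. (\<Sum>k<m. H x i k * G x k i))
     = (LINT x|gauss_vec R. (\<Sum>k<m. \<Sum>p\<in>R. C p i k * (x p * G x k i) + cnj (C p k i) * (cnj (x p) * G x k i)))"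
    unfolding H_def sum_distrib_right by (intro Bochner_Integration.integral_cong sum.cong refl) (simp add: algebra_simps)
  also have "\<dots> = (\<Sum>k<m. \<Sum>p\<in>R. C p i k * (LINT x|gauss_vec R. x p * G x k i) + cnj (C p k i) * (LINT x|gauss_vec R. cnj (x p) * G x k i))"
  proof -
    have int: "integrable (gauss_vec R) (\<lambda>x. C p i k * (x p * G x k i))" "integrable (gauss_vec R) (\<lambda>x. cnj (C p k i) * (cnj (x p) * G x k i))"
      if "p \<in> R" "k < m" for p k
      using coordinate_times_G_integrable[OF that i] by (auto intro!: integrable_mult_right)
    have "(LINT x|gauss_vec R. (\<Sum>k<m. \<Sum>p\<in>R. C p i k * (x p * G x k i) + cnj (C p k i) * (cnj (x p) * G x k i)))
      = (\<Sum>k<m. \<Sum>p\<in>R. LINT x|gauss_vec R. C p i k * (x p * G x k i) + cnj (C p k i) * (cnj (x p) * G x k i))"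
    proof (subst Bochner_Integration.integral_sum)
      show "integrable (gauss_vec R) (\<lambda>x. \<Sum>p\<in>R. C p i k * (x p * G x k i) + cnj (C p k i) * (cnj (x p) * G x k i))" if "k \<in> {..<m}" for k
        using that by (intro Bochner_Integration.integrable_sum Bochner_Integration.integrable_add int) auto
      show "(\<Sum>k<m. LINT x|gauss_vec R. (\<Sum>p\<in>R. C p i k * (x p * G x k i) + cnj (C p k i) * (cnj (x p) * G x k i)))
        = (\<Sum>k<m. \<Sum>p\<in>R. LINT x|gauss_vec R. C p i k * (x p * G x k i) + cnj (C p k i) * (cnj (x p) * G x k i))"
        by (intro sum.cong refl Bochner_Integration.integral_sum Bochner_Integration.integrable_add int) auto
    qed
    also have "\<dots> = (\<Sum>k<m. \<Sum>p\<in>R. C p i k * (LINT x|gauss_vec R. x p * G x k i) + cnj (C p k i) * (LINT x|gauss_vec R. cnj (x p) * G x k i))"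
      by (intro sum.cong refl, subst Bochner_Integration.integral_add) (auto intro!: int)
    finally show ?thesis .
  qed
  also have "\<dots> = (\<Sum>k<m. \<Sum>p\<in>R. - (LINT x|gauss_vec R. (\<Sum>a<m. \<Sum>b<m. (C p i k * cnj (C p b a) + cnj (C p k i) * C p a b) * (G x k a * G x b i))))"
  proof (intro sum.cong refl)
    fix k p assume k: "k \<in> {..<m}" and p: "p \<in> R"
    have k': "k < m" using k by simp
    have int: "integrable (gauss_vec R) (\<lambda>x. (\<Sum>a<m. \<Sum>b<m. G x k a * c a b * G x b i))" for c :: "nat => nat => complex"
    proof -
      have "integrable (gauss_vec R) (\<lambda>x. (\<Sum>a<m. \<Sum>b<m. c a b * (G x k a * G x b i)))"
        using k' i by (intro Bochner_Integration.integrable_sum integrable_mult_right G_prod_integrable) auto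
      thus ?thesis by (simp add: mult_ac)
    qed
    have "C p i k * (LINT x|gauss_vec R. x p * G x k i) + cnj (C p k i) * (LINT x|gauss_vec R. cnj (x p) * G x k i)
      = - (C p i k * (LINT x|gauss_vec R. (\<Sum>a<m. \<Sum>b<m. G x k a * cnj (C p b a) * G x b i)) + cnj (C p k i) * (LINT x|gauss_vec R. (\<Sum>a<m. \<Sum>b<m. G x k a * C p a b * G x b i)))"
      unfolding G_stein[OF p k' i] by simp
    also have "\<dots> = - (LINT x|gauss_vec R. C p i k * (\<Sum>a<m. \<Sum>b<m. G x k a * cnj (C p b a) * G x b i) + cnj (C p k i) * (\<Sum>a<m. \<Sum>b<m. G x k a * C p a b * G x b i))"
      using int[of "\<lambda>a b. cnj (C p b a)"] int[of "C p"] by (subst Bochner_Integration.integral_add) (auto intro!: integrable_mult_right)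
    also have "\<dots> = - (LINT x|gauss_vec R. (\<Sum>a<m. \<Sum>b<m. (C p i k * cnj (C p b a) + cnj (C p k i) * C p a b) * (G x k a * G x b i)))"
      unfolding sum_distrib_left sum.distrib[symmetric]
      by (intro arg_cong[where f=uminus] Bochner_Integration.integral_cong sum.cong refl) (simp add: algebra_simps)
    finally show "C p i k * (LINT x|gauss_vec R. x p * G x k i) + cnj (C p k i) * (LINT x|gauss_vec R. cnj (x p) * G x k i)
      = - (LINT x|gauss_vec R. (\<Sum>a<m. \<Sum>b<m. (C p i k * cnj (C p b a) + cnj (C p k i) * C p a b) * (G x k a * G x b i)))" .
  qed
  also have "\<dots> = (\<Sum>k<m. - (LINT x|gauss_vec R. s i k * (G x k k * G x i i)))"
  proof (intro sum.cong refl)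
    fix k assume "k \<in> {..<m}"
    hence k: "k < m" by simp
    have "(\<Sum>p\<in>R. - (LINT x|gauss_vec R. (\<Sum>a<m. \<Sum>b<m. (C p i k * cnj (C p b a) + cnj (C p k i) * C p a b) * (G x k a * G x b i))))
      = - (LINT x|gauss_vec R. (\<Sum>p\<in>R. \<Sum>a<m. \<Sum>b<m. (C p i k * cnj (C p b a) + cnj (C p k i) * C p a b) * (G x k a * G x b i)))"
      unfolding sum_negf
      by (subst Bochner_Integration.integral_sum) (auto intro!: Bochner_Integration.integrable_sum integrable_mult_right G_prod_integrable k i)
    also have "(\<lambda>x. \<Sum>p\<in>R. \<Sum>a<m. \<Sum>b<m. (C p i k * cnj (C p b a) + cnj (C p k i) * C p a b) * (G x k a * G x b i)) = (\<lambda>x. s i k * (G x k k * G x i i))"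
    proof
      fix x
      have "(\<Sum>p\<in>R. \<Sum>a<m. \<Sum>b<m. (C p i k * cnj (C p b a) + cnj (C p k i) * C p a b) * (G x k a * G x b i))
        = (\<Sum>a<m. \<Sum>b<m. (\<Sum>p\<in>R. C p i k * cnj (C p b a) + cnj (C p k i) * C p a b) * (G x k a * G x b i))"
        unfolding sum_distrib_right by (subst sum.swap, intro sum.cong refl, rule sum.swap)
      also have "\<dots> = (\<Sum>a<m. \<Sum>b<m. if i = b \<and> k = a then s i k * (G x k k * G x i i) else 0)"
      proof (intro sum.cong refl)
        fix a b assume "a \<in> {..<m}" "b \<in> {..<m}"
        hence "(\<Sum>p\<in>R. C p i k * cnj (C p b a) + cnj (C p k i) * C p a b) = (if i = b \<and> k = a then complex_of_real (s i k) else 0)"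
          by (intro cov i k) auto
        thus "(\<Sum>p\<in>R. C p i k * cnj (C p b a) + cnj (C p k i) * C p a b) * (G x k a * G x b i) = (if i = b \<and> k = a then s i k * (G x k k * G x i i) else 0)"
          by (simp only:) auto
      qed
      also have "\<dots> = (\<Sum>a<m. if k = a then (\<Sum>b<m. if i = b then s i k * (G x k k * G x i i) else 0) else 0)"
        by (intro sum.cong refl) auto
      also have "\<dots> = s i k * (G x k k * G x i i)" using i k by simp
      finally show "(\<Sum>p\<in>R. \<Sum>a<m. \<Sum>b<m. (C p i k * cnj (C p b a) + cnj (C p k i) * C p a b) * (G x k a * G x b i)) = s i k * (G x k k * G x i i)" .
    qed
    finally show "(\<Sum>p\<in>R. - (LINT x|gauss_vec R. (\<Sum>a<m. \<Sum>b<m. (C p i k * cnj (C p b a) + cnj (C p k i) * C p a b) * (G x k a * G x b i))))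
      = - (LINT x|gauss_vec R. s i k * (G x k k * G x i i))" .
  qed
  also have "\<dots> = - (LINT x|gauss_vec R. (\<Sum>k<m. s i k * G x k k) * G x i i)"
    unfolding sum_negf sum_distrib_right mult.assoc
    by (subst Bochner_Integration.integral_sum) (auto intro!: integrable_mult_right G_prod_integrable i)
  finally have "(LINT x|gauss_vec R. 1 + w * G x i i) = - (LINT x|gauss_vec R. (\<Sum>k<m. s i k * G x k k) * G x i i)"
    unfolding HG .
  moreover have "(LINT x|gauss_vec R. 1 + w * G x i i) = 1 + w * (LINT x|gauss_vec R. G x i i)"
  proof -
    interpret prob_space "gauss_vec R" by (rule prob_gauss_vec)
    show ?thesis using G_integrable[OF i i] by (simp add: prob_space)
  qed
  ultimately show ?thesis by simp
qed

lemma mean_abs_le_sqrt_second_moment: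
  fixes f :: "'a => complex"
  assumes P: "prob_space M" and [measurable]: "f \<in> borel_measurable M" and b: "\<And>x. x \<in> space M \<Longrightarrow> cmod (f x) \<le> B"
  shows "(LINT x|M. cmod (f x)) \<le> sqrt (LINT x|M. (cmod (f x))\<^sup>2)"
proof (rule real_le_rsqrt)
  interpret prob_space M by fact
  have i1: "integrable M (\<lambda>x. cmod (f x))" by (rule integrable_const_bound[where B=B]) (use b in auto)
  have i2: "integrable M (\<lambda>x. (cmod (f x))\<^sup>2)"
    by (rule integrable_const_bound[where B="B\<^sup>2"]) (use b in \<open>auto intro!: AE_I2 power_mono\<close>)
  show "(LINT x|M. cmod (f x))\<^sup>2 \<le> (LINT x|M. (cmod (f x))\<^sup>2)"
    using variance_eq[OF i1 i2] variance_positive[of "\<lambda>x. cmod (f x)"] by simp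
qed

text \<open>The weighted trace in the Dyson equation concentrates, so the expectation of the product is close
  to the product of the expectations.\<close>

lemma approximate_vector_equation:
  fixes g :: "nat => complex"
  assumes i: "i < m" and sD: "\<And>k. k < m \<Longrightarrow> \<bar>s i k\<bar> \<le> D"
  defines "g \<equiv> \<lambda>i. LINT x|gauss_vec R. G x i i"
  shows "cmod (1 + w * g i + g i * (\<Sum>k<m. s i k * g k)) \<le> (1 / Im w) * (sqrt (real (card R)) * (2 * \<tau> * D / (Im w)\<^sup>2))"
proof -
  interpret prob_space "gauss_vec R" by (rule prob_gauss_vec)
  define T where "T x = (\<Sum>k<m. complex_of_real (s i k) * G x k k)" for x
  define ET where "ET = (LINT x|gauss_vec R. T x)"
  have D0: "0 \<le> D" using sD[OF i] by linarith
  have Tm [measurable]: "T \<in> borel_measurable (gauss_vec R)"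
    unfolding T_def by (intro borel_measurable_sum borel_measurable_times borel_measurable_const G_measurable) auto
  note [measurable] = G_measurable[OF i i]
  define b where "b = (\<Sum>k<m. cmod (complex_of_real (s i k)) * (1 / Im w))"
  have Tb: "cmod (T x) \<le> b" for x
    unfolding T_def b_def by (rule sum_norm_le) (simp only: norm_mult, intro mult_left_mono G_le, auto)
  have b0: "0 \<le> b" using Tb norm_ge_zero order_trans by blast
  have ETb: "cmod ET \<le> b" unfolding ET_def by (rule norm_integral_le_bound[OF prob_gauss_vec Tb b0])
  have db: "cmod (T x - ET) \<le> 2 * b" for x using norm_triangle_ineq4[of "T x" ET] Tb[of x] ETb by linarith
  have ET: "ET = (\<Sum>k<m. s i k * g k)"
    unfolding ET_def T_def g_def
    by (subst Bochner_Integration.integral_sum) (auto intro!: integrable_mult_right G_integrable)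
  have iTG: "integrable (gauss_vec R) (\<lambda>x. T x * G x i i)"
  proof (rule integrable_const_bound[where B="b * (1 / Im w)"])
    show "AE x in gauss_vec R. cmod (T x * G x i i) \<le> b * (1 / Im w)"
      unfolding norm_mult by (intro AE_I2 mult_mono Tb G_le i b0) auto
  qed measurable
  have "1 + w * g i + g i * (\<Sum>k<m. s i k * g k) = ET * g i - (LINT x|gauss_vec R. T x * G x i i)"
  proof -
    have "1 + w * g i = - (LINT x|gauss_vec R. T x * G x i i)"
      using dyson_equation[OF i] unfolding g_def T_def .
    thus ?thesis unfolding ET[symmetric] by (simp add: mult.commute)
  qed
  also have "\<dots> = - (LINT x|gauss_vec R. (T x - ET) * G x i i)"
    unfolding left_diff_distrib g_def using iTG G_integrable[OF i i] by simp
  also have "cmod \<dots> \<le> (LINT x|gauss_vec R. cmod ((T x - ET) * G x i i))"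
    unfolding norm_minus_cancel by (rule integral_norm_bound)
  also have "\<dots> \<le> (LINT x|gauss_vec R. cmod (T x - ET) * (1 / Im w))"
  proof (rule integral_mono)
    have i1: "integrable (gauss_vec R) (\<lambda>x. cmod (T x - ET))" by (rule integrable_const_bound[where B="2 * b"]) (use db in auto)
    thus "integrable (gauss_vec R) (\<lambda>x. cmod (T x - ET) * (1 / Im w))" by simp
    show "integrable (gauss_vec R) (\<lambda>x. cmod ((T x - ET) * G x i i))"
    proof (rule integrable_const_bound[where B="2 * b * (1 / Im w)"])
      show "AE x in gauss_vec R. norm (cmod ((T x - ET) * G x i i)) \<le> 2 * b * (1 / Im w)"
        unfolding norm_mult real_norm_def abs_norm_cancel abs_mult using b0 by (intro AE_I2 mult_mono db G_le i) auto
    qed measurable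
    show "cmod ((T x - ET) * G x i i) \<le> cmod (T x - ET) * (1 / Im w)" for x
      unfolding norm_mult by (intro mult_left_mono G_le i) auto
  qed
  also have "\<dots> = (1 / Im w) * (LINT x|gauss_vec R. cmod (T x - ET))" by (subst integral_mult_left_zero) (rule mult.commute)
  also have "\<dots> \<le> (1 / Im w) * sqrt (LINT x|gauss_vec R. (cmod (T x - ET))\<^sup>2)"
    using w by (intro mult_left_mono mean_abs_le_sqrt_second_moment[OF prob_gauss_vec _ db]) auto
  also have "\<dots> \<le> (1 / Im w) * sqrt (real (card R) * (2 * \<tau> * D / (Im w)\<^sup>2)\<^sup>2)"
    using w weighted_trace_variance[of "\<lambda>k. complex_of_real (s i k)" D] sD
    unfolding ET_def T_def by (intro mult_left_mono real_sqrt_le_mono) auto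
  also have "sqrt (real (card R) * (2 * \<tau> * D / (Im w)\<^sup>2)\<^sup>2) = sqrt (real (card R)) * (2 * \<tau> * D / (Im w)\<^sup>2)"
    using \<tau> D0 by (simp add: real_sqrt_mult)
  finally show ?thesis .
qed

end

end

section \<open>The Stieltjes kernel\<close>

definition unit_measure :: "real measure" where
  "unit_measure = density lborel (\<lambda>x. ennreal (indicator {0..1} x))"

lemma sets_unit_measure [simp, measurable_cong]: "sets unit_measure = sets borel"
  unfolding unit_measure_def by simp

lemma prob_unit_measure: "prob_space unit_measure"
proof
  have "emeasure unit_measure UNIV = (\<integral>\<^sup>+x. indicator {0..1::real} x \<partial>lborel)"
    unfolding unit_measure_def by (subst emeasure_density) (auto intro!: nn_integral_cong split: split_indicator simp del: nn_integral_indicator)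
  also have "\<dots> = 1" by simp
  finally have "emeasure unit_measure UNIV = 1" .
  thus "emeasure unit_measure (space unit_measure) = 1" by (simp add: unit_measure_def)
qed

lemma AE_unit_measure: "AE x in unit_measure. x \<in> {0..1}"
  unfolding unit_measure_def by (subst AE_density) (auto split: split_indicator)

lemma set_integral_unit:
  fixes f :: "real => complex"
  assumes "f \<in> borel_measurable borel"
  shows "(LINT u:{0..1}|lborel. f u) = (LINT u|unit_measure. f u)"
  unfolding unit_measure_def set_lebesgue_integral_def using assms by (subst integral_density) auto

lemma unit_integral_indicator:
  fixes f :: "real => complex"
  assumes [measurable]: "f \<in> borel_measurable borel"
  shows "(LINT u|unit_measure. indicator {0..1} u * f u) = (LINT u|unit_measure. f u)"
proof (rule integral_cong_AE)
  show "AE u in unit_measure. indicator {0..1} u * f u = f u" using AE_unit_measure by eventually_elim simp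
qed measurable

locale unit_profile = profile_equation unit_measure "\<lambda>u t. (cmod (\<Phi> u t))\<^sup>2" K c for \<Phi> :: "real => real => complex" and K c +
  assumes cont_\<Phi>: "\<And>t. continuous_on UNIV (\<lambda>u. \<Phi> u t)"
begin

interpretation prob_space unit_measure by (rule prob_lam)

definition kernel_average :: "(real set => complex) => real => complex" where
  "kernel_average \<nu> t = of_real c * cm_set_integral \<nu> {0..1} (\<lambda>x. complex_of_real ((cmod (\<Phi> x t))\<^sup>2))"

text \<open>A solution of the kernel equation has this density on the unit interval.\<close>

definition kernel_density :: "(real set => complex) => complex => real => complex" where
  "kernel_density \<nu> z u = 1 / (- z + (LINT t|unit_measure. of_real ((cmod (\<Phi> u t))\<^sup>2) / (1 + kernel_average \<nu> t)))"

lemma kernel_average_measurable: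
  assumes "complex_measure \<nu>" shows "kernel_average \<nu> \<in> borel_measurable borel"
proof -
  have "(\<lambda>(x, t). indicator {0..1} x * complex_of_real ((cmod (\<Phi> x t))\<^sup>2)) \<in> borel_measurable (borel \<Otimes>\<^sub>M borel)"
    unfolding case_prod_beta' by measurable
  from borel_measurable_cm_integral[OF assms this] show ?thesis
    unfolding kernel_average_def cm_set_integral_def by measurable
qed

lemma kernel_density_measurable:
  assumes "complex_measure \<nu>" shows "kernel_density \<nu> z \<in> borel_measurable borel"
proof -
  note [measurable] = kernel_average_measurable[OF assms]
  show ?thesis unfolding kernel_density_def by measurable
qed

lemma kernel_equation_iff:
  assumes \<nu>: "complex_measure \<nu>"
  shows "kernel_equation c \<Phi> \<nu> z \<longleftrightarrow> (\<forall>g. continuous_on {0..1} g \<longrightarrow>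
    cm_set_integral \<nu> {0..1} g = (LINT u|unit_measure. (indicator {0..1} u * g u) * kernel_density \<nu> z u))"
proof -
  note [measurable] = kernel_average_measurable[OF \<nu>] kernel_density_measurable[OF \<nu>]
  have "(LINT u:{0..1}|lborel. g u / (- z + (LINT t:{0..1}|lborel. complex_of_real ((cmod (\<Phi> u t))\<^sup>2) /
      (1 + complex_of_real c * cm_set_integral \<nu> {0..1} (\<lambda>x. complex_of_real ((cmod (\<Phi> x t))\<^sup>2))))))
    = (LINT u|unit_measure. (indicator {0..1} u * g u) * kernel_density \<nu> z u)" if g: "continuous_on {0..1} g" for g :: "real => complex"
  proof -
    have "(\<lambda>u. indicator {0..1} u *\<^sub>R g u) \<in> borel_measurable borel"
      by (rule borel_measurable_continuous_on_indicator[OF _ g]) simp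
    moreover have "(\<lambda>u. indicator {0..1} u *\<^sub>R g u) = (\<lambda>u. indicator {0..1} u * g u)" by (auto split: split_indicator)
    ultimately have [measurable]: "(\<lambda>u. indicator {0..1} u * g u) \<in> borel_measurable borel" by simp
    have "(LINT t:{0..1}|lborel. complex_of_real ((cmod (\<Phi> u t))\<^sup>2) / (1 + kernel_average \<nu> t))
       = (LINT t|unit_measure. complex_of_real ((cmod (\<Phi> u t))\<^sup>2) / (1 + kernel_average \<nu> t))" for u
      by (rule set_integral_unit) measurable
    hence "(LINT u:{0..1}|lborel. g u / (- z + (LINT t:{0..1}|lborel. complex_of_real ((cmod (\<Phi> u t))\<^sup>2) / (1 + kernel_average \<nu> t))))
      = (LINT u:{0..1}|lborel. (indicator {0..1} u * g u) * kernel_density \<nu> z u)"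
      unfolding kernel_density_def set_lebesgue_integral_def
      by (intro Bochner_Integration.integral_cong refl) (auto split: split_indicator)
    also have "\<dots> = (LINT u|unit_measure. (indicator {0..1} u * g u) * kernel_density \<nu> z u)"
      by (rule set_integral_unit) measurable
    finally show ?thesis unfolding kernel_average_def .
  qed
  thus ?thesis unfolding kernel_equation_def by auto
qed

lemma continuous_profile: "continuous_on A (\<lambda>u. complex_of_real ((cmod (\<Phi> u t))\<^sup>2))"
  by (intro continuous_intros continuous_on_subset[OF cont_\<Phi>]) auto

lemma profile_measurable_fst [measurable]: "(\<lambda>u. complex_of_real ((cmod (\<Phi> u t))\<^sup>2)) \<in> borel_measurable borel"
  by (intro borel_measurable_continuous_onI continuous_profile)

text \<open>High above the real axis the bound on the mass of a kernel places its density where the profile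
  equation has a unique solution.\<close>

lemma stieltjes_kernel_large:
  assumes \<rho>: "stieltjes_kernel \<rho>" and supp: "cm_support (\<rho> z) \<subseteq> {0..1}" and eq: "kernel_equation c \<Phi> (\<rho> z) z"
    and z: "8 * K \<le> Im z"
  shows "kernel_density (\<rho> z) z \<in> borel_measurable borel"
    "cmod (column_average (kernel_density (\<rho> z) z) t) \<le> 1/2"
    "kernel_density (\<rho> z) z u = profile_step z (kernel_density (\<rho> z) z) u"
proof -
  have y: "Im z > 0" using z K1 by linarith
  have cm: "complex_measure (\<rho> z)" using \<rho> y unfolding stieltjes_kernel_def by blast
  show meas: "kernel_density (\<rho> z) z \<in> borel_measurable borel" by (rule kernel_density_measurable[OF cm])
  note [measurable] = meas
  have ka: "kernel_average (\<rho> z) t = column_average (kernel_density (\<rho> z) z) t" for t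
  proof -
    have "cm_set_integral (\<rho> z) {0..1} (\<lambda>x. complex_of_real ((cmod (\<Phi> x t))\<^sup>2))
      = (LINT x|unit_measure. (indicator {0..1} x * complex_of_real ((cmod (\<Phi> x t))\<^sup>2)) * kernel_density (\<rho> z) z x)"
      using eq continuous_profile unfolding kernel_equation_iff[OF cm] by blast
    also have "\<dots> = (LINT x|unit_measure. indicator {0..1} x * (complex_of_real ((cmod (\<Phi> x t))\<^sup>2) * kernel_density (\<rho> z) z x))"
      by (simp only: mult.assoc)
    also have "\<dots> = (LINT x|unit_measure. complex_of_real ((cmod (\<Phi> x t))\<^sup>2) * kernel_density (\<rho> z) z x)"
      by (rule unit_integral_indicator) measurable
    finally show ?thesis unfolding kernel_average_def column_average_def by simp
  qed
  have "cmod (kernel_average (\<rho> z) t) \<le> 1/2" for t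
  proof -
    let ?f = "\<lambda>x. complex_of_real ((cmod (\<Phi> x t))\<^sup>2)"
    have fb: "cmod (?f x) \<le> K" for x using \<sigma>_le[of x t] \<sigma>_nonneg[of x t] by (simp only: norm_of_real abs_of_nonneg)
    have "?f \<in> bcontfun" using fb continuous_profile by (auto simp: bcontfun_def bounded_iff)
    hence app: "apply_bcontfun (Bcontfun ?f) = ?f" by (rule Bcontfun_inverse)
    have nb: "norm (Bcontfun ?f) \<le> K" by (rule norm_bound) (use app fb in simp)
    have "cmod (cm_integral (\<rho> z) (apply_bcontfun (Bcontfun ?f))) \<le> norm (Bcontfun ?f) / Im z"
      using \<rho> y unfolding stieltjes_kernel_def by blast
    also have "\<dots> \<le> K / (8 * K)" using nb z K1 by (intro frac_le) auto
    also have "\<dots> \<le> 1/2" using K1 by simp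
    finally have *: "cmod (cm_integral (\<rho> z) ?f) \<le> 1/2" unfolding app .
    have "cm_set_integral (\<rho> z) {0..1} ?f = cm_integral (\<rho> z) ?f"
      by (rule cm_integral_support[OF cm supp _ profile_measurable_fst, symmetric]) simp
    hence "cmod (kernel_average (\<rho> z) t) \<le> 1 * cmod (cm_integral (\<rho> z) ?f)"
      unfolding kernel_average_def norm_mult using c01 by (simp add: mult_left_le_one_le)
    thus ?thesis using * by simp
  qed
  thus "cmod (column_average (kernel_density (\<rho> z) z) t) \<le> 1/2" unfolding ka[symmetric] .
  show "kernel_density (\<rho> z) z u = profile_step z (kernel_density (\<rho> z) z) u"
    unfolding profile_step_def ka[symmetric] by (rule kernel_density_def)
qed

text \<open>The solution of the profile equation is the density of a kernel. Conversely, the density of any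
  kernel is this solution high above the real axis, and the analyticity of the integrals of test
  functions carries the agreement to the whole half plane.\<close>

theorem stieltjes_kernel_exists_unique:
  obtains \<pi> m where "\<And>u. (\<lambda>z. m z u) holomorphic_on \<complex>\<^sup>+"
    "\<And>z. Im z > 0 \<Longrightarrow> herglotz_class z (m z)"
    "\<And>z u. Im z > 0 \<Longrightarrow> m z u = profile_step z (m z) u"
    "stieltjes_kernel \<pi>" "\<And>z. Im z > 0 \<Longrightarrow> cm_support (\<pi> z) \<subseteq> {0..1}"
    "\<And>z. Im z > 0 \<Longrightarrow> kernel_equation c \<Phi> (\<pi> z) z"
    "\<And>\<rho> z A. stieltjes_kernel \<rho> \<Longrightarrow> (\<And>z. Im z > 0 \<Longrightarrow> cm_support (\<rho> z) \<subseteq> {0..1}) \<Longrightarrow>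
       (\<And>z. Im z > 0 \<Longrightarrow> kernel_equation c \<Phi> (\<rho> z) z) \<Longrightarrow> Im z > 0 \<Longrightarrow> A \<in> sets borel \<Longrightarrow> \<rho> z A = \<pi> z A"
    "\<And>z. Im z > 0 \<Longrightarrow> cm_set_integral (\<pi> z) {0..1} (\<lambda>_. 1) = (LINT u|unit_measure. m z u)"
    "(\<lambda>z. LINT u|unit_measure. m z u) holomorphic_on \<complex>\<^sup>+"
proof -
  obtain m where hol: "\<And>u. (\<lambda>z. m z u) holomorphic_on \<complex>\<^sup>+" and H: "\<And>z. Im z > 0 \<Longrightarrow> herglotz_class z (m z)"
    and eq: "\<And>z u. Im z > 0 \<Longrightarrow> m z u = profile_step z (m z) u" by (rule profile_equation_solvable) blast
  define \<pi> where "\<pi> z = (\<lambda>A. LINT u:A|unit_measure. m z u)" for z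
  have mm [measurable]: "m z \<in> borel_measurable borel" and mI: "0 \<le> Im (m z u)" "0 \<le> Im (z * m z u)" and mb: "cmod (m z u) \<le> 1 / Im z"
    if "Im z > 0" for z u using H[OF that] unfolding herglotz_class_def by blast+
  have mi: "integrable unit_measure (m z)" if "Im z > 0" for z
    by (rule integrable_bounded[OF mm mb]) (use that in auto)
  have cm: "complex_measure (\<pi> z)" if "Im z > 0" for z
    unfolding \<pi>_def by (rule complex_measure_density[OF sets_unit_measure mi[OF that]])
  have int: "cm_integral (\<pi> z) g = (LINT u|unit_measure. g u * m z u)"
    if "Im z > 0" "g \<in> borel_measurable borel" "\<And>x. cmod (g x) \<le> b" for z g b
    unfolding \<pi>_def by (rule cm_integral_density[OF sets_unit_measure mi[OF that(1)] that(2,3)])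
  have supp: "cm_support (\<pi> z) \<subseteq> {0..1}" if "Im z > 0" for z
    unfolding \<pi>_def using that by (intro cm_support_density AE_unit_measure) auto
  have set_int: "cm_set_integral (\<pi> z) {0..1} g = (LINT u|unit_measure. (indicator {0..1} u * g u) * m z u)"
    if z: "Im z > 0" and g: "continuous_on {0..1} g" for z g
  proof -
    have "(\<lambda>u. indicator {0..1} u *\<^sub>R g u) \<in> borel_measurable borel"
      by (rule borel_measurable_continuous_on_indicator[OF _ g]) simp
    moreover have "(\<lambda>u. indicator {0..1} u *\<^sub>R g u) = (\<lambda>u. indicator {0..1} u * g u)" by (auto split: split_indicator)
    ultimately have m: "(\<lambda>u. indicator {0..1} u * g u) \<in> borel_measurable borel" by simp
    have "bounded (g ` {0..1})" using g by (intro compact_imp_bounded compact_continuous_image) auto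
    then obtain b where b: "\<And>x. x \<in> {0..1} \<Longrightarrow> cmod (g x) \<le> b" unfolding bounded_iff by blast
    have "cmod (indicator {0..1} x * g x) \<le> \<bar>b\<bar>" for x
      using b[of x] by (auto split: split_indicator)
    from int[OF z m this] show ?thesis unfolding cm_set_integral_def .
  qed
  have ka: "kernel_average (\<pi> z) t = column_average (m z) t" if z: "Im z > 0" for z t
  proof -
    note [measurable] = mm[OF z]
    have "cm_set_integral (\<pi> z) {0..1} (\<lambda>x. complex_of_real ((cmod (\<Phi> x t))\<^sup>2))
      = (LINT x|unit_measure. indicator {0..1} x * (complex_of_real ((cmod (\<Phi> x t))\<^sup>2) * m z x))"
      using set_int[OF z continuous_profile] by (simp only: mult.assoc)
    also have "\<dots> = (LINT x|unit_measure. complex_of_real ((cmod (\<Phi> x t))\<^sup>2) * m z x)"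
      by (rule unit_integral_indicator) measurable
    finally show ?thesis unfolding kernel_average_def column_average_def by simp
  qed
  have kd: "kernel_density (\<pi> z) z u = m z u" if z: "Im z > 0" for z u
    unfolding eq[OF z, of u] profile_step_def ka[OF z, symmetric] by (rule kernel_density_def)
  have keq: "kernel_equation c \<Phi> (\<pi> z) z" if z: "Im z > 0" for z
    unfolding kernel_equation_iff[OF cm[OF z]] using set_int[OF z] kd[OF z] by simp
  have total: "cm_set_integral (\<pi> z) {0..1} (\<lambda>_. 1) = (LINT u|unit_measure. m z u)" if z: "Im z > 0" for z
    using set_int[OF z, of "\<lambda>_. 1"] unit_integral_indicator[OF mm[OF z]] by simp
  have op: "open \<complex>\<^sup>+" by (rule open_halfspace_Im_gt)
  have fin: "finite_measure unit_measure" by (rule finite_measure_axioms)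
  have ihol: "(\<lambda>z. LINT u|unit_measure. g u * m z u) holomorphic_on \<complex>\<^sup>+"
    if g: "g \<in> borel_measurable borel" "\<And>x. cmod (g x) \<le> b" for g b
  proof (rule integral_holomorphic[OF fin op, where B="\<lambda>z. b * (1 / Im z)"])
    note [measurable] = g(1)
    show "(\<lambda>z. g u * m z u) holomorphic_on \<complex>\<^sup>+" for u by (intro holomorphic_intros hol)
    show "continuous_on \<complex>\<^sup>+ (\<lambda>z. b * (1 / Im z))" by (intro continuous_intros) auto
    show "cmod (g u * m z u) \<le> b * (1 / Im z)" if "z \<in> \<complex>\<^sup>+" for z u
      unfolding norm_mult using that g(2) order_trans[OF norm_ge_zero g(2)[of 0]] by (intro mult_mono mb) auto
    fix z assume "z \<in> \<complex>\<^sup>+"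
    hence [measurable]: "m z \<in> borel_measurable borel" using mm by simp
    show "(\<lambda>u. g u * m z u) \<in> borel_measurable unit_measure" by measurable
  qed
  have bc: "apply_bcontfun g \<in> borel_measurable borel" "cmod (apply_bcontfun g x) \<le> norm g" for g :: "real \<Rightarrow>\<^sub>C complex" and x
    by (auto intro: borel_measurable_continuous_onI norm_bounded)
  have bcr: "(\<lambda>x. complex_of_real (apply_bcontfun g x)) \<in> borel_measurable borel" "cmod (complex_of_real (apply_bcontfun g x)) \<le> norm g" for g :: "real \<Rightarrow>\<^sub>C real" and x
    using norm_bounded[of g x] by (auto intro!: borel_measurable_continuous_onI continuous_intros)
  have sk: "stieltjes_kernel \<pi>" unfolding stieltjes_kernel_def
  proof (intro conjI ballI allI impI)
    show "complex_measure (\<pi> z)" if "z \<in> \<complex>\<^sup>+" for z using cm that by blast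
    fix g :: "real \<Rightarrow>\<^sub>C complex"
    show "cmod (cm_integral (\<pi> z) (apply_bcontfun g)) \<le> norm g / Im z" if "z \<in> \<complex>\<^sup>+" for z
    proof -
      have z: "Im z > 0" using that by simp
      have "cmod (LINT u|unit_measure. g u * m z u) \<le> norm g * (1 / Im z)"
      proof (rule integral_bounded)
        show "cmod (apply_bcontfun g u * m z u) \<le> norm g * (1 / Im z)" for u
          unfolding norm_mult using z by (intro mult_mono bc mb) auto
      qed
      thus ?thesis using int[OF z bc] by simp
    qed
    show "(\<lambda>z. cm_integral (\<pi> z) (apply_bcontfun g)) analytic_on \<complex>\<^sup>+"
      unfolding analytic_on_open[OF op]
      by (rule holomorphic_transform[OF ihol[OF bc]]) (use int[OF _ bc] in auto)
  next
    fix z and g :: "real \<Rightarrow>\<^sub>C real" assume z': "z \<in> \<complex>\<^sup>+" and g: "\<forall>x. 0 \<le> apply_bcontfun g x"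
    have z: "Im z > 0" using z' by simp
    have i: "cm_integral (\<pi> z) (\<lambda>x. complex_of_real (apply_bcontfun g x)) = (LINT u|unit_measure. complex_of_real (apply_bcontfun g u) * m z u)"
      by (rule int[OF z bcr])
    show "0 \<le> Im (cm_integral (\<pi> z) (\<lambda>x. complex_of_real (apply_bcontfun g x)))"
      unfolding i by (rule integral_Im_nonneg) (use g mI(1)[OF z] in \<open>simp only: Im_of_real_mult mult_nonneg_nonneg\<close>)
    have "z * (LINT u|unit_measure. complex_of_real (apply_bcontfun g u) * m z u) = (LINT u|unit_measure. complex_of_real (apply_bcontfun g u) * (z * m z u))"
      by (simp only: integral_mult_right_zero[symmetric] mult.left_commute)
    moreover have "0 \<le> Im (LINT u|unit_measure. complex_of_real (apply_bcontfun g u) * (z * m z u))"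
      by (rule integral_Im_nonneg) (use g mI(2)[OF z] in \<open>simp only: Im_of_real_mult mult_nonneg_nonneg\<close>)
    ultimately show "0 \<le> Im (z * cm_integral (\<pi> z) (\<lambda>x. complex_of_real (apply_bcontfun g x)))" unfolding i by simp
  qed
  have uniq: "\<rho> z A = \<pi> z A"
    if \<rho>: "stieltjes_kernel \<rho>" "\<And>z. Im z > 0 \<Longrightarrow> cm_support (\<rho> z) \<subseteq> {0..1}" "\<And>z. Im z > 0 \<Longrightarrow> kernel_equation c \<Phi> (\<rho> z) z"
      and z: "Im z > 0" and A: "A \<in> sets borel" for \<rho> z A
  proof (rule complex_measure_eqI[OF _ cm[OF z] _ A])
    have cm\<rho>: "complex_measure (\<rho> z)" if "Im z > 0" for z using \<rho>(1) that unfolding stieltjes_kernel_def by blast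
    show "complex_measure (\<rho> z)" by (rule cm\<rho>[OF z])
    fix g :: "real => real" assume g: "continuous_on UNIV g" "\<forall>x. 0 \<le> g x \<and> g x \<le> 1"
    let ?f = "\<lambda>x. complex_of_real (g x)"
    have fc: "continuous_on A ?f" for A using g(1) by (intro continuous_intros) (auto intro: continuous_on_subset)
    have fb: "cmod (?f x) \<le> 1" for x using g(2) by simp
    have "?f \<in> bcontfun" using fb fc by (auto simp: bcontfun_def bounded_iff)
    hence app: "apply_bcontfun (Bcontfun ?f) = ?f" by (rule Bcontfun_inverse)
    have large: "cm_integral (\<rho> v) ?f = cm_integral (\<pi> v) ?f" if v: "8 * K < Im v" for v
    proof -
      have v0: "Im v > 0" "8 * K \<le> Im v" using v K1 by linarith+
      note L = stieltjes_kernel_large[OF \<rho>(1) \<rho>(2)[OF v0(1)] \<rho>(3)[OF v0(1)] v0(2)]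
      have kdm: "kernel_density (\<rho> v) v = m v"
      proof
        fix u
        show "kernel_density (\<rho> v) v u = m v u"
          by (rule profile_equation_unique[OF v0(2) L(1)], rule L(2), rule L(3), rule mm[OF v0(1)],
              rule herglotz_column_average[OF v0(2) H[OF v0(1)]], rule eq[OF v0(1)])
      qed
      have "cm_integral (\<rho> v) ?f = cm_set_integral (\<rho> v) {0..1} ?f"
        by (rule cm_integral_support[OF cm\<rho>[OF v0(1)] \<rho>(2)[OF v0(1)]]) (auto intro: borel_measurable_continuous_onI fc)
      also have "\<dots> = cm_set_integral (\<pi> v) {0..1} ?f"
        using \<rho>(3)[OF v0(1)] fc set_int[OF v0(1) fc] unfolding kernel_equation_iff[OF cm\<rho>[OF v0(1)]] kdm by simp
      also have "\<dots> = cm_integral (\<pi> v) ?f"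
        by (rule cm_integral_support[OF cm[OF v0(1)] supp[OF v0(1)], symmetric]) (auto intro: borel_measurable_continuous_onI fc)
      finally show ?thesis .
    qed
    have an: "(\<lambda>z. cm_integral (\<rho>' z) ?f) holomorphic_on \<complex>\<^sup>+" if "stieltjes_kernel \<rho>'" for \<rho>'
    proof -
      have "(\<lambda>z. cm_integral (\<rho>' z) (apply_bcontfun (Bcontfun ?f))) analytic_on \<complex>\<^sup>+"
        using that unfolding stieltjes_kernel_def by blast
      thus ?thesis unfolding analytic_on_open[OF op] app .
    qed
    show "cm_integral (\<rho> z) ?f = cm_integral (\<pi> z) ?f"
    proof (rule analytic_continuation_open[of "{z. 8 * K < Im z}" "\<complex>\<^sup>+" "\<lambda>z. cm_integral (\<rho> z) ?f" "\<lambda>z. cm_integral (\<pi> z) ?f"])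
      show "open {z. 8 * K < Im z}" by (rule open_halfspace_Im_gt)
      show "{z. 8 * K < Im z} \<noteq> {}" by (auto intro!: exI[of _ "Complex 0 (8 * K + 1)"])
      show "connected \<complex>\<^sup>+" by (intro convex_connected convex_halfspace_Im_gt)
      show "{z. 8 * K < Im z} \<subseteq> \<complex>\<^sup>+" using K1 by auto
    qed (use op an[OF \<rho>(1)] an[OF sk] large z in auto)
  qed
  have h1: "(\<lambda>z. LINT u|unit_measure. m z u) holomorphic_on \<complex>\<^sup>+" using ihol[of "\<lambda>_. 1" 1] by simp
  show thesis by (rule that[of m \<pi>]) (fact hol H eq sk supp keq uniq total h1)+
qed

end

section \<open>Absolutely convergent series as integrals\<close>

lemma infsum_eq_integral:
  fixes f :: "'a => 'b::{banach, second_countable_topology}"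
  assumes "(\<lambda>k. norm (f k)) summable_on UNIV"
  shows "integrable (count_space UNIV) f" and "infsum f UNIV = (LINT k|count_space UNIV. f k)"
proof -
  have a: "Infinite_Set_Sum.abs_summable_on f UNIV" using assms abs_summable_equivalent by blast
  thus "integrable (count_space UNIV) f" by (simp add: Infinite_Set_Sum.abs_summable_on_def)
  show "infsum f UNIV = (LINT k|count_space UNIV. f k)"
    using infsetsum_infsum[OF a] by (simp add: infsetsum_def)
qed

definition unit_char :: "real => complex" where
  "unit_char t = exp (2 * of_real pi * \<i> * of_real t)"

lemma norm_unit_char [simp]: "cmod (unit_char t) = 1"
  unfolding unit_char_def by (simp add: norm_exp_eq_Re)

lemma unit_char_add: "unit_char (s + t) = unit_char s * unit_char t"
  unfolding unit_char_def by (simp add: exp_add[symmetric] algebra_simps)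

lemma unit_char_0 [simp]: "unit_char 0 = 1" unfolding unit_char_def by simp

lemma unit_char_cnj: "cnj (unit_char t) = unit_char (- t)"
  unfolding unit_char_def by (simp add: exp_cnj)

lemma unit_char_eq_1_iff: "unit_char t = 1 \<longleftrightarrow> t \<in> \<int>"
proof -
  have "unit_char t = 1 \<longleftrightarrow> (\<exists>n::int. 2 * pi * t = of_int (2 * n) * pi)"
    unfolding unit_char_def exp_eq_1 by simp
  also have "\<dots> \<longleftrightarrow> (\<exists>n::int. t = of_int n)" by simp
  also have "\<dots> \<longleftrightarrow> t \<in> \<int>" by (auto simp: Ints_def)
  finally show ?thesis .
qed

lemma unit_char_of_int [simp]: "unit_char (of_int k) = 1"
  by (simp add: unit_char_eq_1_iff)

lemma unit_char_power: "unit_char t ^ k = unit_char (real k * t)"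
  by (induction k) (simp_all add: unit_char_add[symmetric] algebra_simps)

lemma continuous_unit_char [continuous_intros]: "continuous_on A f \<Longrightarrow> continuous_on A (\<lambda>x. unit_char (f x))"
  unfolding unit_char_def by (intro continuous_intros)

lemma sum_unit_char:
  assumes N: "N > 0"
  shows "(\<Sum>p<N. unit_char (of_int d * real p / real N)) = (if int N dvd d then of_nat N else 0)"
proof -
  define z where "z = unit_char (of_int d / real N)"
  have pw: "unit_char (of_int d * real p / real N) = z ^ p" for p
    unfolding z_def unit_char_power by (simp add: mult.commute)
  have zN: "z ^ N = 1" using N pw[of N] by simp
  have dv: "z = 1 \<longleftrightarrow> int N dvd d"
  proof -
    have "of_int d / real N \<in> \<int> \<longleftrightarrow> int N dvd d"
    proof
      assume "of_int d / real N \<in> \<int>"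
      then obtain k :: int where "of_int d / real N = of_int k" by (auto simp: Ints_def)
      hence "real_of_int d = of_int (k * int N)" using N by (simp add: field_simps)
      hence "d = k * int N" by (simp only: of_int_eq_iff)
      thus "int N dvd d" by simp
    next
      assume "int N dvd d"
      then obtain k where "d = int N * k" by (auto simp: dvd_def)
      thus "of_int d / real N \<in> \<int>" using N by simp
    qed
    thus ?thesis unfolding z_def unit_char_eq_1_iff .
  qed
  show ?thesis
  proof (cases "z = 1")
    case True thus ?thesis using dv unfolding pw by simp
  next
    case False
    hence "(\<Sum>p<N. z ^ p) = (z ^ N - 1) / (z - 1)" by (rule geometric_sum)
    thus ?thesis using False dv zN unfolding pw by simp
  qed
qed

lemma sum_unit_char_diff:
  assumes "i < N" "b < N"
  shows "(\<Sum>p<N. unit_char (real i * real p / real N) * cnj (unit_char (real b * real p / real N))) = (if i = b then of_nat N else 0)"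
proof -
  have "(\<Sum>p<N. unit_char (real i * real p / real N) * cnj (unit_char (real b * real p / real N)))
     = (\<Sum>p<N. unit_char (of_int (int i - int b) * real p / real N))"
    by (intro sum.cong refl) (simp add: unit_char_cnj unit_char_add[symmetric] left_diff_distrib diff_divide_distrib)
  also have "\<dots> = (if int N dvd int i - int b then of_nat N else 0)" using assms by (intro sum_unit_char) auto
  also have "int N dvd int i - int b \<longleftrightarrow> i = b"
  proof
    assume d: "int N dvd int i - int b"
    show "i = b"
    proof (rule ccontr)
      assume "i \<noteq> b"
      hence "int i - int b \<noteq> 0" by simp
      with d have "\<bar>int N\<bar> \<le> \<bar>int i - int b\<bar>" by (rule dvd_imp_le_int[rotated])
      thus False using assms by linarith
    qed
  qed simp
  finally show ?thesis .
qed

text \<open>Orthogonality of the characters, as the polarized Parseval identity.\<close>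

lemma parseval:
  assumes N: "N > 0"
  shows "(\<Sum>a<N. (\<Sum>j<N. unit_char (real j * real a / real N) / sqrt N * x j) * cnj (\<Sum>j<N. unit_char (real j * real a / real N) / sqrt N * y j))
    = (\<Sum>j<N. x j * cnj (y j))"
proof -
  have sq: "complex_of_real (sqrt (real N)) * complex_of_real (sqrt (real N)) = of_nat N"
    by (simp add: of_real_mult[symmetric] del: of_real_mult)
  have "(\<Sum>a<N. (\<Sum>j<N. unit_char (real j * real a / real N) / sqrt N * x j) * cnj (\<Sum>k<N. unit_char (real k * real a / real N) / sqrt N * y k))
    = (\<Sum>a<N. \<Sum>j<N. \<Sum>k<N. (x j * cnj (y k) / of_nat N) * (unit_char (real j * real a / real N) * cnj (unit_char (real k * real a / real N))))"
    unfolding cnj_sum sum_product by (intro sum.cong refl) (simp add: sq)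
  also have "\<dots> = (\<Sum>j<N. \<Sum>k<N. \<Sum>a<N. (x j * cnj (y k) / of_nat N) * (unit_char (real j * real a / real N) * cnj (unit_char (real k * real a / real N))))"
    by (rule trans[OF sum.swap], rule sum.cong[OF refl], rule sum.swap)
  also have "\<dots> = (\<Sum>j<N. \<Sum>k<N. if j = k then x j * cnj (y j) else 0)"
    unfolding sum_distrib_left[symmetric] using N by (intro sum.cong refl) (simp add: sum_unit_char_diff)
  also have "\<dots> = (\<Sum>j<N. x j * cnj (y j))" by simp
  finally show ?thesis .
qed

section \<open>The filter and its Fourier transform\<close>

locale summable_filter =
  fixes h :: "int \<times> int => complex"
  assumes h_summable: "(\<lambda>k. cmod (h k)) summable_on UNIV"
begin

definition S :: real where "S = infsum (\<lambda>k. cmod (h k)) UNIV"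

lemma S_nonneg: "0 \<le> S" unfolding S_def by (rule infsum_nonneg) simp

lemma h_integrable: "integrable (count_space UNIV) h" "integrable (count_space UNIV) (\<lambda>k. cmod (h k))"
  using infsum_eq_integral(1)[OF h_summable] by auto

lemma S_eq: "S = (LINT k|count_space UNIV. cmod (h k))"
  unfolding S_def by (rule infsum_eq_integral(2)) (use h_summable in simp)

lemma S_ennreal: "(\<integral>\<^sup>+k. ennreal (cmod (h k)) \<partial>count_space UNIV) = ennreal S"
  unfolding S_eq by (rule nn_integral_eq_integral[OF h_integrable(2)]) simp

lemma bounded_multiple_summable:
  assumes "\<And>k. cmod (g k) \<le> b"
  shows "(\<lambda>k. cmod (h k * g k)) summable_on UNIV"
proof (rule summable_on_comparison_test)
  show "(\<lambda>k. b * cmod (h k)) summable_on UNIV" by (intro summable_on_cmult_right h_summable)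
  show "cmod (h k * g k) \<le> b * cmod (h k)" for k
    using assms[of k] by (simp add: norm_mult mult.commute mult_right_mono)
qed auto

lemma bounded_multiple_integral_le:
  assumes "\<And>k. cmod (g k) \<le> b"
  shows "integrable (count_space UNIV) (\<lambda>k. h k * g k)" "cmod (LINT k|count_space UNIV. h k * g k) \<le> S * b"
proof -
  show i: "integrable (count_space UNIV) (\<lambda>k. h k * g k)"
    by (rule infsum_eq_integral(1)[OF bounded_multiple_summable[OF assms]])
  have "cmod (LINT k|count_space UNIV. h k * g k) \<le> (LINT k|count_space UNIV. cmod (h k * g k))" by (rule integral_norm_bound)
  also have "\<dots> \<le> (LINT k|count_space UNIV. cmod (h k) * b)"
  proof (rule integral_mono)
    show "integrable (count_space UNIV) (\<lambda>k. cmod (h k * g k))" by (rule integrable_norm[OF i])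
    show "integrable (count_space UNIV) (\<lambda>k. cmod (h k) * b)" by (rule integrable_mult_left) (rule h_integrable)
    show "cmod (h k * g k) \<le> cmod (h k) * b" for k using assms[of k] by (simp add: norm_mult mult_left_mono)
  qed
  finally show "cmod (LINT k|count_space UNIV. h k * g k) \<le> S * b" unfolding S_eq using h_integrable by simp
qed

lemma Phi_integral:
  "Phi h u t = (LINT l|count_space UNIV. h l * unit_char (of_int (fst l) * u - of_int (snd l) * t))"
proof -
  have "Phi h u t = infsum (\<lambda>l. h l * unit_char (of_int (fst l) * u - of_int (snd l) * t)) UNIV"
    unfolding Phi_def unit_char_def by (simp add: case_prod_beta')
  also have "\<dots> = (LINT l|count_space UNIV. h l * unit_char (of_int (fst l) * u - of_int (snd l) * t))"
    by (rule infsum_eq_integral(2)[OF bounded_multiple_summable[where b=1]]) simp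
  finally show ?thesis .
qed

lemma Phi_le: "cmod (Phi h u t) \<le> S"
  unfolding Phi_integral using bounded_multiple_integral_le(2)[of "\<lambda>l. unit_char (of_int (fst l) * u - of_int (snd l) * t)" 1] by simp

lemma Phi_continuous: "continuous_on UNIV (\<lambda>p. Phi h (fst p) (snd p))"
  unfolding continuous_on_sequentially comp_def
proof (intro allI ballI impI, elim conjE)
  fix X :: "nat => real \<times> real" and p assume X: "X \<longlonglongrightarrow> p"
  show "(\<lambda>n. Phi h (fst (X n)) (snd (X n))) \<longlonglongrightarrow> Phi h (fst p) (snd p)"
    unfolding Phi_integral
  proof (rule integral_dominated_convergence[where w="\<lambda>k. cmod (h k)"])
    show "integrable (count_space UNIV) (\<lambda>k. cmod (h k))" by (rule h_integrable)
    have "isCont unit_char t" for t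
      using continuous_unit_char[of UNIV "\<lambda>x. x"] by (simp add: continuous_on_eq_continuous_at)
    thus "AE l in count_space UNIV. (\<lambda>n. h l * unit_char (of_int (fst l) * fst (X n) - of_int (snd l) * snd (X n)))
       \<longlonglongrightarrow> h l * unit_char (of_int (fst l) * fst p - of_int (snd l) * snd p)"
      by (intro AE_I2 tendsto_intros isCont_tendsto_compose[of _ unit_char] tendsto_fst[OF X] tendsto_snd[OF X])
  qed (auto simp: norm_mult)
qed

lemma Phi_continuous': 
  assumes "continuous_on A f" "continuous_on A g" shows "continuous_on A (\<lambda>x. Phi h (f x) (g x))"
  using continuous_on_compose2[OF Phi_continuous, of A "\<lambda>x. (f x, g x)"] assms by (auto intro: continuous_on_Pair)

end

section \<open>The periodized matrix in the Fourier basis\<close>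

text \<open>Shifting modulo the size of the matrix makes the filter a circular convolution, which the Fourier
  transform diagonalizes: the transformed entries are independent Gaussian variables whose variances
  are samples of the squared modulus of the symbol.\<close>

locale filter_size = summable_filter +
  fixes N n :: nat
  assumes N: "N > 0" and n: "n > 0"
begin

definition index_set :: "(int \<times> int) set" where
  "index_set = {0..<int N} \<times> {0..<int n}"

lemma index_set_facts: "finite index_set" "card index_set = N * n" "index_set \<noteq> {}"
  unfolding index_set_def using N n by (auto simp: card_cartesian_product)

lemma sum_index_set: "(\<Sum>p\<in>index_set. f p) = (\<Sum>p<N. \<Sum>q<n. f (int p, int q))" for f :: "int \<times> int => 'b::comm_monoid_add"
proof -
  have r: "(\<Sum>p\<in>{0..<int M}. g p) = (\<Sum>p<M. g (int p))" for M and g :: "int => 'b"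
    by (rule sum.reindex_bij_betw[symmetric]) (auto simp: bij_betw_def inj_on_def image_int_atLeastLessThan[of 0, simplified] lessThan_atLeast0)
  show ?thesis unfolding index_set_def sum.cartesian_product' r ..
qed

definition plane_wave :: "int \<times> int => nat => nat => complex" where
  "plane_wave p a b = unit_char (real a * of_int (fst p) / real N) * unit_char (- (real b * of_int (snd p) / real n))"

lemma norm_plane_wave [simp]: "cmod (plane_wave p a b) = 1" unfolding plane_wave_def by (simp add: norm_mult)

lemma plane_wave_add: "plane_wave (fst p + fst q, snd p + snd q) a b = plane_wave p a b * plane_wave q a b"
  unfolding plane_wave_def by (simp add: unit_char_add[symmetric] algebra_simps add_divide_distrib)

lemma plane_wave_mod: "plane_wave (fst p mod int N, snd p mod int n) a b = plane_wave p a b"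
proof -
  have *: "unit_char (real a * of_int (x mod int M) / real M) = unit_char (real a * of_int x / real M)" if "M > 0" for a x M
  proof -
    have "real_of_int x = of_int (x mod int M) + real M * of_int (x div int M)"
      by (metis of_int_add of_int_mult of_int_of_nat_eq mod_mult_div_eq)
    hence "real a * of_int x / real M = real a * of_int (x mod int M) / real M + of_int (int a * (x div int M))"
      using that by (simp add: field_simps)
    thus ?thesis by (simp only: unit_char_add unit_char_of_int mult_1_right)
  qed
  show ?thesis unfolding plane_wave_def unit_char_cnj[symmetric] fst_conv snd_conv *[OF N] *[OF n] ..
qed

abbreviation symbol :: "nat => nat => complex" where
  "symbol a b \<equiv> Phi h (real a / real N) (real b / real n)"

text \<open>The coefficient of the variable at position \<open>p\<close> in the transformed entry \<open>(a, b)\<close>.\<close>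

definition fourier_coeff :: "int \<times> int => nat => nat => complex" where
  "fourier_coeff p a b = symbol a b * plane_wave p a b / of_real (real n * sqrt (real N))"

lemma Phi_plane_wave: "symbol a b = (LINT k|count_space UNIV. h k * plane_wave k a b)"
  unfolding Phi_integral plane_wave_def
  by (intro Bochner_Integration.integral_cong refl arg_cong2[where f="(*)"]) (simp add: unit_char_add[symmetric] mult.commute)

lemma fourier_orthogonality:
  assumes "a < N" "a' < N" "b < n" "b' < n"
  shows "(\<Sum>p\<in>index_set. fourier_coeff p a b * cnj (fourier_coeff p a' b'))
    = (if a = a' \<and> b = b' then complex_of_real ((cmod (symbol a b))\<^sup>2 / real n) else 0)"
proof -
  let ?P = "\<lambda>a b. symbol a b"
  have sq: "complex_of_real (sqrt (real N)) * complex_of_real (sqrt (real N)) = of_nat N"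
    by (simp add: of_real_mult[symmetric] del: of_real_mult)
  have "(\<Sum>p\<in>index_set. fourier_coeff p a b * cnj (fourier_coeff p a' b'))
     = (\<Sum>p\<in>index_set. (?P a b * cnj (?P a' b') / (of_nat n * of_nat n * of_nat N)) * (plane_wave p a b * cnj (plane_wave p a' b')))"
    unfolding fourier_coeff_def by (intro sum.cong refl) (simp add: mult_ac sq[symmetric])
  also have "\<dots> = (?P a b * cnj (?P a' b') / (of_nat n * of_nat n * of_nat N)) * (\<Sum>p\<in>index_set. plane_wave p a b * cnj (plane_wave p a' b'))"
    by (rule sum_distrib_left[symmetric])
  also have "(\<Sum>p\<in>index_set. plane_wave p a b * cnj (plane_wave p a' b'))
     = (\<Sum>p<N. unit_char (real a * real p / real N) * cnj (unit_char (real a' * real p / real N))) * cnj (\<Sum>q<n. unit_char (real b * real q / real n) * cnj (unit_char (real b' * real q / real n)))"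
    unfolding sum_index_set cnj_sum sum_product plane_wave_def by (intro sum.cong refl) (simp add: unit_char_cnj mult_ac)
  also have "\<dots> = (if a = a' then of_nat N else 0) * cnj (if b = b' then of_nat n else 0)"
    using assms by (simp add: sum_unit_char_diff)
  finally show ?thesis using N n
    by (auto simp: complex_norm_square[symmetric] divide_simps simp del: of_real_power)
qed

definition coupling :: "int \<times> int => nat => nat => complex" where
  "coupling p i j = (if i < N \<and> N \<le> j then fourier_coeff p i (j - N) else 0)"

definition variance_profile :: "nat => nat => real" where
  "variance_profile i j =
    (if i < N \<and> N \<le> j then (cmod (symbol i (j - N)))\<^sup>2 / real n
     else if j < N \<and> N \<le> i then (cmod (Phi h (real j / real N) (real (i - N) / real n)))\<^sup>2 / real n else 0)"

lemma variance_profile_le: "\<bar>variance_profile i j\<bar> \<le> S\<^sup>2 / real n"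
proof -
  have "(cmod (Phi h u t))\<^sup>2 / real n \<le> S\<^sup>2 / real n" for u t by (intro divide_right_mono power_mono Phi_le) auto
  thus ?thesis unfolding variance_profile_def by (auto intro: divide_nonneg_nonneg)
qed

text \<open>For fixed \<open>p\<close>, every filter coefficient \<open>h k\<close> contributes a matrix of rank one built from plane waves,
  so the trace norms add up to \<open>S / sqrt n\<close>. The Hilbert-Schmidt norm has the same
  order, but a bound for the trace norm through it would lose the square root of the rank.\<close>

lemma coupling_trace_bound:
  assumes M: "bilinear_bound (N + n) M K"
  shows "cmod (\<Sum>k<N + n. \<Sum>l<N + n. coupling p k l * M l k) \<le> S / sqrt (real n) * K"
proof -
  \<comment> \<open>The matrix \<open>M\<close> tested against the plane wave shifted by \<open>k\<close>, a matrix of rank one.\<close>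
  define Q where "Q k = (\<Sum>a<N. \<Sum>b<n. plane_wave (fst k + fst p, snd k + snd p) a b * M (N + b) a) / of_real (real n * sqrt (real N))" for k
  have Qb: "cmod (Q k) \<le> K / sqrt (real n)" for k
  proof -
    let ?k = "(fst k + fst p, snd k + snd p)"
    define x where "x i = (if i < N then 0 else unit_char (- (real (i - N) * of_int (snd ?k) / real n)))" for i
    define y where "y i = (if i < N then unit_char (real i * of_int (fst ?k) / real N) else 0)" for i
    have nx: "vnorm (N + n) x = sqrt (real n)"
      unfolding L2_set_def sum_lessThan_add by (simp add: x_def)
    have ny: "vnorm (N + n) y = sqrt (real N)"
      unfolding L2_set_def sum_lessThan_add by (simp add: y_def)
    have "(\<Sum>i<N + n. \<Sum>j<N + n. x i * M i j * y j) = (\<Sum>b<n. \<Sum>a<N. x (N + b) * M (N + b) a * y a)"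
      unfolding sum_lessThan_add by (simp add: x_def y_def)
    also have "\<dots> = (\<Sum>a<N. \<Sum>b<n. plane_wave ?k a b * M (N + b) a)"
      by (subst sum.swap) (simp add: x_def y_def plane_wave_def mult_ac)
    finally have "cmod (\<Sum>a<N. \<Sum>b<n. plane_wave ?k a b * M (N + b) a) \<le> K * sqrt (real n) * sqrt (real N)"
      using M[unfolded bilinear_bound_def, rule_format, of x y] nx ny by simp
    hence "cmod (\<Sum>a<N. \<Sum>b<n. plane_wave ?k a b * M (N + b) a) / (real n * sqrt (real N)) \<le> K * sqrt (real n) * sqrt (real N) / (real n * sqrt (real N))"
      by (rule divide_right_mono) simp
    hence "cmod (Q k) \<le> K * sqrt (real n) * sqrt (real N) / (real n * sqrt (real N))"
      unfolding Q_def norm_divide norm_of_real by simp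
    also have "\<dots> = K / sqrt (real n)" using N n by (simp add: real_div_sqrt field_simps)
    finally show ?thesis .
  qed
  have "(\<Sum>k<N + n. \<Sum>l<N + n. coupling p k l * M l k) = (\<Sum>a<N. \<Sum>b<n. fourier_coeff p a b * M (N + b) a)"
    unfolding sum_lessThan_add by (simp add: coupling_def)
  also have "\<dots> = (\<Sum>a<N. \<Sum>b<n. (LINT k|count_space UNIV. h k * (plane_wave k a b * plane_wave p a b * M (N + b) a / of_real (real n * sqrt (real N)))))"
  proof (intro sum.cong refl)
    fix a b
    have "(LINT k|count_space UNIV. h k * (plane_wave k a b * plane_wave p a b * M (N + b) a / of_real (real n * sqrt (real N))))
      = (LINT k|count_space UNIV. (h k * plane_wave k a b) * (plane_wave p a b * M (N + b) a / of_real (real n * sqrt (real N))))"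
      by (simp add: mult_ac)
    also have "\<dots> = (LINT k|count_space UNIV. h k * plane_wave k a b) * (plane_wave p a b * M (N + b) a / of_real (real n * sqrt (real N)))"
      by (rule integral_mult_left_zero)
    finally have eq: "(LINT k|count_space UNIV. h k * (plane_wave k a b * plane_wave p a b * M (N + b) a / of_real (real n * sqrt (real N))))
      = (LINT k|count_space UNIV. h k * plane_wave k a b) * (plane_wave p a b * M (N + b) a / of_real (real n * sqrt (real N)))" .
    show "fourier_coeff p a b * M (N + b) a = (LINT k|count_space UNIV. h k * (plane_wave k a b * plane_wave p a b * M (N + b) a / of_real (real n * sqrt (real N))))"
      unfolding eq fourier_coeff_def Phi_plane_wave by (simp only: times_divide_eq_left times_divide_eq_right mult.assoc)
  qed
  also have "\<dots> = (LINT k|count_space UNIV. (\<Sum>a<N. \<Sum>b<n. h k * (plane_wave k a b * plane_wave p a b * M (N + b) a / of_real (real n * sqrt (real N)))))"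
  proof -
    have int: "integrable (count_space UNIV) (\<lambda>k. h k * (plane_wave k a b * plane_wave p a b * M (N + b) a / of_real (real n * sqrt (real N))))" for a b
      by (rule bounded_multiple_integral_le(1)[where b="cmod (M (N + b) a / of_real (real n * sqrt (real N)))"]) (simp add: norm_mult norm_divide)
    show ?thesis
      by (subst Bochner_Integration.integral_sum, rule Bochner_Integration.integrable_sum, rule int, intro sum.cong refl Bochner_Integration.integral_sum[symmetric] int)
  qed
  also have "\<dots> = (LINT k|count_space UNIV. h k * Q k)"
    unfolding Q_def plane_wave_add by (intro Bochner_Integration.integral_cong refl) (simp add: sum_distrib_left sum_divide_distrib)
  finally show ?thesis using bounded_multiple_integral_le(2)[of Q, OF Qb] by simp
qed

lemma gaussian_coupling: "gaussian_hermitian (N + n) index_set coupling variance_profile (S / sqrt (real n))"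
proof
  show "finite index_set" by (rule index_set_facts)
  show "0 \<le> S / sqrt (real n)" using S_nonneg by simp
  show "cmod (\<Sum>k<N + n. \<Sum>l<N + n. coupling p k l * M l k) \<le> S / sqrt (real n) * K" if "bilinear_bound (N + n) M K" for p M K
    by (rule coupling_trace_bound[OF that])
  fix i k a b assume lt: "i < N + n" "k < N + n" "a < N + n" "b < N + n"
  have 1: "(\<Sum>p\<in>index_set. coupling p i k * cnj (coupling p b a)) = (if i < N \<and> N \<le> k \<and> i = b \<and> k = a then complex_of_real (variance_profile i k) else 0)"
    if "k < N + n" "a < N + n" for i k b a
  proof (cases "i < N \<and> N \<le> k \<and> b < N \<and> N \<le> a")
    case True
    have "(\<Sum>p\<in>index_set. coupling p i k * cnj (coupling p b a)) = (\<Sum>p\<in>index_set. fourier_coeff p i (k - N) * cnj (fourier_coeff p b (a - N)))"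
      unfolding coupling_def using True by simp
    also have "\<dots> = (if i = b \<and> k - N = a - N then complex_of_real ((cmod (symbol i (k - N)))\<^sup>2 / real n) else 0)"
      using True that by (intro fourier_orthogonality) auto
    finally show ?thesis using True by (auto simp: variance_profile_def)
  next
    case False
    have "(\<Sum>p\<in>index_set. coupling p i k * cnj (coupling p b a)) = 0"
      by (rule sum.neutral) (use False in \<open>auto simp: coupling_def\<close>)
    thus ?thesis using False by auto
  qed
  have sym: "variance_profile k i = variance_profile i k" by (auto simp: variance_profile_def)
  have z: "variance_profile i k = 0" if "\<not> (i < N \<and> N \<le> k)" "\<not> (k < N \<and> N \<le> i)" using that by (auto simp: variance_profile_def)
  have "(\<Sum>p\<in>index_set. coupling p i k * cnj (coupling p b a) + cnj (coupling p k i) * coupling p a b)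
     = (\<Sum>p\<in>index_set. coupling p i k * cnj (coupling p b a)) + cnj (\<Sum>p\<in>index_set. coupling p k i * cnj (coupling p a b))"
    unfolding cnj_sum sum.distrib by simp
  also have "\<dots> = (if i = b \<and> k = a then complex_of_real (variance_profile i k) else 0)"
    unfolding 1[OF lt(2,3)] 1[OF lt(1,4)] sym using z by auto
  finally show "(\<Sum>p\<in>index_set. coupling p i k * cnj (coupling p b a) + cnj (coupling p k i) * coupling p a b) = (if i = b \<and> k = a then complex_of_real (variance_profile i k) else 0)" .
qed

definition row_transform :: "(nat => nat => complex) => nat => nat => complex" where
  "row_transform X a j = (\<Sum>i<N. unit_char (real i * real a / real N) / sqrt N * X i j)"

definition fourier_transform :: "(nat => nat => complex) => nat => nat => complex" where
  "fourier_transform X a b = cnj (\<Sum>j<n. unit_char (real j * real b / real n) / sqrt n * cnj (row_transform X a j))"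

lemma fourier_transform_rows:
  "(\<Sum>b<n. fourier_transform X a b * cnj (fourier_transform X c b)) = (\<Sum>j<n. row_transform X a j * cnj (row_transform X c j))"
proof -
  have "(\<Sum>b<n. fourier_transform X a b * cnj (fourier_transform X c b))
    = cnj (\<Sum>b<n. (\<Sum>j<n. unit_char (real j * real b / real n) / sqrt n * cnj (row_transform X a j)) * cnj (\<Sum>j<n. unit_char (real j * real b / real n) / sqrt n * cnj (row_transform X c j)))"
    unfolding fourier_transform_def by simp
  also have "\<dots> = cnj (\<Sum>j<n. cnj (row_transform X a j) * cnj (cnj (row_transform X c j)))"
    unfolding parseval[OF n] ..
  finally show ?thesis by simp
qed

lemma row_transform_columns: "(\<Sum>a<N. row_transform X a j * cnj (row_transform X a j)) = (\<Sum>i<N. X i j * cnj (X i j))"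
  unfolding row_transform_def by (rule parseval[OF N])

lemma fourier_transform_isometry:
  "(\<Sum>a<N. \<Sum>b<n. (cmod (fourier_transform X a b))\<^sup>2) = (\<Sum>i<N. \<Sum>j<n. (cmod (X i j))\<^sup>2)"
proof -
  have "complex_of_real (\<Sum>a<N. \<Sum>b<n. (cmod (fourier_transform X a b))\<^sup>2) = (\<Sum>a<N. \<Sum>b<n. fourier_transform X a b * cnj (fourier_transform X a b))"
    unfolding of_real_sum complex_norm_square ..
  also have "\<dots> = (\<Sum>j<n. \<Sum>a<N. row_transform X a j * cnj (row_transform X a j))"
    unfolding fourier_transform_rows by (rule sum.swap)
  also have "\<dots> = (\<Sum>i<N. \<Sum>j<n. X i j * cnj (X i j))" unfolding row_transform_columns by (rule sum.swap)
  also have "\<dots> = complex_of_real (\<Sum>i<N. \<Sum>j<n. (cmod (X i j))\<^sup>2)"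
    unfolding of_real_sum complex_norm_square ..
  finally show ?thesis by (simp only: of_real_eq_iff)
qed

lemma fourier_transform_diff:
  "fourier_transform (\<lambda>i j. X i j - Y i j) a b = fourier_transform X a b - fourier_transform Y a b"
  unfolding fourier_transform_def row_transform_def
  by (simp add: sum_subtractf right_diff_distrib)

lemma fourier_transform_plane_wave:
  "fourier_transform X a b = (\<Sum>i<N. \<Sum>j<n. plane_wave (int i, int j) a b * X i j) / of_real (sqrt (real N) * sqrt (real n))"
proof -
  have "fourier_transform X a b = (\<Sum>j<n. \<Sum>i<N. plane_wave (int i, int j) a b * X i j / of_real (sqrt (real N) * sqrt (real n)))"
    unfolding fourier_transform_def row_transform_def cnj_sum sum_distrib_left
    by (intro sum.cong refl) (simp add: plane_wave_def unit_char_cnj mult_ac)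
  also have "\<dots> = (\<Sum>i<N. \<Sum>j<n. plane_wave (int i, int j) a b * X i j / of_real (sqrt (real N) * sqrt (real n)))" by (rule sum.swap)
  finally show ?thesis by (simp only: sum_divide_distrib)
qed

text \<open>The transform multiplies \<open>Z\<close> by unitary matrices from both sides, which conjugates its Gram matrix.\<close>

lemma fourier_gram_char_poly:
  assumes Z: "Z \<in> carrier_mat N n"
  defines "W \<equiv> Matrix.mat N n (\<lambda>(a, b). fourier_transform (\<lambda>i j. Z $$ (i, j)) a b)"
  shows "char_poly (W * mat_adjoint W) = char_poly (Z * mat_adjoint Z)"
proof -
  let ?e = "\<lambda>i a. unit_char (real i * real a / real N) / complex_of_real (sqrt N)"
  define F where "F = Matrix.mat N N (\<lambda>(a, i). ?e i a)"
  define F' where "F' = Matrix.mat N N (\<lambda>(i, a). cnj (?e i a))"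
  define A where "A = Z * mat_adjoint Z"
  have W: "W \<in> carrier_mat N n" unfolding W_def by simp
  have cZ: "mat_adjoint Z \<in> carrier_mat n N" by (rule mat_adjoint_carrier[OF Z])
  have cW: "mat_adjoint W \<in> carrier_mat n N" by (rule mat_adjoint_carrier[OF W])
  have A: "A \<in> carrier_mat N N" unfolding A_def using Z cZ by simp
  have cF: "F \<in> carrier_mat N N" "F' \<in> carrier_mat N N" unfolding F_def F'_def by simp_all
  have sq: "complex_of_real (sqrt (real N)) * complex_of_real (sqrt (real N)) = of_nat N"
    by (simp add: of_real_mult[symmetric] del: of_real_mult)
  have FF: "F * F' = 1\<^sub>m N"
  proof (rule eq_matI)
    fix a c assume "a < dim_row (1\<^sub>m N :: complex mat)" "c < dim_col (1\<^sub>m N :: complex mat)"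
    hence ac: "a < N" "c < N" by auto
    have "(F * F') $$ (a, c) = (\<Sum>i<N. ?e i a * cnj (?e i c))"
      using ac unfolding F_def F'_def by (simp add: scalar_prod_def lessThan_atLeast0)
    also have "\<dots> = (\<Sum>i<N. unit_char (real a * real i / real N) * cnj (unit_char (real c * real i / real N))) / of_nat N"
      unfolding sum_divide_distrib by (intro sum.cong refl) (simp add: sq mult.commute)
    also have "\<dots> = 1\<^sub>m N $$ (a, c)" using ac N by (simp add: sum_unit_char_diff)
    finally show "(F * F') $$ (a, c) = 1\<^sub>m N $$ (a, c)" .
  qed (use cF in auto)
  have FF': "F' * F = 1\<^sub>m N" by (rule mat_mult_left_right_inverse[OF cF FF])
  have "W * mat_adjoint W = F * A * F'"
  proof (rule eq_matI)
    fix a c assume "a < dim_row (F * A * F')" "c < dim_col (F * A * F')"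
    hence ac: "a < N" "c < N" using cF by auto
    have "(W * mat_adjoint W) $$ (a, c) = (\<Sum>b<n. fourier_transform (\<lambda>i j. Z $$ (i, j)) a b * cnj (fourier_transform (\<lambda>i j. Z $$ (i, j)) c b))"
      unfolding gram_index[OF W ac] using ac unfolding W_def by simp
    also have "\<dots> = (\<Sum>j<n. \<Sum>k<N. \<Sum>i<N. ?e i a * Z $$ (i, j) * cnj (Z $$ (k, j)) * cnj (?e k c))"
      unfolding fourier_transform_rows row_transform_def cnj_sum sum_product
      by (rule sum.cong[OF refl], rule trans[OF sum.swap], intro sum.cong refl) (simp add: mult_ac)
    also have "\<dots> = (\<Sum>k<N. \<Sum>i<N. \<Sum>j<n. ?e i a * Z $$ (i, j) * cnj (Z $$ (k, j)) * cnj (?e k c))"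
      by (rule trans[OF sum.swap], rule sum.cong[OF refl], rule sum.swap)
    also have "\<dots> = (\<Sum>k<N. (\<Sum>i<N. ?e i a * A $$ (i, k)) * cnj (?e k c))"
      unfolding sum_distrib_right
    proof (intro sum.cong refl)
      fix k i assume "k \<in> {..<N}" "i \<in> {..<N}"
      hence "A $$ (i, k) = (\<Sum>j<n. Z $$ (i, j) * cnj (Z $$ (k, j)))" unfolding A_def by (intro gram_index[OF Z]) auto
      thus "(\<Sum>j<n. ?e i a * Z $$ (i, j) * cnj (Z $$ (k, j)) * cnj (?e k c)) = ?e i a * A $$ (i, k) * cnj (?e k c)"
        by (simp only: sum_distrib_left sum_distrib_right mult.assoc)
    qed
    also have "\<dots> = (F * A * F') $$ (a, c)"
      using ac A cF by (simp add: scalar_prod_def lessThan_atLeast0 F_def F'_def)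
    finally show "(W * mat_adjoint W) $$ (a, c) = (F * A * F') $$ (a, c)" .
  qed (use W cW cF A in auto)
  hence "similar_mat_wit (W * mat_adjoint W) A F F'"
    using W cW A cF FF FF' unfolding similar_mat_wit_def Let_def by auto
  hence "similar_mat (W * mat_adjoint W) A" unfolding similar_mat_def by blast
  thus ?thesis unfolding A_def by (rule char_poly_similar)
qed

definition shift_mod :: "int \<times> int => int \<times> int => int \<times> int" where
  "shift_mod p k = ((fst p - fst k) mod int N, (snd p - snd k) mod int n)"

lemma shift_mod_in: "shift_mod p k \<in> index_set"
  unfolding shift_mod_def index_set_def using N n by auto

lemma shift_mod_id: "(fst p - fst k, snd p - snd k) \<in> index_set \<Longrightarrow> shift_mod p k = (fst p - fst k, snd p - snd k)"
  unfolding shift_mod_def index_set_def by auto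

definition periodized :: "(int \<times> int => complex) => nat => nat => complex" where
  "periodized u i j = (LINT k|count_space UNIV. h k * u (shift_mod (int i, int j) k)) / of_real (sqrt (real n))"

lemma sum_shifted_plane_wave:
  "(\<Sum>p\<in>index_set. plane_wave p a b * u (shift_mod p k)) = plane_wave k a b * (\<Sum>q\<in>index_set. plane_wave q a b * u q)"
proof -
  define unshift where "unshift q = ((fst q + fst k) mod int N, (snd q + snd k) mod int n)" for q
  have "(\<Sum>p\<in>index_set. plane_wave p a b * u (shift_mod p k)) = (\<Sum>q\<in>index_set. plane_wave k a b * (plane_wave q a b * u q))"
  proof (rule sum.reindex_bij_witness[of _ unshift "\<lambda>p. shift_mod p k"])
    fix p assume p: "p \<in> index_set"
    show "unshift (shift_mod p k) = p" "unshift p \<in> index_set" "shift_mod (unshift p) k = p"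
      using p N n unfolding unshift_def shift_mod_def index_set_def
      by (auto simp: mod_simps)
    show "shift_mod p k \<in> index_set" by (rule shift_mod_in)
    have "plane_wave p a b = plane_wave (unshift (shift_mod p k)) a b"
      using p N n unfolding unshift_def shift_mod_def index_set_def by (auto simp: mod_simps)
    also have "\<dots> = plane_wave (shift_mod p k) a b * plane_wave k a b"
      unfolding unshift_def using plane_wave_mod[of "(fst (shift_mod p k) + fst k, snd (shift_mod p k) + snd k)"] plane_wave_add by simp
    finally show "plane_wave k a b * (plane_wave (shift_mod p k) a b * u (shift_mod p k)) = plane_wave p a b * u (shift_mod p k)"
      by (simp add: mult_ac)
  qed
  thus ?thesis by (simp only: sum_distrib_left)
qed

lemma fourier_transform_periodized: "fourier_transform (periodized u) a b = (\<Sum>p\<in>index_set. fourier_coeff p a b * u p)"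
proof -
  obtain B where B: "\<And>p. p \<in> index_set \<Longrightarrow> cmod (u p) \<le> B"
    using finite_imageI[OF index_set_facts(1), of "\<lambda>p. cmod (u p)"] by (meson Max_ge imageI)
  define T where "T = (\<Sum>q\<in>index_set. plane_wave q a b * u q)"
  have int: "integrable (count_space UNIV) (\<lambda>k. h k * u (shift_mod p k))" for p
    by (rule bounded_multiple_integral_le(1)[where b=B]) (rule B[OF shift_mod_in])
  let ?c = "complex_of_real (sqrt (real N) * sqrt (real n))"
  have "(\<Sum>i<N. \<Sum>j<n. plane_wave (int i, int j) a b * periodized u i j) = (\<Sum>p\<in>index_set. plane_wave p a b * ((LINT k|count_space UNIV. h k * u (shift_mod p k)) / of_real (sqrt (real n))))"
    unfolding sum_index_set periodized_def ..
  also have "\<dots> = (\<Sum>p\<in>index_set. plane_wave p a b * (LINT k|count_space UNIV. h k * u (shift_mod p k))) / of_real (sqrt (real n))"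
    by (simp only: sum_divide_distrib times_divide_eq_right)
  also have "(\<Sum>p\<in>index_set. plane_wave p a b * (LINT k|count_space UNIV. h k * u (shift_mod p k))) = (LINT k|count_space UNIV. (\<Sum>p\<in>index_set. plane_wave p a b * (h k * u (shift_mod p k))))"
    using int by (subst Bochner_Integration.integral_sum) auto
  also have "\<dots> = (LINT k|count_space UNIV. h k * plane_wave k a b * T)"
  proof (intro Bochner_Integration.integral_cong refl)
    fix k
    have "(\<Sum>p\<in>index_set. plane_wave p a b * (h k * u (shift_mod p k))) = h k * (\<Sum>p\<in>index_set. plane_wave p a b * u (shift_mod p k))"
      unfolding sum_distrib_left by (intro sum.cong refl) simp
    thus "(\<Sum>p\<in>index_set. plane_wave p a b * (h k * u (shift_mod p k))) = h k * plane_wave k a b * T"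
      unfolding sum_shifted_plane_wave T_def by simp
  qed
  also have "\<dots> = symbol a b * T"
    unfolding Phi_plane_wave by (rule integral_mult_left_zero)
  finally have eq: "(\<Sum>i<N. \<Sum>j<n. plane_wave (int i, int j) a b * periodized u i j) = symbol a b * T / of_real (sqrt (real n))" .
  have sq: "complex_of_real (sqrt (real n)) * ?c = of_real (real n * sqrt (real N))"
    by (simp add: of_real_mult[symmetric] mult_ac del: of_real_mult)
  have "fourier_transform (periodized u) a b = symbol a b * T / of_real (real n * sqrt (real N))"
    unfolding fourier_transform_plane_wave eq sq[symmetric] by simp
  also have "\<dots> = (\<Sum>p\<in>index_set. fourier_coeff p a b * u p)"
    unfolding T_def fourier_coeff_def sum_distrib_left sum_divide_distrib by (intro sum.cong refl) simp
  finally show ?thesis .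
qed

text \<open>In the Fourier basis the Hermitization of the periodized matrix is the Gaussian Hermitian
  matrix with the couplings above.\<close>

lemma H_coupling:
  "gaussian_hermitian.H index_set coupling u i j = (if i < N \<and> N \<le> j then fourier_transform (periodized u) i (j - N)
     else if N \<le> i \<and> j < N then cnj (fourier_transform (periodized u) j (i - N)) else 0)"
proof -
  interpret gaussian_hermitian "N + n" index_set coupling variance_profile "S / sqrt (real n)" by (rule gaussian_coupling)
  show ?thesis unfolding H_def fourier_transform_periodized coupling_def
    by (auto simp: cnj_sum)
qed

end

section \<open>The sampled vector equation\<close>

lemma unit_measure_interval:
  assumes "0 \<le> a" "a \<le> b" "b \<le> 1" shows "measure unit_measure {a..<b} = b - a"
proof -
  have "emeasure unit_measure {a..<b} = (\<integral>\<^sup>+x. indicator {a..<b} x \<partial>lborel)"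
    unfolding unit_measure_def using assms
    by (subst emeasure_density) (auto intro!: nn_integral_cong split: split_indicator simp del: nn_integral_indicator)
  also have "\<dots> = ennreal (b - a)" using assms by simp
  finally show ?thesis using assms by (simp add: measure_def)
qed

lemma AE_unit_measure_half_open: "AE t in unit_measure. t \<in> {0..<1}"
proof -
  have "AE t in lborel. t \<noteq> (1::real)" by (rule AE_lborel_singleton)
  thus ?thesis unfolding unit_measure_def by (subst AE_density) (auto split: split_indicator elim!: eventually_mono)
qed

text \<open>The Riemann sum is the integral of a step function that is uniformly close to \<open>F u\<close>.\<close>

lemma riemann_sum_uniform:
  fixes F :: "real => real => complex"
  assumes cont: "continuous_on UNIV (\<lambda>p. F (fst p) (snd p))"
    and B: "\<And>u t. cmod (F u t) \<le> B" and e: "e > 0"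
  shows "\<exists>n0. \<forall>n\<ge>n0. \<forall>u\<in>{0..1}.
    cmod ((\<Sum>j<n. F u (real j / real n)) / of_nat n - (LINT t|unit_measure. F u t)) \<le> e"
proof -
  interpret prob_space unit_measure by (rule prob_unit_measure)
  have "continuous_on {(0,0)..(1,1)} (\<lambda>p. F (fst p) (snd p))" by (rule continuous_on_subset[OF cont]) simp
  moreover have "compact {(0::real,0::real)..(1,1)}"
    by (simp add: interval_cbox[symmetric] cbox_Pair_eq[symmetric] compact_Times flip: cbox_interval)
  ultimately have "uniformly_continuous_on {(0,0)..(1,1)} (\<lambda>p. F (fst p) (snd p))" by (rule compact_uniformly_continuous)
  then obtain d where d: "d > 0" and uc: "\<And>p q. p \<in> {(0,0)..(1,1)} \<Longrightarrow> q \<in> {(0,0)..(1,1)} \<Longrightarrow> dist q p < d \<Longrightarrow>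
      dist (F (fst q) (snd q)) (F (fst p) (snd p)) < e"
    unfolding uniformly_continuous_on_def using e by metis
  obtain n0 where n0: "n0 > 0" "inverse (real n0) < d" using reals_Archimedean[OF d] by (metis zero_less_Suc)
  show ?thesis
  proof (intro exI[of _ n0] allI impI ballI)
    fix n u assume n: "n0 \<le> n" and u: "u \<in> {0..1::real}"
    have "inverse (real n) \<le> inverse (real n0)" using n n0 by (intro le_imp_inverse_le) auto
    hence n': "n > 0" "inverse (real n) < d" using n n0 by linarith+
    define J where "J j = {real j / real n..<real (Suc j) / real n}" for j
    define st where "st t = (\<Sum>j<n. indicator (J j) t *\<^sub>R F u (real j / real n))" for t
    have Jm: "measure unit_measure (J j) = 1 / real n" if "j < n" for j
      unfolding J_def using that n' by (subst unit_measure_interval) (auto simp: field_simps)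
    have iJ: "integrable unit_measure (\<lambda>t. indicator (J j) t *\<^sub>R F u (real j / real n))" for j
      unfolding J_def by (intro integrable_scaleR_left) (simp add: less_top[symmetric])
    have ist: "integrable unit_measure st" unfolding st_def by (intro Bochner_Integration.integrable_sum iJ)
    have "(LINT t|unit_measure. st t) = (\<Sum>j<n. measure unit_measure (J j) *\<^sub>R F u (real j / real n))"
      unfolding st_def
    proof (subst Bochner_Integration.integral_sum[OF iJ], intro sum.cong refl)
      fix j
      have "integrable unit_measure (indicator (J j) :: real => real)"
        unfolding J_def by (simp add: less_top[symmetric])
      thus "(LINT t|unit_measure. indicator (J j) t *\<^sub>R F u (real j / real n)) = measure unit_measure (J j) *\<^sub>R F u (real j / real n)"
        by (simp add: J_def unit_measure_def)
    qed
    also have "\<dots> = (\<Sum>j<n. F u (real j / real n)) / of_nat n"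
      unfolding sum_divide_distrib by (intro sum.cong refl) (simp add: Jm scaleR_conv_of_real)
    finally have eq: "(\<Sum>j<n. F u (real j / real n)) / of_nat n = (LINT t|unit_measure. st t)" ..
    have "continuous_on UNIV (\<lambda>t. F (fst (u, t)) (snd (u, t)))"
      by (rule continuous_on_compose2[OF cont], intro continuous_on_Pair continuous_on_const continuous_on_id, simp)
    hence cF: "continuous_on UNIV (F u)" by simp
    hence Fm: "F u \<in> borel_measurable borel" by (rule borel_measurable_continuous_onI)
    have iF: "integrable unit_measure (F u)"
      by (rule integrable_const_bound[where B=B]) (use B Fm in \<open>auto simp: measurable_cong_sets[OF sets_unit_measure refl]\<close>)
    have "cmod ((LINT t|unit_measure. st t) - (LINT t|unit_measure. F u t)) = cmod (LINT t|unit_measure. st t - F u t)"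
      using ist iF by simp
    also have "\<dots> \<le> (LINT t|unit_measure. cmod (st t - F u t))" by (rule integral_norm_bound)
    also have "\<dots> \<le> (LINT t|unit_measure. e)"
    proof (rule integral_mono_AE)
      show "AE t in unit_measure. cmod (st t - F u t) \<le> e"
        using AE_unit_measure_half_open
      proof eventually_elim
        fix t :: real assume t: "t \<in> {0..<1}"
        define j where "j = nat \<lfloor>t * real n\<rfloor>"
        have j: "real j \<le> t * real n" "t * real n < real j + 1" using t n' unfolding j_def by (auto simp: of_nat_nat)
        have "t * real n < real n" using t n' by simp
        hence jn: "j < n" using j(1) by linarith
        have iff: "t \<in> J k \<longleftrightarrow> k = j" for k
        proof
          assume "t \<in> J k"
          hence "real k \<le> t * real n" "t * real n < real k + 1" unfolding J_def using n' by (auto simp: field_simps)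
          with j show "k = j" by linarith
        next
          assume "k = j" thus "t \<in> J k" unfolding J_def using n' j by (auto simp: field_simps)
        qed
        have "st t = (\<Sum>k<n. if k = j then F u (real j / real n) else 0)"
          unfolding st_def by (intro sum.cong refl) (simp add: iff indicator_def)
        hence st: "st t = F u (real j / real n)" using jn by simp
        have "real j / real n \<le> t" "t < (real j + 1) / real n" using j n' by (simp_all add: pos_divide_le_eq pos_less_divide_eq)
        hence jt: "\<bar>real j / real n - t\<bar> \<le> inverse (real n)" by (simp add: add_divide_distrib inverse_eq_divide abs_le_iff)
        have jb: "0 \<le> real j / real n" "real j / real n \<le> 1" using jn by auto
        have "dist (F (fst (u, real j / real n)) (snd (u, real j / real n))) (F (fst (u, t)) (snd (u, t))) < e"
        proof (rule uc)
          show "(u, t) \<in> {(0,0)..(1,1)}" "(u, real j / real n) \<in> {(0,0)..(1,1)}" using u t jb by auto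
          show "dist (u, real j / real n) (u, t) < d" using jt n' by (simp add: dist_Pair_Pair dist_real_def)
        qed
        thus "cmod (st t - F u t) \<le> e" unfolding st by (simp add: dist_norm)
      qed
    qed (use ist iF in auto)
    also have "\<dots> = e" using prob_space by (simp)
    finally show "cmod ((\<Sum>j<n. F u (real j / real n)) / of_nat n - (LINT t|unit_measure. F u t)) \<le> e" unfolding eq .
  qed
qed

lemma continuous_unit_integral:
  fixes F :: "real => real => complex"
  assumes c: "\<And>t. continuous_on UNIV (\<lambda>u. F u t)" and m: "\<And>u. F u \<in> borel_measurable borel" and b: "\<And>u t. cmod (F u t) \<le> B"
  shows "continuous_on UNIV (\<lambda>u. LINT t|unit_measure. F u t)"
  unfolding continuous_on_sequentially comp_def
proof (intro allI ballI impI, elim conjE)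
  interpret prob_space unit_measure by (rule prob_unit_measure)
  fix X :: "nat => real" and p assume X: "X \<longlonglongrightarrow> p"
  show "(\<lambda>n. LINT t|unit_measure. F (X n) t) \<longlonglongrightarrow> (LINT t|unit_measure. F p t)"
  proof (rule integral_dominated_convergence[where w="\<lambda>_. B"])
    have "isCont (\<lambda>u. F u t) p" for t using c[of t] by (simp add: continuous_on_eq_continuous_at)
    thus "AE t in unit_measure. (\<lambda>n. F (X n) t) \<longlonglongrightarrow> F p t" by (intro AE_I2 isCont_tendsto_compose[OF _ X]) auto
  qed (use m b in \<open>auto simp: measurable_cong_sets[OF sets_unit_measure refl]\<close>)
qed

lemma filterlim_size_at_top:
  fixes N :: "nat => nat"
  assumes lim: "(\<lambda>n. real (N n) / real n) \<longlonglongrightarrow> c" and c: "0 < c"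
  shows "filterlim (\<lambda>n. real (N n)) at_top sequentially"
proof -
  have "filterlim (\<lambda>n. (real (N n) / real n) * real n) at_top sequentially"
    by (rule filterlim_tendsto_pos_mult_at_top[OF lim c filterlim_real_sequentially])
  moreover have "eventually (\<lambda>n. (real (N n) / real n) * real n = real (N n)) sequentially"
    using eventually_gt_at_top[of 0] by eventually_elim simp
  ultimately show ?thesis by (simp add: filterlim_cong)
qed

abbreviation vector_residual :: "nat => (nat => nat => real) => complex => (nat => complex) => nat => complex" where
  "vector_residual m s w g i \<equiv> 1 + w * g i + g i * (\<Sum>k<m. of_real (s i k) * g k)"

text \<open>For \<open>w\<close> far from the spectrum the vector equation is a contraction perturbed by its
  residual, so approximate solutions are close to each other.\<close>

lemma vector_equation_stable:
  fixes g g' :: "nat => complex" and s :: "nat => nat => real"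
  assumes row: "\<And>i. i < m \<Longrightarrow> (\<Sum>k<m. \<bar>s i k\<bar>) \<le> L" and L: "L \<le> v\<^sup>2 / 4" and v: "v > 0" "v \<le> cmod w"
    and g: "\<And>i. i < m \<Longrightarrow> cmod (g i) \<le> 1 / v" and g': "\<And>i. i < m \<Longrightarrow> cmod (g' i) \<le> 1 / v"
    and r: "\<And>i. i < m \<Longrightarrow> cmod (vector_residual m s w g i) \<le> e"
    and r': "\<And>i. i < m \<Longrightarrow> cmod (vector_residual m s w g' i) \<le> e'"
    and i: "i < m"
  shows "cmod (g i - g' i) \<le> 2 * (e + e') / v"
proof -
  let ?d = "\<lambda>i. cmod (g i - g' i)"
  define D where "D = Max (?d ` {..<m})"
  have D: "?d k \<le> D" if "k < m" for k unfolding D_def using that by (intro Max_ge) auto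
  have "D \<in> ?d ` {..<m}" unfolding D_def using i by (intro Max_in) auto
  then obtain j where j: "j < m" "D = ?d j" by auto
  have D0: "0 \<le> D" using j by simp
  have sb: "cmod (\<Sum>k<m. of_real (s j k) * f k) \<le> L * b" if "\<And>k. k < m \<Longrightarrow> cmod (f k) \<le> b" "0 \<le> b" for f :: "nat => complex" and b
  proof -
    have "cmod (\<Sum>k<m. of_real (s j k) * f k) \<le> (\<Sum>k<m. \<bar>s j k\<bar> * b)"
      using that by (intro sum_norm_le) (auto simp: norm_mult intro: mult_left_mono)
    also have "\<dots> \<le> L * b" unfolding sum_distrib_right[symmetric] using row[OF j(1)] that(2) by (rule mult_right_mono)
    finally show ?thesis .
  qed
  define A where "A = (\<Sum>k<m. of_real (s j k) * g k)"
  define A' where "A' = (\<Sum>k<m. of_real (s j k) * g' k)"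
  have AA: "A - A' = (\<Sum>k<m. of_real (s j k) * (g k - g' k))" unfolding A_def A'_def by (simp add: sum_subtractf right_diff_distrib)
  have a: "cmod A \<le> L * (1 / v)" unfolding A_def by (rule sb) (use g v in auto)
  have b: "cmod (A - A') \<le> L * D" unfolding AA by (rule sb) (use D D0 in auto)
  have "w * (g j - g' j) = (1 + w * g j + g j * A) - (1 + w * g' j + g' j * A') - (g j - g' j) * A - g' j * (A - A')"
    by (simp add: algebra_simps)
  hence "cmod (w * (g j - g' j)) \<le> e + e' + D * (L * (1 / v)) + (1 / v) * (L * D)"
  proof (elim ssubst)
    have "cmod ((g j - g' j) * A) \<le> D * (L * (1 / v))" unfolding norm_mult j(2) by (intro mult_left_mono a) simp
    moreover have "cmod (g' j * (A - A')) \<le> (1 / v) * (L * D)" unfolding norm_mult using v by (intro mult_mono g'[OF j(1)] b) auto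
    moreover note r[OF j(1), folded A_def] r'[OF j(1), folded A'_def]
    ultimately show "cmod ((1 + w * g j + g j * A) - (1 + w * g' j + g' j * A') - (g j - g' j) * A - g' j * (A - A')) \<le> e + e' + D * (L * (1 / v)) + (1 / v) * (L * D)"
      by (intro norm_triangle_le_diff) (smt (verit) norm_triangle_ineq4)
  qed
  moreover have "v * D \<le> cmod (w * (g j - g' j))" unfolding norm_mult j(2) using v by (intro mult_right_mono) auto
  moreover define q where "q = (L / v) * D"
  ultimately have 1: "v * D \<le> e + e' + 2 * q" by (simp add: algebra_simps)
  have "L / v \<le> v / 4" using L v by (simp add: field_simps power2_eq_square)
  hence "q \<le> (v / 4) * D" unfolding q_def using D0 by (rule mult_right_mono)
  with 1 have "v * D \<le> 2 * (e + e')" by simp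
  hence "D \<le> 2 * (e + e') / v" using v by (simp add: field_simps)
  with D[OF i] show ?thesis by linarith
qed

context unit_profile
begin

interpretation prob_space unit_measure by (rule prob_lam)

text \<open>Row and column indices are the two halves of the index range of the Hermitization; a row
  interacts with the columns only.\<close>

definition sampled_profile :: "nat => nat => nat => nat => real" where
  "sampled_profile N n i k =
    (if i < N \<and> N \<le> k then (cmod (\<Phi> (real i / real N) (real (k - N) / real n)))\<^sup>2 / real n
     else if k < N \<and> N \<le> i then (cmod (\<Phi> (real k / real N) (real (i - N) / real n)))\<^sup>2 / real n else 0)"

lemma sampled_profile_row_sum:
  assumes "N \<le> n" "n > 0" shows "(\<Sum>k<N + n. \<bar>sampled_profile N n i k\<bar>) \<le> K"
proof (cases "i < N")
  case True
  have "(\<Sum>k<N + n. \<bar>sampled_profile N n i k\<bar>) = (\<Sum>b<n. (cmod (\<Phi> (real i / real N) (real b / real n)))\<^sup>2 / real n)"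
    unfolding sum_lessThan_add using True by (simp add: sampled_profile_def)
  also have "\<dots> \<le> (\<Sum>b<n. K / real n)" by (intro sum_mono divide_right_mono \<sigma>_le) simp
  finally show ?thesis using assms by simp
next
  case False
  have "(\<Sum>k<N + n. \<bar>sampled_profile N n i k\<bar>) = (\<Sum>b<N. (cmod (\<Phi> (real b / real N) (real (i - N) / real n)))\<^sup>2 / real n)"
    unfolding sum_lessThan_add using False by (simp add: sampled_profile_def)
  also have "\<dots> \<le> (\<Sum>b<N. K / real n)" by (intro sum_mono divide_right_mono \<sigma>_le) simp
  also have "\<dots> = K * (real N / real n)" by simp
  also have "\<dots> \<le> K * 1" using assms K1 by (intro mult_left_mono) auto
  finally show ?thesis by simp
qed

context
  fixes z :: complex and m :: "real => complex"
  assumes z: "Im z > 0" and H: "herglotz_class z m" and eq: "\<And>u. m u = profile_step z m u"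
    and cont: "continuous_on UNIV (\<lambda>p. \<Phi> (fst p) (snd p))"
begin

lemma cont_profile: "continuous_on A f \<Longrightarrow> continuous_on A g \<Longrightarrow> continuous_on A (\<lambda>x. complex_of_real ((cmod (\<Phi> (f x) (g x)))\<^sup>2))"
  using continuous_on_compose2[OF cont, of A "\<lambda>x. (f x, g x)"] by (auto intro!: continuous_intros)

lemma solution_facts: "m \<in> borel_measurable borel" "cmod (m u) \<le> 1 / Im z"
  using H unfolding herglotz_class_def by auto

lemma column_integrand_le: "cmod (of_real ((cmod (\<Phi> x t))\<^sup>2) * m x) \<le> K * (1 / Im z)"
  unfolding norm_mult norm_of_real using \<sigma>_le[of x t] solution_facts(2)[of x] K1 by (intro mult_mono) auto

lemma continuous_column_average: "continuous_on UNIV (column_average m)"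
proof -
  note [measurable] = solution_facts(1)
  have "continuous_on UNIV (\<lambda>t. LINT x|unit_measure. of_real ((cmod (\<Phi> x t))\<^sup>2) * m x)"
  proof (rule continuous_unit_integral[where B="K * (1 / Im z)"])
    show "continuous_on UNIV (\<lambda>t. of_real ((cmod (\<Phi> x t))\<^sup>2) * m x)" for x by (intro continuous_intros cont_profile)
    show "(\<lambda>x. of_real ((cmod (\<Phi> x t))\<^sup>2) * m x) \<in> borel_measurable borel" for t by measurable
    show "cmod (of_real ((cmod (\<Phi> x t))\<^sup>2) * m x) \<le> K * (1 / Im z)" for x t by (rule column_integrand_le)
  qed
  thus ?thesis unfolding column_average_def by (intro continuous_intros)
qed

definition column_value :: "real => complex" where "column_value t = 1 / (1 + column_average m t)"

lemma continuous_column_value: "continuous_on UNIV column_value"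
  unfolding column_value_def using herglotz_denominator(4)[OF z H] by (intro continuous_intros continuous_column_average) auto

lemma column_value_le: "cmod (column_value t) \<le> cmod z / Im z"
proof -
  have "0 < Im z / cmod z" using z by (intro divide_pos_pos) auto
  hence "1 / cmod (1 + column_average m t) \<le> 1 / (Im z / cmod z)"
    using herglotz_denominator(2)[OF z H, of t] by (intro frac_le) auto
  thus ?thesis unfolding column_value_def by (simp add: norm_divide)
qed

lemma row_integrand_le: "cmod (of_real ((cmod (\<Phi> u t))\<^sup>2) * column_value t) \<le> K * (cmod z / Im z)"
  unfolding norm_mult norm_of_real using \<sigma>_le[of u t] column_value_le[of t] K1 by (intro mult_mono) auto

lemma solution_eq: "m u = 1 / (- z + (LINT t|unit_measure. of_real ((cmod (\<Phi> u t))\<^sup>2) * column_value t))"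
  using eq[of u] unfolding profile_step_def column_value_def by simp

lemma solution_denominator: "- z + (LINT t|unit_measure. of_real ((cmod (\<Phi> u t))\<^sup>2) * column_value t) \<noteq> 0"
proof -
  have "Im z \<le> cmod (- z + (LINT t|unit_measure. of_real ((cmod (\<Phi> u t))\<^sup>2) * column_value t))"
    using profile_step_herglotz(2)[OF z H, of u] unfolding column_value_def by simp
  thus ?thesis using z by auto
qed

lemma continuous_solution: "continuous_on UNIV m"
proof -
  have "continuous_on UNIV (\<lambda>u. LINT t|unit_measure. of_real ((cmod (\<Phi> u t))\<^sup>2) * column_value t)"
  proof (rule continuous_unit_integral[OF _ _ row_integrand_le])
    show "continuous_on UNIV (\<lambda>u. of_real ((cmod (\<Phi> u t))\<^sup>2) * column_value t)" for t by (intro continuous_intros cont_profile)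
    show "(\<lambda>t. of_real ((cmod (\<Phi> u t))\<^sup>2) * column_value t) \<in> borel_measurable borel" for u
      by (intro borel_measurable_continuous_onI continuous_intros cont_profile continuous_column_value)
  qed
  hence "continuous_on UNIV (\<lambda>u. 1 / (- z + (LINT t|unit_measure. of_real ((cmod (\<Phi> u t))\<^sup>2) * column_value t)))"
    using solution_denominator by (intro continuous_intros) auto
  thus ?thesis using solution_eq by (simp cong: continuous_on_cong)
qed

text \<open>The solution of the integral equation, sampled on the grid, solves the vector equation up to
  a Riemann sum error.\<close>

definition sampled_solution :: "complex => nat => nat => nat => complex" where
  "sampled_solution w N n i = (if i < N then w * m (real i / real N) else - column_value (real (i - N) / real n) / w)"

lemma sampled_solution_residual:
  assumes w: "w\<^sup>2 = z" and Nn: "1 \<le> N" "N \<le> n" and i: "i < N + n" and e: "0 \<le> e"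
    and y: "1 \<le> Im z" "cmod z = Im z" "K \<le> Im z"
    and row: "\<And>u. u \<in> {0..1} \<Longrightarrow> cmod ((\<Sum>j<n. of_real ((cmod (\<Phi> u (real j / real n)))\<^sup>2) * column_value (real j / real n)) / of_nat n
        - (LINT t|unit_measure. of_real ((cmod (\<Phi> u t))\<^sup>2) * column_value t)) \<le> e"
    and col: "\<And>t. t \<in> {0..1} \<Longrightarrow> cmod ((\<Sum>i<N. of_real ((cmod (\<Phi> (real i / real N) t))\<^sup>2) * m (real i / real N)) / of_nat N
        - (LINT x|unit_measure. of_real ((cmod (\<Phi> x t))\<^sup>2) * m x)) \<le> e"
    and ratio: "\<bar>real N / real n - c\<bar> \<le> e"
  shows "cmod (vector_residual (N + n) (sampled_profile N n) w (sampled_solution w N n) i) \<le> 2 * e"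
proof (cases "i < N")
  case True
  define u where "u = real i / real N"
  have u: "u \<in> {0..1}" unfolding u_def using True by auto
  define R where "R = (\<Sum>j<n. of_real ((cmod (\<Phi> u (real j / real n)))\<^sup>2) * column_value (real j / real n)) / of_nat n"
  define I where "I = (LINT t|unit_measure. of_real ((cmod (\<Phi> u t))\<^sup>2) * column_value t)"
  have w0: "w \<noteq> 0" using w z by auto
  have "(\<Sum>k<N + n. of_real (sampled_profile N n i k) * sampled_solution w N n k) = - R / w"
    unfolding sum_lessThan_add R_def using True
    by (simp add: sampled_profile_def sampled_solution_def u_def sum_divide_distrib sum_negf)
  hence "vector_residual (N + n) (sampled_profile N n) w (sampled_solution w N n) i
     = 1 + w\<^sup>2 * m u - m u * R"
    using True w0 by (simp add: sampled_solution_def u_def power2_eq_square)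
  also have "\<dots> = m u * (I - R)"
  proof -
    have "m u * (- z + I) = 1" using solution_denominator[of u] unfolding solution_eq[of u] I_def by simp
    hence "z * m u = m u * I - 1" by (simp add: algebra_simps)
    thus ?thesis unfolding w by (simp add: algebra_simps)
  qed
  finally have *: "vector_residual (N + n) (sampled_profile N n) w (sampled_solution w N n) i = m u * (I - R)" .
  have "cmod (m u) \<le> 1" using solution_facts(2)[of u] y z by (auto intro: order_trans)
  hence "cmod (m u * (I - R)) \<le> 1 * e"
    unfolding norm_mult using row[OF u] by (intro mult_mono) (auto simp: R_def I_def norm_minus_commute)
  thus ?thesis unfolding * using e by simp
next
  case False
  define t where "t = real (i - N) / real n"
  have t: "t \<in> {0..1}" unfolding t_def using False i by auto
  define R where "R = (\<Sum>i<N. of_real ((cmod (\<Phi> (real i / real N) t))\<^sup>2) * m (real i / real N)) / of_nat N"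
  define I where "I = (LINT x|unit_measure. of_real ((cmod (\<Phi> x t))\<^sup>2) * m x)"
  define r where "r = real N / real n"
  have w0: "w \<noteq> 0" using w z by auto
  have n: "n > 0" using Nn by simp
  have "(\<Sum>k<N + n. of_real (sampled_profile N n i k) * sampled_solution w N n k) = w * (of_real r * R)"
    unfolding sum_lessThan_add R_def r_def using False Nn n
    by (simp add: sampled_profile_def sampled_solution_def t_def sum_divide_distrib sum_distrib_left mult_ac)
  hence "vector_residual (N + n) (sampled_profile N n) w (sampled_solution w N n) i
     = 1 - column_value t - column_value t * (of_real r * R)"
    using False w0 by (simp add: sampled_solution_def t_def)
  also have "\<dots> = column_value t * (of_real c * I - of_real r * R)"
  proof -
    have "column_value t * (1 + of_real c * I) = 1"
      unfolding column_value_def column_average_def I_def using herglotz_denominator(4)[OF z H, of t, unfolded column_average_def] by simp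
    thus ?thesis by (simp add: algebra_simps)
  qed
  also have "of_real c * I - of_real r * R = of_real (c - r) * I + of_real r * (I - R)" by (simp add: algebra_simps)
  finally have *: "vector_residual (N + n) (sampled_profile N n) w (sampled_solution w N n) i
     = column_value t * (of_real (c - r) * I + of_real r * (I - R))" .
  have r1: "0 \<le> r" "r \<le> 1" unfolding r_def using Nn n by auto
  have I1: "cmod I \<le> 1"
    unfolding I_def
  proof (rule norm_integral_le_bound[OF prob_lam])
    fix x
    have "cmod (of_real ((cmod (\<Phi> x t))\<^sup>2) * m x) \<le> K * (1 / Im z)" by (rule column_integrand_le)
    also have "\<dots> \<le> 1" using y z by simp
    finally show "cmod (of_real ((cmod (\<Phi> x t))\<^sup>2) * m x) \<le> 1" .
  qed simp
  have "cmod (of_real (c - r) * I + of_real r * (I - R)) \<le> e * 1 + 1 * e"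
  proof (rule norm_triangle_mono)
    show "cmod (of_real (c - r) * I) \<le> e * 1" unfolding norm_mult norm_of_real using ratio e by (intro mult_mono I1) (auto simp: r_def)
    show "cmod (of_real r * (I - R)) \<le> 1 * e" unfolding norm_mult norm_of_real using r1 col[OF t]
      by (intro mult_mono) (auto simp: R_def I_def norm_minus_commute)
  qed
  moreover have "cmod (column_value t) \<le> 1" using column_value_le[of t] y z by simp
  ultimately have "cmod (column_value t * (of_real (c - r) * I + of_real r * (I - R))) \<le> 1 * (2 * e)"
    unfolding norm_mult by (intro mult_mono) auto
  thus ?thesis unfolding * by simp
qed

text \<open>Any family of approximate solutions of the vector equations therefore has the averages that
  the integral equation predicts.\<close>

lemma vector_equation_limit:
  fixes N :: "nat => nat" and g :: "nat => nat => complex"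
  assumes N: "\<And>n. 1 \<le> n \<Longrightarrow> 1 \<le> N n \<and> N n \<le> n" and lim: "(\<lambda>n. real (N n) / real n) \<longlonglongrightarrow> c" and c: "0 < c"
    and w: "w\<^sup>2 = z" and v: "0 < v" "v \<le> cmod w" "2 * v\<^sup>2 = Im z" and y: "8 * K \<le> Im z" "cmod z = Im z"
    and g: "\<And>n i. 1 \<le> n \<Longrightarrow> i < N n + n \<Longrightarrow> cmod (g n i) \<le> 1 / v"
    and r: "\<And>n i. 1 \<le> n \<Longrightarrow> i < N n + n \<Longrightarrow> cmod (vector_residual (N n + n) (sampled_profile (N n) n) w (g n) i) \<le> \<eta> n"
    and \<eta>: "\<eta> \<longlonglongrightarrow> 0"
  shows "(\<lambda>n. (\<Sum>i<N n. g n i) / (of_nat (N n) * w)) \<longlonglongrightarrow> (LINT u|unit_measure. m u)"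
proof (rule LIMSEQ_I)
  fix e :: real assume e: "0 < e"
  \<comment> \<open>The averages will differ by at most \<open>6 * e0\<close>, and the Riemann sum of \<open>m\<close> by \<open>e0\<close>.\<close>
  define e0 where "e0 = e / 8"
  have e0: "0 < e0" using e by (simp add: e0_def)
  have y1: "8 \<le> Im z" using y K1 by linarith
  have "2\<^sup>2 \<le> v\<^sup>2" using v y1 by (simp add: power2_eq_square)
  hence v2: "2 \<le> v" using v by (metis abs_le_square_iff abs_of_pos zero_less_numeral)
  have w1: "1 \<le> cmod w" using v v2 by linarith
  have cw: "cmod w * cmod w = Im z" using w y(2) by (metis norm_mult power2_eq_square)
  have row_cont: "continuous_on UNIV (\<lambda>p. of_real ((cmod (\<Phi> (fst p) (snd p)))\<^sup>2) * column_value (snd p))"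
    by (intro continuous_intros cont_profile continuous_on_compose2[OF continuous_column_value]) auto
  have col_cont: "continuous_on UNIV (\<lambda>p. of_real ((cmod (\<Phi> (snd p) (fst p)))\<^sup>2) * m (snd p))"
    by (intro continuous_intros cont_profile continuous_on_compose2[OF continuous_solution]) auto
  have m_cont: "continuous_on UNIV (\<lambda>p :: real \<times> real. m (snd p))"
    by (intro continuous_on_compose2[OF continuous_solution] continuous_intros) auto
  obtain n1 where n1: "\<forall>n\<ge>n1. \<forall>u\<in>{0..1}.
      cmod ((\<Sum>j<n. of_real ((cmod (\<Phi> u (real j / real n)))\<^sup>2) * column_value (real j / real n)) / of_nat n
        - (LINT t|unit_measure. of_real ((cmod (\<Phi> u t))\<^sup>2) * column_value t)) \<le> e0"
    using riemann_sum_uniform[of "\<lambda>u t. of_real ((cmod (\<Phi> u t))\<^sup>2) * column_value t", OF row_cont row_integrand_le e0] by (elim exE) (rule that)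
  obtain n2 where n2: "\<forall>n\<ge>n2. \<forall>t\<in>{0..1}.
      cmod ((\<Sum>j<n. of_real ((cmod (\<Phi> (real j / real n) t))\<^sup>2) * m (real j / real n)) / of_nat n
        - (LINT x|unit_measure. of_real ((cmod (\<Phi> x t))\<^sup>2) * m x)) \<le> e0"
    using riemann_sum_uniform[of "\<lambda>t x. of_real ((cmod (\<Phi> x t))\<^sup>2) * m x", OF col_cont column_integrand_le e0] by (elim exE) (rule that)
  obtain n3 where n3: "\<forall>n\<ge>n3. \<forall>u\<in>{0..1::real}. cmod ((\<Sum>j<n. m (real j / real n)) / of_nat n - (LINT u|unit_measure. m u)) \<le> e0"
    using riemann_sum_uniform[of "\<lambda>_ x. m x", OF m_cont solution_facts(2) e0] by (elim exE) (rule that)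
  note inf = filterlim_size_at_top[OF lim c]
  have big: "eventually (\<lambda>n. real (n2 + n3) \<le> real (N n)) sequentially" using inf unfolding filterlim_at_top by blast
  have "eventually (\<lambda>n. \<bar>real (N n) / real n - c\<bar> < e0) sequentially"
    using tendstoD[OF lim e0] by (simp add: dist_real_def)
  moreover have "eventually (\<lambda>n. \<bar>\<eta> n\<bar> < e0) sequentially" using tendstoD[OF \<eta> e0] by (simp add: dist_real_def)
  ultimately have "eventually (\<lambda>n. cmod ((\<Sum>i<N n. g n i) / (of_nat (N n) * w) - (LINT u|unit_measure. m u)) < e) sequentially"
    using big eventually_ge_at_top[of "max 1 n1"]
  proof eventually_elim
    fix n assume ratio: "\<bar>real (N n) / real n - c\<bar> < e0" and \<eta>n: "\<bar>\<eta> n\<bar> < e0" and bigN: "real (n2 + n3) \<le> real (N n)" and n: "max 1 n1 \<le> n"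
    have Nn: "1 \<le> N n" "N n \<le> n" "1 \<le> n" "n2 \<le> N n" "n3 \<le> N n" "n1 \<le> n" using N[of n] n bigN by auto
    have close: "cmod (g n i - sampled_solution w (N n) n i) \<le> 2 * (e0 + 2 * e0) / v" if i: "i < N n + n" for i
    proof (rule vector_equation_stable[where s="sampled_profile (N n) n" and L=K, OF _ _ v(1,2) g[OF Nn(3)] _ _ _ i])
      show "(\<Sum>k<N n + n. \<bar>sampled_profile (N n) n i k\<bar>) \<le> K" for i using Nn by (intro sampled_profile_row_sum) auto
      show "K \<le> v\<^sup>2 / 4" using v y by simp
      show "cmod (vector_residual (N n + n) (sampled_profile (N n) n) w (g n) i) \<le> e0" if "i < N n + n" for i
        using r[OF Nn(3) that] \<eta>n by linarith
      show "cmod (vector_residual (N n + n) (sampled_profile (N n) n) w (sampled_solution w (N n) n) i) \<le> 2 * e0"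
        if "i < N n + n" for i
        using that ratio y y1 K1 e0 by (intro sampled_solution_residual[OF w Nn(1,2)] n1[rule_format, OF Nn(6)] n2[rule_format, OF Nn(4)]) auto
      show "cmod (sampled_solution w (N n) n i) \<le> 1 / v" if "i < N n + n" for i
      proof -
        have "cmod (sampled_solution w (N n) n i) \<le> 1 / cmod w"
        proof (cases "i < N n")
          case True
          have "cmod (sampled_solution w (N n) n i) \<le> cmod w * (1 / Im z)"
            using True mult_left_mono[OF solution_facts(2)[of "real i / real (N n)"] norm_ge_zero[of w]] by (simp add: sampled_solution_def norm_mult)
          also have "\<dots> = 1 / cmod w" using cw[symmetric] w1 by auto
          finally show ?thesis .
        next
          case False
          have "cmod (column_value t) \<le> 1" for t using column_value_le[of t] y z by simp
          thus ?thesis unfolding sampled_solution_def using False by (auto simp: norm_divide intro!: divide_right_mono)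
        qed
        also have "\<dots> \<le> 1 / v" using v by (intro frac_le) auto
        finally show ?thesis .
      qed
    qed
    have "2 * (e0 + 2 * e0) / v \<le> 6 * e0" using v2 e0 by (simp add: field_simps)
    hence close': "cmod (g n i - w * m (real i / real (N n))) \<le> 6 * e0" if "i < N n" for i
      using close[of i] that by (simp add: sampled_solution_def)
    have w0: "w \<noteq> 0" using w1 by auto
    have N0: "of_nat (N n) \<noteq> (0::complex)" using Nn by simp
    have "(\<Sum>i<N n. g n i) / (of_nat (N n) * w) - (\<Sum>i<N n. m (real i / real (N n))) / of_nat (N n)
       = (\<Sum>i<N n. (g n i - w * m (real i / real (N n)))) / (of_nat (N n) * w)"
      unfolding sum_subtractf sum_distrib_left[symmetric] using w0 N0 by (simp add: diff_divide_distrib)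
    also have "cmod \<dots> \<le> (\<Sum>i<N n. 6 * e0) / (real (N n) * 1)"
      unfolding norm_divide norm_mult norm_of_nat using close' Nn w1 e0
      by (intro frac_le sum_norm_le mult_left_mono) (auto intro: sum_nonneg)
    also have "\<dots> = 6 * e0" using Nn by simp
    finally have "cmod ((\<Sum>i<N n. g n i) / (of_nat (N n) * w) - (\<Sum>i<N n. m (real i / real (N n))) / of_nat (N n)) \<le> 6 * e0" .
    moreover have "cmod ((\<Sum>i<N n. m (real i / real (N n))) / of_nat (N n) - (LINT u|unit_measure. m u)) \<le> e0"
      by (rule n3[rule_format, OF Nn(5), of 0]) simp
    ultimately have "cmod ((\<Sum>i<N n. g n i) / (of_nat (N n) * w) - (LINT u|unit_measure. m u)) \<le> 6 * e0 + e0"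
      using norm_diff_triangle_le by blast
    thus "cmod ((\<Sum>i<N n. g n i) / (of_nat (N n) * w) - (LINT u|unit_measure. m u)) < e" using e by (simp add: e0_def)
  qed
  thus "\<exists>no. \<forall>n\<ge>no. cmod ((\<Sum>i<N n. g n i) / (of_nat (N n) * w) - (LINT u|unit_measure. m u)) < e"
    unfolding eventually_sequentially .
qed

end

end

section \<open>The normalized trace of the Gaussian model\<close>

context filter_size
begin

sublocale gaussian: gaussian_hermitian "N + n" index_set coupling variance_profile "S / sqrt (real n)"
  by (rule gaussian_coupling)

text \<open>By Hermitization, the Stieltjes transform at \<open>w\<^sup>2\<close> of the spectral law of the periodized matrix.\<close>

definition model_trace :: "complex => (int \<times> int => complex) => complex" where
  "model_trace w u = (\<Sum>i<N. resolvent (N + n) (hermitization N (fourier_transform (periodized u))) w i i) / (of_nat N * w)"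

lemma H_hermitization: "gaussian.H u = hermitization N (fourier_transform (periodized u))"
  by (intro ext) (simp only: H_coupling hermitization_def)

lemma row_sum_as_weighted_trace:
  "(\<Sum>i<N. f i) / (of_nat N * w) = (\<Sum>i<N + n. (if i < N then 1 / (of_nat N * w) else 0) * f i)" for f :: "nat => complex"
  unfolding sum_lessThan_add by (simp add: sum_divide_distrib)

lemma norm_row_weight: "cmod (if i < N then 1 / (of_nat N * w) else 0) \<le> 1 / (real N * cmod w)"
  by (simp add: norm_divide norm_mult)

lemma model_trace_restrict: "model_trace w (restrict u index_set) = model_trace w u"
proof -
  have "gaussian.H (restrict u index_set) = gaussian.H u" unfolding gaussian.H_def by (intro ext sum.cong) auto
  thus ?thesis unfolding model_trace_def H_hermitization[symmetric] by simp
qed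

context
  fixes w :: complex assumes w: "Im w > 0"
begin

lemma model_trace_gaussian: "model_trace w u = (\<Sum>i<N + n. (if i < N then 1 / (of_nat N * w) else 0) * gaussian.G w u i i)"
  unfolding model_trace_def H_hermitization[symmetric] gaussian.G_def[OF w] by (rule row_sum_as_weighted_trace)

lemma model_trace_measurable: "model_trace w \<in> borel_measurable (gauss_vec index_set)"
  unfolding model_trace_gaussian[abs_def]
  by (intro borel_measurable_sum borel_measurable_times borel_measurable_const gaussian.G_measurable[OF w]) auto

lemma model_trace_le: "cmod (model_trace w u) \<le> 1 / (cmod w * Im w)"
proof -
  have "cmod (model_trace w u) \<le> (\<Sum>i<N. 1 / Im w) / (real N * cmod w)"
    unfolding model_trace_def norm_divide norm_mult norm_of_nat
    by (intro divide_right_mono sum_norm_le resolvent_entry_le[OF hermitian_hermitization w]) auto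
  thus ?thesis using N by (simp add: mult.commute)
qed

definition model_mean :: "nat => complex" where
  "model_mean i = (LINT x|gauss_vec index_set. gaussian.G w x i i)"

lemma model_trace_mean: "(LINT x|gauss_vec index_set. model_trace w x) = (\<Sum>i<N. model_mean i) / (of_nat N * w)"
proof -
  have "(LINT x|gauss_vec index_set. model_trace w x) = (\<Sum>i<N + n. (if i < N then 1 / (of_nat N * w) else 0) * model_mean i)"
    unfolding model_trace_gaussian model_mean_def
    by (subst Bochner_Integration.integral_sum) (auto intro!: gaussian.G_integrable[OF w])
  thus ?thesis unfolding row_sum_as_weighted_trace .
qed

lemma model_mean_le: "i < N + n \<Longrightarrow> cmod (model_mean i) \<le> 1 / Im w"
  unfolding model_mean_def using w by (intro norm_integral_le_bound[OF prob_gauss_vec] gaussian.G_le[OF w]) auto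

lemma model_mean_residual:
  assumes i: "i < N + n" and Nn: "N \<le> n"
  shows "cmod (vector_residual (N + n) variance_profile w model_mean i)
    \<le> 2 * S ^ 3 / (Im w) ^ 3 / sqrt (real n)"
proof -
  have "cmod (vector_residual (N + n) variance_profile w model_mean i)
     \<le> (1 / Im w) * (sqrt (real (card index_set)) * (2 * (S / sqrt (real n)) * (S\<^sup>2 / real n) / (Im w)\<^sup>2))"
    unfolding model_mean_def by (rule gaussian.approximate_vector_equation[OF w i variance_profile_le])
  also have "\<dots> \<le> (1 / Im w) * (real n * (2 * (S / sqrt (real n)) * (S\<^sup>2 / real n) / (Im w)\<^sup>2))"
  proof (intro mult_left_mono mult_right_mono)
    have "sqrt (real N * real n) \<le> sqrt (real n * real n)" using Nn by (intro real_sqrt_le_mono mult_right_mono) auto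
    thus "sqrt (real (card index_set)) \<le> real n" unfolding index_set_facts(2) by simp
  qed (use w S_nonneg in auto)
  also have "\<dots> = 2 * S ^ 3 / (Im w) ^ 3 / sqrt (real n)"
    using n w by (simp add: field_simps power2_eq_square power3_eq_cube)
  finally show ?thesis .
qed

text \<open>Each coordinate moves the trace by a multiple of \<open>1 / sqrt n\<close> times the weight \<open>1 / N\<close>, and
  there are \<open>N * n\<close> coordinates, so the variance is of order \<open>1 / N\<close>.\<close>

lemma model_trace_deviation:
  assumes d: "\<delta> > 0"
  shows "measure (gauss_vec index_set) {x \<in> space (gauss_vec index_set). \<delta> \<le> cmod (model_trace w x - (\<Sum>i<N. model_mean i) / (of_nat N * w))}
    \<le> 4 * S\<^sup>2 / ((cmod w)\<^sup>2 * (Im w) ^ 4 * \<delta>\<^sup>2) / real N"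
proof -
  interpret gv: prob_space "gauss_vec index_set" by (rule prob_gauss_vec)
  note [measurable] = model_trace_measurable
  let ?e = "(\<Sum>i<N. model_mean i) / (of_nat N * w)"
  let ?q = "\<lambda>x. (cmod (model_trace w x - ?e))\<^sup>2"
  have w0: "cmod w > 0" using w by auto
  have int: "integrable (gauss_vec index_set) ?q"
  proof (rule gv.integrable_const_bound[where B="(1 / (cmod w * Im w) + cmod ?e)\<^sup>2"])
    show "AE x in gauss_vec index_set. norm (?q x) \<le> (1 / (cmod w * Im w) + cmod ?e)\<^sup>2"
      using model_trace_le by (intro AE_I2) (auto intro!: power_mono order_trans[OF norm_triangle_ineq4] add_mono)
  qed measurable
  have "measure (gauss_vec index_set) {x \<in> space (gauss_vec index_set). \<delta> \<le> cmod (model_trace w x - ?e)}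
     = measure (gauss_vec index_set) {x \<in> space (gauss_vec index_set). \<delta>\<^sup>2 \<le> ?q x}"
    using d by (intro arg_cong[where f="measure _"] Collect_cong conj_cong refl) (auto simp: power_mono abs_le_square_iff[symmetric])
  also have "\<dots> \<le> (LINT x|gauss_vec index_set. ?q x) / \<delta>\<^sup>2"
    using d by (intro integral_Markov_inequality_measure[OF int sets.top]) auto
  also have "\<dots> \<le> real (card index_set) * (2 * (S / sqrt (real n)) * (1 / (real N * cmod w)) / (Im w)\<^sup>2)\<^sup>2 / \<delta>\<^sup>2"
    using gaussian.weighted_trace_variance[OF w, where d="\<lambda>i. if i < N then 1 / (of_nat N * w) else 0", OF norm_row_weight, folded model_trace_gaussian, unfolded model_trace_mean]
    by (rule divide_right_mono) simp
  also have "\<dots> = 4 * S\<^sup>2 / ((cmod w)\<^sup>2 * (Im w) ^ 4 * \<delta>\<^sup>2) / real N"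
    unfolding index_set_facts(2) using N n d w w0
    by (simp add: field_simps power2_eq_square power4_eq_xxxx)
  finally show ?thesis .
qed

end

section \<open>Comparison with the periodized matrix\<close>

text \<open>Hermitization and the unitary invariance of the spectrum turn the transform into a trace; the
  Lipschitz bound then compares it with the model, and the Fourier transform preserves the distance.\<close>

lemma fourier_gram_stieltjes:
  assumes Z: "Z \<in> carrier_mat N n"
  obtains \<nu> where "real_distribution \<nu>" "cdf \<nu> = empirical_cdf (Z * mat_adjoint Z)"
    "\<And>a. a > 0 \<Longrightarrow> measure \<nu> {x. a < \<bar>x\<bar>} \<le> ((\<Sum>i<N. \<Sum>j<n. (cmod (Z $$ (i, j)))\<^sup>2) / real N) / a"
    "\<And>w u. Im w > 0 \<Longrightarrow> cmod (stieltjes_transform \<nu> (w\<^sup>2) - model_trace w u)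
       \<le> sqrt (2 * (\<Sum>i<N. \<Sum>j<n. (cmod (Z $$ (i, j) - periodized u i j))\<^sup>2)) * (1 / (real N * cmod w) / (Im w)\<^sup>2 * sqrt (real (N + n)))"
proof -
  define W where "W = Matrix.mat N n (\<lambda>(a, b). fourier_transform (\<lambda>i j. Z $$ (i, j)) a b)"
  have W: "W \<in> carrier_mat N n" unfolding W_def by simp
  have cW: "mat_adjoint W \<in> carrier_mat n N" by (rule mat_adjoint_carrier[OF W])
  let ?X = "hermitization N (\<lambda>i j. W $$ (i, j))"
  obtain \<nu> where \<nu>: "real_distribution \<nu>" "cdf \<nu> = empirical_cdf (Z * mat_adjoint Z)"
    "\<And>a. a > 0 \<Longrightarrow> measure \<nu> {x. a < \<bar>x\<bar>} \<le> ((\<Sum>i<N. \<Sum>j<n. (cmod (Z $$ (i, j)))\<^sup>2) / real N) / a"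
    and st: "\<And>A R z. A \<in> carrier_mat N N \<Longrightarrow> char_poly A = char_poly (Z * mat_adjoint Z) \<Longrightarrow> R \<in> carrier_mat N N \<Longrightarrow>
       (A - z \<cdot>\<^sub>m 1\<^sub>m N) * R = 1\<^sub>m N \<Longrightarrow> stieltjes_transform \<nu> z = mtrace R / of_nat N"
    using gram_spectral_measure[OF Z N] by blast
  show thesis
  proof (rule that[OF \<nu>])
    fix w u assume w: "Im w > 0"
    let ?Y = "hermitization N (fourier_transform (periodized u))"
    let ?d = "\<lambda>i. if i < N then 1 / (of_nat N * w) else 0"
    have "stieltjes_transform \<nu> (w\<^sup>2) = mtrace (Matrix.mat N N (\<lambda>(i, j). resolvent (N + n) ?X w i j / w)) / of_nat N"
      using W cW fourier_gram_char_poly[OF Z, folded W_def]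
      by (intro st[OF _ _ _ hermitization_resolvent[OF W w]]) auto
    also have "\<dots> = (\<Sum>i<N. resolvent (N + n) ?X w i i) / (of_nat N * w)"
      unfolding mtrace_def by (simp add: sum_divide_distrib[symmetric] mult.commute)
    also have "\<dots> = (\<Sum>i<N + n. ?d i * resolvent (N + n) ?X w i i)" by (rule row_sum_as_weighted_trace)
    finally have sX: "stieltjes_transform \<nu> (w\<^sup>2) = (\<Sum>i<N + n. ?d i * resolvent (N + n) ?X w i i)" .
    have sY: "model_trace w u = (\<Sum>i<N + n. ?d i * resolvent (N + n) ?Y w i i)"
      unfolding model_trace_def by (rule row_sum_as_weighted_trace)
    have "(\<Sum>k<N + n. \<Sum>l<N + n. (cmod (?Y k l - ?X k l))\<^sup>2)
       = (\<Sum>a<N. \<Sum>b<n. (cmod (fourier_transform (periodized u) a b - W $$ (a, b)))\<^sup>2) + (\<Sum>b<n. \<Sum>a<N. (cmod (fourier_transform (periodized u) a b - W $$ (a, b)))\<^sup>2)"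
      unfolding sum_lessThan_add by (simp add: hermitization_def sum.distrib complex_cnj_diff[symmetric] del: complex_cnj_diff)
    also have "(\<Sum>b<n. \<Sum>a<N. (cmod (fourier_transform (periodized u) a b - W $$ (a, b)))\<^sup>2) = (\<Sum>a<N. \<Sum>b<n. (cmod (fourier_transform (periodized u) a b - W $$ (a, b)))\<^sup>2)"
      by (rule sum.swap)
    also have "(\<Sum>a<N. \<Sum>b<n. (cmod (fourier_transform (periodized u) a b - W $$ (a, b)))\<^sup>2)
       = (\<Sum>a<N. \<Sum>b<n. (cmod (fourier_transform (\<lambda>i j. Z $$ (i, j) - periodized u i j) a b))\<^sup>2)"
      unfolding fourier_transform_diff W_def by (intro sum.cong refl) (simp add: norm_minus_commute)
    also have "\<dots> = (\<Sum>i<N. \<Sum>j<n. (cmod (Z $$ (i, j) - periodized u i j))\<^sup>2)" by (rule fourier_transform_isometry)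
    finally have dist: "(\<Sum>k<N + n. \<Sum>l<N + n. (cmod (?Y k l - ?X k l))\<^sup>2) = 2 * (\<Sum>i<N. \<Sum>j<n. (cmod (Z $$ (i, j) - periodized u i j))\<^sup>2)" by simp
    show "cmod (stieltjes_transform \<nu> (w\<^sup>2) - model_trace w u)
       \<le> sqrt (2 * (\<Sum>i<N. \<Sum>j<n. (cmod (Z $$ (i, j) - periodized u i j))\<^sup>2)) * (1 / (real N * cmod w) / (Im w)\<^sup>2 * sqrt (real (N + n)))"
      unfolding sX sY dist[symmetric]
      by (rule resolvent_trace_lipschitz[OF hermitian_hermitization hermitian_hermitization w norm_row_weight])
  qed
qed

end

context summable_filter
begin

lemma borel_measurable_nn_integral_count_space:
  fixes f :: "'a => 'i::countable => ennreal"
  assumes "\<And>i. (\<lambda>x. f x i) \<in> borel_measurable M"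
  shows "(\<lambda>x. \<integral>\<^sup>+i. f x i \<partial>count_space UNIV) \<in> borel_measurable M"
proof -
  interpret sigma_finite_measure "count_space (UNIV :: 'i set)" by (rule sigma_finite_measure_count_space)
  have "(\<lambda>(i, x). f x i) \<in> borel_measurable (count_space UNIV \<Otimes>\<^sub>M M)"
    by (rule measurable_pair_measure_countable1) (use assms in auto)
  hence "(\<lambda>(x, i). f x i) \<in> borel_measurable (M \<Otimes>\<^sub>M count_space UNIV)"
    by (subst measurable_pair_swap_iff) (simp add: case_prod_beta')
  thus ?thesis by (rule borel_measurable_nn_integral)
qed

text \<open>The Cauchy-Schwarz inequality for the measure with weights \<open>\<bar>h k\<bar>\<close>.\<close>

lemma filter_cauchy_schwarz:
  "ennreal ((cmod (LINT k|count_space UNIV. h k * g k))\<^sup>2) \<le> ennreal S * (\<integral>\<^sup>+k. ennreal (cmod (h k) * (cmod (g k))\<^sup>2) \<partial>count_space UNIV)"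
proof (cases "integrable (count_space UNIV) (\<lambda>k. h k * g k)")
  case True
  let ?a = "\<lambda>k. ennreal (sqrt (cmod (h k)))" and ?b = "\<lambda>k. ennreal (sqrt (cmod (h k)) * cmod (g k))"
  have "ennreal (cmod (LINT k|count_space UNIV. h k * g k)) \<le> (\<integral>\<^sup>+k. norm (h k * g k) \<partial>count_space UNIV)"
    by (rule integral_norm_bound_ennreal[OF True])
  also have "\<dots> = (\<integral>\<^sup>+k. ?a k * ?b k \<partial>count_space UNIV)"
    by (intro nn_integral_cong) (simp add: ennreal_mult[symmetric] norm_mult mult.assoc[symmetric])
  finally have "(ennreal (cmod (LINT k|count_space UNIV. h k * g k)))\<^sup>2 \<le> (\<integral>\<^sup>+k. ?a k * ?b k \<partial>count_space UNIV)\<^sup>2"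
    by (rule power_mono) simp
  also have "\<dots> \<le> (\<integral>\<^sup>+k. (?a k)\<^sup>2 \<partial>count_space UNIV) * (\<integral>\<^sup>+k. (?b k)\<^sup>2 \<partial>count_space UNIV)"
    by (rule Cauchy_Schwarz_nn_integral) auto
  also have "\<dots> = ennreal S * (\<integral>\<^sup>+k. ennreal (cmod (h k) * (cmod (g k))\<^sup>2) \<partial>count_space UNIV)"
    unfolding S_ennreal[symmetric] by (simp add: ennreal_power power_mult_distrib)
  finally show ?thesis by (simp add: ennreal_power)
qed (simp add: not_integrable_integral_eq)

end

section \<open>The filtered field on a probability space\<close>

locale gaussian_field = summable_filter + prob_space P for P :: "'w measure" +
  fixes U :: "int \<times> int => 'w => complex"
  assumes U_indep: "indep_vars (\<lambda>_. borel) U UNIV" and U_law: "\<And>p. distr P borel (U p) = CN"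
begin

lemma U_measurable [measurable]: "U p \<in> borel_measurable P"
  using U_indep unfolding indep_vars_def by (elim conjE) (erule bspec, simp)

lemma U_nn_integral:
  assumes [measurable]: "f \<in> borel_measurable borel"
  shows "(\<integral>\<^sup>+\<omega>. f (U p \<omega>) \<partial>P) = (\<integral>\<^sup>+y. f y \<partial>CN)"
  unfolding U_law[of p, symmetric] by (subst nn_integral_distr) auto

lemma U_second_moment: "(\<integral>\<^sup>+\<omega>. ennreal ((cmod (U p \<omega>))\<^sup>2) \<partial>P) = 1"
proof -
  have "(\<integral>\<^sup>+\<omega>. ennreal ((cmod (U p \<omega>))\<^sup>2) \<partial>P) = (\<integral>\<^sup>+y. ennreal ((cmod y)\<^sup>2) \<partial>CN)"
    by (rule U_nn_integral) measurable
  also have "\<dots> = ennreal 1" unfolding std_complex_normal_moment2(2)[symmetric]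
    by (rule nn_integral_eq_integral[OF std_complex_normal_moment2(1)]) simp
  finally show ?thesis by simp
qed

lemma U_first_moment: "(\<integral>\<^sup>+\<omega>. ennreal (cmod (U p \<omega>)) \<partial>P) \<le> 2"
proof -
  have "(\<integral>\<^sup>+\<omega>. ennreal (cmod (U p \<omega>)) \<partial>P) \<le> (\<integral>\<^sup>+\<omega>. 1 + ennreal ((cmod (U p \<omega>))\<^sup>2) \<partial>P)"
  proof (intro nn_integral_mono)
    fix \<omega>
    have "cmod (U p \<omega>) \<le> 1 + (cmod (U p \<omega>))\<^sup>2" by (smt (verit) power2_eq_square mult_le_cancel_right1 norm_ge_zero zero_le_power2)
    hence "ennreal (cmod (U p \<omega>)) \<le> ennreal (1 + (cmod (U p \<omega>))\<^sup>2)" by (rule ennreal_leI)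
    thus "ennreal (cmod (U p \<omega>)) \<le> 1 + ennreal ((cmod (U p \<omega>))\<^sup>2)" by (simp add: ennreal_plus)
  qed
  also have "\<dots> = (\<integral>\<^sup>+\<omega>. 1 \<partial>P) + (\<integral>\<^sup>+\<omega>. ennreal ((cmod (U p \<omega>))\<^sup>2) \<partial>P)" by (rule nn_integral_add) auto
  also have "\<dots> = 2" unfolding U_second_moment by (simp add: emeasure_space_1)
  finally show ?thesis .
qed

lemma U_restrict_measurable: "(\<lambda>\<omega>. restrict (\<lambda>p. U p \<omega>) R) \<in> P \<rightarrow>\<^sub>M gauss_vec R"
  unfolding restrict_def by (intro measurable_PiM_single') (auto simp: measurable_cong_sets[OF refl sets_std_complex_normal])

lemma U_restrict_law:
  assumes "R \<noteq> {}" shows "distr P (gauss_vec R) (\<lambda>\<omega>. restrict (\<lambda>p. U p \<omega>) R) = gauss_vec R"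
proof -
  have "indep_vars (\<lambda>_. borel) U R" by (rule indep_vars_subset[OF U_indep]) simp
  hence "distr P (PiM R (\<lambda>_. borel)) (\<lambda>\<omega>. restrict (\<lambda>p. U p \<omega>) R) = PiM R (\<lambda>p. distr P borel (U p))"
    using indep_vars_iff_distr_eq_PiM'[OF assms, of U "\<lambda>_. borel"] by simp
  moreover have "distr P (PiM R (\<lambda>_. borel)) (\<lambda>\<omega>. restrict (\<lambda>p. U p \<omega>) R) = distr P (gauss_vec R) (\<lambda>\<omega>. restrict (\<lambda>p. U p \<omega>) R)"
    by (intro distr_cong refl sets_PiM_cong) simp
  ultimately show ?thesis unfolding U_law by simp
qed

text \<open>The expected sums of absolute values are finite.\<close>

lemma filter_output_AE:
  "AE \<omega> in P. \<forall>q. integrable (count_space UNIV) (\<lambda>k. h k * U (q - k) \<omega>)"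
  unfolding AE_all_countable
proof
  fix q
  have "(\<integral>\<^sup>+\<omega>. (\<integral>\<^sup>+k. ennreal (cmod (h k)) * ennreal (cmod (U (q - k) \<omega>)) \<partial>count_space UNIV) \<partial>P)
     = (\<integral>\<^sup>+k. (\<integral>\<^sup>+\<omega>. ennreal (cmod (h k)) * ennreal (cmod (U (q - k) \<omega>)) \<partial>P) \<partial>count_space UNIV)"
    by (rule nn_integral_count_space_nn_integral) auto
  also have "\<dots> = (\<integral>\<^sup>+k. ennreal (cmod (h k)) * (\<integral>\<^sup>+\<omega>. ennreal (cmod (U (q - k) \<omega>)) \<partial>P) \<partial>count_space UNIV)"
    by (intro nn_integral_cong nn_integral_cmult) auto
  also have "\<dots> \<le> (\<integral>\<^sup>+k. ennreal (cmod (h k)) * 2 \<partial>count_space UNIV)"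
    by (intro nn_integral_mono mult_left_mono U_first_moment) simp
  also have "\<dots> = ennreal S * 2" unfolding S_ennreal[symmetric] by (rule nn_integral_multc) auto
  also have "\<dots> < \<infinity>" by (simp add: ennreal_mult_less_top)
  finally have fin: "(\<integral>\<^sup>+\<omega>. (\<integral>\<^sup>+k. ennreal (cmod (h k)) * ennreal (cmod (U (q - k) \<omega>)) \<partial>count_space UNIV) \<partial>P) \<noteq> \<infinity>" by simp
  have "AE \<omega> in P. (\<integral>\<^sup>+k. ennreal (cmod (h k)) * ennreal (cmod (U (q - k) \<omega>)) \<partial>count_space UNIV) \<noteq> \<infinity>"
  proof (rule nn_integral_PInf_AE[OF _ fin])
    show "(\<lambda>\<omega>. \<integral>\<^sup>+k. ennreal (cmod (h k)) * ennreal (cmod (U (q - k) \<omega>)) \<partial>count_space UNIV) \<in> borel_measurable P"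
      by (rule borel_measurable_nn_integral_count_space) auto
  qed
  thus "AE \<omega> in P. integrable (count_space UNIV) (\<lambda>k. h k * U (q - k) \<omega>)"
  proof eventually_elim
    fix \<omega> assume "(\<integral>\<^sup>+k. ennreal (cmod (h k)) * ennreal (cmod (U (q - k) \<omega>)) \<partial>count_space UNIV) \<noteq> \<infinity>"
    thus "integrable (count_space UNIV) (\<lambda>k. h k * U (q - k) \<omega>)"
      by (intro integrableI_bounded) (auto simp: norm_mult ennreal_mult less_top)
  qed
qed

text \<open>The weighted energy of a family of field values that depend on the filter index, which
  controls the squared entries through the Cauchy-Schwarz inequality.\<close>

definition energy :: "(int \<times> int) set => (int \<times> int => int \<times> int => 'w => complex) => 'w => ennreal" where
  "energy R V \<omega> = (\<Sum>p\<in>R. \<integral>\<^sup>+k. ennreal (cmod (h k) * (cmod (V p k \<omega>))\<^sup>2) \<partial>count_space UNIV)"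

lemma energy_measurable:
  assumes "\<And>p k. V p k \<in> borel_measurable P" shows "energy R V \<in> borel_measurable P"
proof -
  note [measurable] = assms
  show ?thesis unfolding energy_def[abs_def]
    by (intro borel_measurable_sum borel_measurable_nn_integral_count_space) measurable
qed

lemma energy_expectation:
  assumes "\<And>p k. V p k \<in> borel_measurable P" and R: "finite R"
    and b: "\<And>p k. p \<in> R \<Longrightarrow> (\<integral>\<^sup>+\<omega>. ennreal ((cmod (V p k \<omega>))\<^sup>2) \<partial>P) \<le> B p k"
  shows "(\<integral>\<^sup>+\<omega>. energy R V \<omega> \<partial>P) \<le> (\<integral>\<^sup>+k. ennreal (cmod (h k)) * (\<Sum>p\<in>R. B p k) \<partial>count_space UNIV)"
proof -
  note [measurable] = assms(1)
  have "(\<integral>\<^sup>+\<omega>. energy R V \<omega> \<partial>P) = (\<Sum>p\<in>R. \<integral>\<^sup>+\<omega>. (\<integral>\<^sup>+k. ennreal (cmod (h k) * (cmod (V p k \<omega>))\<^sup>2) \<partial>count_space UNIV) \<partial>P)"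
    unfolding energy_def by (intro nn_integral_sum borel_measurable_nn_integral_count_space) measurable
  also have "\<dots> = (\<Sum>p\<in>R. \<integral>\<^sup>+k. (\<integral>\<^sup>+\<omega>. ennreal (cmod (h k) * (cmod (V p k \<omega>))\<^sup>2) \<partial>P) \<partial>count_space UNIV)"
    by (intro sum.cong refl nn_integral_count_space_nn_integral) auto
  also have "\<dots> = (\<Sum>p\<in>R. \<integral>\<^sup>+k. ennreal (cmod (h k)) * (\<integral>\<^sup>+\<omega>. ennreal ((cmod (V p k \<omega>))\<^sup>2) \<partial>P) \<partial>count_space UNIV)"
    by (intro sum.cong refl nn_integral_cong, subst nn_integral_cmult[symmetric]) (auto simp: ennreal_mult)
  also have "\<dots> \<le> (\<Sum>p\<in>R. \<integral>\<^sup>+k. ennreal (cmod (h k)) * B p k \<partial>count_space UNIV)"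
    by (intro sum_mono nn_integral_mono mult_left_mono b) auto
  also have "\<dots> = (\<integral>\<^sup>+k. (\<Sum>p\<in>R. ennreal (cmod (h k)) * B p k) \<partial>count_space UNIV)"
    by (intro nn_integral_sum[symmetric]) auto
  finally show ?thesis by (simp add: sum_distrib_left)
qed

lemma energy_controls_entries:
  assumes R: "finite R" and x: "\<And>p. p \<in> R \<Longrightarrow> x p = (LINT k|count_space UNIV. h k * V p k \<omega>) / of_real (sqrt (real n))" and n: "n > 0"
  shows "ennreal (\<Sum>p\<in>R. (cmod (x p))\<^sup>2) \<le> ennreal (S / real n) * energy R V \<omega>"
proof -
  have "ennreal ((cmod (x p))\<^sup>2) \<le> ennreal (S / real n) * (\<integral>\<^sup>+k. ennreal (cmod (h k) * (cmod (V p k \<omega>))\<^sup>2) \<partial>count_space UNIV)" if "p \<in> R" for p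
  proof -
    have "ennreal ((cmod (x p))\<^sup>2) = ennreal (1 / real n) * ennreal ((cmod (LINT k|count_space UNIV. h k * V p k \<omega>))\<^sup>2)"
      unfolding x[OF that] norm_divide using n by (simp add: power_divide ennreal_mult[symmetric])
    also have "\<dots> \<le> ennreal (1 / real n) * (ennreal S * (\<integral>\<^sup>+k. ennreal (cmod (h k) * (cmod (V p k \<omega>))\<^sup>2) \<partial>count_space UNIV))"
      by (intro mult_left_mono filter_cauchy_schwarz) simp
    also have "\<dots> = ennreal (S / real n) * (\<integral>\<^sup>+k. ennreal (cmod (h k) * (cmod (V p k \<omega>))\<^sup>2) \<partial>count_space UNIV)"
      using S_nonneg by (simp add: mult.assoc[symmetric] ennreal_mult[symmetric])
    finally show ?thesis .
  qed
  hence "(\<Sum>p\<in>R. ennreal ((cmod (x p))\<^sup>2)) \<le> ennreal (S / real n) * energy R V \<omega>"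
    unfolding energy_def sum_distrib_left by (intro sum_mono) auto
  thus ?thesis by simp
qed

end

context filter_size
begin

text \<open>The number of positions for which the shift by \<open>k\<close> wraps around.\<close>

definition boundary :: "int \<times> int => nat" where
  "boundary k = card {p \<in> index_set. p - k \<notin> index_set}"

lemma boundary_le_all: "boundary k \<le> N * n"
  unfolding boundary_def index_set_facts(2)[symmetric] by (intro card_mono index_set_facts) auto

lemma boundary_le: "real (boundary k) \<le> (\<bar>real_of_int (fst k)\<bar> * real n + \<bar>real_of_int (snd k)\<bar> * real N)"
proof -
  have shift: "card {p \<in> {0..<int M}. p - k \<notin> {0..<int M}} \<le> nat \<bar>k\<bar>" for M k
  proof -
    have "card {p \<in> {0..<int M}. p - k \<notin> {0..<int M}} \<le> card (if 0 \<le> k then {0..<k} else {int M + k..<int M})"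
      by (intro card_mono) auto
    also have "\<dots> = nat \<bar>k\<bar>" by simp
    finally show ?thesis .
  qed
  let ?X = "{p \<in> {0..<int N}. p - fst k \<notin> {0..<int N}}" and ?Y = "{p \<in> {0..<int n}. p - snd k \<notin> {0..<int n}}"
  have "finite ?X" "finite ?Y" by (rule finite_subset[of _ "{0..<int N}"], auto) (rule finite_subset[of _ "{0..<int n}"], auto)
  hence "boundary k \<le> card (?X \<times> {0..<int n} \<union> {0..<int N} \<times> ?Y)"
    unfolding boundary_def index_set_def by (intro card_mono finite_UnI finite_cartesian_product) (auto simp: minus_prod_def)
  also have "\<dots> \<le> card (?X \<times> {0..<int n}) + card ({0..<int N} \<times> ?Y)" by (rule card_Un_le)
  also have "\<dots> = card ?X * n + N * card ?Y" by (simp add: card_cartesian_product)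
  also have "\<dots> \<le> nat \<bar>fst k\<bar> * n + N * nat \<bar>snd k\<bar>" by (intro add_mono mult_mono shift) auto
  finally have "real (boundary k) \<le> real (nat \<bar>fst k\<bar> * n + N * nat \<bar>snd k\<bar>)" by (rule of_nat_mono)
  thus ?thesis by (simp add: mult.commute)
qed

end

locale sampled_field = gaussian_field h P U + filter_size h N n
  for h :: "int \<times> int => complex" and P :: "'w measure" and U :: "int \<times> int => 'w => complex" and N n :: nat
begin

lemma Z_mat_carrier: "Z_mat h U (\<lambda>_. N) n \<omega> \<in> carrier_mat N n"
  unfolding Z_mat_def by simp

lemma Z_mat_entry:
  assumes "\<And>q. integrable (count_space UNIV) (\<lambda>k. h k * U (q - k) \<omega>)" "i < N" "j < n"
  shows "Z_mat h U (\<lambda>_. N) n \<omega> $$ (i, j) = (LINT k|count_space UNIV. h k * U ((int i, int j) - k) \<omega>) / of_real (sqrt (real n))"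
proof -
  define f where "f k = h k * U ((int i, int j) - k) \<omega>" for k
  have "Infinite_Set_Sum.abs_summable_on f UNIV"
    unfolding Infinite_Set_Sum.abs_summable_on_def f_def by (rule assms(1))
  hence "(\<lambda>k. cmod (f k)) summable_on UNIV" using abs_summable_equivalent by blast
  from infsum_eq_integral(2)[OF this] show ?thesis
    unfolding Z_mat_def f_def using assms(2,3) by (simp add: case_prod_beta' minus_prod_def)
qed

definition mismatch_energy :: "'w => ennreal" where
  "mismatch_energy = energy index_set (\<lambda>p k \<omega>. U (p - k) \<omega> - U (shift_mod p k) \<omega>)"

definition total_energy :: "'w => ennreal" where
  "total_energy = energy index_set (\<lambda>p k \<omega>. U (p - k) \<omega>)"

lemma energies_measurable [measurable]: "mismatch_energy \<in> borel_measurable P" "total_energy \<in> borel_measurable P"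
  unfolding mismatch_energy_def total_energy_def by (intro energy_measurable; measurable)+

lemma matrix_energy_bounds:
  "AE \<omega> in P. ennreal (\<Sum>i<N. \<Sum>j<n. (cmod (Z_mat h U (\<lambda>_. N) n \<omega> $$ (i, j)))\<^sup>2) \<le> ennreal (S / real n) * total_energy \<omega> \<and>
     ennreal (\<Sum>i<N. \<Sum>j<n. (cmod (Z_mat h U (\<lambda>_. N) n \<omega> $$ (i, j) - periodized (\<lambda>p. U p \<omega>) i j))\<^sup>2) \<le> ennreal (S / real n) * mismatch_energy \<omega>"
  using filter_output_AE
proof eventually_elim
  fix \<omega> assume "\<forall>q. integrable (count_space UNIV) (\<lambda>k. h k * U (q - k) \<omega>)"
  hence int: "integrable (count_space UNIV) (\<lambda>k. h k * U (q - k) \<omega>)" for q by blast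
  let ?Z = "Z_mat h U (\<lambda>_. N) n \<omega>" and ?P = "periodized (\<lambda>p. U p \<omega>)"
  have idx: "p = (int (nat (fst p)), int (nat (snd p)))" "nat (fst p) < N" "nat (snd p) < n" if "p \<in> index_set" for p
    using that unfolding index_set_def by auto
  have Ze: "?Z $$ (nat (fst p), nat (snd p)) = (LINT k|count_space UNIV. h k * U (p - k) \<omega>) / of_real (sqrt (real n))" if "p \<in> index_set" for p
    using Z_mat_entry[OF int idx(2,3)[OF that]] idx(1)[OF that] by simp
  have Pe: "?P (nat (fst p)) (nat (snd p)) = (LINT k|count_space UNIV. h k * U (shift_mod p k) \<omega>) / of_real (sqrt (real n))" if "p \<in> index_set" for p
    unfolding periodized_def using idx(1)[OF that] by simp
  obtain B where B: "\<And>p. p \<in> index_set \<Longrightarrow> cmod (U p \<omega>) \<le> B"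
    using finite_imageI[OF index_set_facts(1), of "\<lambda>p. cmod (U p \<omega>)"] by (meson Max_ge imageI)
  have intP: "integrable (count_space UNIV) (\<lambda>k. h k * U (shift_mod p k) \<omega>)" for p
    by (rule bounded_multiple_integral_le(1)[where b=B]) (rule B[OF shift_mod_in])
  have De: "?Z $$ (nat (fst p), nat (snd p)) - ?P (nat (fst p)) (nat (snd p))
      = (LINT k|count_space UNIV. h k * (U (p - k) \<omega> - U (shift_mod p k) \<omega>)) / of_real (sqrt (real n))" if "p \<in> index_set" for p
    unfolding Ze[OF that] Pe[OF that] right_diff_distrib Bochner_Integration.integral_diff[OF int intP] by (rule diff_divide_distrib[symmetric])
  have s: "(\<Sum>i<N. \<Sum>j<n. f i j) = (\<Sum>p\<in>index_set. f (nat (fst p)) (nat (snd p)))" for f :: "nat => nat => real"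
    unfolding sum_index_set by simp
  show "ennreal (\<Sum>i<N. \<Sum>j<n. (cmod (?Z $$ (i, j)))\<^sup>2) \<le> ennreal (S / real n) * total_energy \<omega> \<and>
     ennreal (\<Sum>i<N. \<Sum>j<n. (cmod (?Z $$ (i, j) - ?P i j))\<^sup>2) \<le> ennreal (S / real n) * mismatch_energy \<omega>"
    unfolding s total_energy_def mismatch_energy_def
  proof
    show "ennreal (\<Sum>p\<in>index_set. (cmod (?Z $$ (nat (fst p), nat (snd p))))\<^sup>2) \<le> ennreal (S / real n) * energy index_set (\<lambda>p k \<omega>. U (p - k) \<omega>) \<omega>"
      by (rule energy_controls_entries[OF index_set_facts(1) _ n]) (rule Ze)
    show "ennreal (\<Sum>p\<in>index_set. (cmod (?Z $$ (nat (fst p), nat (snd p)) - ?P (nat (fst p)) (nat (snd p))))\<^sup>2)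
       \<le> ennreal (S / real n) * energy index_set (\<lambda>p k \<omega>. U (p - k) \<omega> - U (shift_mod p k) \<omega>) \<omega>"
      by (rule energy_controls_entries[OF index_set_facts(1) _ n]) (rule De)
  qed
qed

lemma total_energy_expectation: "(\<integral>\<^sup>+\<omega>. total_energy \<omega> \<partial>P) \<le> ennreal (S * (real N * real n))"
proof -
  have "(\<integral>\<^sup>+\<omega>. total_energy \<omega> \<partial>P) \<le> (\<integral>\<^sup>+k. ennreal (cmod (h k)) * (\<Sum>p\<in>index_set. 1) \<partial>count_space UNIV)"
    unfolding total_energy_def by (rule energy_expectation[OF _ index_set_facts(1)]) (simp_all add: U_second_moment)
  also have "\<dots> = (\<integral>\<^sup>+k. ennreal (cmod (h k)) \<partial>count_space UNIV) * (\<Sum>p\<in>index_set. 1)" by (rule nn_integral_multc) simp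
  also have "(\<Sum>p\<in>index_set. 1) = ennreal (real N * real n)"
    by (simp add: index_set_facts(2) ennreal_of_nat_eq_real_of_nat ennreal_mult)
  finally show ?thesis unfolding S_ennreal using S_nonneg by (simp add: ennreal_mult)
qed

text \<open>Only wrapped shifts contribute, since the two fields agree elsewhere.\<close>

lemma mismatch_energy_expectation:
  "(\<integral>\<^sup>+\<omega>. mismatch_energy \<omega> \<partial>P) \<le> (\<integral>\<^sup>+k. ennreal (cmod (h k)) * ennreal (4 * real (boundary k)) \<partial>count_space UNIV)"
proof -
  have b: "(\<integral>\<^sup>+\<omega>. ennreal ((cmod (U (p - k) \<omega> - U (shift_mod p k) \<omega>))\<^sup>2) \<partial>P) \<le> (if p - k \<in> index_set then 0 else 4)" for p k
  proof (cases "p - k \<in> index_set")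
    case True
    hence "shift_mod p k = p - k" using shift_mod_id[of p k] by (simp add: minus_prod_def)
    thus ?thesis by simp
  next
    case False
    have "(\<integral>\<^sup>+\<omega>. ennreal ((cmod (U (p - k) \<omega> - U (shift_mod p k) \<omega>))\<^sup>2) \<partial>P)
       \<le> (\<integral>\<^sup>+\<omega>. 2 * ennreal ((cmod (U (p - k) \<omega>))\<^sup>2) + 2 * ennreal ((cmod (U (shift_mod p k) \<omega>))\<^sup>2) \<partial>P)"
    proof (intro nn_integral_mono)
      fix \<omega>
      have "(cmod (a - b))\<^sup>2 \<le> 2 * (cmod a)\<^sup>2 + 2 * (cmod b)\<^sup>2" for a b :: complex
      proof -
        have "(cmod (a - b))\<^sup>2 \<le> (cmod a + cmod b)\<^sup>2" by (intro power_mono norm_triangle_ineq4) simp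
        moreover have "(cmod a + cmod b)\<^sup>2 + (cmod a - cmod b)\<^sup>2 = 2 * (cmod a)\<^sup>2 + 2 * (cmod b)\<^sup>2" by (simp add: power2_eq_square algebra_simps)
        ultimately show ?thesis using zero_le_power2[of "cmod a - cmod b"] by linarith
      qed
      hence "ennreal ((cmod (U (p - k) \<omega> - U (shift_mod p k) \<omega>))\<^sup>2) \<le> ennreal (2 * (cmod (U (p - k) \<omega>))\<^sup>2 + 2 * (cmod (U (shift_mod p k) \<omega>))\<^sup>2)"
        by (rule ennreal_leI)
      thus "ennreal ((cmod (U (p - k) \<omega> - U (shift_mod p k) \<omega>))\<^sup>2) \<le> 2 * ennreal ((cmod (U (p - k) \<omega>))\<^sup>2) + 2 * ennreal ((cmod (U (shift_mod p k) \<omega>))\<^sup>2)"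
        by (simp add: ennreal_plus ennreal_mult)
    qed
    also have "\<dots> = 2 * (\<integral>\<^sup>+\<omega>. ennreal ((cmod (U (p - k) \<omega>))\<^sup>2) \<partial>P) + 2 * (\<integral>\<^sup>+\<omega>. ennreal ((cmod (U (shift_mod p k) \<omega>))\<^sup>2) \<partial>P)"
      by (subst nn_integral_add) (auto simp: nn_integral_cmult)
    also have "\<dots> = 4" unfolding U_second_moment by simp
    finally show ?thesis using False by simp
  qed
  have "(\<integral>\<^sup>+\<omega>. mismatch_energy \<omega> \<partial>P) \<le> (\<integral>\<^sup>+k. ennreal (cmod (h k)) * (\<Sum>p\<in>index_set. if p - k \<in> index_set then 0 else 4) \<partial>count_space UNIV)"
    unfolding mismatch_energy_def by (rule energy_expectation[OF _ index_set_facts(1) b]) measurable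
  also have "\<dots> = (\<integral>\<^sup>+k. ennreal (cmod (h k)) * ennreal (4 * real (boundary k)) \<partial>count_space UNIV)"
  proof (intro nn_integral_cong arg_cong2[where f="(*)"] refl)
    fix k
    have "(\<Sum>p\<in>index_set. if p - k \<in> index_set then 0 else (4::ennreal)) = (\<Sum>p\<in>{p\<in>index_set. p - k \<notin> index_set}. 4)"
      using index_set_facts(1) by (intro sum.mono_neutral_cong_right) auto
    thus "(\<Sum>p\<in>index_set. if p - k \<in> index_set then 0 else 4) = ennreal (4 * real (boundary k))"
      by (simp add: boundary_def ennreal_mult ennreal_of_nat_eq_real_of_nat mult.commute)
  qed
  finally show ?thesis .
qed

lemma model_trace_field_law:
  assumes w: "Im w > 0" and [measurable]: "Measurable.pred borel Q"
  shows "prob {\<omega> \<in> space P. Q (model_trace w (\<lambda>p. U p \<omega>))} = measure (gauss_vec index_set) {x \<in> space (gauss_vec index_set). Q (model_trace w x)}"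
proof -
  note [measurable] = model_trace_measurable[OF w] U_restrict_measurable[of index_set]
  have "measure (gauss_vec index_set) {x \<in> space (gauss_vec index_set). Q (model_trace w x)}
     = measure (distr P (gauss_vec index_set) (\<lambda>\<omega>. restrict (\<lambda>p. U p \<omega>) index_set)) {x \<in> space (gauss_vec index_set). Q (model_trace w x)}"
    unfolding U_restrict_law[OF index_set_facts(3)] ..
  also have "\<dots> = prob ((\<lambda>\<omega>. restrict (\<lambda>p. U p \<omega>) index_set) -` {x \<in> space (gauss_vec index_set). Q (model_trace w x)} \<inter> space P)"
    by (rule measure_distr) measurable
  also have "(\<lambda>\<omega>. restrict (\<lambda>p. U p \<omega>) index_set) -` {x \<in> space (gauss_vec index_set). Q (model_trace w x)} \<inter> space P = {\<omega> \<in> space P. Q (model_trace w (\<lambda>p. U p \<omega>))}"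
    using measurable_space[OF U_restrict_measurable[of index_set]] by (auto simp: model_trace_restrict)
  finally show ?thesis ..
qed

lemma model_trace_field_measurable: "Im w > 0 \<Longrightarrow> (\<lambda>\<omega>. model_trace w (\<lambda>p. U p \<omega>)) \<in> borel_measurable P"
  using measurable_compose[OF U_restrict_measurable[of index_set] model_trace_measurable, of w] by (simp add: model_trace_restrict)

end

section \<open>Convergence of the Stieltjes transforms\<close>

locale matrix_model = gaussian_field h P U
  for h :: "int \<times> int => complex" and P :: "'w measure" and U :: "int \<times> int => 'w => complex" +
  fixes N :: "nat => nat" and c :: real
  assumes N_range: "\<And>n. n \<ge> 1 \<Longrightarrow> 1 \<le> N n \<and> N n \<le> n" and c_range: "0 < c" "c \<le> 1"
    and N_lim: "(\<lambda>n. real (N n) / real n) \<longlonglongrightarrow> c"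
begin

lemma sampled: "n \<ge> 1 \<Longrightarrow> sampled_field h P U (N n) n"
  by unfold_locales (use N_range[of n] in auto)

abbreviation boundary_density :: "nat => int \<times> int => real" where
  "boundary_density n k \<equiv> 4 * real (filter_size.boundary (N (Suc n)) (Suc n) k) / (real (Suc n))\<^sup>2"

text \<open>For a fixed shift the fraction of wrapped positions vanishes in the limit, and the summable
  coefficients dominate.\<close>

lemma mismatch_limit:
  "(\<lambda>n. \<integral>\<^sup>+k. ennreal (cmod (h k)) * ennreal (boundary_density n k) \<partial>count_space UNIV) \<longlonglongrightarrow> 0"
proof -
  have le: "real (filter_size.boundary (N (Suc n)) (Suc n) k) \<le> (real (Suc n))\<^sup>2"
    "real (filter_size.boundary (N (Suc n)) (Suc n) k) \<le> (\<bar>real_of_int (fst k)\<bar> + \<bar>real_of_int (snd k)\<bar>) * real (Suc n)" for n k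
  proof -
    interpret sampled_field h P U "N (Suc n)" "Suc n" by (rule sampled) simp
    have Nn: "N (Suc n) \<le> Suc n" using N_range[of "Suc n"] by simp
    have "boundary k \<le> N (Suc n) * Suc n" by (rule boundary_le_all)
    also have "\<dots> \<le> Suc n * Suc n" using Nn by (rule mult_right_mono) simp
    finally show "real (boundary k) \<le> (real (Suc n))\<^sup>2" unfolding power2_eq_square of_nat_mult[symmetric] by (rule of_nat_mono)
    have "\<bar>real_of_int (snd k)\<bar> * real (N (Suc n)) \<le> \<bar>real_of_int (snd k)\<bar> * real (Suc n)" using Nn by (intro mult_left_mono) auto
    thus "real (boundary k) \<le> (\<bar>real_of_int (fst k)\<bar> + \<bar>real_of_int (snd k)\<bar>) * real (Suc n)"
      using boundary_le[of k] by (simp only: distrib_right)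
  qed
  have "(\<lambda>n. \<integral>\<^sup>+k. ennreal (cmod (h k)) * ennreal (boundary_density n k) \<partial>count_space UNIV)
     \<longlonglongrightarrow> (\<integral>\<^sup>+k. 0 \<partial>count_space (UNIV :: (int \<times> int) set))"
  proof (rule nn_integral_dominated_convergence[where w="\<lambda>k. ennreal (cmod (h k)) * 4"])
    show "AE k in count_space UNIV. ennreal (cmod (h k)) * ennreal (boundary_density n k) \<le> ennreal (cmod (h k)) * 4" for n
    proof (intro AE_I2 mult_left_mono)
      fix k
      have "ennreal (boundary_density n k) \<le> ennreal 4"
        using le(1)[of n k] by (intro ennreal_leI) (simp add: divide_le_eq)
      thus "ennreal (boundary_density n k) \<le> 4" by simp
    qed simp
    have "(\<integral>\<^sup>+k. ennreal (cmod (h k)) * 4 \<partial>count_space UNIV) = ennreal S * 4"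
      unfolding S_ennreal[symmetric] by (rule nn_integral_multc) simp
    thus "(\<integral>\<^sup>+k. ennreal (cmod (h k)) * 4 \<partial>count_space UNIV) < \<infinity>" by (simp add: ennreal_mult_less_top)
    show "AE k in count_space UNIV. (\<lambda>n. ennreal (cmod (h k)) * ennreal (boundary_density n k)) \<longlonglongrightarrow> 0"
    proof (intro AE_I2)
      fix k :: "int \<times> int"
      define C where "C = 4 * (\<bar>real_of_int (fst k)\<bar> + \<bar>real_of_int (snd k)\<bar>)"
      have "(\<lambda>n. boundary_density n k) \<longlonglongrightarrow> 0"
      proof (rule tendsto_sandwich[OF always_eventually always_eventually])
        show "(\<lambda>_. 0::real) \<longlonglongrightarrow> 0" by simp
        show "(\<lambda>n. C * inverse (real (Suc n))) \<longlonglongrightarrow> 0" using tendsto_mult_right_zero[OF LIMSEQ_inverse_real_of_nat] by simp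
        show "\<forall>n. boundary_density n k \<le> C * inverse (real (Suc n))"
        proof
          fix n
          have "boundary_density n k \<le> (C * real (Suc n)) / (real (Suc n))\<^sup>2"
            unfolding C_def mult.assoc by (intro divide_right_mono mult_left_mono le(2)) auto
          also have "\<dots> = C * inverse (real (Suc n))" by (simp add: power2_eq_square inverse_eq_divide)
          finally show "boundary_density n k \<le> C * inverse (real (Suc n))" .
        qed
      qed simp
      from ennreal_tendsto_cmult[OF _ tendsto_ennrealI[OF this], of "ennreal (cmod (h k))"]
      show "(\<lambda>n. ennreal (cmod (h k)) * ennreal (boundary_density n k)) \<longlonglongrightarrow> 0" by simp
    qed
  qed auto
  thus ?thesis by simp
qed

lemma profile: "unit_profile (Phi h) (S\<^sup>2 + 1) c"
proof (intro unit_profile.intro profile_equation.intro unit_profile_axioms.intro)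
  show "prob_space unit_measure" by (rule prob_unit_measure)
  show "(cmod (Phi h u t))\<^sup>2 \<le> S\<^sup>2 + 1" for u t
    using power_mono[OF Phi_le[of u t], of 2] by simp
  have "continuous_on UNIV (\<lambda>p. (cmod (Phi h (fst p) (snd p)))\<^sup>2)" by (intro continuous_intros Phi_continuous)
  hence "(\<lambda>p. (cmod (Phi h (fst p) (snd p)))\<^sup>2) \<in> borel_measurable borel" by (rule borel_measurable_continuous_onI)
  thus "(\<lambda>(x, t). (cmod (Phi h x t))\<^sup>2) \<in> borel_measurable (borel \<Otimes>\<^sub>M borel)" unfolding borel_prod by (simp add: case_prod_beta')
  show "continuous_on UNIV (\<lambda>u. Phi h u t)" for t by (intro Phi_continuous' continuous_intros)
qed (use c_range in auto)

sublocale profile: unit_profile "Phi h" "S\<^sup>2 + 1" c by (rule profile)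

text \<open>The mean approaches the limit by the stability of the vector equation, the fluctuations vanish by
  the variance bound.\<close>

lemma model_trace_in_probability:
  assumes w: "Im w > 0" and w2: "w\<^sup>2 = z" and v: "2 * (Im w)\<^sup>2 = Im z" and y: "8 * (S\<^sup>2 + 1) \<le> Im z" "cmod z = Im z"
    and m: "profile.herglotz_class z m" "\<And>u. m u = profile.profile_step z m u" and d: "\<delta> > 0"
  shows "(\<lambda>n. prob {\<omega> \<in> space P. \<delta> \<le> cmod (filter_size.model_trace h (N n) n w (\<lambda>p. U p \<omega>) - (LINT u|unit_measure. m u))}) \<longlonglongrightarrow> 0"
proof -
  define g where "g n i = filter_size.model_mean h (N n) n w i" for n i
  let ?f = "LINT u|unit_measure. m u"
  define e where "e n = (\<Sum>i<N n. g n i) / (of_nat (N n) * w)" for n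
  have z: "Im z > 0" using y by (smt (verit) zero_le_power2)
  have "e \<longlonglongrightarrow> ?f" unfolding e_def
  proof (rule profile.vector_equation_limit[OF z m Phi_continuous N_range N_lim c_range(1) w2 w _ v y])
    show "Im w \<le> cmod w" using abs_Im_le_cmod[of w] by linarith
    show "cmod (g n i) \<le> 1 / Im w" if "1 \<le> n" "i < N n + n" for n i
    proof -
      interpret sampled_field h P U "N n" n by (rule sampled) fact
      show ?thesis unfolding g_def by (rule model_mean_le[OF w that(2)])
    qed
    show "cmod (vector_residual (N n + n) (profile.sampled_profile (N n) n) w (g n) i) \<le> 2 * S ^ 3 / (Im w) ^ 3 / sqrt (real n)"
      if "1 \<le> n" "i < N n + n" for n i
    proof -
      interpret sampled_field h P U "N n" n by (rule sampled) fact
      have "profile.sampled_profile (N n) n = variance_profile"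
        by (intro ext) (simp only: profile.sampled_profile_def variance_profile_def)
      thus ?thesis unfolding g_def using model_mean_residual[OF w that(2)] N_range[OF that(1)] by simp
    qed
    show "(\<lambda>n. 2 * S ^ 3 / (Im w) ^ 3 / sqrt (real n)) \<longlonglongrightarrow> 0"
      by (intro real_tendsto_divide_at_top[OF tendsto_const] filterlim_compose[OF sqrt_at_top filterlim_real_sequentially])
  qed
  hence ev: "eventually (\<lambda>n. cmod (e n - ?f) < \<delta> / 2) sequentially"
    using tendstoD[of e ?f sequentially "\<delta> / 2"] d by (simp add: dist_norm)
  define C where "C = 4 * S\<^sup>2 / ((cmod w)\<^sup>2 * (Im w) ^ 4 * (\<delta> / 2)\<^sup>2)"
  show ?thesis
  proof (rule tendsto_sandwich[where f="\<lambda>_. 0" and h="\<lambda>n. C / real (N n)"])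
    show "(\<lambda>n. C / real (N n)) \<longlonglongrightarrow> 0" by (rule real_tendsto_divide_at_top[OF tendsto_const filterlim_size_at_top[OF N_lim c_range(1)]])
    show "eventually (\<lambda>n. prob {\<omega> \<in> space P. \<delta> \<le> cmod (filter_size.model_trace h (N n) n w (\<lambda>p. U p \<omega>) - ?f)} \<le> C / real (N n)) sequentially"
      using ev eventually_ge_at_top[of 1]
    proof eventually_elim
      fix n assume en: "cmod (e n - ?f) < \<delta> / 2" and n: "1 \<le> n"
      interpret sampled_field h P U "N n" n by (rule sampled) fact
      note [measurable] = model_trace_field_measurable[OF w]
      have "prob {\<omega> \<in> space P. \<delta> \<le> cmod (model_trace w (\<lambda>p. U p \<omega>) - ?f)} \<le> prob {\<omega> \<in> space P. \<delta> / 2 \<le> cmod (model_trace w (\<lambda>p. U p \<omega>) - e n)}"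
      proof (rule finite_measure_mono)
        show "{\<omega> \<in> space P. \<delta> \<le> cmod (model_trace w (\<lambda>p. U p \<omega>) - ?f)} \<subseteq> {\<omega> \<in> space P. \<delta> / 2 \<le> cmod (model_trace w (\<lambda>p. U p \<omega>) - e n)}"
        proof clarify
          fix \<omega> assume "\<delta> \<le> cmod (model_trace w (\<lambda>p. U p \<omega>) - ?f)"
          moreover have "cmod (model_trace w (\<lambda>p. U p \<omega>) - ?f) \<le> cmod (model_trace w (\<lambda>p. U p \<omega>) - e n) + cmod (e n - ?f)"
            using norm_triangle_ineq[of "model_trace w (\<lambda>p. U p \<omega>) - e n" "e n - ?f"] by simp
          ultimately show "\<delta> / 2 \<le> cmod (model_trace w (\<lambda>p. U p \<omega>) - e n)" using en by linarith
        qed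
      qed measurable
      also have "\<dots> = measure (gauss_vec index_set) {x \<in> space (gauss_vec index_set). \<delta> / 2 \<le> cmod (model_trace w x - e n)}"
        by (rule model_trace_field_law[OF w]) measurable
      also have "\<dots> \<le> C / real (N n)"
        unfolding e_def g_def C_def using d by (intro model_trace_deviation[OF w]) simp
      finally show "prob {\<omega> \<in> space P. \<delta> \<le> cmod (model_trace w (\<lambda>p. U p \<omega>) - ?f)} \<le> C / real (N n)" .
    qed
  qed auto
qed

end

context matrix_model
begin

text \<open>The points at which the transforms are compared: they accumulate in the region where the
  vector equation is a contraction, and \<open>w\<close> is the square root of \<open>z\<close> in the upper half plane.\<close>

definition height :: "nat => real" where "height j = 8 * (S\<^sup>2 + 1) + 1 / real (Suc j)"

definition point :: "nat => complex" where "point j = Complex 0 (height j)"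

definition root_point :: "nat => complex" where
  "root_point j = Complex (sqrt (height j / 2)) (sqrt (height j / 2))"

lemma height_ge: "8 * (S\<^sup>2 + 1) \<le> height j" "8 \<le> height j"
proof -
  show "8 * (S\<^sup>2 + 1) \<le> height j" unfolding height_def by simp
  moreover have "8 \<le> 8 * (S\<^sup>2 + 1)" by simp
  ultimately show "8 \<le> height j" by linarith
qed

lemma points:
  "Im (point j) > 0" "8 * (S\<^sup>2 + 1) \<le> Im (point j)" "cmod (point j) = Im (point j)" "point j \<noteq> Complex 0 (8 * (S\<^sup>2 + 1))"
  "point \<longlonglongrightarrow> Complex 0 (8 * (S\<^sup>2 + 1))" "(root_point j)\<^sup>2 = point j" "2 * (Im (root_point j))\<^sup>2 = Im (point j)"
  "1 \<le> Im (root_point j)"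
proof -
  have h: "8 \<le> height j" by (rule height_ge)
  show "Im (point j) > 0" "cmod (point j) = Im (point j)" "2 * (Im (root_point j))\<^sup>2 = Im (point j)"
    using h unfolding point_def root_point_def by (simp_all add: cmod_def)
  show "8 * (S\<^sup>2 + 1) \<le> Im (point j)" unfolding point_def using height_ge by simp
  show "point j \<noteq> Complex 0 (8 * (S\<^sup>2 + 1))" unfolding point_def height_def by simp
  show "(root_point j)\<^sup>2 = point j"
    using h unfolding point_def root_point_def by (simp add: complex_eq_iff power2_eq_square)
  show "1 \<le> Im (root_point j)" using h unfolding root_point_def by simp
  have "height \<longlonglongrightarrow> 8 * (S\<^sup>2 + 1) + 0"
    unfolding height_def[abs_def] using LIMSEQ_inverse_real_of_nat by (intro tendsto_add tendsto_const) (simp add: inverse_eq_divide)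
  thus "point \<longlonglongrightarrow> Complex 0 (8 * (S\<^sup>2 + 1))"
    unfolding point_def[abs_def] by (intro tendsto_Complex tendsto_const) simp
qed

lemma Z_mat_eq: "Z_mat h U N n = Z_mat h U (\<lambda>_. N n) n"
  unfolding Z_mat_def ..

definition solution_family :: "(complex => real => complex) => bool" where
  "solution_family m \<longleftrightarrow> (\<forall>z. Im z > 0 \<longrightarrow> profile.herglotz_class z (m z) \<and> (\<forall>u. m z u = profile.profile_step z (m z) u))"

abbreviation good_spectrum :: "(complex => real => complex) => real => nat => real => (real => real) => bool" where
  "good_spectrum m M J \<delta> F \<equiv> (\<exists>\<nu>. real_distribution \<nu> \<and> cdf \<nu> = F \<and> (\<forall>a>0. measure \<nu> {x. a < \<bar>x\<bar>} \<le> M / a) \<and>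
     (\<forall>j\<le>J. cmod (stieltjes_transform \<nu> (point j) - (LINT u|unit_measure. m (point j) u)) < \<delta>))"

text \<open>The exceptional event collects large entries, a large distance to the periodized matrix, and
  a deviation of the Gaussian model from the limit at one of finitely many points.\<close>

lemma spectral_control:
  fixes m :: "complex => real => complex"
  assumes m: "solution_family m"
    and M: "M > 0" and d: "\<delta> > 0" and e: "\<eta> > 0"
  shows "eventually (\<lambda>n. \<exists>B\<in>sets P. prob B \<le> S\<^sup>2 / M + \<eta> \<and> (AE \<omega> in P. \<omega> \<notin> B \<longrightarrow>
     good_spectrum m M J \<delta> (empirical_cdf (Z_mat h U N n \<omega> * mat_adjoint (Z_mat h U N n \<omega>))))) sequentially"
proof -
  \<comment> \<open>The two transforms will differ by at most \<open>4 * sqrt \<delta>' / c = \<delta> / 4\<close>.\<close>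
  define \<delta>' where "\<delta>' = (\<delta> * c / 16)\<^sup>2"
  have d': "\<delta>' > 0" using d c_range unfolding \<delta>'_def by simp
  define \<rho> where "\<rho> n = (\<integral>\<^sup>+k. ennreal (cmod (h k)) * ennreal (4 * real (filter_size.boundary (N n) n k) / (real n)\<^sup>2) \<partial>count_space UNIV)" for n
  have "\<rho> \<longlonglongrightarrow> 0" using mismatch_limit by (subst filterlim_sequentially_Suc[symmetric]) (simp add: \<rho>_def)
  from ennreal_tendsto_cmult[OF _ this, of "ennreal (S / \<delta>')"]
  have "(\<lambda>n. ennreal (S / \<delta>') * \<rho> n) \<longlonglongrightarrow> 0" by simp
  hence ev1: "eventually (\<lambda>n. ennreal (S / \<delta>') * \<rho> n < ennreal (\<eta> / 2)) sequentially"
    using e by (intro order_tendstoD(2)) auto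
  have w0: "Im (root_point j) > 0" for j using points(8)[of j] by linarith
  have mj: "profile.herglotz_class (point j) (m (point j))" "\<And>u. m (point j) u = profile.profile_step (point j) (m (point j)) u" for j
    using m points(1)[of j] unfolding solution_family_def by blast+
  have "(\<lambda>n. \<Sum>j\<le>J. prob {\<omega> \<in> space P. \<delta> / 2 \<le> cmod (filter_size.model_trace h (N n) n (root_point j) (\<lambda>p. U p \<omega>) - (LINT u|unit_measure. m (point j) u))}) \<longlonglongrightarrow> (\<Sum>j\<le>J. 0)"
    using d by (intro tendsto_sum model_trace_in_probability[OF w0 points(6) points(7) points(2) points(3) mj]) auto
  hence ev2: "eventually (\<lambda>n. (\<Sum>j\<le>J. prob {\<omega> \<in> space P. \<delta> / 2 \<le> cmod (filter_size.model_trace h (N n) n (root_point j) (\<lambda>p. U p \<omega>) - (LINT u|unit_measure. m (point j) u))}) < \<eta> / 2) sequentially"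
    using e by (intro order_tendstoD(2)) auto
  have ev3: "eventually (\<lambda>n. c / 2 < real (N n) / real n) sequentially"
    using c_range by (intro order_tendstoD(1)[OF N_lim]) simp
  show ?thesis using ev1 ev2 ev3 eventually_ge_at_top[of 1]
  proof eventually_elim
    fix n
    assume n1: "ennreal (S / \<delta>') * \<rho> n < ennreal (\<eta> / 2)"
      and n2: "(\<Sum>j\<le>J. prob {\<omega> \<in> space P. \<delta> / 2 \<le> cmod (filter_size.model_trace h (N n) n (root_point j) (\<lambda>p. U p \<omega>) - (LINT u|unit_measure. m (point j) u))}) < \<eta> / 2"
      and n3: "c / 2 < real (N n) / real n" and n4: "1 \<le> n"
    interpret sampled_field h P U "N n" n by (rule sampled) fact
    define C where "C j = {\<omega> \<in> space P. \<delta> / 2 \<le> cmod (model_trace (root_point j) (\<lambda>p. U p \<omega>) - (LINT u|unit_measure. m (point j) u))}" for j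
    define B1 where "B1 = {\<omega> \<in> space P. 1 \<le> ennreal (S / (real n * (real (N n) * M))) * total_energy \<omega>}"
    define B2 where "B2 = {\<omega> \<in> space P. 1 \<le> ennreal (S / (real n * (real n * \<delta>'))) * mismatch_energy \<omega>}"
    note w = w0
    have N0: "0 < N n" using N_range[OF n4] by simp
    have Cs [measurable]: "C j \<in> sets P" for j
      unfolding C_def using model_trace_field_measurable[OF w[of j]] by measurable
    have Bs [measurable]: "B1 \<in> sets P" "B2 \<in> sets P" unfolding B1_def B2_def by measurable
    have "emeasure P B1 \<le> ennreal (S / (real n * (real (N n) * M))) * (\<integral>\<^sup>+\<omega>. total_energy \<omega> * indicator (space P) \<omega> \<partial>P)"
      unfolding B1_def by (rule nn_integral_Markov_inequality) auto
    also have "\<dots> \<le> ennreal (S / (real n * (real (N n) * M))) * ennreal (S * (real (N n) * real n))"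
      using total_energy_expectation by (intro mult_left_mono) (auto cong: nn_integral_cong)
    also have "\<dots> = ennreal (S\<^sup>2 / M)"
      using S_nonneg M N0 n by (subst ennreal_mult[symmetric]) (auto simp: power2_eq_square)
    finally have p1: "prob B1 \<le> S\<^sup>2 / M" using M by (simp add: emeasure_eq_measure)
    have "emeasure P B2 \<le> ennreal (S / (real n * (real n * \<delta>'))) * (\<integral>\<^sup>+\<omega>. mismatch_energy \<omega> * indicator (space P) \<omega> \<partial>P)"
      unfolding B2_def by (rule nn_integral_Markov_inequality) auto
    also have "\<dots> \<le> ennreal (S / (real n * (real n * \<delta>'))) * (\<integral>\<^sup>+k. ennreal (cmod (h k)) * ennreal (4 * real (boundary k)) \<partial>count_space UNIV)"
      using mismatch_energy_expectation by (intro mult_left_mono) (auto cong: nn_integral_cong)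
    also have "\<dots> = ennreal (S / \<delta>') * \<rho> n"
    proof -
      have "(\<integral>\<^sup>+k. ennreal (cmod (h k)) * ennreal (4 * real (boundary k)) \<partial>count_space UNIV)
        = (\<integral>\<^sup>+k. ennreal ((real n)\<^sup>2) * (ennreal (cmod (h k)) * ennreal (4 * real (boundary k) / (real n)\<^sup>2)) \<partial>count_space UNIV)"
        using n by (intro nn_integral_cong) (simp add: ennreal_mult[symmetric])
      also have "\<dots> = ennreal ((real n)\<^sup>2) * \<rho> n" unfolding \<rho>_def by (rule nn_integral_cmult) simp
      finally show ?thesis
        using n d' S_nonneg by (simp add: mult.assoc[symmetric] ennreal_mult[symmetric] power2_eq_square)
    qed
    also have "\<dots> < ennreal (\<eta> / 2)" by (rule n1)
    finally have p2: "prob B2 < \<eta> / 2" using e by (simp add: emeasure_eq_measure ennreal_less_iff)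
    have "prob (\<Union>j\<le>J. C j) \<le> (\<Sum>j\<le>J. prob (C j))" by (rule finite_measure_subadditive_finite) auto
    hence p3: "prob (\<Union>j\<le>J. C j) < \<eta> / 2" using n2 unfolding C_def by linarith
    define B where "B = B1 \<union> (B2 \<union> (\<Union>j\<le>J. C j))"
    have "prob B \<le> prob B1 + prob (B2 \<union> (\<Union>j\<le>J. C j))" unfolding B_def by (rule measure_Un_le) auto
    also have "prob (B2 \<union> (\<Union>j\<le>J. C j)) \<le> prob B2 + prob (\<Union>j\<le>J. C j)" by (rule measure_Un_le) auto
    finally have pB: "prob B \<le> S\<^sup>2 / M + \<eta>" using p1 p2 p3 by simp
    have "AE \<omega> in P. \<omega> \<notin> B \<longrightarrow>
       good_spectrum m M J \<delta> (empirical_cdf (Z_mat h U N n \<omega> * mat_adjoint (Z_mat h U N n \<omega>)))"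
      using matrix_energy_bounds AE_space
    proof (eventually_elim, intro impI, elim conjE)
      fix \<omega> assume \<omega>: "\<omega> \<in> space P" "\<omega> \<notin> B"
      let ?Z = "Z_mat h U (\<lambda>_. N n) n \<omega>"
      let ?T = "\<Sum>i<N n. \<Sum>j<n. (cmod (?Z $$ (i, j)))\<^sup>2"
      let ?D = "\<Sum>i<N n. \<Sum>j<n. (cmod (?Z $$ (i, j) - periodized (\<lambda>p. U p \<omega>) i j))\<^sup>2"
      assume T: "ennreal ?T \<le> ennreal (S / real n) * total_energy \<omega>"
        and D: "ennreal ?D \<le> ennreal (S / real n) * mismatch_energy \<omega>"
      have scale: "x \<le> b" if "ennreal x \<le> ennreal (S / real n) * E" "\<not> 1 \<le> ennreal (S / (real n * b)) * E" "b > 0" for x b E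
      proof -
        have "ennreal (S / real n) = ennreal b * ennreal (S / (real n * b))"
          using that(3) S_nonneg n by (simp add: ennreal_mult[symmetric])
        hence "ennreal x \<le> ennreal b * (ennreal (S / (real n * b)) * E)" using that(1) by (simp add: mult.assoc)
        also have "\<dots> \<le> ennreal b * 1" using that(2) by (intro mult_left_mono) auto
        finally show ?thesis using that(3) by (simp add: ennreal_le_iff)
      qed
      have Tb: "?T \<le> real (N n) * M" by (rule scale[OF T]) (use \<omega> M N0 in \<open>auto simp: B_def B1_def\<close>)
      have Db: "?D \<le> real n * \<delta>'" by (rule scale[OF D]) (use \<omega> d' n in \<open>auto simp: B_def B2_def\<close>)
      obtain \<nu> where \<nu>: "real_distribution \<nu>" "cdf \<nu> = empirical_cdf (?Z * mat_adjoint ?Z)"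
        "\<And>a. a > 0 \<Longrightarrow> measure \<nu> {x. a < \<bar>x\<bar>} \<le> (?T / real (N n)) / a"
        and st: "\<And>w u. Im w > 0 \<Longrightarrow> cmod (stieltjes_transform \<nu> (w\<^sup>2) - model_trace w u)
           \<le> sqrt (2 * (\<Sum>i<N n. \<Sum>j<n. (cmod (?Z $$ (i, j) - periodized u i j))\<^sup>2)) * (1 / (real (N n) * cmod w) / (Im w)\<^sup>2 * sqrt (real (N n + n)))"
        using fourier_gram_stieltjes[OF Z_mat_carrier[of \<omega>]] by blast
      have tail: "measure \<nu> {x. a < \<bar>x\<bar>} \<le> M / a" if "a > 0" for a
      proof -
        have "?T / real (N n) \<le> M" using Tb N0 by (simp add: divide_le_eq mult.commute)
        hence "(?T / real (N n)) / a \<le> M / a" using that by (intro divide_right_mono) auto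
        with \<nu>(3)[OF that] show ?thesis by linarith
      qed
      have close: "cmod (stieltjes_transform \<nu> (point j) - (LINT u|unit_measure. m (point j) u)) < \<delta>" if j: "j \<le> J" for j
      proof -
        let ?w = "root_point j"
        have w1: "1 \<le> Im ?w" "1 \<le> cmod ?w" using points(8)[of j] abs_Im_le_cmod[of ?w] by linarith+
        have "\<omega> \<notin> C j" using \<omega> j unfolding B_def by auto
        hence 1: "cmod (model_trace ?w (\<lambda>p. U p \<omega>) - (LINT u|unit_measure. m (point j) u)) < \<delta> / 2"
          unfolding C_def using \<omega> by auto
        have "cmod (stieltjes_transform \<nu> (point j) - model_trace ?w (\<lambda>p. U p \<omega>))
           \<le> sqrt (2 * ?D) * (1 / (real (N n) * cmod ?w) / (Im ?w)\<^sup>2 * sqrt (real (N n + n)))"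
          using st[OF w[of j], of "\<lambda>p. U p \<omega>"] unfolding points(6) .
        also have "\<dots> \<le> sqrt (2 * (real n * \<delta>')) * (1 / real (N n) * sqrt (2 * real n))"
        proof (rule mult_mono[OF real_sqrt_le_mono mult_mono[OF _ real_sqrt_le_mono]])
          show "2 * ?D \<le> 2 * (real n * \<delta>')" using Db by simp
          have "1 / (real (N n) * cmod ?w) \<le> 1 / real (N n)"
            using w1 N0 mult_left_mono[OF w1(2), of "real (N n)"] by (intro frac_le) simp_all
          from frac_le[OF _ this, of 1 "(Im ?w)\<^sup>2"]
          have "1 / (real (N n) * cmod ?w) / (Im ?w)\<^sup>2 \<le> 1 / real (N n) / 1"
            using w1 by (simp add: one_le_power)
          thus "1 / (real (N n) * cmod ?w) / (Im ?w)\<^sup>2 \<le> 1 / real (N n)" by simp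
          show "real (N n + n) \<le> 2 * real n" using N_range[OF n4] by simp
        qed (use d' in \<open>auto intro!: sum_nonneg\<close>)
        also have "\<dots> = sqrt ((2 * real n)\<^sup>2 * (\<delta> * c / 16)\<^sup>2) / real (N n)"
          unfolding \<delta>'_def by (simp add: real_sqrt_mult[symmetric] power2_eq_square mult_ac)
        also have "\<dots> = (2 * real n) * (\<delta> * c / 16) / real (N n)"
          using d c_range by (simp add: real_sqrt_mult)
        also have "\<dots> < \<delta> / 2"
        proof -
          have "c / 2 * real n < real (N n)" using n3 n by (simp add: field_simps)
          hence "\<delta> * (c / 2 * real n) < \<delta> * real (N n)" using d by (intro mult_strict_left_mono)
          moreover have "0 < \<delta> * real (N n)" using d N0 by simp
          ultimately show ?thesis using N0 by (simp add: field_simps)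
        qed
        finally have "cmod (stieltjes_transform \<nu> (point j) - model_trace ?w (\<lambda>p. U p \<omega>)) < \<delta> / 2" .
        with 1 show ?thesis
          using norm_triangle_ineq[of "stieltjes_transform \<nu> (point j) - model_trace ?w (\<lambda>p. U p \<omega>)" "model_trace ?w (\<lambda>p. U p \<omega>) - (LINT u|unit_measure. m (point j) u)"]
          by simp
      qed
      show "\<exists>\<nu>. real_distribution \<nu> \<and> cdf \<nu> = empirical_cdf (Z_mat h U N n \<omega> * mat_adjoint (Z_mat h U N n \<omega>)) \<and>
        (\<forall>a>0. measure \<nu> {x. a < \<bar>x\<bar>} \<le> M / a) \<and>
        (\<forall>j\<le>J. cmod (stieltjes_transform \<nu> (point j) - (LINT u|unit_measure. m (point j) u)) < \<delta>)"
        unfolding Z_mat_eq using \<nu>(1,2) tail close by blast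
    qed
    thus "\<exists>B\<in>sets P. prob B \<le> S\<^sup>2 / M + \<eta> \<and> (AE \<omega> in P. \<omega> \<notin> B \<longrightarrow>
     good_spectrum m M J \<delta> (empirical_cdf (Z_mat h U N n \<omega> * mat_adjoint (Z_mat h U N n \<omega>))))"
      using pB by (intro bexI[of _ B]) (auto simp: B_def)
  qed
qed

lemma point_sequence: "\<And>j. Im (point j) > 0" "\<And>j. point j \<noteq> Complex 0 (8 * (S\<^sup>2 + 1))" "point \<longlonglongrightarrow> Complex 0 (8 * (S\<^sup>2 + 1))"
  "Im (Complex 0 (8 * (S\<^sup>2 + 1))) > 0"
  using points by (auto intro: add_nonneg_pos)

text \<open>For every accuracy some realization has a spectrum close to the prediction, since the exceptional
  events do not have full measure; the limit law is a limit of these spectra.\<close>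

lemma limit_law_exists:
  assumes m: "solution_family m"
    and hol: "(\<lambda>z. LINT u|unit_measure. m z u) holomorphic_on \<complex>\<^sup>+"
  obtains \<mu> where "real_distribution \<mu>" "\<And>z. Im z > 0 \<Longrightarrow> stieltjes_transform \<mu> z = (LINT u|unit_measure. m z u)"
proof -
  \<comment> \<open>With this bound the exceptional events have probability at most 1/2.\<close>
  define M where "M = 4 * (S\<^sup>2 + 1)"
  have M: "M > 0" unfolding M_def by (intro mult_pos_pos add_nonneg_pos) auto
  have SM: "S\<^sup>2 / M + 1 / 4 < 1" using M unfolding M_def by (simp add: field_simps)
  have "\<exists>\<nu>. real_distribution \<nu> \<and> (\<forall>a>0. measure \<nu> {x. a < \<bar>x\<bar>} \<le> M / a) \<and>
     (\<forall>j\<le>k. cmod (stieltjes_transform \<nu> (point j) - (LINT u|unit_measure. m (point j) u)) < 1 / real (Suc k))" for k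
  proof -
    have pos: "0 < 1 / real (Suc k)" "0 < (1 / 4 :: real)" by simp_all
    obtain n B where B: "B \<in> sets P" "prob B \<le> S\<^sup>2 / M + 1 / 4" and AE: "AE \<omega> in P. \<omega> \<notin> B \<longrightarrow>
     good_spectrum m M k (1 / real (Suc k)) (empirical_cdf (Z_mat h U N n \<omega> * mat_adjoint (Z_mat h U N n \<omega>)))"
      using eventually_happens'[OF sequentially_bot spectral_control[OF m M pos, of k]] by (elim exE bexE conjE) (rule that)
    show ?thesis
    proof (rule ccontr)
      assume no: "\<not> ?thesis"
      have "AE \<omega> in P. \<omega> \<in> B" using AE by eventually_elim (use no in blast)
      hence "prob B = 1" using B(1) by (simp add: prob_eq_1)
      thus False using B(2) SM by linarith
    qed
  qed
  then obtain \<nu> where \<nu>: "\<And>k. real_distribution (\<nu> k)" "\<And>k a. a > 0 \<Longrightarrow> measure (\<nu> k) {x. a < \<bar>x\<bar>} \<le> M / a"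
    "\<And>k j. j \<le> k \<Longrightarrow> cmod (stieltjes_transform (\<nu> k) (point j) - (LINT u|unit_measure. m (point j) u)) < 1 / real (Suc k)"
    by metis
  have lim: "(\<lambda>k. stieltjes_transform (\<nu> k) (point j)) \<longlonglongrightarrow> (LINT u|unit_measure. m (point j) u)" for j
  proof (rule LIM_zero_cancel, rule Lim_null_comparison)
    show "eventually (\<lambda>k. norm (stieltjes_transform (\<nu> k) (point j) - (LINT u|unit_measure. m (point j) u)) \<le> 1 / real (Suc k)) sequentially"
        using eventually_ge_at_top[of j] by eventually_elim (rule less_imp_le[OF \<nu>(3)])
    show "(\<lambda>k. 1 / real (Suc k)) \<longlonglongrightarrow> 0" using LIMSEQ_inverse_real_of_nat by (simp add: inverse_eq_divide)
  qed
  show thesis by (rule stieltjes_limit_exists[OF point_sequence \<nu>(1) _ hol lim], erule \<nu>(2), rule that)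
qed

lemma empirical_convergence:
  assumes m: "solution_family m"
    and \<mu>: "real_distribution \<mu>" "\<And>z. Im z > 0 \<Longrightarrow> stieltjes_transform \<mu> z = (LINT u|unit_measure. m z u)"
  shows "cdf_tendsto_in_prob P (\<lambda>n \<omega>. empirical_cdf (Z_mat h U N n \<omega> * mat_adjoint (Z_mat h U N n \<omega>))) \<mu>"
  unfolding cdf_tendsto_in_prob_def
proof (intro allI impI LIMSEQ_I)
  fix \<epsilon> r :: real assume \<epsilon>: "0 < \<epsilon>" and r: "0 < r"
  let ?F = "\<lambda>n \<omega>. empirical_cdf (Z_mat h U N n \<omega> * mat_adjoint (Z_mat h U N n \<omega>))"
  let ?X = "\<lambda>n. {\<omega> \<in> space P. \<epsilon> \<le> levy_dist (?F n \<omega>) (cdf \<mu>)}"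
  define M where "M = 4 * (S\<^sup>2 + 1) / r"
  have M: "M > 0" unfolding M_def using r by (intro divide_pos_pos mult_pos_pos add_nonneg_pos) auto
  have SM: "S\<^sup>2 / M + r / 4 < r"
  proof -
    have "S\<^sup>2 / M = r * (S\<^sup>2 / (4 * (S\<^sup>2 + 1)))" unfolding M_def by simp
    also have "\<dots> \<le> r * (1 / 4)" using r by (intro mult_left_mono) (auto simp: divide_le_eq add_nonneg_pos)
    finally show ?thesis using r by linarith
  qed
  obtain J \<delta> where \<delta>: "\<delta> > 0" and crit: "\<And>\<nu>. real_distribution \<nu> \<Longrightarrow> \<forall>a>0. measure \<nu> {x. a < \<bar>x\<bar>} \<le> M / a \<Longrightarrow>
     \<forall>j\<le>J. cmod (stieltjes_transform \<nu> (point j) - stieltjes_transform \<mu> (point j)) < \<delta> \<Longrightarrow> levy_dist (cdf \<nu>) (cdf \<mu>) < \<epsilon>"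
    using levy_closeness_criterion[OF point_sequence \<mu>(1) \<epsilon>, of M] by blast
  have r4: "0 < r / 4" using r by simp
  have "eventually (\<lambda>n. norm (prob (?X n) - 0) < r) sequentially"
    using spectral_control[OF m M \<delta> r4, of J]
  proof eventually_elim
    fix n
    assume "\<exists>B\<in>sets P. prob B \<le> S\<^sup>2 / M + r / 4 \<and> (AE \<omega> in P. \<omega> \<notin> B \<longrightarrow>
     good_spectrum m M J \<delta> (?F n \<omega>))"
    then obtain B where B: "B \<in> sets P" "prob B \<le> S\<^sup>2 / M + r / 4" and AE: "AE \<omega> in P. \<omega> \<notin> B \<longrightarrow>
     good_spectrum m M J \<delta> (?F n \<omega>)"
      by blast
    have "AE \<omega> in P. \<omega> \<in> ?X n \<longrightarrow> \<omega> \<in> B"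
      using AE
    proof eventually_elim
      fix \<omega>
      assume *: "\<omega> \<notin> B \<longrightarrow> good_spectrum m M J \<delta> (?F n \<omega>)"
      show "\<omega> \<in> ?X n \<longrightarrow> \<omega> \<in> B"
      proof (intro impI, rule ccontr)
        assume X: "\<omega> \<in> ?X n" and "\<omega> \<notin> B"
        with * obtain \<nu> where \<nu>: "real_distribution \<nu>" "cdf \<nu> = ?F n \<omega>" "\<forall>a>0. measure \<nu> {x. a < \<bar>x\<bar>} \<le> M / a"
          "\<forall>j\<le>J. cmod (stieltjes_transform \<nu> (point j) - (LINT u|unit_measure. m (point j) u)) < \<delta>" by blast
        have "levy_dist (cdf \<nu>) (cdf \<mu>) < \<epsilon>"
          using \<nu>(4) by (intro crit \<nu>(1,3)) (simp add: \<mu>(2) points(1))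
        thus False using X unfolding \<nu>(2) by simp
      qed
    qed
    hence "prob (?X n) \<le> prob B" using B(1)
      by (cases "?X n \<in> sets P") (auto intro: finite_measure_mono_AE simp: measure_notin_sets)
    also have "\<dots> < r" using B(2) SM by linarith
    finally show "norm (prob (?X n) - 0) < r" by simp
  qed
  thus "\<exists>no. \<forall>n\<ge>no. norm (prob (?X n) - 0) < r" unfolding eventually_sequentially .
qed

end

section \<open>The limit theorem\<close>

theorem theorem3p1:
  fixes P :: "'w measure"
    and h :: "int \<times> int \<Rightarrow> complex"
    and U :: "int \<times> int \<Rightarrow> 'w \<Rightarrow> complex"
    and N :: "nat \<Rightarrow> nat"
    and c :: real
  assumes "prob_space P"
    and N_range: "\<And>n. n \<ge> 1 \<Longrightarrow> 1 \<le> N n \<and> N n \<le> n"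
    and c_range: "0 < c" "c \<le> 1"
    and N_lim: "(\<lambda>n. real (N n) / real n) \<longlonglongrightarrow> c"
    and h_summable: "(\<lambda>k. cmod (h k)) summable_on UNIV"
    and U_indep: "prob_space.indep_vars P (\<lambda>_. borel) U UNIV"
    and U_law: "\<And>p. distr P borel (U p) = std_complex_normal"
  shows "\<exists>\<pi> :: complex \<Rightarrow> real set \<Rightarrow> complex.
      (stieltjes_kernel \<pi> \<and> (\<forall>z\<in>\<complex>\<^sup>+. cm_support (\<pi> z) \<subseteq> {0..1}) \<and>
         (\<forall>z\<in>\<complex>\<^sup>+. kernel_equation c (Phi h) (\<pi> z) z)) \<and>
      (\<forall>\<rho> :: complex \<Rightarrow> real set \<Rightarrow> complex.
         stieltjes_kernel \<rho> \<and> (\<forall>z\<in>\<complex>\<^sup>+. cm_support (\<rho> z) \<subseteq> {0..1}) \<and>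
         (\<forall>z\<in>\<complex>\<^sup>+. kernel_equation c (Phi h) (\<rho> z) z)
         \<longrightarrow> (\<forall>z\<in>\<complex>\<^sup>+. \<forall>A\<in>sets borel. \<rho> z A = \<pi> z A)) \<and>
      (\<exists>\<mu>. real_distribution \<mu> \<and>
         (\<forall>z\<in>\<complex>\<^sup>+. stieltjes_transform \<mu> z = cm_set_integral (\<pi> z) {0..1} (\<lambda>_. 1)) \<and>
         (\<forall>\<nu>. real_distribution \<nu> \<and>
            (\<forall>z\<in>\<complex>\<^sup>+. stieltjes_transform \<nu> z = cm_set_integral (\<pi> z) {0..1} (\<lambda>_. 1))
            \<longrightarrow> \<nu> = \<mu>) \<and>
         cdf_tendsto_in_prob P
           (\<lambda>n \<omega>. empirical_cdf (Z_mat h U N n \<omega> * mat_adjoint (Z_mat h U N n \<omega>))) \<mu>)"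
proof -
  interpret matrix_model h P U N c
    by (intro matrix_model.intro gaussian_field.intro summable_filter.intro gaussian_field_axioms.intro matrix_model_axioms.intro)
       (use assms in auto)
  show ?thesis
  proof (rule profile.stieltjes_kernel_exists_unique)
    fix \<pi> m
    assume m: "\<And>z. Im z > 0 \<Longrightarrow> profile.herglotz_class z (m z)" "\<And>z u. Im z > 0 \<Longrightarrow> m z u = profile.profile_step z (m z) u"
      and \<pi>: "stieltjes_kernel \<pi>" "\<And>z. Im z > 0 \<Longrightarrow> cm_support (\<pi> z) \<subseteq> {0..1}" "\<And>z. Im z > 0 \<Longrightarrow> kernel_equation c (Phi h) (\<pi> z) z"
      and uniq: "\<And>\<rho> z A. stieltjes_kernel \<rho> \<Longrightarrow> (\<And>z. Im z > 0 \<Longrightarrow> cm_support (\<rho> z) \<subseteq> {0..1}) \<Longrightarrow>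
       (\<And>z. Im z > 0 \<Longrightarrow> kernel_equation c (Phi h) (\<rho> z) z) \<Longrightarrow> Im z > 0 \<Longrightarrow> A \<in> sets borel \<Longrightarrow> \<rho> z A = \<pi> z A"
      and mass: "\<And>z. Im z > 0 \<Longrightarrow> cm_set_integral (\<pi> z) {0..1} (\<lambda>_. 1) = (LINT u|unit_measure. m z u)"
      and hol: "(\<lambda>z. LINT u|unit_measure. m z u) holomorphic_on \<complex>\<^sup>+"
    have fam: "solution_family m" unfolding solution_family_def using m by blast
    obtain \<mu> where \<mu>: "real_distribution \<mu>" "\<And>z. Im z > 0 \<Longrightarrow> stieltjes_transform \<mu> z = (LINT u|unit_measure. m z u)"
      by (rule limit_law_exists[OF fam hol]) (rule that)
    have kernel: "stieltjes_kernel \<pi> \<and> (\<forall>z\<in>\<complex>\<^sup>+. cm_support (\<pi> z) \<subseteq> {0..1}) \<and> (\<forall>z\<in>\<complex>\<^sup>+. kernel_equation c (Phi h) (\<pi> z) z)"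
      using \<pi> by auto
    have unique: "\<forall>\<rho>. stieltjes_kernel \<rho> \<and> (\<forall>z\<in>\<complex>\<^sup>+. cm_support (\<rho> z) \<subseteq> {0..1}) \<and> (\<forall>z\<in>\<complex>\<^sup>+. kernel_equation c (Phi h) (\<rho> z) z)
           \<longrightarrow> (\<forall>z\<in>\<complex>\<^sup>+. \<forall>A\<in>sets borel. \<rho> z A = \<pi> z A)"
    proof (intro allI impI ballI, elim conjE)
      fix \<rho> :: "complex \<Rightarrow> real set \<Rightarrow> complex" and z :: complex and A :: "real set"
      assume \<rho>: "stieltjes_kernel \<rho>" "\<forall>z\<in>\<complex>\<^sup>+. cm_support (\<rho> z) \<subseteq> {0..1}" "\<forall>z\<in>\<complex>\<^sup>+. kernel_equation c (Phi h) (\<rho> z) z"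
        and z: "z \<in> \<complex>\<^sup>+" and A: "A \<in> sets borel"
      show "\<rho> z A = \<pi> z A" by (rule uniq[OF \<rho>(1)]) (use \<rho> z A in auto)
    qed
    have transform: "\<forall>z\<in>\<complex>\<^sup>+. stieltjes_transform \<mu> z = cm_set_integral (\<pi> z) {0..1} (\<lambda>_. 1)"
      using \<mu>(2) mass by simp
    have determined: "\<forall>\<nu>. real_distribution \<nu> \<and> (\<forall>z\<in>\<complex>\<^sup>+. stieltjes_transform \<nu> z = cm_set_integral (\<pi> z) {0..1} (\<lambda>_. 1)) \<longrightarrow> \<nu> = \<mu>"
    proof (intro allI impI, elim conjE)
      fix \<nu> assume "real_distribution \<nu>" "\<forall>z\<in>\<complex>\<^sup>+. stieltjes_transform \<nu> z = cm_set_integral (\<pi> z) {0..1} (\<lambda>_. 1)"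
      thus "\<nu> = \<mu>" using transform by (intro stieltjes_transform_inj[OF _ \<mu>(1)]) auto
    qed
    have conv: "cdf_tendsto_in_prob P (\<lambda>n \<omega>. empirical_cdf (Z_mat h U N n \<omega> * mat_adjoint (Z_mat h U N n \<omega>))) \<mu>"
      by (rule empirical_convergence[OF fam \<mu>])
    from kernel unique \<mu>(1) transform determined conv show ?thesis by blast
  qed
qed

end
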